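(* Let $0<R<1$, let $\rho$ be an allowable radial metric on $A(R,1)$ that is regular, and put $\gamma_\diamond=-R^2\rho^2(R)$ and $$\tau_\diamond=\int_R^1\frac{\rho(y)\,dy}{\sqrt{y^2\rho^2(y)-R^2\rho^2(R)}}.$$ Let $\gamma$ be a real number with $y^2\rho^2(y)+\gamma\ge0$ for $R\le y\le1$, define $$q(s)=\exp\left(\int_1^s\frac{dy}{\sqrt{y^2+\gamma\rho(y)^{-2}}}\right),\quad R\le s\le1,\qquad r=q(R),\qquad p^\gamma=q^{-1},$$ and let $f^\gamma\colon A(r,1)\to A(R,1)$ be the harmonic mapping $f^\gamma(se^{it})=p^\gamma(s)e^{it}$. Then $f^\gamma$ is a quasiconformal minimizer of $\mathcal{E}^\rho$ if and only if $\gamma>-R^2\rho^2(R)$, equivalently, if and only if $\operatorname{Mod}(A(r,1))<\tau_\diamond$. If $\gamma=-R^2\rho^2(R)$, then the minimizer $f^\gamma$ is harmonic but is not quasiconformal. The constant of quasiconformality is $$K_{f^\gamma}=\max\left\{\sqrt{\frac{\gamma_\diamond-\gamma}{\gamma_\diamond}},\ \sqrt{\frac{\gamma_\diamond}{\gamma_\diamond-\gamma}}\right\}.$$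
   Context: $A(a,b)=\{z\in\mathbb{C}: a<|z|<b\}$, $\operatorname{Mod}A(r,1)=\log(1/r)$. Metrics: a metric on a domain $\Omega^*$ is a smooth nonvanishing (positive) function $\rho$; its Gauss curvature is $\mathcal{K}=-\Delta\log\rho/\rho^2$ and its area $\mathcal{A}(\rho)=\int_{\Omega^*}\rho^2\,du\,dv$. It is allowable if $\sup|\mathcal{K}|<\infty$ and $\mathcal{A}(\rho)<\infty$. A metric on $A(R,1)$ is radial if $\rho(z)=\rho(|z|)$; a radial metric is regular if $\inf_{R<s<1}s\rho(s)=\lim_{s\to R+0}s\rho(s)$ and it has bounded Gauss curvature. $\rho(R)$ denotes the boundary value $\lim_{s\to R+0}\rho(s)$. A map $f$ is ($\rho$-)harmonic if $f_{z\bar z}+(\log\rho^2)_w(f)\,f_zf_{\bar z}=0$. The quasiconformality constant of $f$ is $K_f=\sup_z\frac{|f_z|+|f_{\bar z}|}{|f_z|-|f_{\bar z}|}$, and $f$ is quasiconformal if $K_f<\infty$. Energy: for $f\colon\Omega\to\overline{\Omega^*}$ in $W^{1,2}_{loc}$, $|df|^2=2\rho^2(f(z))(|f_z|^2+|f_{\bar z}|^2)$ and $\mathcal{E}^\rho[f]=\int_\Omega|df|^2\,dx\,dy$; on the boundary circle $|w|=R$ the boundary value $\rho(R)$ is used. Minimizer means: a mapping attaining $\inf\{\mathcal{E}^\rho[h]:h\in\mathfrak{D}^\rho(A(r,1),A(R,1))\}$, where $\mathfrak{D}^\rho(\Omega,\Omega^* )$ is the set of deformations, i.e. mappings $h\colon\Omega\to\overline{\Omega^*}$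 such that (1) $h\in W^{1,2}_{loc}$ and $|dh|\in L^2(\Omega)$; (2) $J_h=\det Dh\ge0$ a.e.; (3) $\int_\Omega\rho^2(h)J_h\le\mathcal{A}(\rho)$; (4) there are sense-preserving diffeomorphisms $h_j$ of $\Omega$ onto $\Omega^*$ with $h_j\to h$ uniformly on compact subsets of $\Omega$ and $\delta^\rho_{h_j}\to\delta^\rho_h$ uniformly on $\overline\Omega$. Here $\delta^\rho_f(z)=\inf_{b\in\partial\Omega^*}\operatorname{dist}_\rho(f(z),b)$ for $z\in\Omega$ (equal to $0$ if $f(z)\in\partial\Omega^*$), $\delta_f^\rho=0$ on $\partial\Omega$, and $\operatorname{dist}_\rho(a,b)=\inf_\gamma\int_\gamma\rho|dw|$ over rectifiable Jordan arcs in $\Omega^*$ connecting $a$ and $b$ ($\infty$ if none). *)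

theory Defs
  imports "HOL-Analysis.Analysis"
begin

section \<open>Partial and Wirtinger derivatives\<close>

definition dx :: "(complex \<Rightarrow> 'a::real_normed_vector) \<Rightarrow> complex \<Rightarrow> 'a" where
  "dx f z = frechet_derivative f (at z) 1"

definition dy :: "(complex \<Rightarrow> 'a::real_normed_vector) \<Rightarrow> complex \<Rightarrow> 'a" where
  "dy f z = frechet_derivative f (at z) \<i>"

definition dz :: "(complex \<Rightarrow> complex) \<Rightarrow> complex \<Rightarrow> complex" where
  "dz f z = (dx f z - \<i> * dy f z) / 2"

definition dzbar :: "(complex \<Rightarrow> complex) \<Rightarrow> complex \<Rightarrow> complex" where
  "dzbar f z = (dx f z + \<i> * dy f z) / 2"

definition laplacian :: "(complex \<Rightarrow> real) \<Rightarrow> complex \<Rightarrow> real" where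
  "laplacian u z = dx (dx u) z + dy (dy u) z"

text \<open>Only used for open \<^term>\<open>S\<close>.\<close>

primrec Ck_on :: "nat \<Rightarrow> complex set \<Rightarrow> (complex \<Rightarrow> 'a::real_normed_vector) \<Rightarrow> bool" where
  "Ck_on 0 S f \<longleftrightarrow> continuous_on S f"
| "Ck_on (Suc k) S f \<longleftrightarrow>
     (\<forall>z\<in>S. f differentiable (at z)) \<and> Ck_on k S (dx f) \<and> Ck_on k S (dy f)"

definition smooth_on :: "complex set \<Rightarrow> (complex \<Rightarrow> 'a::real_normed_vector) \<Rightarrow> bool" where
  "smooth_on S f \<longleftrightarrow> (\<forall>k. Ck_on k S f)"


section \<open>Annuli and metrics\<close>

definition annulus :: "real \<Rightarrow> real \<Rightarrow> complex set" where
  "annulus a b = {z. a < cmod z \<and> cmod z < b}"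

text \<open>Conformal modulus of \<^term>\<open>annulus r 1\<close>.\<close>

definition annulus_modulus :: "real \<Rightarrow> real" where
  "annulus_modulus r = ln (1 / r)"

definition is_metric :: "complex set \<Rightarrow> (complex \<Rightarrow> real) \<Rightarrow> bool" where
  "is_metric \<Omega> \<rho> \<longleftrightarrow> smooth_on \<Omega> \<rho> \<and> (\<forall>w\<in>\<Omega>. 0 < \<rho> w)"

definition gauss_curvature :: "(complex \<Rightarrow> real) \<Rightarrow> complex \<Rightarrow> real" where
  "gauss_curvature \<rho> w = - laplacian (\<lambda>w. ln (\<rho> w)) w / (\<rho> w)\<^sup>2"

definition metric_area :: "complex set \<Rightarrow> (complex \<Rightarrow> real) \<Rightarrow> ennreal" where
  "metric_area \<Omega> \<rho> = (\<integral>\<^sup>+ w \<in> \<Omega>. ennreal ((\<rho> w)\<^sup>2) \<partial>lebesgue)"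

definition allowable :: "complex set \<Rightarrow> (complex \<Rightarrow> real) \<Rightarrow> bool" where
  "allowable \<Omega> \<rho> \<longleftrightarrow>
     is_metric \<Omega> \<rho> \<and> bounded (gauss_curvature \<rho> ` \<Omega>) \<and> metric_area \<Omega> \<rho> < \<infinity>"

definition radial_metric :: "real \<Rightarrow> (complex \<Rightarrow> real) \<Rightarrow> bool" where
  "radial_metric R \<rho> \<longleftrightarrow>
     is_metric (annulus R 1) \<rho> \<and> (\<forall>z\<in>annulus R 1. \<rho> z = \<rho> (of_real (cmod z)))"

definition regular_metric :: "real \<Rightarrow> (complex \<Rightarrow> real) \<Rightarrow> bool" where
  "regular_metric R \<rho> \<longleftrightarrow> radial_metric R \<rho> \<and>
     ((\<lambda>s. s * \<rho> (of_real s)) \<longlongrightarrow> (INF s\<in>{R<..<1}. s * \<rho> (of_real s))) (at_right R) \<and>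
     bounded (gauss_curvature \<rho> ` annulus R 1)"

text \<open>A radial metric on \<^term>\<open>annulus R 1\<close>, extended to the two boundary circles by its
  boundary values. For a regular metric of finite area both limits exist: \<open>u(t) = ln (s \<rho>(s))\<close>
  with \<open>s = exp t\<close> satisfies \<open>u'' = - K exp (2 u)\<close> with \<open>K\<close> bounded and \<open>exp (2 u)\<close>
  integrable, so that \<open>u\<close> is bounded together with \<open>u'\<close>.\<close>

definition bdry_ext :: "real \<Rightarrow> (complex \<Rightarrow> real) \<Rightarrow> complex \<Rightarrow> real" where
  "bdry_ext R \<rho> w =
     (if cmod w = R then Lim (at_right R) (\<lambda>s. \<rho> (of_real s))
      else if cmod w = 1 then Lim (at_left 1) (\<lambda>s. \<rho> (of_real s))
      else \<rho> w)"

definition radial_value :: "real \<Rightarrow> (complex \<Rightarrow> real) \<Rightarrow> real \<Rightarrow> real" where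
  "radial_value R \<rho> s = bdry_ext R \<rho> (of_real s)"


section \<open>Harmonic and quasiconformal maps\<close>

definition rho_harmonic ::
  "complex set \<Rightarrow> complex set \<Rightarrow> (complex \<Rightarrow> real) \<Rightarrow> (complex \<Rightarrow> complex) \<Rightarrow> bool" where
  "rho_harmonic \<Omega> \<Omega>' \<rho> f \<longleftrightarrow> Ck_on 2 \<Omega> f \<and> f ` \<Omega> \<subseteq> \<Omega>' \<and>
     (\<forall>z\<in>\<Omega>. dzbar (dz f) z
        + dz (\<lambda>w. of_real (ln ((\<rho> w)\<^sup>2))) (f z) * dz f z * dzbar f z = 0)"

text \<open>The quotient is taken in the extended reals, where \<open>a / 0 = \<infinity>\<close> for \<open>a > 0\<close>.\<close>

definition qc_constant :: "complex set \<Rightarrow> (complex \<Rightarrow> complex) \<Rightarrow> ereal" where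
  "qc_constant \<Omega> f =
     (SUP z\<in>\<Omega>. ereal (cmod (dz f z) + cmod (dzbar f z)) /
                ereal (cmod (dz f z) - cmod (dzbar f z)))"

definition quasiconformal :: "complex set \<Rightarrow> (complex \<Rightarrow> complex) \<Rightarrow> bool" where
  "quasiconformal \<Omega> f \<longleftrightarrow> (\<forall>z\<in>\<Omega>. f differentiable (at z)) \<and> qc_constant \<Omega> f < \<infinity>"


section \<open>Weak derivatives and energy\<close>

definition test_function :: "complex set \<Rightarrow> (complex \<Rightarrow> real) \<Rightarrow> bool" where
  "test_function \<Omega> \<phi> \<longleftrightarrow> smooth_on UNIV \<phi> \<and>
     (\<exists>K. compact K \<and> K \<subseteq> \<Omega> \<and> (\<forall>z. z \<notin> K \<longrightarrow> \<phi> z = 0))"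

definition locally_integrable :: "complex set \<Rightarrow> (complex \<Rightarrow> 'a::euclidean_space) \<Rightarrow> bool" where
  "locally_integrable \<Omega> f \<longleftrightarrow> (\<forall>K. compact K \<and> K \<subseteq> \<Omega> \<longrightarrow> set_integrable lebesgue K f)"

text \<open>\<open>g\<close> collects the two first-order distributional partial derivatives of \<open>h\<close>.\<close>

definition weak_gradient ::
  "complex set \<Rightarrow> (complex \<Rightarrow> complex) \<Rightarrow> (complex \<Rightarrow> complex) \<times> (complex \<Rightarrow> complex) \<Rightarrow> bool" where
  "weak_gradient \<Omega> h g \<longleftrightarrow>
     locally_integrable \<Omega> h \<and> locally_integrable \<Omega> (fst g) \<and> locally_integrable \<Omega> (snd g) \<and>
     (\<forall>\<phi>. test_function \<Omega> \<phi> \<longrightarrow>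
        (LINT z:\<Omega>|lebesgue. dx \<phi> z *\<^sub>R h z) = - (LINT z:\<Omega>|lebesgue. \<phi> z *\<^sub>R fst g z) \<and>
        (LINT z:\<Omega>|lebesgue. dy \<phi> z *\<^sub>R h z) = - (LINT z:\<Omega>|lebesgue. \<phi> z *\<^sub>R snd g z))"

definition W12loc :: "complex set \<Rightarrow> (complex \<Rightarrow> complex) set" where
  "W12loc \<Omega> = {h. locally_integrable \<Omega> (\<lambda>z. (cmod (h z))\<^sup>2) \<and>
     (\<exists>g. weak_gradient \<Omega> h g \<and>
        locally_integrable \<Omega> (\<lambda>z. (cmod (fst g z))\<^sup>2) \<and>
        locally_integrable \<Omega> (\<lambda>z. (cmod (snd g z))\<^sup>2))}"

text \<open>A weak gradient is unique up to a null set, on which the notions below do not depend.\<close>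

definition wgrad ::
  "complex set \<Rightarrow> (complex \<Rightarrow> complex) \<Rightarrow> (complex \<Rightarrow> complex) \<times> (complex \<Rightarrow> complex)" where
  "wgrad \<Omega> h = (SOME g. weak_gradient \<Omega> h g)"

definition wdx :: "complex set \<Rightarrow> (complex \<Rightarrow> complex) \<Rightarrow> complex \<Rightarrow> complex" where
  "wdx \<Omega> h = fst (wgrad \<Omega> h)"

definition wdy :: "complex set \<Rightarrow> (complex \<Rightarrow> complex) \<Rightarrow> complex \<Rightarrow> complex" where
  "wdy \<Omega> h = snd (wgrad \<Omega> h)"

definition wdz :: "complex set \<Rightarrow> (complex \<Rightarrow> complex) \<Rightarrow> complex \<Rightarrow> complex" where
  "wdz \<Omega> h z = (wdx \<Omega> h z - \<i> * wdy \<Omega> h z) / 2"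

definition wdzbar :: "complex set \<Rightarrow> (complex \<Rightarrow> complex) \<Rightarrow> complex \<Rightarrow> complex" where
  "wdzbar \<Omega> h z = (wdx \<Omega> h z + \<i> * wdy \<Omega> h z) / 2"

text \<open>Determinant of the matrix with columns \<open>a\<close> and \<open>b\<close>.\<close>

definition det2 :: "complex \<Rightarrow> complex \<Rightarrow> real" where
  "det2 a b = Re a * Im b - Re b * Im a"

text \<open>Here and below \<open>\<rho>\<close> is a function on the closure of the target domain, since \<open>h\<close> may take
  values on its boundary.\<close>

definition energy :: "complex set \<Rightarrow> (complex \<Rightarrow> real) \<Rightarrow> (complex \<Rightarrow> complex) \<Rightarrow> ennreal" where
  "energy \<Omega> \<rho> h =
     (\<integral>\<^sup>+ z \<in> \<Omega>. ennreal (2 * (\<rho> (h z))\<^sup>2 * ((cmod (wdz \<Omega> h z))\<^sup>2 + (cmod (wdzbar \<Omega> h z))\<^sup>2))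
        \<partial>lebesgue)"


section \<open>Deformations\<close>

text \<open>Every rectifiable Jordan arc has an injective Lipschitz parametrization, and conversely an
  injective Lipschitz path is a rectifiable Jordan arc. The endpoints are exempt from lying in
  \<open>\<Omega>\<close>, because arcs are also used to reach boundary points. The infimum over the empty set is
  \<open>\<infinity>\<close>.\<close>

definition rho_dist :: "complex set \<Rightarrow> (complex \<Rightarrow> real) \<Rightarrow> complex \<Rightarrow> complex \<Rightarrow> ennreal" where
  "rho_dist \<Omega> \<rho> a b =
     (INF g \<in> {g. arc g \<and> (\<exists>L. L-lipschitz_on {0..1} g) \<and>
                  pathstart g = a \<and> pathfinish g = b \<and> g ` {0<..<1} \<subseteq> \<Omega>}.
        \<integral>\<^sup>+ t \<in> {0<..<1}. ennreal (\<rho> (g t) * norm (vector_derivative g (at t))) \<partial>lebesgue)"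

definition bdry_defect ::
  "complex set \<Rightarrow> complex set \<Rightarrow> (complex \<Rightarrow> real) \<Rightarrow> (complex \<Rightarrow> complex) \<Rightarrow> complex \<Rightarrow> ennreal" where
  "bdry_defect \<Omega> \<Omega>' \<rho> f z =
     (if z \<in> \<Omega> \<and> f z \<notin> frontier \<Omega>' then INF b\<in>frontier \<Omega>'. rho_dist \<Omega>' \<rho> (f z) b else 0)"

text \<open>Uniform convergence of functions with values in \<open>[0,\<infinity>]\<close>, with respect to the absolute
  difference.\<close>

definition ennreal_uniform_limit ::
  "'a set \<Rightarrow> (nat \<Rightarrow> 'a \<Rightarrow> ennreal) \<Rightarrow> ('a \<Rightarrow> ennreal) \<Rightarrow> bool" where
  "ennreal_uniform_limit S F G \<longleftrightarrow>
     (\<forall>e::real. e > 0 \<longrightarrow>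
        (\<exists>N. \<forall>n\<ge>N. \<forall>x\<in>S. F n x \<le> G x + ennreal e \<and> G x \<le> F n x + ennreal e))"

definition sense_preserving_diffeo ::
  "complex set \<Rightarrow> complex set \<Rightarrow> (complex \<Rightarrow> complex) \<Rightarrow> bool" where
  "sense_preserving_diffeo \<Omega> \<Omega>' f \<longleftrightarrow>
     bij_betw f \<Omega> \<Omega>' \<and> smooth_on \<Omega> f \<and> smooth_on \<Omega>' (the_inv_into \<Omega> f) \<and>
     (\<forall>z\<in>\<Omega>. det2 (dx f z) (dy f z) > 0)"

definition deformations ::
  "complex set \<Rightarrow> complex set \<Rightarrow> (complex \<Rightarrow> real) \<Rightarrow> (complex \<Rightarrow> complex) set" where
  "deformations \<Omega> \<Omega>' \<rho> = {h.
     h ` \<Omega> \<subseteq> closure \<Omega>' \<and>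
     h \<in> W12loc \<Omega> \<and> energy \<Omega> \<rho> h < \<infinity> \<and>
     (AE z in lebesgue. z \<in> \<Omega> \<longrightarrow> det2 (wdx \<Omega> h z) (wdy \<Omega> h z) \<ge> 0) \<and>
     (\<integral>\<^sup>+ z \<in> \<Omega>. ennreal ((\<rho> (h z))\<^sup>2 * det2 (wdx \<Omega> h z) (wdy \<Omega> h z)) \<partial>lebesgue)
       \<le> metric_area \<Omega>' \<rho> \<and>
     (\<exists>hs. (\<forall>j. sense_preserving_diffeo \<Omega> \<Omega>' (hs j)) \<and>
        (\<forall>K. compact K \<and> K \<subseteq> \<Omega> \<longrightarrow> uniform_limit K hs h sequentially) \<and>
        ennreal_uniform_limit (closure \<Omega>) (\<lambda>j. bdry_defect \<Omega> \<Omega>' \<rho> (hs j))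
          (bdry_defect \<Omega> \<Omega>' \<rho> h))}"

definition energy_minimizer ::
  "complex set \<Rightarrow> complex set \<Rightarrow> (complex \<Rightarrow> real) \<Rightarrow> (complex \<Rightarrow> complex) \<Rightarrow> bool" where
  "energy_minimizer \<Omega> \<Omega>' \<rho> f \<longleftrightarrow> f \<in> deformations \<Omega> \<Omega>' \<rho> \<and>
     energy \<Omega> \<rho> f = (INF h\<in>deformations \<Omega> \<Omega>' \<rho>. energy \<Omega> \<rho> h)"


section \<open>The radial maps\<close>

definition gamma_crit :: "real \<Rightarrow> (complex \<Rightarrow> real) \<Rightarrow> real" where
  "gamma_crit R \<rho> = - (R\<^sup>2 * (radial_value R \<rho> R)\<^sup>2)"

text \<open>This integral may be infinite. In \<^typ>\<open>ennreal\<close> we have \<open>a / 0 = \<infinity>\<close> for \<open>a > 0\<close>, which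
  is the correct value of the integrand at zeros of the square root.\<close>

definition tau_crit :: "real \<Rightarrow> (complex \<Rightarrow> real) \<Rightarrow> ennreal" where
  "tau_crit R \<rho> =
     (\<integral>\<^sup>+ y \<in> {R<..<1}. ennreal (radial_value R \<rho> y) /
         ennreal (sqrt (y\<^sup>2 * (radial_value R \<rho> y)\<^sup>2 - R\<^sup>2 * (radial_value R \<rho> R)\<^sup>2)) \<partial>lborel)"

definition q_fun :: "real \<Rightarrow> (complex \<Rightarrow> real) \<Rightarrow> real \<Rightarrow> real \<Rightarrow> real" where
  "q_fun R \<rho> \<gamma> s = exp (LBINT y=1..s. 1 / sqrt (y\<^sup>2 + \<gamma> / (radial_value R \<rho> y)\<^sup>2))"

definition p_fun :: "real \<Rightarrow> (complex \<Rightarrow> real) \<Rightarrow> real \<Rightarrow> real \<Rightarrow> real" where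
  "p_fun R \<rho> \<gamma> = inv_into {R..1} (q_fun R \<rho> \<gamma>)"

definition f_map :: "real \<Rightarrow> (complex \<Rightarrow> real) \<Rightarrow> real \<Rightarrow> complex \<Rightarrow> complex" where
  "f_map R \<rho> \<gamma> z = rcis (p_fun R \<rho> \<gamma> (cmod z)) (Arg z)"

end

theory Submission
  imports Defs "HOL-Complex_Analysis.Winding_Numbers"
begin

text \<open>
  In the coordinates \<open>x + \<i> t = ln z\<close> on the source and \<open>\<lambda> + \<i> \<theta> = ln w\<close> on the target the annuli
  become cylinders, a radial metric becomes \<open>m(\<lambda>) = s \<rho>(s)\<close> with \<open>s = exp \<lambda>\<close>, and the energy of a map is
  \<open>\<integral> m\<^sup>2(\<lambda>) (\<lambda>\<^sub>x\<^sup>2 + \<lambda>\<^sub>t\<^sup>2 + \<theta>\<^sub>x\<^sup>2 + \<theta>\<^sub>t\<^sup>2) dx dt\<close>. A radial map \<open>\<lambda> = \<lambda>(x)\<close>, \<open>\<theta> = t\<close> is harmonic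
  when \<open>m\<^sup>2 (\<lambda>'\<^sup>2 - 1)\<close> is a constant \<open>\<gamma>\<close>, that is, \<open>\<lambda>' = a(\<lambda>)\<close> with \<open>a = sqrt (1 + \<gamma> / m\<^sup>2)\<close>. This is
  the differential equation that \<open>p\<close> solves. Its dilatation at a point is \<open>max a (1/a)\<close>, and \<open>a\<close> is
  farthest from \<open>1\<close> where \<open>m\<close> is smallest. By regularity this is the circle \<open>|w| = R\<close>, and
  \<open>a(R)\<^sup>2 = (\<gamma>\<^sub>0 - \<gamma>) / \<gamma>\<^sub>0\<close>, which gives the formula for the constant of quasiconformality. As \<open>a(R)\<close>
  vanishes exactly for \<open>\<gamma> = \<gamma>\<^sub>0\<close>, the map is quasiconformal exactly for \<open>\<gamma> > \<gamma>\<^sub>0\<close>. The modulus of the source is \<open>\<integral> d\<lambda> / a\<close>, a strictly decreasing function of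
  \<open>\<gamma>\<close> with the value \<open>\<tau>\<^sub>0\<close> at \<open>\<gamma>\<^sub>0\<close>.

  That the radial map is a minimiser, for \<^emph>\<open>every\<close> admissible \<open>\<gamma>\<close>, follows from a calibration
  (\<open>calibration_inequality\<close>). Pointwise,
  \<open>m\<^sup>2 (\<lambda>\<^sub>x\<^sup>2 + \<lambda>\<^sub>t\<^sup>2 + \<theta>\<^sub>x\<^sup>2 + \<theta>\<^sub>t\<^sup>2) \<ge> \<alpha>(\<lambda>) \<lambda>\<^sub>x + \<beta> \<theta>\<^sub>t + \<kappa>(\<lambda>) (\<lambda>\<^sub>x \<theta>\<^sub>t - \<lambda>\<^sub>t \<theta>\<^sub>x) - |\<gamma>|\<close>,
  where \<open>\<alpha> = 2 \<gamma> / a\<close>, \<open>\<beta> = 0\<close>, \<open>\<kappa> = 2 m\<^sup>2 / a\<close> for \<open>\<gamma> \<ge> 0\<close> and \<open>\<alpha> = 0\<close>, \<open>\<beta> = - 2 \<gamma>\<close>,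
  \<open>\<kappa> = 2 m\<^sup>2 a\<close> for \<open>\<gamma> < 0\<close>, with equality for the radial map. All terms on the right are null
  Lagrangians: Stokes' theorem on the cylinder expresses their integrals by the values of \<open>\<lambda>\<close> on the
  two boundary circles and by the winding number of the map (\<open>cylinder_energy_bound\<close>). This yields
  one bound for all competitors, \<open>energy_level\<close>, and the radial map attains it.

  A deformation \<open>h\<close> is only a Sobolev map and need not be defined on the boundary circles, so the
  bound is proved up to an error \<open>e\<close> that tends to zero (\<open>energy_bound_approx\<close>). The uniform
  convergence of the boundary defects puts one of the diffeomorphisms that approximate \<open>h\<close> close to
  the boundary of the target on whole collars of the source (\<open>deformation_approx\<close>), hence its
  winding number has the right sign (\<open>circulation_sign\<close>). On the remaining compact annulus \<open>h\<close> is
  mollified (\<open>smooth_approximation\<close>). Jensen's inequality keeps the energy under control, and the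
  smooth map so obtained is so close to the diffeomorphism that it has the same winding number.

  Two facts about the data enter. The metric extends continuously and positively to the closed
  annulus, since \<open>ln m\<close> has second derivative \<open>- K m\<^sup>2\<close>, which is integrable by finite area and
  bounded curvature (\<open>logm_lipschitz\<close>). And if \<open>\<tau>\<^sub>0\<close> is finite, then \<open>m\<close> attains its minimum \<open>m(R)\<close> at
  no interior point, because near such a point \<open>m\<^sup>2 - m(R)\<^sup>2\<close> would vanish quadratically and \<open>\<tau>\<^sub>0\<close> would
  diverge like \<open>\<integral> dy / y\<close> (\<open>crit_radicand_pos\<close>).\<close>

section \<open>Functions of class \<open>C\<^sup>k\<close> on the plane\<close>

lemma has_derivative_dx_dy:
  fixes f :: "complex \<Rightarrow> 'a::real_normed_vector"
  assumes "f differentiable (at z)"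
  shows "(f has_derivative (\<lambda>h. Re h *\<^sub>R dx f z + Im h *\<^sub>R dy f z)) (at z)"
proof -
  let ?D = "frechet_derivative f (at z)"
  have D: "(f has_derivative ?D) (at z)"
    using assms frechet_derivative_works by blast
  then have "linear ?D" by (rule has_derivative_linear)
  have "?D h = Re h *\<^sub>R dx f z + Im h *\<^sub>R dy f z" for h
  proof -
    have "h = Re h *\<^sub>R 1 + Im h *\<^sub>R \<i>" by (simp add: complex_eq_iff)
    then have "?D h = ?D (Re h *\<^sub>R 1 + Im h *\<^sub>R \<i>)" by simp
    also have "\<dots> = Re h *\<^sub>R ?D 1 + Im h *\<^sub>R ?D \<i>"
      using \<open>linear ?D\<close> by (simp add: linear_add linear_scale)
    finally show ?thesis by (simp add: dx_def dy_def)
  qed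
  then have "?D = (\<lambda>h. Re h *\<^sub>R dx f z + Im h *\<^sub>R dy f z)" by blast
  with D show ?thesis by simp
qed

lemma dx_dy_eqI:
  assumes "(f has_derivative D) (at z)"
  shows "dx f z = D 1" "dy f z = D \<i>"
  using frechet_derivative_at[OF assms] by (simp_all add: dx_def dy_def)

lemma has_derivative_dx_dy_I:
  assumes "(f has_derivative (\<lambda>h. Re h *\<^sub>R a + Im h *\<^sub>R b)) (at z)"
  shows "f differentiable (at z)" "dx f z = a" "dy f z = b"
  using dx_dy_eqI[OF assms] assms by (auto simp: differentiable_def)

lemma Ck_on_cong:
  assumes "open S" "\<And>z. z \<in> S \<Longrightarrow> f z = g z" "Ck_on k S f"
  shows "Ck_on k S g"
  using assms(2,3)
proof (induction k arbitrary: f g)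
  case 0
  then show ?case using continuous_on_cong[of S S f g] by simp
next
  case (Suc k)
  have d: "(g has_derivative (\<lambda>h. Re h *\<^sub>R dx f z + Im h *\<^sub>R dy f z)) (at z)" if "z \<in> S" for z
    using has_derivative_transform_within_open[OF has_derivative_dx_dy \<open>open S\<close> that Suc.prems(1)]
      Suc.prems(2) that by simp
  show ?case
    using has_derivative_dx_dy_I[OF d] Suc.prems(2) Suc.IH[of "dx f" "dx g"] Suc.IH[of "dy f" "dy g"]
    by auto
qed

lemma Ck_on_SucI:
  assumes "open S"
    and "\<And>z. z \<in> S \<Longrightarrow> (f has_derivative (\<lambda>h. Re h *\<^sub>R fx z + Im h *\<^sub>R fy z)) (at z)"
    and "Ck_on k S fx" "Ck_on k S fy"
  shows "Ck_on (Suc k) S f"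
  using has_derivative_dx_dy_I[OF assms(2)] Ck_on_cong[OF assms(1) _ assms(3), of "dx f"]
    Ck_on_cong[OF assms(1) _ assms(4), of "dy f"] by auto

lemma Ck_on_SucD:
  assumes "Ck_on (Suc k) S f" "z \<in> S"
  shows "(f has_derivative (\<lambda>h. Re h *\<^sub>R dx f z + Im h *\<^sub>R dy f z)) (at z)"
  using assms has_derivative_dx_dy by auto

lemma Ck_on_lower:
  assumes "Ck_on (Suc k) S f" shows "Ck_on k S f"
  using assms
proof (induction k arbitrary: f)
  case 0
  then show ?case
    by (auto intro!: continuous_at_imp_continuous_on differentiable_imp_continuous_within)
next
  case (Suc k)
  show ?case using Suc.IH[of "dx f"] Suc.IH[of "dy f"] Suc.prems by simp
qed

lemma Ck_on_imp_continuous_on: "Ck_on k S f \<Longrightarrow> continuous_on S f"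
proof (induction k)
  case (Suc k)
  show ?case using Ck_on_lower[of k S f] Suc.prems Suc.IH by blast
qed simp

lemma Ck_on_subset: "Ck_on k S f \<Longrightarrow> T \<subseteq> S \<Longrightarrow> Ck_on k T f"
  by (induction k arbitrary: f) (auto intro: continuous_on_subset)

lemma Ck_on_const [simp]: "Ck_on k S (\<lambda>_. c)"
proof (induction k arbitrary: c)
  case (Suc k)
  have "dx (\<lambda>_. c) = (\<lambda>_. 0)" "dy (\<lambda>_. c) = (\<lambda>_. 0)"
    by (auto simp: dx_def dy_def fun_eq_iff)
  then show ?case using Suc.IH by simp
qed simp

lemma Ck_on_bounded_linear:
  assumes "bounded_linear L" shows "Ck_on k S L"
proof (cases k)
  case 0
  then show ?thesis using assms linear_continuous_on by auto
next
  case (Suc n)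
  have "(L has_derivative L) (at z)" for z
    using assms bounded_linear_imp_has_derivative by blast
  then have "L differentiable (at z)" "dx L z = L 1" "dy L z = L \<i>" for z
    using dx_dy_eqI[of L L] by (auto simp: differentiable_def)
  moreover from this have "dx L = (\<lambda>_. L 1)" "dy L = (\<lambda>_. L \<i>)" by blast+
  ultimately show ?thesis using Suc by simp
qed

lemma Ck_on_add:
  assumes "open S" "Ck_on k S f" "Ck_on k S g"
  shows "Ck_on k S (\<lambda>z. f z + g z)"
  using assms(2,3)
proof (induction k arbitrary: f g)
  case 0
  then show ?case by (simp add: continuous_on_add)
next
  case (Suc k)
  show ?case
  proof (rule Ck_on_SucI[where fx = "\<lambda>z. dx f z + dx g z" and fy = "\<lambda>z. dy f z + dy g z"])
    fix z assume "z \<in> S"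
    show "((\<lambda>z. f z + g z) has_derivative
        (\<lambda>h. Re h *\<^sub>R (dx f z + dx g z) + Im h *\<^sub>R (dy f z + dy g z))) (at z)"
      by (rule has_derivative_eq_rhs[OF has_derivative_add[OF
          Ck_on_SucD[OF Suc.prems(1) \<open>z \<in> S\<close>] Ck_on_SucD[OF Suc.prems(2) \<open>z \<in> S\<close>]]])
        (simp add: fun_eq_iff algebra_simps)
  qed (use Suc.IH[of "dx f" "dx g"] Suc.IH[of "dy f" "dy g"] Suc.prems \<open>open S\<close> in auto)
qed

text \<open>The product rule keeps the shape of the statement, so one induction on the order of
  differentiability settles products of all kinds.\<close>

lemma Ck_on_bilinear:
  assumes "bounded_bilinear bp" "open S" "Ck_on k S f" "Ck_on k S g"
  shows "Ck_on k S (\<lambda>z. bp (f z) (g z))"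
proof -
  interpret bounded_bilinear bp by fact
  show ?thesis
    using assms(3,4)
  proof (induction k arbitrary: f g)
    case 0
    then show ?case by (simp add: continuous_on)
  next
    case (Suc k)
    show ?case
    proof (rule Ck_on_SucI[where fx = "\<lambda>z. bp (f z) (dx g z) + bp (dx f z) (g z)"
          and fy = "\<lambda>z. bp (f z) (dy g z) + bp (dy f z) (g z)"])
      fix z assume "z \<in> S"
      show "((\<lambda>z. bp (f z) (g z)) has_derivative
        (\<lambda>h. Re h *\<^sub>R (bp (f z) (dx g z) + bp (dx f z) (g z)) +
             Im h *\<^sub>R (bp (f z) (dy g z) + bp (dy f z) (g z)))) (at z)"
        by (rule has_derivative_eq_rhs[OF FDERIV[OF
            Ck_on_SucD[OF Suc.prems(1) \<open>z \<in> S\<close>] Ck_on_SucD[OF Suc.prems(2) \<open>z \<in> S\<close>]]])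
          (simp add: fun_eq_iff algebra_simps add_left add_right scaleR_left scaleR_right)
    next
      show "Ck_on k S (\<lambda>z. bp (f z) (dx g z) + bp (dx f z) (g z))"
        by (intro Ck_on_add Suc.IH \<open>open S\<close> Ck_on_lower[OF Suc.prems(1)]
            Ck_on_lower[OF Suc.prems(2)]) (use Suc.prems in auto)
      show "Ck_on k S (\<lambda>z. bp (f z) (dy g z) + bp (dy f z) (g z))"
        by (intro Ck_on_add Suc.IH \<open>open S\<close> Ck_on_lower[OF Suc.prems(1)]
            Ck_on_lower[OF Suc.prems(2)]) (use Suc.prems in auto)
    qed fact
  qed
qed

lemmas Ck_on_mult = Ck_on_bilinear[OF bounded_bilinear_mult]
lemmas Ck_on_scaleR = Ck_on_bilinear[OF bounded_bilinear_scaleR]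

lemma Ck_on_linear_compose:
  assumes "bounded_linear L" "open S" "Ck_on k S f"
  shows "Ck_on k S (\<lambda>z. L (f z))"
  using assms(3)
proof (induction k arbitrary: f)
  case 0
  then show ?case using bounded_linear.continuous_on[OF assms(1)] by auto
next
  case (Suc k)
  interpret bounded_linear L by fact
  show ?case
  proof (rule Ck_on_SucI[where fx = "\<lambda>z. L (dx f z)" and fy = "\<lambda>z. L (dy f z)"])
    fix z assume "z \<in> S"
    show "((\<lambda>z. L (f z)) has_derivative (\<lambda>h. Re h *\<^sub>R L (dx f z) + Im h *\<^sub>R L (dy f z))) (at z)"
      by (rule has_derivative_eq_rhs[OF bounded_linear.has_derivative[OF assms(1)
          Ck_on_SucD[OF Suc.prems \<open>z \<in> S\<close>]]])
        (simp add: fun_eq_iff add scaleR)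
  qed (use Suc.IH[of "dx f"] Suc.IH[of "dy f"] Suc.prems assms in auto)
qed

lemma Ck_on_diff:
  assumes "open S" "Ck_on k S f" "Ck_on k S g"
  shows "Ck_on k S (\<lambda>z. f z - g z)"
  using Ck_on_add[OF assms(1,2) Ck_on_linear_compose[OF bounded_linear_minus[OF bounded_linear_ident] assms(1,3)]]
  by simp

lemma Ck_on_Re [simp]: "Ck_on k S Re" and Ck_on_Im [simp]: "Ck_on k S Im"
  and Ck_on_id [simp]: "Ck_on k S (\<lambda>z. z)"
  by (simp_all add: Ck_on_bounded_linear bounded_linear_Re bounded_linear_Im bounded_linear_ident)

lemma Ck_on_compose:
  fixes f :: "complex \<Rightarrow> complex"
  assumes "open S" "Ck_on k T \<Phi>" "Ck_on k S f" "f ` S \<subseteq> T"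
  shows "Ck_on k S (\<lambda>z. \<Phi> (f z))"
  using assms(2,3)
proof (induction k arbitrary: \<Phi>)
  case 0
  then show ?case using continuous_on_compose2[of T \<Phi> S f] assms(4) by auto
next
  case (Suc k)
  show ?case
  proof (rule Ck_on_SucI[where
        fx = "\<lambda>z. Re (dx f z) *\<^sub>R dx \<Phi> (f z) + Im (dx f z) *\<^sub>R dy \<Phi> (f z)" and
        fy = "\<lambda>z. Re (dy f z) *\<^sub>R dx \<Phi> (f z) + Im (dy f z) *\<^sub>R dy \<Phi> (f z)"])
    fix z assume "z \<in> S"
    then have "f z \<in> T" using assms(4) by auto
    show "((\<lambda>z. \<Phi> (f z)) has_derivative
       (\<lambda>h. Re h *\<^sub>R (Re (dx f z) *\<^sub>R dx \<Phi> (f z) + Im (dx f z) *\<^sub>R dy \<Phi> (f z)) +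
            Im h *\<^sub>R (Re (dy f z) *\<^sub>R dx \<Phi> (f z) + Im (dy f z) *\<^sub>R dy \<Phi> (f z)))) (at z)"
      by (rule has_derivative_eq_rhs[OF has_derivative_compose[OF
          Ck_on_SucD[OF Suc.prems(2) \<open>z \<in> S\<close>] Ck_on_SucD[OF Suc.prems(1) \<open>f z \<in> T\<close>]]])
        (simp add: fun_eq_iff algebra_simps)
  next
    have 1: "Ck_on k S (\<lambda>z. dx \<Phi> (f z))" "Ck_on k S (\<lambda>z. dy \<Phi> (f z))"
      using Suc.IH[of "dx \<Phi>"] Suc.IH[of "dy \<Phi>"] Suc.prems(1) Ck_on_lower[OF Suc.prems(2)] by simp_all
    have 2: "Ck_on k S (\<lambda>z. Re (dx f z))" "Ck_on k S (\<lambda>z. Im (dx f z))"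
      "Ck_on k S (\<lambda>z. Re (dy f z))" "Ck_on k S (\<lambda>z. Im (dy f z))"
      using Suc.prems(2)
      by (auto intro!: Ck_on_linear_compose[OF bounded_linear_Re \<open>open S\<close>]
          Ck_on_linear_compose[OF bounded_linear_Im \<open>open S\<close>])
    show "Ck_on k S (\<lambda>z. Re (dx f z) *\<^sub>R dx \<Phi> (f z) + Im (dx f z) *\<^sub>R dy \<Phi> (f z))"
      "Ck_on k S (\<lambda>z. Re (dy f z) *\<^sub>R dx \<Phi> (f z) + Im (dy f z) *\<^sub>R dy \<Phi> (f z))"
      by (intro Ck_on_add Ck_on_scaleR \<open>open S\<close> 1 2)+
  qed fact
qed

lemma has_derivative_real_chain:
  fixes u :: "complex \<Rightarrow> real"
  assumes "(u has_derivative (\<lambda>h. Re h *\<^sub>R ux + Im h *\<^sub>R uy)) (at z)"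
    and "(\<psi> has_real_derivative d) (at (u z))"
  shows "((\<lambda>z. \<psi> (u z)) has_derivative (\<lambda>h. Re h *\<^sub>R (d * ux) + Im h *\<^sub>R (d * uy))) (at z)"
proof -
  have "((\<lambda>z. \<psi> (u z)) has_derivative (\<lambda>h. d * (Re h *\<^sub>R ux + Im h *\<^sub>R uy))) (at z)"
    using has_derivative_compose[OF assms(1), of \<psi> "(*) d"] assms(2)
    by (simp add: has_field_derivative_def)
  then show ?thesis by (rule has_derivative_eq_rhs) (simp add: fun_eq_iff algebra_simps)
qed

text \<open>The outer function comes with a whole sequence of successive derivatives
  \<open>\<psi> i\<close>, which makes the induction hypothesis applicable to the
  derivative.\<close>

lemma Ck_on_real_chain:
  fixes u :: "complex \<Rightarrow> real" and \<psi> :: "nat \<Rightarrow> real \<Rightarrow> real"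
  assumes "open S" "Ck_on k S u"
    and \<psi>: "\<And>i x. x \<in> u ` S \<Longrightarrow> (\<psi> i has_real_derivative \<psi> (Suc i) x) (at x)"
  shows "Ck_on k S (\<lambda>z. \<psi> i (u z))"
  using assms(2)
proof (induction k arbitrary: i)
  case 0
  have "continuous_on (u ` S) (\<psi> i)"
    using \<psi> by (meson DERIV_isCont continuous_at_imp_continuous_on)
  then show ?case using continuous_on_compose2[of "u ` S" "\<psi> i" S u] 0 by auto
next
  case (Suc k)
  show ?case
  proof (rule Ck_on_SucI[where fx = "\<lambda>z. \<psi> (Suc i) (u z) * dx u z"
        and fy = "\<lambda>z. \<psi> (Suc i) (u z) * dy u z"])
    fix z assume "z \<in> S"
    show "((\<lambda>z. \<psi> i (u z)) has_derivative (\<lambda>h. Re h *\<^sub>R (\<psi> (Suc i) (u z) * dx u z)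
        + Im h *\<^sub>R (\<psi> (Suc i) (u z) * dy u z))) (at z)"
      by (rule has_derivative_real_chain[OF Ck_on_SucD[OF Suc.prems \<open>z \<in> S\<close>]])
        (use \<psi> \<open>z \<in> S\<close> in auto)
  next
    show "Ck_on k S (\<lambda>z. \<psi> (Suc i) (u z) * dx u z)" "Ck_on k S (\<lambda>z. \<psi> (Suc i) (u z) * dy u z)"
      using Suc.prems by (auto intro!: Ck_on_mult assms(1) Suc.IH Ck_on_lower[OF Suc.prems])
  qed fact
qed

lemma Ck_on_inverse:
  fixes u :: "complex \<Rightarrow> real"
  assumes "open S" "Ck_on k S u" "\<And>z. z \<in> S \<Longrightarrow> u z \<noteq> 0"
  shows "Ck_on k S (\<lambda>z. inverse (u z))"
  using assms(2)
proof (induction k)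
  case 0
  then show ?case using assms(3) by (auto intro!: continuous_on_inverse)
next
  case (Suc k)
  note inv = Suc.IH[OF Ck_on_lower[OF Suc.prems]]
  show ?case
  proof (rule Ck_on_SucI[where fx = "\<lambda>z. (-1) * (inverse (u z) * inverse (u z)) * dx u z"
        and fy = "\<lambda>z. (-1) * (inverse (u z) * inverse (u z)) * dy u z"])
    fix z assume "z \<in> S"
    show "((\<lambda>z. inverse (u z)) has_derivative (\<lambda>h. Re h *\<^sub>R ((-1) * (inverse (u z) * inverse (u z)) * dx u z)
        + Im h *\<^sub>R ((-1) * (inverse (u z) * inverse (u z)) * dy u z))) (at z)"
      by (rule has_derivative_real_chain[OF Ck_on_SucD[OF Suc.prems \<open>z \<in> S\<close>]])
        (use assms(3)[OF \<open>z \<in> S\<close>] in \<open>auto intro!: derivative_eq_intros\<close>)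
  next
    show "Ck_on k S (\<lambda>z. (-1) * (inverse (u z) * inverse (u z)) * dx u z)"
       "Ck_on k S (\<lambda>z. (-1) * (inverse (u z) * inverse (u z)) * dy u z)"
      by (intro Ck_on_mult assms(1) inv Ck_on_const; use Suc.prems in simp)+
  qed fact
qed

lemma Ck_on_sqrt:
  fixes u :: "complex \<Rightarrow> real"
  assumes "open S" "Ck_on k S u" "\<And>z. z \<in> S \<Longrightarrow> u z > 0"
  shows "Ck_on k S (\<lambda>z. sqrt (u z))"
  using assms(2)
proof (induction k)
  case 0
  then show ?case by (auto intro!: continuous_intros)
next
  case (Suc k)
  have inv: "Ck_on k S (\<lambda>z. inverse (sqrt (u z)))"
    using assms(3) by (intro Ck_on_inverse assms(1) Suc.IH Ck_on_lower[OF Suc.prems]) force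
  show ?case
  proof (rule Ck_on_SucI[where fx = "\<lambda>z. (1/2) * inverse (sqrt (u z)) * dx u z"
        and fy = "\<lambda>z. (1/2) * inverse (sqrt (u z)) * dy u z"])
    fix z assume "z \<in> S"
    show "((\<lambda>z. sqrt (u z)) has_derivative (\<lambda>h. Re h *\<^sub>R ((1/2) * inverse (sqrt (u z)) * dx u z)
        + Im h *\<^sub>R ((1/2) * inverse (sqrt (u z)) * dy u z))) (at z)"
      by (rule has_derivative_real_chain[OF Ck_on_SucD[OF Suc.prems \<open>z \<in> S\<close>]])
        (use assms(3)[OF \<open>z \<in> S\<close>] in \<open>auto intro!: derivative_eq_intros simp: field_simps\<close>)
  next
    show "Ck_on k S (\<lambda>z. (1/2) * inverse (sqrt (u z)) * dx u z)"
       "Ck_on k S (\<lambda>z. (1/2) * inverse (sqrt (u z)) * dy u z)"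
      by (intro Ck_on_mult assms(1) inv Ck_on_const; use Suc.prems in simp)+
  qed fact
qed

lemma Ck_on_cmod:
  assumes "open S" "0 \<notin> S" shows "Ck_on k S cmod"
proof (rule Ck_on_cong[OF assms(1)])
  show "Ck_on k S (\<lambda>z. sqrt (Re z * Re z + Im z * Im z))"
    by (intro Ck_on_sqrt Ck_on_add Ck_on_mult assms(1) Ck_on_Re Ck_on_Im)
      (use assms(2) in \<open>metis complex_neq_0 power2_eq_square\<close>)
qed (simp add: cmod_def power2_eq_square)

lemma vector_derivative_horizontal:
  assumes "(f has_derivative (\<lambda>h. Re h *\<^sub>R a + Im h *\<^sub>R b)) (at (Complex x t))"
  shows "((\<lambda>x. f (Complex x t)) has_vector_derivative a) (at x)"
    and "((\<lambda>t. f (Complex x t)) has_vector_derivative b) (at t)"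
proof -
  have 1: "((\<lambda>x. Complex x t) has_derivative (\<lambda>h. Complex h 0)) (at x)"
    by (simp add: Complex_eq[abs_def]) (auto intro!: derivative_eq_intros simp: Complex_eq)
  have 2: "((\<lambda>t. Complex x t) has_derivative (\<lambda>h. Complex 0 h)) (at t)"
    by (simp add: Complex_eq[abs_def]) (auto intro!: derivative_eq_intros simp: Complex_eq)
  show "((\<lambda>x. f (Complex x t)) has_vector_derivative a) (at x)"
    using has_derivative_compose[OF 1 assms] by (simp add: has_vector_derivative_def)
  show "((\<lambda>t. f (Complex x t)) has_vector_derivative b) (at t)"
    using has_derivative_compose[OF 2 assms] by (simp add: has_vector_derivative_def)
qed

text \<open>Differentiation of \<open>f(x, t) = f(x, a) + \<integral> f\<^sub>y(x, s) ds\<close>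
  under the integral sign gives a formula for \<open>f\<^sub>x\<close>, whose derivative in
  \<open>t\<close> is the claim. The symmetry makes the differential of the argument of a map a
  closed form.\<close>

lemma mixed_partials_symmetric:
  fixes f :: "complex \<Rightarrow> 'a::banach"
  assumes "open S" "Ck_on 2 S f" "z \<in> S"
  shows "dy (dx f) z = dx (dy f) z"
proof -
  have C2: "Ck_on (Suc (Suc 0)) S f" using assms(2) by (simp add: numeral_2_eq_2)
  have C1: "Ck_on (Suc 0) S (dx f)" "Ck_on (Suc 0) S (dy f)" using C2 by auto
  obtain d0 where "d0 > 0" "cball z d0 \<subseteq> S" using assms(1,3) open_contains_cball by blast
  define d where "d = d0 / 2"
  have "d > 0" using \<open>d0 > 0\<close> d_def by simp
  define x0 where "x0 = Re z"
  define a b where "a = Im z - d" and "b = Im z + d"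
  have ab: "a < b" "a < Im z" "Im z < b" using \<open>d > 0\<close> by (auto simp: a_def b_def)
  define U where "U = {x0 - d<..<x0 + d}"
  have inS: "Complex x t \<in> S" if "x \<in> U" "t \<in> {a..b}" for x t
  proof -
    have "cmod (z - Complex x t) \<le> \<bar>Re (z - Complex x t)\<bar> + \<bar>Im (z - Complex x t)\<bar>"
      by (rule cmod_le)
    also have "\<dots> \<le> d + d" using that by (auto simp: U_def x0_def a_def b_def)
    finally have "Complex x t \<in> cball z d0" by (simp add: d_def dist_norm)
    then show ?thesis using \<open>cball z d0 \<subseteq> S\<close> by blast
  qed
  have x0U: "x0 \<in> U" using \<open>d > 0\<close> by (simp add: U_def)
  have contC: "continuous_on (U \<times> {a..b}) (\<lambda>(x, t). g (Complex x t))"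
    if "continuous_on S g" for g :: "complex \<Rightarrow> 'a"
  proof -
    have "continuous_on (U \<times> {a..b}) (\<lambda>p. Complex (fst p) (snd p))"
      by (intro continuous_intros)
    then have "continuous_on (U \<times> {a..b}) (\<lambda>p. g (Complex (fst p) (snd p)))"
      by (rule continuous_on_compose2[OF that]) (use inS in auto)
    then show ?thesis by (simp add: case_prod_unfold)
  qed
  have contt: "continuous_on {a..b} (\<lambda>t. g (Complex x t))"
    if "continuous_on S g" "x \<in> U" for x and g :: "complex \<Rightarrow> 'a"
    by (rule continuous_on_compose2[OF that(1)]) (use inS that(2) in \<open>auto intro!: continuous_intros\<close>)
  have cdy: "continuous_on S (dy f)" using C1(2) Ck_on_imp_continuous_on by blast
  have cdxdy: "continuous_on S (dx (dy f))" using C2 by auto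
  have eq: "dx f (Complex x0 t) = dx f (Complex x0 a) + integral {a..t} (\<lambda>s. dx (dy f) (Complex x0 s))"
    if t: "t \<in> {a..b}" for t
  proof -
    have F: "f (Complex x t) = f (Complex x a) + integral {a..t} (\<lambda>s. dy f (Complex x s))"
      if "x \<in> U" for x
    proof -
      have "((\<lambda>s. dy f (Complex x s)) has_integral f (Complex x t) - f (Complex x a)) {a..t}"
      proof (rule fundamental_theorem_of_calculus)
        show "((\<lambda>t. f (Complex x t)) has_vector_derivative dy f (Complex x s)) (at s within {a..t})"
          if "s \<in> {a..t}" for s
          by (rule has_vector_derivative_at_within, rule vector_derivative_horizontal(2),
            rule Ck_on_SucD[OF C2], rule inS) (use that t \<open>x \<in> U\<close> in auto)
      qed (use t in auto)
      then show ?thesis by (simp add: integral_unique)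
    qed
    have sub: "cbox a t \<subseteq> {a..b}" using t by auto
    have "((\<lambda>x. integral (cbox a t) (\<lambda>s. dy f (Complex x s))) has_vector_derivative
        integral (cbox a t) (\<lambda>s. dx (dy f) (Complex x0 s))) (at x0 within U)"
    proof (rule leibniz_rule_vector_derivative)
      show "continuous_on (U \<times> cbox a t) (\<lambda>(x, s). dx (dy f) (Complex x s))"
        by (rule continuous_on_subset[OF contC[OF cdxdy]]) (use sub in auto)
      show "(\<lambda>s. dy f (Complex x s)) integrable_on cbox a t" if "x \<in> U" for x
        using continuous_on_subset[OF contt[OF cdy that] sub] by (rule integrable_continuous)
      show "((\<lambda>x. dy f (Complex x s)) has_vector_derivative dx (dy f) (Complex x s)) (at x within U)"
        if "x \<in> U" "s \<in> cbox a t" for x s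
        by (rule has_vector_derivative_at_within, rule vector_derivative_horizontal(1),
            rule Ck_on_SucD[OF C1(2)], rule inS) (use that sub in auto)
    qed (use x0U in \<open>auto simp: U_def\<close>)
    moreover have "at x0 within U = at x0" using x0U by (intro at_within_open) (auto simp: U_def)
    ultimately have L: "((\<lambda>x. integral {a..t} (\<lambda>s. dy f (Complex x s))) has_vector_derivative
        integral {a..t} (\<lambda>s. dx (dy f) (Complex x0 s))) (at x0)" by simp
    have A: "((\<lambda>x. f (Complex x a)) has_vector_derivative dx f (Complex x0 a)) (at x0)"
      by (rule vector_derivative_horizontal(1), rule Ck_on_SucD[OF C2], rule inS)
        (use ab x0U in auto)
    have B: "((\<lambda>x. f (Complex x t)) has_vector_derivative dx f (Complex x0 t)) (at x0)"
      by (rule vector_derivative_horizontal(1), rule Ck_on_SucD[OF C2], rule inS)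
        (use t x0U in auto)
    have "((\<lambda>x. f (Complex x t)) has_vector_derivative
        dx f (Complex x0 a) + integral {a..t} (\<lambda>s. dx (dy f) (Complex x0 s))) (at x0)"
      using has_vector_derivative_add[OF A L]
      by (rule has_vector_derivative_transform_within_open[of _ _ _ U]) (use x0U F in \<open>auto simp: U_def\<close>)
    then show ?thesis using B vector_derivative_unique_at by blast
  qed
  have zC: "z = Complex x0 (Im z)" by (simp add: x0_def)
  have "((\<lambda>t. dx f (Complex x0 a) + integral {a..t} (\<lambda>s. dx (dy f) (Complex x0 s)))
      has_vector_derivative (0 + dx (dy f) (Complex x0 (Im z)))) (at (Im z) within {a..b})"
    by (intro has_vector_derivative_add has_vector_derivative_const integral_has_vector_derivative
        contt cdxdy x0U) (use ab in auto)
  moreover have "Im z \<in> {a..b}" using ab by auto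
  ultimately have "((\<lambda>t. dx f (Complex x0 t)) has_vector_derivative 0 + dx (dy f) (Complex x0 (Im z)))
      (at (Im z) within {a..b})"
    using eq by (intro has_vector_derivative_transform[of "Im z" "{a..b}" "\<lambda>t. dx f (Complex x0 t)"])
  then have "((\<lambda>t. dx f (Complex x0 t)) has_vector_derivative dx (dy f) z) (at (Im z) within {a..b})"
    unfolding zC[symmetric] by simp
  moreover have "at (Im z) within {a..b} = at (Im z)"
    using ab by (intro at_within_interior) auto
  ultimately have 1: "((\<lambda>t. dx f (Complex x0 t)) has_vector_derivative dx (dy f) z) (at (Im z))" by simp
  have 2: "((\<lambda>t. dx f (Complex x0 t)) has_vector_derivative dy (dx f) z) (at (Im z))"
    by (rule vector_derivative_horizontal(2)) (use Ck_on_SucD[OF C1(1) assms(3)] zC in simp)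
  show ?thesis using 1 2 vector_derivative_unique_at by blast
qed

section \<open>A smooth function that is flat at the origin\<close>

text \<open>On \<open>x > 0\<close> the \<open>i\<close>-th derivative of \<open>exp (- 1 /
  x)\<close> is a polynomial in \<open>1 / x\<close> times \<open>exp (- 1 / x)\<close>.
  Differentiating \<open>P(1/x) exp (-1/x)\<close> gives the recursion.\<close>

primrec bump_poly :: "nat \<Rightarrow> real poly" where
  "bump_poly 0 = 1"
| "bump_poly (Suc i) = [:0, 0, 1:] * (bump_poly i - pderiv (bump_poly i))"

definition bump_deriv :: "nat \<Rightarrow> real \<Rightarrow> real" where
  "bump_deriv i x = (if x \<le> 0 then 0 else poly (bump_poly i) (1 / x) * exp (- (1 / x)))"

abbreviation flat_exp :: "real \<Rightarrow> real" where "flat_exp \<equiv> bump_deriv 0"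

lemma poly_times_exp_minus_tendsto_0:
  "((\<lambda>y::real. poly q y * exp (- y)) \<longlongrightarrow> 0) at_top"
proof -
  have "((\<lambda>y::real. \<Sum>i\<le>degree q. coeff q i * (y ^ i / exp y)) \<longlongrightarrow> (\<Sum>i\<le>degree q. coeff q i * 0)) at_top"
    by (intro tendsto_sum tendsto_mult tendsto_const tendsto_power_div_exp_0)
  moreover have "poly q y * exp (- y) = (\<Sum>i\<le>degree q. coeff q i * (y ^ i / exp y))" for y :: real
    by (simp add: poly_altdef sum_distrib_right exp_minus divide_inverse mult.assoc)
  ultimately show ?thesis by simp
qed

lemma bump_deriv_has_derivative: "(bump_deriv i has_real_derivative bump_deriv (Suc i) x) (at x)"
proof (cases x "0::real" rule: linorder_cases)
  case less
  have "((\<lambda>_. 0) has_real_derivative 0) (at x)" by simp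
  then have "(bump_deriv i has_real_derivative 0) (at x)"
    by (rule has_field_derivative_transform_within_open[of _ _ _ "{..<0}"])
      (use less in \<open>auto simp: bump_deriv_def\<close>)
  then show ?thesis using less by (simp add: bump_deriv_def)
next
  case greater
  let ?p = "bump_poly i"
  have "((\<lambda>x. poly ?p (1/x) * exp (- (1/x))) has_real_derivative
      (poly (pderiv ?p) (1/x) * (- (1/x^2))) * exp (- (1/x)) + poly ?p (1/x) * (exp (- (1/x)) * (1/x^2))) (at x)"
  proof -
    have i: "((\<lambda>x. 1 / x) has_real_derivative - (1/x^2)) (at x)"
      using greater by (auto intro!: derivative_eq_intros simp: power2_eq_square divide_inverse)
    have e: "((\<lambda>x. exp (- (1/x))) has_real_derivative exp (- (1/x)) * (1/x^2)) (at x)"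
      using DERIV_fun_exp[OF DERIV_minus[OF i]] by simp
    show ?thesis
      by (rule DERIV_cong[OF DERIV_mult[OF DERIV_chain2[OF poly_DERIV[of ?p] i] e]])
        (simp add: algebra_simps)
  qed
  then have "(bump_deriv i has_real_derivative
      (poly (pderiv ?p) (1/x) * (- (1/x^2))) * exp (- (1/x)) + poly ?p (1/x) * (exp (- (1/x)) * (1/x^2))) (at x)"
    by (rule has_field_derivative_transform_within_open[of _ _ _ "{0<..}"])
      (use greater in \<open>auto simp: bump_deriv_def\<close>)
  moreover have "(poly (pderiv ?p) (1/x) * (- (1/x^2))) * exp (- (1/x)) + poly ?p (1/x) * (exp (- (1/x)) * (1/x^2))
     = bump_deriv (Suc i) x"
    using greater by (simp add: bump_deriv_def power2_eq_square algebra_simps)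
  ultimately show ?thesis by simp
next
  case equal
  let ?q = "[:0, 1:] * bump_poly i"
  have "((\<lambda>h. poly ?q (inverse h) * exp (- inverse h)) \<longlongrightarrow> 0) (at_right (0::real))"
    using filterlim_compose[OF poly_times_exp_minus_tendsto_0 filterlim_inverse_at_top_right] .
  then have R: "((\<lambda>h. (bump_deriv i (0 + h) - bump_deriv i 0) / h) \<longlongrightarrow> 0) (at_right 0)"
    by (rule Lim_transform_eventually)
      (auto simp: eventually_at_filter bump_deriv_def field_simps)
  have L: "((\<lambda>h. (bump_deriv i (0 + h) - bump_deriv i 0) / h) \<longlongrightarrow> 0) (at_left 0)"
    by (rule Lim_transform_eventually[OF tendsto_const])
      (auto simp: eventually_at_filter bump_deriv_def)
  show ?thesis
    using filterlim_split_at[OF L R] equal by (simp add: DERIV_def bump_deriv_def)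
qed

lemma flat_exp_nonneg [simp]: "flat_exp x \<ge> 0"
  and flat_exp_le_1 [simp]: "flat_exp x \<le> 1"
  and flat_exp_pos: "x > 0 \<Longrightarrow> flat_exp x > 0"
  and flat_exp_zero: "x \<le> 0 \<Longrightarrow> flat_exp x = 0"
  by (auto simp: bump_deriv_def)

text \<open>This makes indicator functions of boxes pointwise limits of test functions.\<close>

lemma flat_exp_scaled_tendsto:
  "(\<lambda>n. flat_exp (real n * x)) \<longlonglongrightarrow> indicator {0<..} x"
proof (cases "x > 0")
  case True
  have "(\<lambda>n. exp (- (inverse (real n) * inverse x))) \<longlonglongrightarrow> exp (- (0 * inverse x))"
    by (rule tendsto_exp[OF tendsto_minus[OF tendsto_mult[OF lim_inverse_n tendsto_const]]])
  moreover have "\<forall>\<^sub>F n in sequentially.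
      exp (- (inverse (real n) * inverse x)) = flat_exp (real n * x)"
    using eventually_gt_at_top[of 0]
    by eventually_elim (use True in \<open>simp add: bump_deriv_def not_le inverse_eq_divide\<close>)
  ultimately have "(\<lambda>n. flat_exp (real n * x)) \<longlonglongrightarrow> 1"
    using Lim_transform_eventually by fastforce
  then show ?thesis using True by simp
next
  case False
  then have "flat_exp (real n * x) = 0" for n
    by (simp add: bump_deriv_def mult_nonneg_nonpos)
  then show ?thesis using False by simp
qed

lemma smooth_flat_exp_compose:
  assumes "smooth_on UNIV u"
  shows "smooth_on UNIV (\<lambda>z. flat_exp (u z))"
  unfolding smooth_on_def
proof
  fix k show "Ck_on k UNIV (\<lambda>z. flat_exp (u z))"
    by (rule Ck_on_real_chain[of UNIV k u bump_deriv])
      (use assms bump_deriv_has_derivative in \<open>simp_all add: smooth_on_def del: bump_poly.simps\<close>)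
qed

section \<open>Lipschitz paths and the length of their derivative\<close>

text \<open>One half of the theorem of Rademacher in dimension one: the increments of a Lipschitz
  function form an absolutely continuous measure, whose density exists by the theorem of Radon
  and Nikodym.\<close>

lemma lipschitz_has_density:
  fixes u :: "real \<Rightarrow> real"
  assumes "K-lipschitz_on UNIV u"
  obtains \<phi> where "\<phi> \<in> borel_measurable borel"
    "\<And>a b. a \<le> b \<Longrightarrow> set_integrable lborel {a..b} \<phi>"
    "\<And>a b. a \<le> b \<Longrightarrow> (LINT t:{a..b}|lborel. \<phi> t) = u b - u a"
proof -
  have K0: "K \<ge> 0" using assms lipschitz_on_nonneg by blast
  have lip: "\<bar>u y - u x\<bar> \<le> K * \<bar>y - x\<bar>" for x y
    using lipschitz_onD[OF assms, of y x] by (simp add: dist_real_def)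
  \<comment> \<open>the added linear term makes \<open>u\<close> strictly increasing, so that increments become lengths of image intervals\<close>
  define G where "G x = u x + (K + 1) * x" for x
  have low: "y - x \<le> G y - G x" and up: "G y - G x \<le> (2 * K + 1) * (y - x)" if "x \<le> y" for x y
    using lip[of y x] that by (auto simp: G_def algebra_simps)
  have contG: "continuous_on S G" for S
    unfolding G_def using continuous_on_subset[OF lipschitz_on_continuous_on[OF assms]]
    by (intro continuous_intros) auto
  have smono: "G x < G y" if "x < y" for x y using low[of x y] that by auto
  have injG: "G x = G y \<longleftrightarrow> x = y" for x y using smono by (metis linorder_neq_iff)
  have surjG: "\<exists>x. G x = y" for y
  proof -
    define c where "c = \<bar>y - G 0\<bar>"
    have "G (- c) \<le> y" "y \<le> G c" using low[of 0 c] low[of "-c" 0] by (auto simp: c_def)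
    then show ?thesis using IVT'[of G "-c" y c] contG by (auto simp: c_def)
  qed
  define H where "H = inv G"
  have "surj G" unfolding surj_def using surjG by metis
  then have GH [simp]: "G (H y) = y" for y unfolding H_def by (rule surj_f_inv_f)
  have HG [simp]: "H (G x) = x" for x using injG GH by blast
  have "mono H"
    by (rule monoI) (metis GH linorder_not_le smono)
  then have [measurable]: "H \<in> borel_measurable borel" by (rule borel_measurable_mono)
  define M where "M = distr lborel borel H"
  have vim: "H -` A = G ` A" for A by (auto simp: image_iff) (metis GH)
  have emM: "emeasure M A = emeasure lborel (G ` A)" if "A \<in> sets borel" for A
    using that by (simp add: M_def emeasure_distr vim)
  have "absolutely_continuous lborel M"
    unfolding absolutely_continuous_def
  proof
    fix A :: "real set" assume A: "A \<in> null_sets lborel"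
    then have "negligible A" by (simp add: negligible_iff_null_sets null_sets_completionI)
    then have "negligible (G ` A)"
    proof (rule negligible_locally_Lipschitz_image[rotated])
      fix x assume "x \<in> A"
      have "norm (G y - G x) \<le> (2 * K + 1) * norm (y - x)" for y
        using low[of x y] up[of x y] low[of y x] up[of y x] by (cases "x \<le> y") auto
      then show "\<exists>T B. open T \<and> x \<in> T \<and> (\<forall>y\<in>A \<inter> T. norm (G y - G x) \<le> B * norm (y - x))"
        by (intro exI[of _ UNIV] exI[of _ "2 * K + 1"]) auto
    qed simp
    moreover have "G ` A \<in> sets borel"
      using measurable_sets[OF \<open>H \<in> borel_measurable borel\<close>, of A] A by (auto simp flip: vim)
    ultimately have "emeasure lborel (G ` A) = 0"
      by (simp add: negligible_iff_null_sets null_sets_def)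
    then show "A \<in> null_sets M" using A emM[of A] by (auto simp: M_def null_sets_def)
  qed
  then obtain \<psi> where [measurable]: "\<psi> \<in> borel_measurable lborel" and \<psi>: "density lborel \<psi> = M"
    using sigma_finite_measure.Radon_Nikodym[OF sigma_finite_lborel, of M] by (auto simp: M_def)
  have int\<psi>: "(\<integral>\<^sup>+t. \<psi> t * indicator {a..b} t \<partial>lborel) = ennreal (G b - G a)" if "a \<le> b" for a b
  proof -
    have "G ` {a..b} = {G a..G b}"
    proof (intro set_eqI iffI)
      fix y assume "y \<in> {G a..G b}"
      then have "H y \<in> {a..b}" using \<open>mono H\<close> monoD[of H] HG by (metis atLeastAtMost_iff)
      then show "y \<in> G ` {a..b}" using GH by (metis imageI)
    qed (use smono in \<open>force simp: less_eq_real_def\<close>)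
    then show ?thesis
      using emM[of "{a..b}"] low[OF that] that by (simp add: \<psi>[symmetric] emeasure_density)
  qed
  have fin: "AE t in lborel. \<psi> t \<noteq> \<infinity>"
  proof -
    have "AE t in lborel. \<forall>n::nat. t \<in> {- real n..real n} \<longrightarrow> \<psi> t \<noteq> \<infinity>"
    proof (subst AE_all_countable, intro allI)
      fix n :: nat
      have "AE t in lborel. \<psi> t * indicator {- real n..real n} t \<noteq> \<infinity>"
        by (rule nn_integral_PInf_AE) (use int\<psi>[of "- real n" "real n"] in auto)
      then show "AE t in lborel. t \<in> {- real n..real n} \<longrightarrow> \<psi> t \<noteq> \<infinity>"
        by eventually_elim auto
    qed
    then show ?thesis
    proof eventually_elim
      case (elim t)
      obtain n :: nat where "\<bar>t\<bar> \<le> real n" using real_arch_simple by blast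
      then show ?case using elim by (metis abs_le_iff atLeastAtMost_iff minus_le_iff)
    qed
  qed
  define \<phi> where "\<phi> t = enn2real (\<psi> t) - (K + 1)" for t
  have bi: "has_bochner_integral lborel (\<lambda>t. indicator {a..b} t *\<^sub>R enn2real (\<psi> t)) (G b - G a)" if "a \<le> b" for a b
  proof (rule has_bochner_integral_nn_integral)
    have "(\<integral>\<^sup>+t. ennreal (indicator {a..b} t *\<^sub>R enn2real (\<psi> t)) \<partial>lborel) = (\<integral>\<^sup>+t. \<psi> t * indicator {a..b} t \<partial>lborel)"
      by (intro nn_integral_cong_AE) (use fin in \<open>eventually_elim; simp add: less_top split: split_indicator\<close>)
    then show "(\<integral>\<^sup>+t. ennreal (indicator {a..b} t *\<^sub>R enn2real (\<psi> t)) \<partial>lborel) = ennreal (G b - G a)"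
      using int\<psi>[OF that] by simp
  qed (use low[OF that] that in auto)
  have bc: "has_bochner_integral lborel (\<lambda>t. indicator {a..b} t *\<^sub>R (K + 1)) ((b - a) * (K + 1))" if "a \<le> b" for a b
    using has_bochner_integral_indicator[of "{a..b}" lborel "K + 1"] that by simp
  have both: "has_bochner_integral lborel (\<lambda>t. indicator {a..b} t *\<^sub>R \<phi> t) (u b - u a)" if "a \<le> b" for a b
    using has_bochner_integral_diff[OF bi[OF that] bc[OF that]]
    by (simp add: \<phi>_def G_def algebra_simps)
  show thesis
  proof (rule that[of \<phi>])
    show "\<phi> \<in> borel_measurable borel" unfolding \<phi>_def by measurable
  qed (use both in \<open>auto simp: set_integrable_def set_lebesgue_integral_def has_bochner_integral_iff\<close>)
qed

text \<open>The other half is the differentiation theorem of Lebesgue. At an exceptional point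
  the density is at most \<open>c\<close> while the mean values over arbitrarily short intervals
  exceed \<open>c'\<close>. By Vitali's theorem disjoint such intervals cover the exceptional set
  up to a null set, and they lie in an open set that barely exceeds \<open>{\<phi> \<le>
  c}\<close>. Comparing the integrals of \<open>\<phi> - c\<close> bounds their total
  length.\<close>

lemma density_upper_exceptional_set_negligible:
  fixes \<phi> :: "real \<Rightarrow> real"
  assumes [measurable]: "\<phi> \<in> borel_measurable borel"
    and int: "\<And>a b. a \<le> b \<Longrightarrow> set_integrable lborel {a..b} \<phi>"
    and "c < c'" "N > 0"
  shows "negligible {x. \<bar>x\<bar> < N \<and> \<phi> x \<le> c \<and>
     (\<forall>d>0. \<exists>a b. a \<le> x \<and> x \<le> b \<and> a < b \<and> b - a < d \<and> c' * (b - a) < (LINT t:{a..b}|lborel. \<phi> t))}"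
    (is "negligible ?E")
  unfolding negligible_outer
proof (intro allI impI)
  fix e0 :: real assume "e0 > 0"
  \<comment> \<open>chosen so that the final estimate \<open>(1 + |c|) e / (c' - c)\<close> of the total length is \<open>e0 / 2\<close>\<close>
  define e where "e = e0 * (c' - c) / (2 * (1 + \<bar>c\<bar>))"
  have e: "e > 0" using \<open>e0 > 0\<close> \<open>c < c'\<close> by (simp add: e_def)
  \<comment> \<open>a finite measure that dominates \<open>\<phi> - c\<close> up to the factor \<open>1 + |c|\<close>\<close>
  define f where "f x = (1 + \<bar>\<phi> x\<bar>) * indicator {-N..N} x" for x
  have [measurable]: "f \<in> borel_measurable borel" unfolding f_def by measurable
  have f_int: "integrable lborel f"
  proof -
    have "set_integrable lborel {-N..N} (\<lambda>x. 1 + \<bar>\<phi> x\<bar>)"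
      using int[of "-N" N] \<open>N > 0\<close>
      by (intro set_integral_add set_integrable_abs) (auto simp: set_integrable_def)
    then show ?thesis by (simp add: set_integrable_def f_def[abs_def] mult.commute)
  qed
  define M where "M = density lborel (\<lambda>x. ennreal (f x))"
  have f0: "f x \<ge> 0" for x by (simp add: f_def)
  have fin: "emeasure M (space M) \<noteq> \<infinity>"
    using f_int f0 by (simp add: M_def emeasure_density nn_integral_eq_integral)
  interpret M: finite_measure M using fin by (rule finite_measureI)
  define A where "A = {x. \<bar>x\<bar> < N \<and> \<phi> x \<le> c}"
  have [measurable]: "A \<in> sets borel" unfolding A_def by measurable
  have sM: "sets M = sets borel" by (simp add: M_def)
  obtain U0 where U0: "A \<subseteq> U0" "open U0" "measure M U0 < measure M A + e"
  proof -
    have "(INF U\<in>{U. A \<subseteq> U \<and> open U}. emeasure M U) < emeasure M A + ennreal e"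
      using e M.emeasure_finite[of A]
      by (subst outer_regular[symmetric]) (use fin sM in \<open>auto simp: ennreal_add_left_cancel_less less_top\<close>)
    then obtain U where "A \<subseteq> U" "open U" "emeasure M U < emeasure M A + ennreal e"
      unfolding INF_less_iff by blast
    moreover from this have "measure M U < measure M A + e"
      using e by (simp add: M.emeasure_eq_measure ennreal_plus[symmetric] ennreal_less_iff del: ennreal_plus)
    ultimately show thesis using that by blast
  qed
  define U where "U = U0 \<inter> {-N<..<N}"
  have U: "open U" "A \<subseteq> U" "U \<subseteq> {-N<..<N}"
    using U0 by (auto simp: U_def A_def)
  have [measurable]: "U \<in> sets borel" using U by simp
  have MUA: "measure M (U - A) < e"
  proof -
    have "measure M U \<le> measure M U0" using U0 by (intro M.finite_measure_mono) (auto simp: U_def sM)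
    moreover have "measure M (U - A) = measure M U - measure M A"
      using U by (intro M.finite_measure_Diff) (auto simp: sM)
    ultimately show ?thesis using U0 by simp
  qed
  define Fam where "Fam = {(a, b). a < b \<and> {a..b} \<subseteq> U \<and> c' * (b - a) < (LINT t:{a..b}|lborel. \<phi> t)}"
  define cen where "cen p = (fst p + snd p) / 2" for p :: "real \<times> real"
  define rad where "rad p = (snd p - fst p) / 2" for p :: "real \<times> real"
  have cball: "cball (cen p) (rad p) = {fst p..snd p}" for p
    by (simp add: cball_eq_atLeastAtMost cen_def rad_def field_simps)
  obtain C where C: "countable C" "C \<subseteq> Fam"
    "pairwise (\<lambda>i j. disjnt (cball (cen i) (rad i)) (cball (cen j) (rad j))) C"
    "negligible (?E - (\<Union>i \<in> C. cball (cen i) (rad i)))"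
  proof (rule Vitali_covering_theorem_cballs[of Fam rad ?E cen])
    show "0 < rad p" if "p \<in> Fam" for p using that by (auto simp: Fam_def rad_def)
    fix x d :: real assume x: "x \<in> ?E" and "d > 0"
    then have "x \<in> U" using U by (auto simp: A_def)
    then obtain \<delta> where \<delta>: "\<delta> > 0" "ball x \<delta> \<subseteq> U" using U open_contains_ball by blast
    obtain a b where ab: "a \<le> x" "x \<le> b" "a < b" "b - a < min \<delta> d" "c' * (b - a) < (LINT t:{a..b}|lborel. \<phi> t)"
      using x \<open>d > 0\<close> \<delta>(1) by (auto dest!: spec[of _ "min \<delta> d"])
    have "{a..b} \<subseteq> ball x \<delta>" using ab by (auto simp: dist_real_def)
    then have "(a, b) \<in> Fam" using ab \<delta> by (auto simp: Fam_def)
    moreover have "x \<in> cball (cen (a, b)) (rad (a, b))" unfolding cball using ab by simp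
    moreover have "rad (a, b) < d" using ab by (simp add: rad_def)
    ultimately show "\<exists>i. i \<in> Fam \<and> x \<in> cball (cen i) (rad i) \<and> rad i < d" by blast
  qed blast
  define W where "W = (\<Union>p\<in>C. {fst p..snd p})"
  have bound: "measure lebesgue (\<Union>p\<in>D. {fst p..snd p}) \<le> e0 / 2" if "D \<subseteq> C" "finite D" for D
  proof -
    let ?W = "\<Union>p\<in>D. {fst p..snd p}"
    have disj: "disjoint_family_on (\<lambda>p. {fst p..snd p}) D"
      using C(3) that(1) unfolding disjoint_family_on_def pairwise_def cball disjnt_def by blast
    have D: "fst p < snd p" "{fst p..snd p} \<subseteq> U" "c' * (snd p - fst p) \<le> (LINT t:{fst p..snd p}|lborel. \<phi> t)"
      if "p \<in> D" for p
    proof -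
      have "p \<in> Fam" using that \<open>D \<subseteq> C\<close> C(2) by blast
      then show "fst p < snd p" "{fst p..snd p} \<subseteq> U" "c' * (snd p - fst p) \<le> (LINT t:{fst p..snd p}|lborel. \<phi> t)"
        unfolding Fam_def by (simp_all add: case_prod_unfold)
    qed
    have [measurable]: "?W \<in> sets borel" using that(2) by (intro sets.finite_UN) auto
    have WU: "?W \<subseteq> U" using D(2) by blast
    have mW: "measure lebesgue ?W = measure lborel ?W" by (simp add: measure_completion)
    have finW: "emeasure lborel ?W < \<infinity>"
    proof -
      have "emeasure lborel ?W \<le> emeasure lborel {-N..N}"
        using WU U(3) by (intro emeasure_mono) fastforce+
      also have "\<dots> < \<infinity>" using \<open>N > 0\<close> by simp
      finally show ?thesis .
    qed
    have mWs: "measure lborel ?W = (\<Sum>p\<in>D. snd p - fst p)"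
      by (subst measure_finite_Union) (use that disj D(1) in \<open>auto intro!: sum.cong simp: less_imp_le\<close>)
    have intW: "set_integrable lborel ?W \<phi>"
    proof (rule set_integrable_subset[OF int[of "-N" N]])
      have "{-N<..<N} \<subseteq> {-N..N}" by auto
      then show "?W \<subseteq> {-N..N}" using WU U(3) by blast
    qed (use \<open>N > 0\<close> in auto)
    have intWc: "set_integrable lborel ?W (\<lambda>_. c)"
      using finW by (simp add: set_integrable_def)
    have "(c' - c) * measure lborel ?W \<le> (\<Sum>p\<in>D. LINT t:{fst p..snd p}|lborel. \<phi> t) - c * measure lborel ?W"
    proof -
      have "(\<Sum>p\<in>D. c' * (snd p - fst p)) \<le> (\<Sum>p\<in>D. LINT t:{fst p..snd p}|lborel. \<phi> t)"
        by (rule sum_mono) (rule D(3))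
      then show ?thesis by (simp only: mWs sum_distrib_left[symmetric] left_diff_distrib)
    qed
    also have "(\<Sum>p\<in>D. LINT t:{fst p..snd p}|lborel. \<phi> t) = (LINT t:?W|lborel. \<phi> t)"
      by (rule set_integral_finite_Union[symmetric]) (use that disj D(1) int in \<open>auto simp: less_imp_le\<close>)
    also have "(LINT t:?W|lborel. \<phi> t) - c * measure lborel ?W = (LINT t:?W|lborel. \<phi> t - c)"
      using intW intWc finW by (subst set_integral_diff) (auto simp: set_lebesgue_integral_def)
    also have "\<dots> \<le> (LINT t:U - A|lborel. (1 + \<bar>c\<bar>) * f t)"
      unfolding set_lebesgue_integral_def
    proof (rule integral_mono)
      show "integrable lborel (\<lambda>t. indicator ?W t *\<^sub>R (\<phi> t - c))"
        using set_integral_diff(1)[OF intW intWc] by (simp add: set_integrable_def)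
      show "integrable lborel (\<lambda>t. indicator (U - A) t *\<^sub>R ((1 + \<bar>c\<bar>) * f t))"
        using f_int by (intro integrable_mult_indicator) auto
      fix t
      show "indicator ?W t *\<^sub>R (\<phi> t - c) \<le> indicator (U - A) t *\<^sub>R ((1 + \<bar>c\<bar>) * f t)"
      proof (cases "t \<in> ?W \<and> \<phi> t > c")
        case True
        have "t \<in> U" using True WU by blast
        moreover from this have "t \<in> {-N<..<N}" using U(3) by blast
        moreover have "t \<notin> A" using True by (simp add: A_def)
        ultimately have t: "t \<in> U" "t \<notin> A" "t \<in> {-N..N}" by simp_all
        have "\<phi> t - c \<le> (1 + \<bar>c\<bar>) * (1 + \<bar>\<phi> t\<bar>)"
          using mult_nonneg_nonneg[of "\<bar>c\<bar>" "\<bar>\<phi> t\<bar>"] abs_ge_self[of "\<phi> t"] abs_ge_minus_self[of c]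
          by (simp add: algebra_simps del: abs_ge_self abs_ge_minus_self mult_nonneg_nonneg)
        then show ?thesis using t True by (simp add: f_def)
      next
        case False
        then have "indicator ?W t *\<^sub>R (\<phi> t - c) \<le> 0" by (auto simp: indicator_def)
        also have "0 \<le> indicator (U - A) t *\<^sub>R ((1 + \<bar>c\<bar>) * f t)" using f0 by simp
        finally show ?thesis .
      qed
    qed
    also have "\<dots> = (1 + \<bar>c\<bar>) * measure M (U - A)"
    proof -
      have "emeasure M (U - A) = (\<integral>\<^sup>+t. ennreal (indicator (U - A) t *\<^sub>R f t) \<partial>lborel)"
        unfolding M_def by (subst emeasure_density) (auto intro!: nn_integral_cong split: split_indicator)
      also have "\<dots> = ennreal (LINT t|lborel. indicator (U - A) t *\<^sub>R f t)"
        by (rule nn_integral_eq_integral) (use f0 integrable_mult_indicator[OF _ f_int, of "U - A"] in auto)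
      finally have "measure M (U - A) = (LINT t:U - A|lborel. f t)"
        unfolding set_lebesgue_integral_def
        by (rule measure_eq_emeasure_eq_ennreal[rotated]) (use f0 in simp)
      then show ?thesis by (simp add: set_lebesgue_integral_def mult.left_commute)
    qed
    also have "\<dots> \<le> (1 + \<bar>c\<bar>) * e" using MUA by (intro mult_left_mono) auto
    also have "\<dots> = (c' - c) * (e0 / 2)" by (simp add: e_def field_simps)
    finally show ?thesis using \<open>c < c'\<close> mW by simp
  qed
  have Wm: "W \<in> lmeasurable" "measure lebesgue W \<le> e0 / 2"
    unfolding W_def using fmeasurable_UN_bound[OF C(1) _ bound] measure_UN_bound[OF C(1) _ bound] by auto
  have neg: "negligible (?E - W)" using C(4) by (simp add: W_def cball)
  have nm: "?E - W \<in> lmeasurable" by (rule negligible_imp_measurable[OF neg])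
  have "measure lebesgue (W \<union> (?E - W)) \<le> measure lebesgue W + measure lebesgue (?E - W)"
    by (rule measure_Un_le[OF fmeasurableD[OF Wm(1)] fmeasurableD[OF nm]])
  then have "measure lebesgue (W \<union> (?E - W)) < e0"
    using Wm(2) negligible_imp_measure0[OF neg] \<open>e0 > 0\<close> by linarith
  moreover have "W \<union> (?E - W) \<in> lmeasurable" by (rule fmeasurable.Un[OF Wm(1) nm])
  moreover have "?E \<subseteq> W \<union> (?E - W)" by blast
  ultimately show "\<exists>T. ?E \<subseteq> T \<and> T \<in> lmeasurable \<and> measure lebesgue T < e0" by blast
qed

lemma lipschitz_density_is_derivative:
  fixes u \<phi> :: "real \<Rightarrow> real"
  assumes [measurable]: "\<phi> \<in> borel_measurable borel"
    and int: "\<And>a b. a \<le> b \<Longrightarrow> set_integrable lborel {a..b} \<phi>"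
    and u: "\<And>a b. a \<le> b \<Longrightarrow> (LINT t:{a..b}|lborel. \<phi> t) = u b - u a"
  shows "AE x in lebesgue. (u has_real_derivative \<phi> x) (at x)"
proof -
  \<comment> \<open>upper and lower derivates are treated at once by the sign \<open>s\<close>; rational \<open>c\<close>, \<open>c'\<close> keep the number of null sets countable\<close>
  define Ex where "Ex s N c c' = {x. \<bar>x\<bar> < N \<and> s * \<phi> x \<le> c \<and>
     (\<forall>d>0. \<exists>a b. a \<le> x \<and> x \<le> b \<and> a < b \<and> b - a < d \<and> c' * (b - a) < s * (u b - u a))}"
    for s N c c' :: real
  have "AE x in lebesgue. \<forall>s\<in>{1, -1}. \<forall>n::nat. \<forall>c\<in>\<rat>. \<forall>c'\<in>\<rat>. c < c' \<longrightarrow> x \<notin> Ex s (real (Suc n)) c c'"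
  proof -
    have *: "AE x in lebesgue. c < c' \<longrightarrow> x \<notin> Ex s (real (Suc n)) c c'" if "s \<in> {1, -1}" for s :: real and n :: nat and c c'
    proof (cases "c < c'")
      case True
      have eq: "(LINT t:{a..b}|lborel. s * \<phi> t) = s * (u b - u a)" if "a < b" for a b
        using u[of a b] that by simp
      have "Ex s (real (Suc n)) c c' = {x. \<bar>x\<bar> < real (Suc n) \<and> s * \<phi> x \<le> c \<and>
         (\<forall>d>0. \<exists>a b. a \<le> x \<and> x \<le> b \<and> a < b \<and> b - a < d \<and> c' * (b - a) < (LINT t:{a..b}|lborel. s * \<phi> t))}"
        unfolding Ex_def by (intro Collect_cong conj_cong refl all_cong ex_cong1) (simp only: eq)
      also have "negligible \<dots>"
        by (rule density_upper_exceptional_set_negligible)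
          (use int True that in \<open>auto simp: set_integrable_def\<close>)
      finally have "Ex s (real (Suc n)) c c' \<in> null_sets lebesgue"
        by (simp add: negligible_iff_null_sets)
      then show ?thesis by (rule AE_I') auto
    qed simp
    show ?thesis
      by (subst AE_ball_countable, simp, intro ballI, subst AE_all_countable, intro allI,
          subst AE_ball_countable, rule countable_rat, intro ballI,
          subst AE_ball_countable, rule countable_rat, intro ballI, rule *)
  qed
  then show ?thesis
  proof eventually_elim
    case (elim x)
    obtain n :: nat where n: "\<bar>x\<bar> < real (Suc n)" by (metis reals_Archimedean2 order_less_trans lessI of_nat_less_iff)
    have up: "\<exists>d>0. \<forall>a b. a \<le> x \<longrightarrow> x \<le> b \<longrightarrow> a < b \<longrightarrow> b - a < d \<longrightarrow> s * (u b - u a) \<le> (s * \<phi> x + e) * (b - a)"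
      if "s \<in> {1, -1}" "e > 0" for s e :: real
    proof -
      obtain c where c: "c \<in> \<rat>" "s * \<phi> x < c" "c < s * \<phi> x + e" using Rats_dense_in_real[of "s * \<phi> x" "s * \<phi> x + e"] \<open>e > 0\<close> by auto
      obtain c' where c': "c' \<in> \<rat>" "c < c'" "c' < s * \<phi> x + e" using Rats_dense_in_real[OF c(3)] by auto
      have "x \<notin> Ex s (real (Suc n)) c c'" using elim that c c' by blast
      then have "\<not> (\<forall>d>0. \<exists>a b. a \<le> x \<and> x \<le> b \<and> a < b \<and> b - a < d \<and> c' * (b - a) < s * (u b - u a))"
        using n less_imp_le[OF c(2)] by (simp add: Ex_def)
      then obtain d where d0: "d > 0" and
        "\<not> (\<exists>a b. a \<le> x \<and> x \<le> b \<and> a < b \<and> b - a < d \<and> c' * (b - a) < s * (u b - u a))"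
        by blast
      then have d: "s * (u b - u a) \<le> c' * (b - a)" if "a \<le> x" "x \<le> b" "a < b" "b - a < d" for a b
        using that not_le by blast
      have "s * (u b - u a) \<le> (s * \<phi> x + e) * (b - a)" if "a \<le> x" "x \<le> b" "a < b" "b - a < d" for a b
        using d[OF that] mult_right_mono[OF less_imp_le[OF c'(3)], of "b - a"] that by linarith
      then show ?thesis using d0 by blast
    qed
    show ?case
      unfolding has_field_derivative_def has_derivative_at_alt
    proof (intro conjI bounded_linear_mult_right allI impI)
      fix e :: real assume "e > 0"
      obtain d1 where d1: "d1 > 0" "\<And>a b. a \<le> x \<Longrightarrow> x \<le> b \<Longrightarrow> a < b \<Longrightarrow> b - a < d1 \<Longrightarrow> u b - u a \<le> (\<phi> x + e) * (b - a)"
        using up[of 1 e] \<open>e > 0\<close> by auto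
      obtain d2 where d2: "d2 > 0" "\<And>a b. a \<le> x \<Longrightarrow> x \<le> b \<Longrightarrow> a < b \<Longrightarrow> b - a < d2 \<Longrightarrow> - (u b - u a) \<le> (- \<phi> x + e) * (b - a)"
        using up[of "-1" e] \<open>e > 0\<close> by auto
      have "norm (u y - u x - \<phi> x * (y - x)) \<le> e * norm (y - x)" if "norm (y - x) < min d1 d2" for y
      proof (cases y x rule: linorder_cases)
        case less
        then show ?thesis using d1(2)[of y x] d2(2)[of y x] that by (auto simp: algebra_simps abs_le_iff)
      next
        case greater
        then show ?thesis using d1(2)[of x y] d2(2)[of x y] that by (auto simp: algebra_simps abs_le_iff)
      qed simp
      then show "\<exists>d>0. \<forall>y. norm (y - x) < d \<longrightarrow> norm (u y - u x - \<phi> x * (y - x)) \<le> e * norm (y - x)"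
        using d1(1) d2(1) by (intro exI[of _ "min d1 d2"]) auto
    qed
  qed
qed

text \<open>In integrals the Borel function \<open>d\<close> stands in for the derivative, with
  which it agrees almost everywhere.\<close>

lemma lipschitz_path_length:
  fixes g :: "real \<Rightarrow> complex"
  assumes "L-lipschitz_on {0..1} g"
  obtains d where "d \<in> borel_measurable borel"
    "AE t in lebesgue. t \<in> {0<..<1} \<longrightarrow> vector_derivative g (at t) = d t"
    "ennreal (cmod (g 1 - g 0)) \<le> (\<integral>\<^sup>+ t. ennreal (indicator {0<..<1} t * norm (d t)) \<partial>lebesgue)"
proof -
  define cl where "cl t = max 0 (min 1 t)" for t :: real
  have cl: "cl t \<in> {0..1}" "\<bar>cl s - cl t\<bar> \<le> \<bar>s - t\<bar>" for s t by (auto simp: cl_def)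
  define h where "h t = g (cl t)" for t
  have L0: "L \<ge> 0" using assms lipschitz_on_nonneg by blast
  have hlip: "cmod (h s - h t) \<le> L * \<bar>s - t\<bar>" for s t
  proof -
    have "cmod (h s - h t) \<le> L * \<bar>cl s - cl t\<bar>"
      using lipschitz_onD[OF assms cl(1) cl(1)] by (simp add: h_def dist_norm)
    also have "\<dots> \<le> L * \<bar>s - t\<bar>" using cl(2) L0 by (intro mult_left_mono)
    finally show ?thesis .
  qed
  have lipR: "L-lipschitz_on UNIV (\<lambda>t. Re (h t))" and lipI: "L-lipschitz_on UNIV (\<lambda>t. Im (h t))"
  proof -
    have "\<bar>Re (h s) - Re (h t)\<bar> \<le> L * \<bar>s - t\<bar>" "\<bar>Im (h s) - Im (h t)\<bar> \<le> L * \<bar>s - t\<bar>" for s t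
      using abs_Re_le_cmod[of "h s - h t"] abs_Im_le_cmod[of "h s - h t"] hlip[of s t] by auto
    then show "L-lipschitz_on UNIV (\<lambda>t. Re (h t))" "L-lipschitz_on UNIV (\<lambda>t. Im (h t))"
      using L0 by (auto intro!: lipschitz_onI simp: dist_real_def)
  qed
  obtain \<phi> where \<phi>: "\<phi> \<in> borel_measurable borel"
    "\<And>a b. a \<le> b \<Longrightarrow> set_integrable lborel {a..b} \<phi>"
    "\<And>a b. a \<le> b \<Longrightarrow> (LINT t:{a..b}|lborel. \<phi> t) = Re (h b) - Re (h a)"
    using lipschitz_has_density[OF lipR] by metis
  obtain \<psi> where \<psi>: "\<psi> \<in> borel_measurable borel"
    "\<And>a b. a \<le> b \<Longrightarrow> set_integrable lborel {a..b} \<psi>"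
    "\<And>a b. a \<le> b \<Longrightarrow> (LINT t:{a..b}|lborel. \<psi> t) = Im (h b) - Im (h a)"
    using lipschitz_has_density[OF lipI] by metis
  note [measurable] = \<phi>(1) \<psi>(1)
  define d where "d t = complex_of_real (\<phi> t) + \<i> * complex_of_real (\<psi> t)" for t
  have [measurable]: "d \<in> borel_measurable borel" unfolding d_def by measurable
  have D: "AE t in lebesgue. ((\<lambda>t. Re (h t)) has_real_derivative \<phi> t) (at t)"
    "AE t in lebesgue. ((\<lambda>t. Im (h t)) has_real_derivative \<psi> t) (at t)"
    by (rule lipschitz_density_is_derivative; fact \<phi> \<psi>)+
  have AEd: "AE t in lebesgue. t \<in> {0<..<1} \<longrightarrow> vector_derivative g (at t) = d t"
    using D
  proof eventually_elim
    case (elim t)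
    show ?case
    proof
      assume t: "t \<in> {0<..<1}"
      have "(h has_vector_derivative d t) (at t)"
        using elim unfolding has_vector_derivative_complex_iff
        by (simp add: d_def has_real_derivative_iff_has_vector_derivative)
      then have "(g has_vector_derivative d t) (at t)"
        by (rule has_vector_derivative_transform_within_open[of _ _ _ "{0<..<1}"])
          (use t in \<open>auto simp: h_def cl_def\<close>)
      then show "vector_derivative g (at t) = d t" by (rule vector_derivative_at)
    qed
  qed
  have cr: "set_integrable lborel {0..1} (\<lambda>t. complex_of_real (f t))"
    if "set_integrable lborel {0..1} f" for f :: "real \<Rightarrow> real"
    using integrable_of_real[OF that[unfolded set_integrable_def], where 'a = complex]
    unfolding set_integrable_def by (simp add: scaleR_conv_of_real)
  have ir: "set_integrable lborel {0..1} (\<lambda>t. complex_of_real (\<phi> t))"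
    "set_integrable lborel {0..1} (\<lambda>t. \<i> * complex_of_real (\<psi> t))"
    using cr[OF \<phi>(2)] cr[OF \<psi>(2)] by (auto intro!: set_integrable_mult_right)
  have id: "set_integrable lborel {0..1} d" unfolding d_def[abs_def] by (intro set_integral_add ir)
  have "(LINT t:{0..1}|lborel. d t) = h 1 - h 0"
    unfolding d_def[abs_def] using ir \<phi>(3)[of 0 1] \<psi>(3)[of 0 1]
    by (subst set_integral_add) (auto simp: set_integral_complex_of_real complex_eq_iff)
  then have "cmod (h 1 - h 0) \<le> (LINT t:{0..1}|lborel. norm (d t))"
    using integral_norm_bound[of lborel "\<lambda>t. indicator {0..1} t *\<^sub>R d t"] by (simp add: set_lebesgue_integral_def)
  then have "ennreal (cmod (h 1 - h 0)) \<le> ennreal (LINT t:{0..1}|lborel. norm (d t))" by (rule ennreal_leI)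
  also have "\<dots> = (\<integral>\<^sup>+ t. ennreal (indicator {0..1} t *\<^sub>R norm (d t)) \<partial>lborel)"
    unfolding set_lebesgue_integral_def
    using set_integrable_norm[OF id]
    by (intro nn_integral_eq_integral[symmetric]) (auto simp: set_integrable_def)
  also have "\<dots> = (\<integral>\<^sup>+ t. ennreal (indicator {0..1} t *\<^sub>R norm (d t)) \<partial>lebesgue)"
    by (simp add: nn_integral_completion)
  also have "\<dots> = (\<integral>\<^sup>+ t. ennreal (indicator {0<..<1} t * norm (d t)) \<partial>lebesgue)"
  proof (rule nn_integral_cong_AE)
    have "AE t in lebesgue. t \<noteq> (0::real)" "AE t in lebesgue. t \<noteq> (1::real)"
      by (auto intro: AE_completion AE_lborel_singleton)
    then show "AE t in lebesgue. ennreal (indicator {0..1} t *\<^sub>R norm (d t)) =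
       ennreal (indicator {0<..<1} t * norm (d t))"
      by eventually_elim (auto split: split_indicator)
  qed
  finally have "ennreal (cmod (g 1 - g 0)) \<le> \<dots>" by (simp add: h_def cl_def)
  with AEd \<open>d \<in> borel_measurable borel\<close> show thesis using that by blast
qed

text \<open>With a lower bound for the metric the distance to the boundary of the target is at
  least a multiple of the Euclidean one; this reads closeness to the boundary off the boundary
  defect.\<close>

lemma rho_dist_ge:
  assumes "c \<ge> 0" "\<And>w. w \<in> \<Omega> \<Longrightarrow> c \<le> \<rho> w"
  shows "ennreal (c * cmod (a - b)) \<le> rho_dist \<Omega> \<rho> a b"
  unfolding rho_dist_def
proof (rule INF_greatest)
  fix g assume "g \<in> {g. arc g \<and> (\<exists>L. L-lipschitz_on {0..1} g) \<and>
      pathstart g = a \<and> pathfinish g = b \<and> g ` {0<..<1} \<subseteq> \<Omega>}"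
  then obtain L where g: "arc g" "L-lipschitz_on {0..1} g" "a = pathstart g" "b = pathfinish g"
    and im: "g ` {0<..<1} \<subseteq> \<Omega>" by blast
  obtain d where [measurable]: "d \<in> borel_measurable borel"
    and d: "AE t in lebesgue. t \<in> {0<..<1} \<longrightarrow> vector_derivative g (at t) = d t"
      "ennreal (cmod (g 1 - g 0)) \<le> (\<integral>\<^sup>+ t. ennreal (indicator {0<..<1} t * norm (d t)) \<partial>lebesgue)"
    by (rule lipschitz_path_length[OF g(2)])
  have "ennreal (c * cmod (pathstart g - pathfinish g)) = ennreal c * ennreal (cmod (g 1 - g 0))"
    using assms(1) by (simp add: ennreal_mult pathstart_def pathfinish_def norm_minus_commute)
  also have "\<dots> \<le> ennreal c * (\<integral>\<^sup>+ t. ennreal (indicator {0<..<1} t * norm (d t)) \<partial>lebesgue)"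
    by (intro mult_left_mono d(2)) simp
  also have "\<dots> = (\<integral>\<^sup>+ t. ennreal c * ennreal (indicator {0<..<1} t * norm (d t)) \<partial>lebesgue)"
    by (rule nn_integral_cmult[symmetric]) (auto intro!: measurable_completion)
  also have "\<dots> \<le> (\<integral>\<^sup>+ t \<in> {0<..<1}. ennreal (\<rho> (g t) * norm (vector_derivative g (at t))) \<partial>lebesgue)"
  proof (rule nn_integral_mono_AE, use d(1) in eventually_elim)
    case (elim t)
    show ?case
    proof (cases "t \<in> {0<..<1}")
      case True
      then have "c \<le> \<rho> (g t)" using im assms(2) by blast
      then show ?thesis using True elim assms(1)
        by (auto simp flip: ennreal_mult intro!: ennreal_leI mult_right_mono)
    qed simp
  qed
  finally show "ennreal (c * cmod (a - b)) \<le>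
     (\<integral>\<^sup>+ t \<in> {0<..<1}. ennreal (\<rho> (g t) * norm (vector_derivative g (at t))) \<partial>lebesgue)"
    using g by simp
qed

section \<open>Integration in logarithmic coordinates\<close>

text \<open>The complex exponential as a map of \<open>\<real>\<^sup>2\<close>, whose Jacobian is
  the determinant of a matrix.\<close>

definition exp_plane :: "real^2 \<Rightarrow> real^2" where
  "exp_plane v = (exp (v$1) * cos (v$2)) *\<^sub>R axis 1 1 + (exp (v$1) * sin (v$2)) *\<^sub>R axis 2 1"

definition exp_plane' :: "real^2 \<Rightarrow> real^2 \<Rightarrow> real^2" where
  "exp_plane' v h = (exp (v$1) * cos (v$2) * (h$1) - exp (v$1) * sin (v$2) * (h$2)) *\<^sub>R axis 1 1
     + (exp (v$1) * sin (v$2) * (h$1) + exp (v$1) * cos (v$2) * (h$2)) *\<^sub>R axis 2 1"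

definition complex_of_plane :: "real^2 \<Rightarrow> complex" where
  "complex_of_plane v = Complex (v$1) (v$2)"

lemma exp_plane_nth [simp]: "exp_plane v $ 1 = exp (v$1) * cos (v$2)" "exp_plane v $ 2 = exp (v$1) * sin (v$2)"
  by (simp_all add: exp_plane_def axis_def)

lemma complex_of_plane_exp: "complex_of_plane (exp_plane v) = exp (Complex (v$1) (v$2))"
  by (simp add: complex_of_plane_def complex_eq_iff Re_exp Im_exp)

lemma has_derivative_exp_plane: "(exp_plane has_derivative exp_plane' v) (at v within S)"
  unfolding exp_plane_def[abs_def] exp_plane'_def[abs_def]
  by (auto intro!: derivative_eq_intros bounded_linear.has_derivative[OF bounded_linear_vec_nth]
      simp: fun_eq_iff algebra_simps)

lemma det_exp_plane': "det (matrix (exp_plane' v)) = exp (2 * v$1)"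
proof -
  have "det (matrix (exp_plane' v)) =
      exp (v$1) * exp (v$1) * (cos (v$2) * cos (v$2)) + exp (v$1) * exp (v$1) * (sin (v$2) * sin (v$2))"
    by (simp add: det_2 matrix_def exp_plane'_def axis_def)
  also have "\<dots> = exp (v$1) * exp (v$1)"
    by (simp only: distrib_left[symmetric] sin_cos_squared_add3 mult_1_right)
  also have "\<dots> = exp (2 * v$1)" by (simp flip: exp_add)
  finally show ?thesis .
qed

lemma prod_Basis_plane: "(\<Prod>b\<in>Basis. (w::real^2) \<bullet> b) = w$1 * w$2"
  by (simp add: Basis_vec_def prod.UNION_disjoint axis_eq_axis UNIV_2 inner_axis)

lemma exp_plane_inj: "inj_on exp_plane {v. 0 < v$2 \<and> v$2 < 2*pi}"
proof (rule inj_onI)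
  fix v w assume vw: "v \<in> {v. 0 < v$2 \<and> v$2 < 2*pi}" "w \<in> {v. 0 < v$2 \<and> v$2 < 2*pi}"
    and eq: "exp_plane v = exp_plane w"
  have "exp (Complex (v$1) (v$2)) = exp (Complex (w$1) (w$2))"
    using eq by (metis complex_of_plane_exp)
  then have "Complex (v$1) (v$2) = Complex (w$1) (w$2)"
    by (rule exp_complex_eqI[rotated]) (use vw in auto)
  then show "v = w" by (simp add: vec_eq_iff forall_2)
qed

lemma exp_plane_surj:
  assumes "v$2 \<noteq> 0" shows "v \<in> exp_plane ` {v. 0 < v$2 \<and> v$2 < 2*pi}"
proof -
  define z where "z = complex_of_plane v"
  have z0: "z \<noteq> 0" using assms by (auto simp: z_def complex_of_plane_def complex_eq_iff)
  define w :: "real^2" where "w = ln (cmod z) *\<^sub>R axis 1 1 + Arg2pi z *\<^sub>R axis 2 1"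
  have w: "w$1 = ln (cmod z)" "w$2 = Arg2pi z" by (simp_all add: w_def axis_def)
  have "exp (Complex (w$1) (w$2)) = of_real (cmod z) * cis (Arg2pi z)"
    using z0 by (simp add: exp_eq_polar w)
  also have "\<dots> = z" using Arg2pi_eq[of z] z0 by (metis cis_conv_exp Arg2pi)
  finally have "complex_of_plane (exp_plane w) = complex_of_plane v"
    by (simp add: complex_of_plane_exp z_def)
  then have "v = exp_plane w" by (simp add: complex_of_plane_def vec_eq_iff forall_2)
  moreover have "Arg2pi z \<noteq> 0"
    using assms by (auto simp: Arg2pi_eq_0 complex_is_Real_iff z_def complex_of_plane_def)
  then have "0 < w$2" "w$2 < 2*pi" using Arg2pi_ge_0[of z] Arg2pi_lt_2pi[of z] by (auto simp: w)
  ultimately show ?thesis by blast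
qed

lemma measurable_complex_of_plane [measurable]: "complex_of_plane \<in> borel_measurable borel"
  unfolding complex_of_plane_def[abs_def] Complex_eq by measurable

lemma measurable_exp_complex [measurable]: "(\<lambda>v::real^2. exp (Complex (v$1) (v$2))) \<in> borel_measurable borel"
  unfolding Complex_eq by measurable

text \<open>The strip \<open>0 < t < 2 \<pi>\<close> is mapped bijectively onto the plane without
  a ray, which is a null set, with Jacobian \<open>exp (2 x)\<close>.\<close>

lemma lborel_exp_plane:
  "lborel = distr (density lborel (\<lambda>v::real^2. ennreal (indicator {v. 0 < v$2 \<and> v$2 < 2*pi} v * exp (2 * v$1))))
       borel (\<lambda>v. exp (Complex (v$1) (v$2)))" (is "_ = ?D")
proof (rule lborel_eqI)
  fix l u :: complex
  assume le: "\<And>b. b \<in> Basis \<Longrightarrow> l \<bullet> b \<le> u \<bullet> b"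
  define U where "U = {v::real^2. 0 < v$2 \<and> v$2 < 2*pi}"
  have [measurable]: "U \<in> sets borel" unfolding U_def by measurable
  define B where "B = {v. complex_of_plane v \<in> box l u}"
  have [measurable]: "B \<in> sets borel"
    using measurable_sets[OF measurable_complex_of_plane, of "box l u"] by (simp add: B_def vimage_def)
  define l' u' :: "real^2" where "l' = Re l *\<^sub>R axis 1 1 + Im l *\<^sub>R axis 2 1"
    and "u' = Re u *\<^sub>R axis 1 1 + Im u *\<^sub>R axis 2 1"
  have lu': "l'$1 = Re l" "l'$2 = Im l" "u'$1 = Re u" "u'$2 = Im u"
    by (simp_all add: l'_def u'_def axis_def)
  have B: "B = box l' u'"
    by (auto simp: B_def complex_of_plane_def in_box_complex_iff mem_box_cart lu' forall_2)
  have leRI: "Re l \<le> Re u" "Im l \<le> Im u"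
    using le[of 1] le[of \<i>] by (simp_all add: Basis_complex_def)
  have Bm: "B \<in> lmeasurable" "measure lebesgue B = (\<Prod>b\<in>Basis. (u - l) \<bullet> b)"
  proof -
    show "B \<in> lmeasurable" by (simp add: B)
    have "\<forall>b\<in>Basis. l' \<bullet> b \<le> u' \<bullet> b"
      using leRI by (auto simp: Basis_vec_def inner_axis lu' forall_2)
    then have "measure lebesgue B = (\<Prod>b\<in>Basis. (u' - l') \<bullet> b)"
      by (simp add: B measure_completion measure_lborel_box)
    also have "\<dots> = (Re u - Re l) * (Im u - Im l)" by (simp add: prod_Basis_plane lu')
    finally show "measure lebesgue B = (\<Prod>b\<in>Basis. (u - l) \<bullet> b)"
      by (simp add: Basis_complex_def)
  qed
  define S where "S = U \<inter> {v. exp_plane v \<in> B}"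
  have S_eq: "S = U \<inter> {v. exp (Complex (v$1) (v$2)) \<in> box l u}"
    by (simp add: S_def B_def complex_of_plane_exp)
  have [measurable]: "S \<in> sets borel"
    unfolding S_eq using measurable_sets[OF measurable_exp_complex, of "box l u"] \<open>U \<in> sets borel\<close>
    by (auto simp: vimage_def)
  have img: "exp_plane ` S = B \<inter> exp_plane ` U" unfolding S_def by auto
  have "negligible ((B - exp_plane ` S) \<union> (exp_plane ` S - B))"
  proof (rule negligible_subset[OF negligible_standard_hyperplane_cart[of 2]])
    show "(B - exp_plane ` S) \<union> (exp_plane ` S - B) \<subseteq> {v. v$2 = 0}"
      using exp_plane_surj unfolding img U_def by blast
  qed
  note sym = this
  have "exp_plane ` S \<in> lmeasurable \<and> measure lebesgue (exp_plane ` S) = measure lebesgue B"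
    using lmeasurable_negligible_symdiff[OF Bm(1) sym] measure_negligible_symdiff[OF Bm(1) sym] by simp
  then have "((\<lambda>v. \<bar>det (matrix (exp_plane' v))\<bar>) has_integral measure lebesgue B) S"
    by (subst has_measure_differentiable_image[symmetric, where f = exp_plane])
      (use exp_plane_inj in \<open>auto intro: has_derivative_exp_plane inj_on_subset simp: S_def U_def
         \<open>S \<in> sets borel\<close>[unfolded S_def U_def]\<close>)
  then have "((\<lambda>v. exp (2 * v$1)) has_integral measure lebesgue B) S"
    by (simp add: det_exp_plane')
  then have I: "(\<integral>\<^sup>+v. ennreal (indicator S v * exp (2 * v$1)) \<partial>lborel) = ennreal (measure lebesgue B)"
    by (intro nn_integral_has_integral_lebesgue) auto
  have "emeasure ?D (box l u) =
     (\<integral>\<^sup>+v. ennreal (indicator U v * exp (2 * v$1)) * indicator {v. exp (Complex (v$1) (v$2)) \<in> box l u} v \<partial>lborel)"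
    using measurable_sets[OF measurable_exp_complex, of "box l u"]
    by (subst emeasure_distr) (auto simp: emeasure_density vimage_def U_def[symmetric])
  also have "\<dots> = (\<integral>\<^sup>+v. ennreal (indicator S v * exp (2 * v$1)) \<partial>lborel)"
    by (intro nn_integral_cong) (auto simp: S_eq split: split_indicator)
  finally show "emeasure ?D (box l u) = ennreal (\<Prod>b\<in>Basis. (u - l) \<bullet> b)"
    using I Bm by simp
qed simp

lemma lborel_plane: "lborel = distr (lborel \<Otimes>\<^sub>M lborel) borel (\<lambda>(x, t). x *\<^sub>R axis 1 1 + t *\<^sub>R axis 2 1 :: real^2)"
  (is "_ = distr _ _ ?f")
proof (rule lborel_eqI)
  fix l u :: "real^2"
  assume "\<And>b. b \<in> Basis \<Longrightarrow> l \<bullet> b \<le> u \<bullet> b"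
  then have le: "l$i \<le> u$i" for i
    using \<open>\<And>b. b \<in> Basis \<Longrightarrow> l \<bullet> b \<le> u \<bullet> b\<close>[of "axis i 1"] by (simp add: inner_axis)
  have f: "?f p $ 1 = fst p" "?f p $ 2 = snd p" for p by (auto simp: axis_def case_prod_unfold)
  have m: "?f \<in> borel_measurable (lborel \<Otimes>\<^sub>M lborel)" by measurable
  have v: "?f -` box l u \<inter> space (lborel \<Otimes>\<^sub>M lborel) = {l$1<..<u$1} \<times> {l$2<..<u$2}"
    by (auto simp: mem_box_cart forall_2 f space_pair_measure simp del: case_prod_beta)
      (auto simp: axis_def)
  have "(\<Prod>b\<in>Basis. (u - l) \<bullet> b) = (u$1 - l$1) * (u$2 - l$2)"
    by (simp add: prod_Basis_plane)
  then show "emeasure (distr (lborel \<Otimes>\<^sub>M lborel) borel ?f) (box l u) = ennreal (\<Prod>b\<in>Basis. (u - l) \<bullet> b)"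
    using le by (simp add: emeasure_distr[OF m] v lborel.emeasure_pair_measure_Times ennreal_mult)
qed simp

theorem nn_integral_exp_coordinates:
  assumes [measurable]: "F \<in> borel_measurable borel"
  shows "(\<integral>\<^sup>+z. F z \<partial>lborel) =
    (\<integral>\<^sup>+x. (\<integral>\<^sup>+t. F (exp (Complex x t)) * ennreal (indicator {0<..<2*pi} t * exp (2 * x)) \<partial>lborel) \<partial>lborel)"
proof -
  have [measurable]: "(\<lambda>p. F (exp (Complex (fst p) (snd p)))) \<in> borel_measurable (lborel \<Otimes>\<^sub>M lborel)"
    unfolding Complex_eq by measurable
  let ?w = "\<lambda>v::real^2. ennreal (indicator {v. 0 < v$2 \<and> v$2 < 2*pi} v * exp (2 * v$1))"
  have [measurable]: "?w \<in> borel_measurable borel" by measurable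
  have "(\<integral>\<^sup>+z. F z \<partial>lborel) = (\<integral>\<^sup>+v. ?w v * F (exp (Complex (v$1) (v$2))) \<partial>lborel)"
    by (subst lborel_exp_plane) (simp add: nn_integral_distr nn_integral_density)
  also have "\<dots> = (\<integral>\<^sup>+p. F (exp (Complex (fst p) (snd p))) * ennreal (indicator {0<..<2*pi} (snd p) * exp (2 * fst p))
       \<partial>(lborel \<Otimes>\<^sub>M lborel))"
    by (subst lborel_plane, subst nn_integral_distr)
      (auto intro!: nn_integral_cong simp: axis_def mult.commute split: split_indicator)
  also have "\<dots> = (\<integral>\<^sup>+x. (\<integral>\<^sup>+t. F (exp (Complex x t)) * ennreal (indicator {0<..<2*pi} t * exp (2 * x)) \<partial>lborel) \<partial>lborel)"
    by (subst lborel.nn_integral_fst[symmetric]) simp_all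
  finally show ?thesis .
qed

section \<open>Weak gradients\<close>

lemma integral_translate_lborel:
  fixes F :: "complex \<Rightarrow> complex"
  shows "(LINT z|lborel. F (z + v)) = (LINT z|lborel. F z)"
proof (cases "F \<in> borel_measurable borel")
  case True
  then show ?thesis
    by (subst (2) lborel_distr_plus[of v, symmetric]) (simp add: integral_distr add.commute)
next
  case False
  have "(\<lambda>z. F (z + v)) \<notin> borel_measurable borel"
  proof
    assume "(\<lambda>z. F (z + v)) \<in> borel_measurable borel"
    then have "(\<lambda>z. F ((z - v) + v)) \<in> borel_measurable borel"
      by (rule measurable_compose[rotated]) simp
    then show False using False by simp
  qed
  then have "\<not> integrable lborel F" "\<not> integrable lborel (\<lambda>z. F (z + v))"
    using False by (auto dest: borel_measurable_integrable)
  then show ?thesis by (simp add: not_integrable_integral_eq)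
qed

lemma integrable_compact_support:
  fixes F :: "complex \<Rightarrow> 'a::{banach, second_countable_topology}"
  assumes "continuous_on UNIV F" "compact K" "\<And>z. z \<notin> K \<Longrightarrow> F z = 0"
  shows "integrable lborel F"
proof -
  have "integrable lborel (\<lambda>z. indicator K z *\<^sub>R F z)"
    using assms(1,2) by (intro borel_integrable_compact) (auto intro: continuous_on_subset)
  moreover have "(\<lambda>z. indicator K z *\<^sub>R F z) = F" using assms(3) by (auto simp: fun_eq_iff indicator_def)
  ultimately show ?thesis by simp
qed

lemma integral_over_box_eq_lborel:
  fixes F :: "complex \<Rightarrow> complex"
  assumes "continuous_on UNIV F" "\<And>z. z \<notin> cbox a b \<Longrightarrow> F z = 0"
  shows "integral (cbox a b) F = (LINT z|lborel. F z)"
proof -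
  have "integral (cbox a b) F = integral UNIV (\<lambda>z. if z \<in> cbox a b then F z else 0)"
    by (rule integral_restrict_UNIV[symmetric])
  also have "(\<lambda>z. if z \<in> cbox a b then F z else 0) = F" using assms(2) by auto
  also have "integral UNIV F = (LINT z|lborel. F z)"
    by (rule integral_lborel, rule integrable_compact_support[OF assms(1) compact_cbox assms(2)])
  finally show ?thesis .
qed

lemma has_derivative_zero_outside:
  fixes F :: "complex \<Rightarrow> 'a::real_normed_vector"
  assumes "closed K" "\<And>z. z \<notin> K \<Longrightarrow> F z = 0" "z \<notin> K"
  shows "(F has_derivative (\<lambda>_. 0)) (at z)"
proof (rule has_derivative_transform_within_open[OF has_derivative_const[of 0]])
  show "open (- K)" using assms(1) by (simp add: open_Compl)
  show "z \<in> - K" using assms(3) by simp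
  show "0 = F x" if "x \<in> - K" for x using that assms(2)[of x] by simp
qed

text \<open>The integral of \<open>F (z + s v)\<close> over the plane does not depend on
  \<open>s\<close>, by translation invariance, and \<open>F'\<close> is the derivative of the
  integrand at \<open>s = 0\<close>.\<close>

lemma integral_derivative_compact_support:
  fixes F F' :: "complex \<Rightarrow> complex" and D :: "complex \<Rightarrow> complex \<Rightarrow> complex" and v :: complex
  assumes D: "\<And>z. (F has_derivative D z) (at z)" "\<And>z. D z v = F' z"
    and cont: "continuous_on UNIV F'"
    and K: "compact K" "\<And>z. z \<notin> K \<Longrightarrow> F z = 0"
  shows "(LINT z|lborel. F' z) = 0"
proof -
  have cF: "continuous_on UNIV F"
    using D(1) has_derivative_continuous by (blast intro: continuous_at_imp_continuous_on)
  have shift: "continuous_on S (\<lambda>z. G (z + w))" if "continuous_on UNIV G" for G :: "complex \<Rightarrow> complex" and w S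
    by (rule continuous_on_compose2[OF that]) (auto intro!: continuous_intros)
  obtain r where r: "K \<subseteq> ball (0::complex) r"
    using K(1) compact_imp_bounded bounded_subset_ballD by blast
  have "bounded (cball (0::complex) (r + norm v))" by simp
  then obtain b where b: "cball (0::complex) (r + norm v) \<subseteq> cbox (- b) b"
    using bounded_subset_cbox_symmetric by blast
  let ?Q = "cbox (- b) b"
  have out: "F (z + s *\<^sub>R v) = 0" if "z \<notin> ?Q" "\<bar>s\<bar> \<le> 1" for z s
  proof (rule K(2))
    show "z + s *\<^sub>R v \<notin> K"
    proof
      assume "z + s *\<^sub>R v \<in> K"
      then have "norm (z + s *\<^sub>R v) \<le> r" using r by force
      moreover have "norm (s *\<^sub>R v) \<le> norm v" using that(2) by (simp add: mult_left_le_one_le)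
      ultimately have "norm z \<le> r + norm v"
        using norm_triangle_ineq4[of "z + s *\<^sub>R v" "s *\<^sub>R v"] by simp
      then show False using b that(1) by auto
    qed
  qed
  have F'0: "F' z = 0" if "z \<notin> ?Q" for z
  proof -
    have "ball (0::complex) r \<subseteq> cball 0 (r + norm v)" by (auto intro!: add_increasing2)
    then have "z \<notin> K" using that r b by blast
    then have "(F has_derivative (\<lambda>_. 0)) (at z)"
      by (intro has_derivative_zero_outside[OF compact_imp_closed[OF K(1)]] K(2))
    then have "D z = (\<lambda>_. 0)" using D(1) has_derivative_unique by blast
    then show ?thesis using D(2)[of z] by simp
  qed
  define I where "I s = integral ?Q (\<lambda>z. F (z + s *\<^sub>R v))" for s
  have "(I has_vector_derivative integral ?Q (\<lambda>z. F' (z + 0 *\<^sub>R v))) (at 0 within {-1<..<1})"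
    unfolding I_def
  proof (rule leibniz_rule_vector_derivative)
    fix s z
    have "((\<lambda>s. F (z + s *\<^sub>R v)) has_derivative (\<lambda>h. D (z + s *\<^sub>R v) (h *\<^sub>R v))) (at s within {-1<..<1})"
      by (rule has_derivative_compose[OF _ D(1)]) (auto intro!: derivative_eq_intros)
    then show "((\<lambda>s. F (z + s *\<^sub>R v)) has_vector_derivative F' (z + s *\<^sub>R v)) (at s within {-1<..<1})"
      using linear_scale[OF has_derivative_linear[OF D(1)]] by (simp add: has_vector_derivative_def D(2))
    show "continuous_on ({-1<..<1} \<times> ?Q) (\<lambda>(s, z). F' (z + s *\<^sub>R v))"
      unfolding case_prod_unfold by (rule continuous_on_compose2[OF cont]) (auto intro!: continuous_intros)
    show "(\<lambda>z. F (z + s *\<^sub>R v)) integrable_on ?Q" by (intro integrable_continuous shift cF)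
  qed auto
  then have "(I has_vector_derivative integral ?Q F') (at 0)"
    by (simp add: at_within_open[of 0 "{-1<..<1}"])
  moreover have "(I has_vector_derivative 0) (at 0)"
  proof (rule has_vector_derivative_transform_within_open[of "\<lambda>_. LINT z|lborel. F z" 0 0 "{-1<..<1}"])
    show "(LINT z|lborel. F z) = I s" if "s \<in> {-1<..<1}" for s
      unfolding I_def using that out shift[OF cF] integral_translate_lborel[of F]
      by (subst integral_over_box_eq_lborel) auto
  qed auto
  ultimately have "integral ?Q F' = 0" using vector_derivative_unique_at by blast
  then show ?thesis using integral_over_box_eq_lborel[OF cont F'0] by simp
qed

lemma continuous_on_extend_by_zero:
  assumes "open \<Omega>" "closed K" "K \<subseteq> \<Omega>" "continuous_on \<Omega> G" "\<And>z. z \<in> \<Omega> \<Longrightarrow> z \<notin> K \<Longrightarrow> G z = 0"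
  shows "continuous_on UNIV (\<lambda>z. if z \<in> \<Omega> then G z else 0)" (is "continuous_on _ ?G")
proof -
  have "continuous_on \<Omega> ?G" by (rule continuous_on_eq[OF assms(4)]) simp
  moreover have "continuous_on (- K) ?G"
    by (rule continuous_on_eq[OF continuous_on_const[of _ 0]]) (use assms(5) in auto)
  moreover have "\<Omega> \<union> - K = UNIV" using assms(3) by auto
  ultimately show ?thesis
    using continuous_on_open_Un[of \<Omega> "- K" ?G] assms(1,2) by (simp add: open_Compl)
qed

lemma continuous_on_imp_locally_integrable:
  fixes f :: "complex \<Rightarrow> 'a::euclidean_space"
  assumes "continuous_on \<Omega> f" shows "locally_integrable \<Omega> f"
  unfolding locally_integrable_def set_integrable_def
proof (intro allI impI)
  fix K assume K: "compact K \<and> K \<subseteq> \<Omega>"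
  have c: "continuous_on K f" using assms K continuous_on_subset by blast
  have "integrable lborel (\<lambda>x. indicator K x *\<^sub>R f x)"
    using K c by (intro borel_integrable_compact) auto
  moreover from this have "(\<lambda>x. indicator K x *\<^sub>R f x) \<in> borel_measurable lborel" by auto
  ultimately show "integrable lebesgue (\<lambda>x. indicator K x *\<^sub>R f x)"
    by (simp add: integrable_completion)
qed

lemma set_lebesgue_integral_lborel:
  fixes G :: "complex \<Rightarrow> 'a::euclidean_space"
  assumes "continuous_on UNIV (\<lambda>z. if z \<in> \<Omega> then G z else 0)"
  shows "(LINT z:\<Omega>|lebesgue. G z) = (LINT z|lborel. (if z \<in> \<Omega> then G z else 0))"
proof -
  have "(\<lambda>z. indicator \<Omega> z *\<^sub>R G z) = (\<lambda>z. if z \<in> \<Omega> then G z else 0)" by (auto simp: fun_eq_iff)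
  then show ?thesis unfolding set_lebesgue_integral_def
    using assms by (simp add: integral_completion borel_measurable_continuous_onI)
qed

lemma test_function_bounded:
  assumes "test_function \<Omega> \<phi>"
  obtains K B where "compact K" "K \<subseteq> \<Omega>" "\<And>z. z \<notin> K \<Longrightarrow> \<phi> z = 0" "\<And>z. \<bar>\<phi> z\<bar> \<le> B"
    "continuous_on UNIV \<phi>"
proof -
  obtain K where K: "compact K" "K \<subseteq> \<Omega>" "\<And>z. z \<notin> K \<Longrightarrow> \<phi> z = 0"
    using assms unfolding test_function_def by blast
  have "Ck_on 0 UNIV \<phi>" using assms unfolding test_function_def smooth_on_def by blast
  then have c: "continuous_on UNIV \<phi>" by simp
  have "bounded (\<phi> ` K)"
    by (intro compact_imp_bounded compact_continuous_image K continuous_on_subset[OF c]) auto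
  then obtain B where B: "\<And>z. z \<in> K \<Longrightarrow> \<bar>\<phi> z\<bar> \<le> B" by (auto simp: bounded_iff)
  have "\<bar>\<phi> z\<bar> \<le> \<bar>B\<bar>" for z using B[of z] K(3)[of z] by (cases "z \<in> K") auto
  then show thesis using that K c by blast
qed

text \<open>The product of a test function with the map, extended by zero, is again
  differentiable on the whole plane, so the integrals of its partial derivatives vanish.\<close>

lemma classical_imp_weak_gradient:
  fixes f :: "complex \<Rightarrow> complex"
  assumes \<Omega>: "open \<Omega>" and f: "Ck_on (Suc 0) \<Omega> f"
  shows "weak_gradient \<Omega> f (dx f, dy f)"
proof -
  have cf: "continuous_on \<Omega> f" using f Ck_on_imp_continuous_on by blast
  have cd: "continuous_on \<Omega> (dx f)" "continuous_on \<Omega> (dy f)" using f by auto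
  have *: "(LINT z:\<Omega>|lebesgue. \<phi>' z *\<^sub>R f z) = - (LINT z:\<Omega>|lebesgue. \<phi> z *\<^sub>R f' z)"
    if "test_function \<Omega> \<phi>" and v: "\<And>z. \<phi>' z = Re v *\<^sub>R dx \<phi> z + Im v *\<^sub>R dy \<phi> z"
      "\<And>z. f' z = Re v *\<^sub>R dx f z + Im v *\<^sub>R dy f z" for \<phi> \<phi>' f' v
  proof -
    obtain K where K: "compact K" "K \<subseteq> \<Omega>" "\<And>z. z \<notin> K \<Longrightarrow> \<phi> z = 0"
      by (rule test_function_bounded[OF \<open>test_function \<Omega> \<phi>\<close>]) (rule that)
    have sm: "Ck_on (Suc 0) UNIV \<phi>"
    proof -
      have "smooth_on UNIV \<phi>" using \<open>test_function \<Omega> \<phi>\<close> by (simp only: test_function_def)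
      then have "\<forall>k. Ck_on k UNIV \<phi>" unfolding smooth_on_def .
      then show ?thesis by (rule spec[of "\<lambda>k. Ck_on k UNIV \<phi>"])
    qed
    have d\<phi>: "(\<phi> has_derivative (\<lambda>h. Re h *\<^sub>R dx \<phi> z + Im h *\<^sub>R dy \<phi> z)) (at z)" for z
      using Ck_on_SucD[OF sm] by simp
    have c\<phi>: "continuous_on UNIV \<phi>" "continuous_on UNIV (dx \<phi>)" "continuous_on UNIV (dy \<phi>)"
      using sm Ck_on_imp_continuous_on[OF sm] by auto
    have \<phi>'0: "dx \<phi> z = 0" "dy \<phi> z = 0" if "z \<notin> K" for z
    proof -
      have "(\<phi> has_derivative (\<lambda>_. 0)) (at z)"
        by (rule has_derivative_zero_outside[OF compact_imp_closed[OF K(1)] K(3) that])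
      from dx_dy_eqI[OF this] show "dx \<phi> z = 0" "dy \<phi> z = 0" by auto
    qed
    have cl: "closed K" using K compact_imp_closed by blast
    have sub: "continuous_on \<Omega> \<phi>" "continuous_on \<Omega> (dx \<phi>)" "continuous_on \<Omega> (dy \<phi>)"
      using c\<phi> continuous_on_subset by blast+
    define F where "F z = (if z \<in> \<Omega> then \<phi> z *\<^sub>R f z else 0)" for z
    define A where "A z = (if z \<in> \<Omega> then \<phi>' z *\<^sub>R f z else 0)" for z
    define B where "B z = (if z \<in> \<Omega> then \<phi> z *\<^sub>R f' z else 0)" for z
    have cA: "continuous_on UNIV A"
      unfolding A_def v
    proof (rule continuous_on_extend_by_zero[OF \<Omega> cl K(2)])
      show "continuous_on \<Omega> (\<lambda>z. (Re v *\<^sub>R dx \<phi> z + Im v *\<^sub>R dy \<phi> z) *\<^sub>R f z)"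
        by (intro continuous_intros cf sub)
    qed (simp add: \<phi>'0)
    have cB: "continuous_on UNIV B"
      unfolding B_def v
    proof (rule continuous_on_extend_by_zero[OF \<Omega> cl K(2)])
      show "continuous_on \<Omega> (\<lambda>z. \<phi> z *\<^sub>R (Re v *\<^sub>R dx f z + Im v *\<^sub>R dy f z))"
        by (intro continuous_intros cd sub)
    qed (simp add: K(3))
    define D where "D z = (\<lambda>h. if z \<in> \<Omega> then \<phi> z *\<^sub>R (Re h *\<^sub>R dx f z + Im h *\<^sub>R dy f z)
        + (Re h *\<^sub>R dx \<phi> z + Im h *\<^sub>R dy \<phi> z) *\<^sub>R f z else 0)" for z
    have "(LINT z|lborel. A z + B z) = 0"
    proof (rule integral_derivative_compact_support[where D = D and v = v and F = F])
      show "(F has_derivative D z) (at z)" for z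
      proof (cases "z \<in> \<Omega>")
        case True
        have "((\<lambda>z. \<phi> z *\<^sub>R f z) has_derivative D z) (at z)"
          using has_derivative_scaleR[OF d\<phi>[of z] Ck_on_SucD[OF f True]] True by (simp add: D_def)
        then show ?thesis
          by (rule has_derivative_transform_within_open[OF _ \<Omega> True]) (simp add: F_def)
      next
        case False
        then have "z \<notin> K" using K(2) by auto
        then have "(F has_derivative (\<lambda>_. 0)) (at z)"
          by (rule has_derivative_zero_outside[OF compact_imp_closed[OF K(1)], rotated]) (simp add: F_def K(3))
        then show ?thesis using False by (simp add: D_def)
      qed
      show "D z v = A z + B z" for z by (simp add: D_def A_def B_def v)
      show "continuous_on UNIV (\<lambda>z. A z + B z)" by (intro continuous_intros cA cB)
      show "F z = 0" if "z \<notin> K" for z using that K by (simp add: F_def)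
    qed fact
    moreover have "integrable lborel A" "integrable lborel B"
      by (rule integrable_compact_support[OF _ K(1)], fact, use K \<phi>'0 in \<open>simp add: A_def B_def v\<close>)+
    ultimately show ?thesis
      using set_lebesgue_integral_lborel[of \<Omega> "\<lambda>z. \<phi>' z *\<^sub>R f z"] cA
        set_lebesgue_integral_lborel[of \<Omega> "\<lambda>z. \<phi> z *\<^sub>R f' z"] cB
      by (simp add: A_def[abs_def] B_def[abs_def] eq_neg_iff_add_eq_0)
  qed
  show ?thesis
    unfolding weak_gradient_def using *[of _ "dx _" 1 "dx f"] *[of _ "dy _" \<i> "dy f"]
    by (auto intro: continuous_on_imp_locally_integrable cf cd)
qed

text \<open>Products of flat functions of the distances to the sides are supported in the box and
  tend to its indicator function as \<open>n\<close> grows.\<close>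

lemma test_function_box:
  assumes "cbox a b \<subseteq> \<Omega>"
  shows "test_function \<Omega> (\<lambda>w. flat_exp (real n * (Re w - Re a)) * flat_exp (real n * (Re b - Re w)) *
     (flat_exp (real n * (Im w - Im a)) * flat_exp (real n * (Im b - Im w))))"
  unfolding test_function_def
proof (intro conjI exI[of _ "cbox a b"] allI impI)
  have "Ck_on k UNIV (\<lambda>w. real n * (Re w - Re a))" "Ck_on k UNIV (\<lambda>w. real n * (Re b - Re w))"
    "Ck_on k UNIV (\<lambda>w. real n * (Im w - Im a))" "Ck_on k UNIV (\<lambda>w. real n * (Im b - Im w))" for k
    by (intro Ck_on_mult Ck_on_diff Ck_on_const Ck_on_Re Ck_on_Im open_UNIV)+
  then have "Ck_on k UNIV (\<lambda>w. flat_exp (real n * (Re w - Re a)))" "Ck_on k UNIV (\<lambda>w. flat_exp (real n * (Re b - Re w)))"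
    "Ck_on k UNIV (\<lambda>w. flat_exp (real n * (Im w - Im a)))" "Ck_on k UNIV (\<lambda>w. flat_exp (real n * (Im b - Im w)))" for k
    using smooth_flat_exp_compose unfolding smooth_on_def by blast+
  then show "smooth_on UNIV (\<lambda>w. flat_exp (real n * (Re w - Re a)) * flat_exp (real n * (Re b - Re w)) *
     (flat_exp (real n * (Im w - Im a)) * flat_exp (real n * (Im b - Im w))))"
    unfolding smooth_on_def by (intro allI Ck_on_mult open_UNIV)
  fix z assume "z \<notin> cbox a b"
  then have "Re z < Re a \<or> Re b < Re z \<or> Im z < Im a \<or> Im b < Im z" by (auto simp: in_cbox_complex_iff)
  then show "flat_exp (real n * (Re z - Re a)) * flat_exp (real n * (Re b - Re z)) *
     (flat_exp (real n * (Im z - Im a)) * flat_exp (real n * (Im b - Im z))) = 0"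
    by (auto simp: flat_exp_zero mult_nonneg_nonpos)
qed (use assms in auto)

lemma integral_box_zero_of_test_functions:
  fixes d :: "complex \<Rightarrow> complex"
  assumes d: "locally_integrable \<Omega> d" and sub: "cbox a b \<subseteq> \<Omega>"
    and zero: "\<And>\<phi>. test_function \<Omega> \<phi> \<Longrightarrow> (LINT z:\<Omega>|lebesgue. \<phi> z *\<^sub>R d z) = 0"
  shows "(LINT z:box a b|lebesgue. d z) = 0"
proof -
  define \<phi> where "\<phi> n w = flat_exp (real n * (Re w - Re a)) * flat_exp (real n * (Re b - Re w)) *
     (flat_exp (real n * (Im w - Im a)) * flat_exp (real n * (Im b - Im w)))" for n w
  have di: "set_integrable lebesgue (cbox a b) d"
    using d sub by (auto simp: locally_integrable_def)
  have t: "test_function \<Omega> (\<phi> n)" for n unfolding \<phi>_def by (rule test_function_box[OF sub])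
  have \<phi>c: "continuous_on UNIV (\<phi> n)" for n
  proof -
    have "Ck_on 0 UNIV (\<phi> n)" using t[of n] unfolding test_function_def smooth_on_def by blast
    then show ?thesis by simp
  qed
  have \<phi>0: "\<phi> n z = 0" if "z \<notin> cbox a b" for n z
    using that by (auto simp: \<phi>_def in_cbox_complex_iff not_le flat_exp_zero mult_nonneg_nonpos)
  have \<phi>b: "\<bar>\<phi> n z\<bar> \<le> 1" for n z
    by (simp add: \<phi>_def abs_mult mult_le_one)
  have eq: "(LINT z:\<Omega>|lebesgue. \<phi> n z *\<^sub>R d z) = (LINT z|lebesgue. \<phi> n z *\<^sub>R (indicator (cbox a b) z *\<^sub>R d z))" for n
    unfolding set_lebesgue_integral_def
    using \<phi>0 sub by (intro Bochner_Integration.integral_cong) (auto split: split_indicator)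
  have lim: "(\<lambda>n. (LINT z|lebesgue. \<phi> n z *\<^sub>R (indicator (cbox a b) z *\<^sub>R d z))) \<longlonglongrightarrow>
      (LINT z|lebesgue. indicator (box a b) z *\<^sub>R (indicator (cbox a b) z *\<^sub>R d z))"
  proof (rule integral_dominated_convergence[where w = "\<lambda>z. norm (indicator (cbox a b) z *\<^sub>R d z)"])
    have m: "(\<lambda>z. indicator (cbox a b) z *\<^sub>R d z) \<in> borel_measurable lebesgue"
      using di by (auto simp: set_integrable_def)
    show "(\<lambda>z. indicator (box a b) z *\<^sub>R (indicator (cbox a b) z *\<^sub>R d z)) \<in> borel_measurable lebesgue"
      by (intro borel_measurable_scaleR m borel_measurable_indicator) auto
    show "(\<lambda>z. \<phi> n z *\<^sub>R (indicator (cbox a b) z *\<^sub>R d z)) \<in> borel_measurable lebesgue" for n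
    proof (rule borel_measurable_scaleR[OF _ m])
      show "\<phi> n \<in> borel_measurable lebesgue"
        by (rule measurable_completion) (simp add: borel_measurable_continuous_onI \<phi>c)
    qed
    show "integrable lebesgue (\<lambda>z. norm (indicator (cbox a b) z *\<^sub>R d z))"
      by (rule integrable_norm[OF di[unfolded set_integrable_def]])
    show "AE z in lebesgue. norm (\<phi> n z *\<^sub>R (indicator (cbox a b) z *\<^sub>R d z)) \<le> norm (indicator (cbox a b) z *\<^sub>R d z)" for n
    proof -
      have "norm (c *\<^sub>R X) \<le> norm X" if "\<bar>c\<bar> \<le> 1" for c and X :: complex
        using that by (simp add: mult_left_le_one_le)
      then show ?thesis using \<phi>b by blast
    qed
    show "AE z in lebesgue. (\<lambda>n. \<phi> n z *\<^sub>R (indicator (cbox a b) z *\<^sub>R d z)) \<longlonglongrightarrow>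
        indicator (box a b) z *\<^sub>R (indicator (cbox a b) z *\<^sub>R d z)"
    proof (rule AE_I2)
      fix z
      have "(\<lambda>n. \<phi> n z) \<longlonglongrightarrow> indicator {0<..} (Re z - Re a) * indicator {0<..} (Re b - Re z) *
          (indicator {0<..} (Im z - Im a) * indicator {0<..} (Im b - Im z))"
        unfolding \<phi>_def by (intro tendsto_mult flat_exp_scaled_tendsto)
      also have "indicator {0<..} (Re z - Re a) * indicator {0<..} (Re b - Re z) *
          (indicator {0<..} (Im z - Im a) * indicator {0<..} (Im b - Im z)) = (indicator (box a b) z :: real)"
        by (auto simp: indicator_def in_box_complex_iff)
      finally show "(\<lambda>n. \<phi> n z *\<^sub>R (indicator (cbox a b) z *\<^sub>R d z)) \<longlonglongrightarrow>
          indicator (box a b) z *\<^sub>R (indicator (cbox a b) z *\<^sub>R d z)"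
        by (intro tendsto_scaleR tendsto_const)
    qed
  qed
  have "(LINT z|lebesgue. \<phi> n z *\<^sub>R (indicator (cbox a b) z *\<^sub>R d z)) = 0" for n
    using zero[OF t] eq by simp
  with lim have "(LINT z|lebesgue. indicator (box a b) z *\<^sub>R (indicator (cbox a b) z *\<^sub>R d z)) = 0"
    by (simp add: LIMSEQ_const_iff)
  moreover have "(\<lambda>z. indicator (box a b) z *\<^sub>R (indicator (cbox a b) z *\<^sub>R d z)) = (\<lambda>z. indicator (box a b) z *\<^sub>R d z)"
    using box_subset_cbox[of a b] by (auto simp: indicator_def fun_eq_iff)
  ultimately show ?thesis unfolding set_lebesgue_integral_def by (simp only:)
qed

text \<open>The positive and the negative part define two finite measures that agree on boxes,
  hence on all Borel sets.\<close>

lemma AE_zero_of_box_integrals_real: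
  fixes d :: "complex \<Rightarrow> real"
  assumes di: "set_integrable lebesgue (box l u) d"
    and zero: "\<And>a b. box a b \<subseteq> box l u \<Longrightarrow> (LINT z:box a b|lebesgue. d z) = 0"
  shows "AE z in lborel. z \<in> box l u \<longrightarrow> d z = 0"
proof -
  let ?d = "\<lambda>z. indicator (box l u) z *\<^sub>R d z"
  have dint: "integrable lebesgue ?d" using di by (simp add: set_integrable_def)
  obtain e where [measurable]: "e \<in> borel_measurable lborel" and e: "AE z in lborel. ?d z = e z"
    using completion_ex_borel_measurable_real[of ?d lborel] dint by auto
  have ei: "integrable lborel e"
  proof -
    have "e \<in> borel_measurable lebesgue" by (rule measurable_completion) measurable
    then have "integrable lebesgue e"
      using integrable_cong_AE[of ?d lebesgue e] dint AE_completion[OF e] by blast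
    then show ?thesis using integrable_completion[of e lborel] by simp
  qed
  define p where "p z = ennreal (max 0 (e z))" for z
  define m where "m z = ennreal (max 0 (- e z))" for z
  have [measurable]: "p \<in> borel_measurable lborel" "m \<in> borel_measurable lborel"
    unfolding p_def m_def by measurable
  have box: "(\<integral>\<^sup>+z. p z * indicator (box a b) z \<partial>lborel) = (\<integral>\<^sup>+z. m z * indicator (box a b) z \<partial>lborel)" for a b
  proof -
    have i1: "integrable lborel (\<lambda>z. indicator (box a b) z * max 0 (e z))"
      "integrable lborel (\<lambda>z. indicator (box a b) z * max 0 (- e z))"
    proof -
      have M: "integrable lborel (\<lambda>z. max 0 (e z))" "integrable lborel (\<lambda>z. max 0 (- e z))"
        using ei by (auto intro: integrable_max)
      have bs: "box a b \<in> sets lborel" by simp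
      show "integrable lborel (\<lambda>z. indicator (box a b) z * max 0 (e z))"
        "integrable lborel (\<lambda>z. indicator (box a b) z * max 0 (- e z))"
        by (fact integrable_mult_indicator[OF bs M(1), unfolded real_scaleR_def]
            integrable_mult_indicator[OF bs M(2), unfolded real_scaleR_def])+
    qed
    obtain a' b' where ab': "box a b \<inter> box l u = box a' b'" using box_Int_box[of a b l u] by blast
    have "(LINT z|lborel. indicator (box a b) z * e z) = (LINT z|lebesgue. indicator (box a b) z * e z)"
      by (simp add: integral_completion)
    also have "\<dots> = (LINT z|lebesgue. indicator (box a b) z * ?d z)"
    proof (rule integral_cong_AE)
      show "(\<lambda>z. indicator (box a b) z * e z) \<in> borel_measurable lebesgue"
        by (intro measurable_completion) measurable
      show "(\<lambda>z. indicator (box a b) z * ?d z) \<in> borel_measurable lebesgue"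
        using dint by (intro borel_measurable_times borel_measurable_indicator) auto
      show "AE z in lebesgue. indicator (box a b) z * e z = indicator (box a b) z * ?d z"
        using AE_completion[OF e] by eventually_elim simp
    qed
    also have "\<dots> = (LINT z:box a' b'|lebesgue. d z)"
      unfolding set_lebesgue_integral_def ab'[symmetric]
      by (intro Bochner_Integration.integral_cong) (auto split: split_indicator)
    also have "\<dots> = 0" using ab' by (intro zero) blast
    also have "(\<lambda>z. indicator (box a b) z * e z) =
        (\<lambda>z. indicator (box a b) z * max 0 (e z) - indicator (box a b) z * max 0 (- e z))"
      by (auto simp: fun_eq_iff indicator_def max_def)
    finally have "(LINT z|lborel. indicator (box a b) z * max 0 (e z)) = (LINT z|lborel. indicator (box a b) z * max 0 (- e z))"
      using Bochner_Integration.integral_diff[OF i1] by simp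
    then have eqi: "ennreal (LINT z|lborel. indicator (box a b) z * max 0 (e z)) = ennreal (LINT z|lborel. indicator (box a b) z * max 0 (- e z))"
      by simp
    have "(\<integral>\<^sup>+z. p z * indicator (box a b) z \<partial>lborel) = (\<integral>\<^sup>+z. ennreal (indicator (box a b) z * max 0 (e z)) \<partial>lborel)"
      by (rule nn_integral_cong) (simp add: p_def split: split_indicator)
    also have "\<dots> = ennreal (LINT z|lborel. indicator (box a b) z * max 0 (e z))"
      by (rule nn_integral_eq_integral[OF i1(1)]) simp
    also note eqi
    also have "ennreal (LINT z|lborel. indicator (box a b) z * max 0 (- e z)) =
        (\<integral>\<^sup>+z. ennreal (indicator (box a b) z * max 0 (- e z)) \<partial>lborel)"
      by (rule nn_integral_eq_integral[OF i1(2), symmetric]) simp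
    also have "\<dots> = (\<integral>\<^sup>+z. m z * indicator (box a b) z \<partial>lborel)"
      by (rule nn_integral_cong) (simp add: m_def split: split_indicator)
    finally show ?thesis .
  qed
  have fin: "(\<integral>\<^sup>+z. p z \<partial>lborel) \<noteq> \<infinity>"
  proof -
    have "(\<integral>\<^sup>+z. p z \<partial>lborel) = ennreal (LINT z|lborel. max 0 (e z))"
      unfolding p_def by (rule nn_integral_eq_integral) (use ei in auto)
    then show ?thesis by simp
  qed
  have "density lborel p = density lborel m"
  proof (rule measure_eqI_generator_eq[where E = "range (\<lambda>(a, b). box a b)" and A = "\<lambda>n. box (- (real n *\<^sub>R One)) (real n *\<^sub>R One)" and \<Omega> = UNIV])
    show "Int_stable (range (\<lambda>(a, b). box a b :: complex set))"
      by (auto simp: Int_stable_def box_Int_box)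
    show "sets (density lborel p) = sigma_sets UNIV (range (\<lambda>(a, b). box a b))"
      "sets (density lborel m) = sigma_sets UNIV (range (\<lambda>(a, b). box a b))"
      by (simp_all add: borel_eq_box)
    show "(\<Union>n. box (- (real n *\<^sub>R One)) (real n *\<^sub>R One)) = (UNIV :: complex set)"
      by (rule UN_box_eq_UNIV)
    show "emeasure (density lborel p) (box (- (real n *\<^sub>R One)) (real n *\<^sub>R One)) \<noteq> \<infinity>" for n
    proof -
      have "emeasure (density lborel p) (box (- (real n *\<^sub>R One)) (real n *\<^sub>R One)) \<le> (\<integral>\<^sup>+z. p z \<partial>lborel)"
        by (simp add: emeasure_density) (intro nn_integral_mono, simp split: split_indicator)
      then show ?thesis using fin by (metis infinity_ennreal_def neq_top_trans)
    qed
  qed (auto simp: emeasure_density box)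
  then have "AE z in lborel. p z = m z"
    using finite_density_unique[of p lborel m] fin by simp
  then show ?thesis using e
  proof eventually_elim
    case (elim z)
    then have "e z = 0" by (auto simp: p_def m_def max_def split: if_splits)
    then show ?case using elim by auto
  qed
qed

lemma AE_zero_of_box_integrals:
  fixes d :: "complex \<Rightarrow> complex"
  assumes di: "set_integrable lebesgue (box l u) d"
    and zero: "\<And>a b. box a b \<subseteq> box l u \<Longrightarrow> (LINT z:box a b|lebesgue. d z) = 0"
  shows "AE z in lborel. z \<in> box l u \<longrightarrow> d z = 0"
proof -
  have sub: "set_integrable lebesgue (box a b) d" if "box a b \<subseteq> box l u" for a b
    by (rule set_integrable_subset[OF di _ that]) simp
  have "AE z in lborel. z \<in> box l u \<longrightarrow> Re (d z) = 0"
  proof (rule AE_zero_of_box_integrals_real)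
    show "set_integrable lebesgue (box l u) (\<lambda>z. Re (d z))"
      using integrable_Re[OF di[unfolded set_integrable_def]] by (simp add: set_integrable_def)
    show "(LINT z:box a b|lebesgue. Re (d z)) = 0" if "box a b \<subseteq> box l u" for a b
      using integral_Re[OF sub[OF that, unfolded set_integrable_def]] zero[OF that]
      by (simp add: set_lebesgue_integral_def)
  qed
  moreover have "AE z in lborel. z \<in> box l u \<longrightarrow> Im (d z) = 0"
  proof (rule AE_zero_of_box_integrals_real)
    show "set_integrable lebesgue (box l u) (\<lambda>z. Im (d z))"
      using integrable_Im[OF di[unfolded set_integrable_def]] by (simp add: set_integrable_def)
    show "(LINT z:box a b|lebesgue. Im (d z)) = 0" if "box a b \<subseteq> box l u" for a b
      using integral_Im[OF sub[OF that, unfolded set_integrable_def]] zero[OF that]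
      by (simp add: set_lebesgue_integral_def)
  qed
  ultimately show ?thesis by eventually_elim (simp add: complex_eq_iff)
qed

lemma integrable_test_function_times:
  fixes g :: "complex \<Rightarrow> complex"
  assumes "test_function \<Omega> \<phi>" "locally_integrable \<Omega> g"
  shows "set_integrable lebesgue \<Omega> (\<lambda>z. \<phi> z *\<^sub>R g z)"
proof -
  obtain K B where K: "compact K" "K \<subseteq> \<Omega>" "\<And>z. z \<notin> K \<Longrightarrow> \<phi> z = 0" "\<And>z. \<bar>\<phi> z\<bar> \<le> B"
    "continuous_on UNIV \<phi>"
    using test_function_bounded[OF assms(1)] by metis
  have gK: "integrable lebesgue (\<lambda>z. indicator K z *\<^sub>R g z)"
    using assms(2) K(1,2) by (auto simp: locally_integrable_def set_integrable_def)
  have "integrable lebesgue (\<lambda>z. \<phi> z *\<^sub>R (indicator K z *\<^sub>R g z))"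
  proof (rule Bochner_Integration.integrable_bound)
    show "integrable lebesgue (\<lambda>z. B *\<^sub>R (indicator K z *\<^sub>R g z))"
      by (intro integrable_scaleR_right gK)
    show "(\<lambda>z. \<phi> z *\<^sub>R (indicator K z *\<^sub>R g z)) \<in> borel_measurable lebesgue"
    proof (rule borel_measurable_scaleR)
      show "\<phi> \<in> borel_measurable lebesgue"
        by (rule measurable_completion) (simp add: borel_measurable_continuous_onI K(5))
    qed (use gK in auto)
    show "AE z in lebesgue. norm (\<phi> z *\<^sub>R (indicator K z *\<^sub>R g z)) \<le> norm (B *\<^sub>R (indicator K z *\<^sub>R g z))"
    proof (rule AE_I2)
      fix z
      have "\<bar>\<phi> z\<bar> \<le> \<bar>B\<bar>" using K(4)[of z] by linarith
      then show "norm (\<phi> z *\<^sub>R (indicator K z *\<^sub>R g z)) \<le> norm (B *\<^sub>R (indicator K z *\<^sub>R g z))"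
        unfolding norm_scaleR by (intro mult_right_mono) auto
    qed
  qed
  moreover have "(\<lambda>z. \<phi> z *\<^sub>R (indicator K z *\<^sub>R g z)) = (\<lambda>z. indicator \<Omega> z *\<^sub>R (\<phi> z *\<^sub>R g z))"
    using K(2,3) by (auto simp: indicator_def fun_eq_iff)
  ultimately show ?thesis unfolding set_integrable_def by (simp only:)
qed

lemma locally_integrable_diff:
  assumes "locally_integrable \<Omega> f" "locally_integrable \<Omega> g"
  shows "locally_integrable \<Omega> (\<lambda>z. f z - g z)"
  using assms unfolding locally_integrable_def by (auto intro!: set_integral_diff)

lemma AE_eq_of_test_functions:
  fixes g1 g2 :: "complex \<Rightarrow> complex"
  assumes \<Omega>: "open \<Omega>" and l: "locally_integrable \<Omega> g1" "locally_integrable \<Omega> g2"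
    and eq: "\<And>\<phi>. test_function \<Omega> \<phi> \<Longrightarrow> (LINT z:\<Omega>|lebesgue. \<phi> z *\<^sub>R g1 z) = (LINT z:\<Omega>|lebesgue. \<phi> z *\<^sub>R g2 z)"
  shows "AE z in lebesgue. z \<in> \<Omega> \<longrightarrow> g1 z = g2 z"
proof -
  define d where "d z = g1 z - g2 z" for z
  have ld: "locally_integrable \<Omega> d" unfolding d_def by (rule locally_integrable_diff[OF l])
  have zero: "(LINT z:\<Omega>|lebesgue. \<phi> z *\<^sub>R d z) = 0" if "test_function \<Omega> \<phi>" for \<phi>
    using set_integral_diff(2)[OF integrable_test_function_times[OF that l(1)]
        integrable_test_function_times[OF that l(2)]] eq[OF that]
    by (simp add: d_def scaleR_diff_right)
  have AEbox: "AE z in lborel. z \<in> cbox a b \<longrightarrow> d z = 0" if sub: "cbox a b \<subseteq> \<Omega>" for a b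
  proof -
    have "set_integrable lebesgue (cbox a b) d" using ld sub by (auto simp: locally_integrable_def)
    then have "set_integrable lebesgue (box a b) d"
      by (rule set_integrable_subset) (auto simp: box_subset_cbox)
    moreover have "(LINT z:box a' b'|lebesgue. d z) = 0" if "box a' b' \<subseteq> box a b" for a' b'
    proof (cases "box a' b' = {}")
      case False
      then have "cbox a' b' \<subseteq> cbox a b" using that by (metis closure_box closure_mono box_subset_cbox closed_cbox closure_minimal subset_trans)
      then show ?thesis by (intro integral_box_zero_of_test_functions[OF ld _ zero]) (use sub in auto)
    qed (simp add: set_lebesgue_integral_def)
    ultimately have "AE z in lborel. z \<in> box a b \<longrightarrow> d z = 0" by (rule AE_zero_of_box_integrals)
    moreover have "AE z in lborel. z \<notin> cbox a b - box a b"
    proof -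
      have "negligible (cbox a b - box a b)" by (rule negligible_frontier_interval)
      moreover have "cbox a b - box a b \<in> sets borel" by simp
      ultimately show ?thesis
        by (intro AE_not_in) (simp add: negligible_iff_null_sets null_sets_completion_iff)
    qed
    ultimately show ?thesis by eventually_elim auto
  qed
  obtain \<D> where D: "countable \<D>" "\<D> \<subseteq> Pow \<Omega>" "\<And>X. X \<in> \<D> \<Longrightarrow> \<exists>a b. X = cbox a b" "\<Union>\<D> = \<Omega>"
    using open_countable_Union_open_cbox[OF \<Omega>] by metis
  have "AE z in lborel. \<forall>X\<in>\<D>. z \<in> X \<longrightarrow> d z = 0"
    unfolding AE_ball_countable[OF D(1)]
  proof
    fix X assume X: "X \<in> \<D>"
    then obtain a b where "X = cbox a b" using D(3) by blast
    then show "AE z in lborel. z \<in> X \<longrightarrow> d z = 0" using AEbox X D(2) by auto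
  qed
  then have "AE z in lborel. z \<in> \<Omega> \<longrightarrow> g1 z = g2 z"
    by eventually_elim (use D(4) in \<open>auto simp: d_def\<close>)
  then show ?thesis by (rule AE_completion)
qed

text \<open>The weak gradient chosen by \<open>wgrad\<close> is an arbitrary one. Uniqueness
  identifies it with the classical gradient of the radial map.\<close>

lemma weak_gradient_unique:
  assumes \<Omega>: "open \<Omega>" and g1: "weak_gradient \<Omega> h g1" and g2: "weak_gradient \<Omega> h g2"
  shows "AE z in lebesgue. z \<in> \<Omega> \<longrightarrow> fst g1 z = fst g2 z \<and> snd g1 z = snd g2 z"
proof -
  have l: "locally_integrable \<Omega> (fst g1)" "locally_integrable \<Omega> (snd g1)"
    "locally_integrable \<Omega> (fst g2)" "locally_integrable \<Omega> (snd g2)"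
    using g1 g2 by (auto simp: weak_gradient_def)
  have "AE z in lebesgue. z \<in> \<Omega> \<longrightarrow> fst g1 z = fst g2 z"
    by (rule AE_eq_of_test_functions[OF \<Omega> l(1,3)]) (use g1 g2 in \<open>auto simp: weak_gradient_def\<close>)
  moreover have "AE z in lebesgue. z \<in> \<Omega> \<longrightarrow> snd g1 z = snd g2 z"
    by (rule AE_eq_of_test_functions[OF \<Omega> l(2,4)]) (use g1 g2 in \<open>auto simp: weak_gradient_def\<close>)
  ultimately show ?thesis by eventually_elim auto
qed

section \<open>Mollification with control of a weighted energy\<close>

lemma Ck_on_translate:
  fixes \<psi> :: "complex \<Rightarrow> real"
  assumes "\<And>k. Ck_on k UNIV \<psi>"
  shows "Ck_on k UNIV (\<lambda>w. \<psi> (z - w))"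
  by (rule Ck_on_compose[OF open_UNIV assms]) (auto intro!: Ck_on_diff Ck_on_const Ck_on_id open_UNIV)

lemma dx_dy_reflect:
  fixes \<psi> :: "complex \<Rightarrow> real"
  assumes "Ck_on (Suc 0) UNIV \<psi>"
  shows "dx (\<lambda>w. \<psi> (z - w)) w = - dx \<psi> (z - w)" "dy (\<lambda>w. \<psi> (z - w)) w = - dy \<psi> (z - w)"
proof -
  have "((\<lambda>w. \<psi> (z - w)) has_derivative (\<lambda>h. Re (- h) *\<^sub>R dx \<psi> (z - w) + Im (- h) *\<^sub>R dy \<psi> (z - w))) (at w)"
    by (rule has_derivative_compose[OF _ Ck_on_SucD[OF assms]]) (auto intro!: derivative_eq_intros)
  from dx_dy_eqI[OF this] show "dx (\<lambda>w. \<psi> (z - w)) w = - dx \<psi> (z - w)" "dy (\<lambda>w. \<psi> (z - w)) w = - dy \<psi> (z - w)"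
    by auto
qed

text \<open>Convolution over a fixed box, which makes differentiation under the integral sign
  elementary; the box is later taken large enough to contain the support of the kernel.\<close>

definition conv :: "complex \<Rightarrow> complex \<Rightarrow> (complex \<Rightarrow> real) \<Rightarrow> (complex \<Rightarrow> complex) \<Rightarrow> complex \<Rightarrow> complex" where
  "conv a b \<psi> H z = integral (cbox a b) (\<lambda>w. \<psi> (z - w) *\<^sub>R H w)"

lemma conv_has_derivative:
  assumes \<psi>: "Ck_on (Suc 0) UNIV \<psi>" and H: "continuous_on UNIV H"
  shows "(conv a b \<psi> H has_derivative
     (\<lambda>h. Re h *\<^sub>R conv a b (dx \<psi>) H z + Im h *\<^sub>R conv a b (dy \<psi>) H z)) (at z)"
proof -
  have c: "continuous_on UNIV \<psi>" "continuous_on UNIV (dx \<psi>)" "continuous_on UNIV (dy \<psi>)"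
    using \<psi> Ck_on_imp_continuous_on[OF \<psi>] by auto
  define B :: "complex \<Rightarrow> complex \<Rightarrow> complex \<Rightarrow>\<^sub>L complex" where
    "B z w = (blinfun_scaleR_left (dx \<psi> (z - w) *\<^sub>R H w) o\<^sub>L Blinfun Re) +
       (blinfun_scaleR_left (dy \<psi> (z - w) *\<^sub>R H w) o\<^sub>L Blinfun Im)" for z w
  have Bapp: "blinfun_apply (B z w) h = Re h *\<^sub>R (dx \<psi> (z - w) *\<^sub>R H w) + Im h *\<^sub>R (dy \<psi> (z - w) *\<^sub>R H w)" for z w h
    by (simp add: B_def blinfun.add_left bounded_linear_Blinfun_apply bounded_linear_Re bounded_linear_Im)
  have d: "((\<lambda>z. \<psi> (z - w) *\<^sub>R H w) has_derivative blinfun_apply (B z w)) (at z within UNIV)" for z w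
  proof -
    have "((\<lambda>z. \<psi> (z - w)) has_derivative (\<lambda>h. Re h *\<^sub>R dx \<psi> (z - w) + Im h *\<^sub>R dy \<psi> (z - w))) (at z)"
      by (rule has_derivative_compose[OF _ Ck_on_SucD[OF \<psi>]]) (auto intro!: derivative_eq_intros)
    then have "((\<lambda>z. \<psi> (z - w) *\<^sub>R H w) has_derivative (\<lambda>h. (Re h *\<^sub>R dx \<psi> (z - w) + Im h *\<^sub>R dy \<psi> (z - w)) *\<^sub>R H w)) (at z)"
      by (rule has_derivative_scaleR_left)
    then show ?thesis by (rule has_derivative_eq_rhs) (auto simp: fun_eq_iff Bapp algebra_simps)
  qed
  have cshift: "continuous_on UNIV (\<lambda>p. \<eta> (fst p - snd p) *\<^sub>R H (snd p))" if "continuous_on UNIV \<eta>" for \<eta> :: "complex \<Rightarrow> real"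
    by (intro continuous_intros continuous_on_compose2[OF that] continuous_on_compose2[OF H]) auto
  have cH: "continuous_on UNIV (\<lambda>w. \<eta> (z - w) *\<^sub>R H w)" if "continuous_on UNIV \<eta>" for \<eta> :: "complex \<Rightarrow> real" and z
    by (intro continuous_intros continuous_on_compose2[OF that] H) auto
  have int: "(\<lambda>w. \<eta> (z - w) *\<^sub>R H w) integrable_on cbox a b" if "continuous_on UNIV \<eta>" for \<eta> :: "complex \<Rightarrow> real" and z
    by (rule integrable_continuous, rule continuous_on_subset[OF cH[OF that]]) simp
  have cB: "continuous_on (UNIV \<times> cbox a b) (\<lambda>(z, w). B z w)"
    unfolding B_def case_prod_unfold
    by (intro continuous_intros bounded_linear.continuous_on[OF bounded_linear_blinfun_scaleR_left]
        continuous_on_subset[OF cshift[OF c(2)]] continuous_on_subset[OF cshift[OF c(3)]]) auto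
  have f1: "(conv a b \<psi> H has_derivative blinfun_apply (integral (cbox a b) (B z))) (at z within UNIV)"
    unfolding conv_def[abs_def] by (rule leibniz_rule[OF d int[OF c(1)] cB]) auto
  have f2: "blinfun_apply (integral (cbox a b) (B z)) h =
      Re h *\<^sub>R conv a b (dx \<psi>) H z + Im h *\<^sub>R conv a b (dy \<psi>) H z" for h
  proof -
    have iB: "B z integrable_on cbox a b"
    proof (rule integrable_continuous)
      show "continuous_on (cbox a b) (B z)"
      proof -
        have "continuous_on (cbox a b) (\<lambda>w. (\<lambda>(z, w). B z w) (z, w))"
          by (rule continuous_on_compose2[OF cB]) (auto intro!: continuous_intros)
        then show ?thesis by simp
      qed
    qed
    have "blinfun_apply (integral (cbox a b) (B z)) h = integral (cbox a b) (\<lambda>w. blinfun_apply (B z w) h)"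
      using integral_linear[OF iB bounded_linear_blinfun_apply[OF bounded_linear_ident]]
        blinfun_apply_integral[OF iB] by simp
    also have "\<dots> = Re h *\<^sub>R conv a b (dx \<psi>) H z + Im h *\<^sub>R conv a b (dy \<psi>) H z"
      unfolding Bapp conv_def
      by (simp only: integral_add[OF integrable_cmul[OF int[OF c(2)]] integrable_cmul[OF int[OF c(3)]]] integral_cmul)
    finally show ?thesis .
  qed
  show ?thesis by (rule has_derivative_eq_rhs[OF f1]) (rule ext, rule f2)
qed

lemma Ck_on_conv:
  assumes "\<And>k. Ck_on k UNIV \<psi>" and H: "continuous_on UNIV H"
  shows "Ck_on k UNIV (conv a b \<psi> H)"
  using assms(1)
proof (induction k arbitrary: \<psi>)
  case 0
  have "continuous_on UNIV (conv a b \<psi> H)"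
    using conv_has_derivative[OF 0 H] has_derivative_continuous
    by (blast intro: continuous_at_imp_continuous_on)
  then show ?case by simp
next
  case (Suc k)
  have *: "Ck_on n UNIV (dx \<psi>)" "Ck_on n UNIV (dy \<psi>)" for n using Suc.prems[of "Suc n"] by auto
  show ?case
    by (rule Ck_on_SucI[OF open_UNIV conv_has_derivative[OF Suc.prems H] Suc.IH[OF *(1)] Suc.IH[OF *(2)]])
qed

lemma mollifier_exists:
  assumes "\<epsilon> > 0"
  obtains \<phi> :: "complex \<Rightarrow> real" where "\<And>k. Ck_on k UNIV \<phi>" "\<And>w. \<phi> w \<ge> 0" "\<And>w. cmod w \<ge> \<epsilon> \<Longrightarrow> \<phi> w = 0"
    "integrable lborel \<phi>" "(LINT w|lborel. \<phi> w) = 1"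
proof -
  define \<psi> where "\<psi> w = flat_exp (\<epsilon>\<^sup>2 - (Re w * Re w + Im w * Im w))" for w
  have sm: "Ck_on k UNIV \<psi>" for k
  proof -
    have "smooth_on UNIV \<psi>"
      unfolding \<psi>_def
      by (rule smooth_flat_exp_compose) (auto simp: smooth_on_def intro!: Ck_on_diff Ck_on_const Ck_on_add Ck_on_mult)
    then show ?thesis by (simp add: smooth_on_def)
  qed
  have n2: "Re w * Re w + Im w * Im w = (cmod w)\<^sup>2" for w using cmod_power2[of w] by (simp only: power2_eq_square)
  have out: "\<psi> w = 0" if "cmod w \<ge> \<epsilon>" for w
    using power_mono[OF that, of 2] assms by (simp add: \<psi>_def n2 flat_exp_zero)
  have pos: "\<psi> w > 0" if "cmod w < \<epsilon>" for w
    using power_strict_mono[OF that, of 2] assms by (simp add: \<psi>_def n2 flat_exp_pos)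
  have nn: "\<psi> w \<ge> 0" for w by (simp add: \<psi>_def)
  have c: "continuous_on UNIV \<psi>" using sm[of 0] by simp
  have int: "integrable lborel \<psi>"
    by (rule integrable_compact_support[OF c compact_cball[of 0 \<epsilon>]]) (auto intro: out)
  define I where "I = (LINT w|lborel. \<psi> w)"
  have "I > 0"
  proof (rule ccontr)
    assume "\<not> I > 0"
    then have "I = 0" using integral_nonneg_AE[of \<psi> lborel] nn by (simp add: I_def not_less antisym)
    then have "AE w in lborel. \<psi> w = 0"
      using integral_nonneg_eq_0_iff_AE[OF int] nn by (simp add: I_def)
    then have "AE w in lborel. w \<notin> ball (0::complex) \<epsilon>"
      by (rule eventually_mono) (use pos in force)
    then have "ball (0::complex) \<epsilon> \<in> null_sets lborel"
      by (subst AE_iff_null_sets) auto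
    then have "negligible (ball (0::complex) \<epsilon>)"
      by (simp add: negligible_iff_null_sets null_sets_completionI)
    then show False using assms open_not_negligible[of "ball (0::complex) \<epsilon>"] by auto
  qed
  show thesis
  proof (rule that[of "\<lambda>w. (1 / I) * \<psi> w"])
    show "Ck_on k UNIV (\<lambda>w. (1 / I) * \<psi> w)" for k
      by (intro Ck_on_mult Ck_on_const sm open_UNIV)
    show "(LINT w|lborel. (1 / I) * \<psi> w) = 1" using \<open>I > 0\<close> by (simp add: I_def[symmetric])
  qed (use \<open>I > 0\<close> nn out int in auto)
qed

text \<open>The variance of \<open>v\<close> with respect to the probability density
  \<open>\<phi>\<close> is nonnegative.\<close>

lemma jensen_sq:
  fixes v :: "complex \<Rightarrow> complex" and \<phi> :: "complex \<Rightarrow> real"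
  assumes \<phi>: "\<And>w. \<phi> w \<ge> 0" "integrable M \<phi>" "(LINT w|M. \<phi> w) = 1"
    and v: "integrable M (\<lambda>w. \<phi> w *\<^sub>R v w)" "(\<lambda>w. \<phi> w * (cmod (v w))\<^sup>2) \<in> borel_measurable M"
  shows "ennreal ((cmod (LINT w|M. \<phi> w *\<^sub>R v w))\<^sup>2) \<le> (\<integral>\<^sup>+w. ennreal (\<phi> w * (cmod (v w))\<^sup>2) \<partial>M)"
proof (cases "(\<integral>\<^sup>+w. ennreal (\<phi> w * (cmod (v w))\<^sup>2) \<partial>M) < \<infinity>")
  case True
  have i2: "integrable M (\<lambda>w. \<phi> w * (cmod (v w))\<^sup>2)"
    using True v(2) \<phi>(1) by (intro integrableI_nonneg) auto
  define c where "c = (LINT w|M. \<phi> w *\<^sub>R v w)"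
  have i1: "integrable M (\<lambda>w. (\<phi> w *\<^sub>R v w) \<bullet> c)" using v(1) by (rule integrable_inner_left)
  have "0 \<le> (LINT w|M. \<phi> w * (cmod (v w - c))\<^sup>2)"
    using \<phi>(1) by (intro integral_nonneg_AE) auto
  also have "(\<lambda>w. \<phi> w * (cmod (v w - c))\<^sup>2) = (\<lambda>w. \<phi> w * (cmod (v w))\<^sup>2 - 2 * ((\<phi> w *\<^sub>R v w) \<bullet> c) + (cmod c)\<^sup>2 * \<phi> w)"
    by (auto simp: fun_eq_iff power2_norm_eq_inner inner_diff algebra_simps inner_commute)
  also have "(LINT w|M. \<phi> w * (cmod (v w))\<^sup>2 - 2 * ((\<phi> w *\<^sub>R v w) \<bullet> c) + (cmod c)\<^sup>2 * \<phi> w)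
      = (LINT w|M. \<phi> w * (cmod (v w))\<^sup>2) - 2 * (c \<bullet> c) + (cmod c)\<^sup>2"
  proof -
    have "(LINT w|M. (\<phi> w *\<^sub>R v w) \<bullet> c) = c \<bullet> c"
      unfolding c_def by (rule integral_inner_left) (rule v(1))
    then show ?thesis using i1 i2 \<phi>(2,3) by simp
  qed
  finally have "(cmod c)\<^sup>2 \<le> (LINT w|M. \<phi> w * (cmod (v w))\<^sup>2)"
    by (simp add: power2_norm_eq_inner)
  then have "ennreal ((cmod c)\<^sup>2) \<le> ennreal (LINT w|M. \<phi> w * (cmod (v w))\<^sup>2)" by (rule ennreal_leI)
  also have "\<dots> = (\<integral>\<^sup>+w. ennreal (\<phi> w * (cmod (v w))\<^sup>2) \<partial>M)"
    using \<phi>(1) by (intro nn_integral_eq_integral[symmetric] i2) auto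
  finally show ?thesis by (simp add: c_def)
next
  case False
  then have "(\<integral>\<^sup>+w. ennreal (\<phi> w * (cmod (v w))\<^sup>2) \<partial>M) = \<infinity>" by (auto simp: not_less top_unique)
  then show ?thesis by simp
qed

lemma lborel_distr_reflect: "distr lborel borel (\<lambda>w. z - w) = (lborel :: complex measure)"
proof -
  have "(lborel :: complex measure) = density (distr lborel borel (\<lambda>w. z + (- 1) *\<^sub>R w)) (\<lambda>_. 1)"
    using lborel_affine[of "- 1" z] by simp
  then show ?thesis by (simp add: density_1)
qed

text \<open>An open set is exhausted by compact sets, on each of which the function is
  measurable.\<close>

lemma locally_integrable_measurable:
  fixes g :: "complex \<Rightarrow> 'a::euclidean_space"
  assumes "open \<Omega>" "locally_integrable \<Omega> g"
  shows "(\<lambda>w. indicator \<Omega> w *\<^sub>R g w) \<in> borel_measurable lebesgue"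
proof -
  obtain C where C: "\<And>n::nat. compact (C n)" "\<And>n. C n \<subseteq> \<Omega>" "\<And>n. C n \<subseteq> interior (C (Suc n))" "\<Union>(range C) = \<Omega>"
    by (rule open_Union_compact_subsets[OF assms(1)]) blast
  have mono: "C m \<subseteq> C n" if "m \<le> n" for m n
    using that by (rule lift_Suc_mono_le[of C, rotated]) (use C(3) interior_subset in blast)
  show ?thesis
  proof (rule borel_measurable_LIMSEQ_metric)
    have "integrable lebesgue (\<lambda>w. indicator (C n) w *\<^sub>R g w)" for n
      using assms(2) C(1,2) by (auto simp: locally_integrable_def set_integrable_def)
    then show "(\<lambda>w. indicator (C n) w *\<^sub>R g w) \<in> borel_measurable lebesgue" for n
      by (rule borel_measurable_integrable)
    fix w
    show "(\<lambda>n. indicator (C n) w *\<^sub>R g w) \<longlonglongrightarrow> indicator \<Omega> w *\<^sub>R g w"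
    proof (cases "w \<in> \<Omega>")
      case True
      then obtain N where "w \<in> C N" using C(4) by blast
      then have "\<forall>n\<ge>N. indicator (C n) w *\<^sub>R g w = indicator \<Omega> w *\<^sub>R g w"
        using mono True by (auto simp: indicator_def)
      then show ?thesis by (intro tendsto_eventually) (auto simp: eventually_sequentially)
    next
      case False
      then have eq: "(\<lambda>n. indicator (C n) w *\<^sub>R g w) = (\<lambda>n. indicator \<Omega> w *\<^sub>R g w)"
        using C(2) by (auto simp: indicator_def fun_eq_iff)
      show ?thesis unfolding eq by (rule tendsto_const)
    qed
  qed
qed

text \<open>The mollification \<open>k\<close> of a continuous Sobolev map. The gradient of
  \<open>k\<close> is the mollified weak gradient, and by Jensen's inequality the mollified
  energy density dominates the energy density of \<open>k\<close>. The weight \<open>V\<close> is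
  continuous and \<open>k\<close> is uniformly close to \<open>h\<close>, so evaluating it at
  \<open>k\<close> instead of \<open>h\<close> costs at most \<open>e\<close>.\<close>

theorem smooth_approximation:
  fixes h :: "complex \<Rightarrow> complex" and V :: "complex \<Rightarrow> real"
  assumes \<Omega>: "open \<Omega>" and C: "compact C" "C \<subseteq> \<Omega>"
    and h: "continuous_on \<Omega> h" and g: "weak_gradient \<Omega> h g"
    and V: "continuous_on UNIV V" "\<And>w. V w \<ge> 0" and e: "e > 0"
  obtains k where "\<And>n. Ck_on n UNIV k" "\<And>z. z \<in> C \<Longrightarrow> cmod (k z - h z) < e"
    "(\<integral>\<^sup>+z\<in>C. ennreal (V (k z) * ((cmod (dx k z))\<^sup>2 + (cmod (dy k z))\<^sup>2)) \<partial>lborel) \<le>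
     (\<integral>\<^sup>+w\<in>\<Omega>. ennreal ((V (h w) + e) * ((cmod (fst g w))\<^sup>2 + (cmod (snd g w))\<^sup>2)) \<partial>lebesgue)"
proof -
  obtain d where d: "d > 0" "\<And>x y. x \<in> C \<Longrightarrow> y \<in> - \<Omega> \<Longrightarrow> d \<le> dist x y"
  proof -
    have "C \<inter> - \<Omega> = {}" using C(2) by blast
    then obtain d where "d > 0" "\<forall>x\<in>C. \<forall>y\<in>- \<Omega>. d \<le> dist x y"
      using separate_compact_closed[OF C(1)] \<Omega> by (metis closed_Compl)
    then show thesis using that by blast
  qed
  \<comment> \<open>a compact neighbourhood of \<open>C\<close> in \<open>\<Omega>\<close>; outside of it \<open>h\<close> may be changed, so that it extends continuously to the plane\<close>
  define C1 where "C1 = {x + y |x y. x \<in> C \<and> y \<in> cball 0 (d / 2)}"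
  have C1c: "compact C1" unfolding C1_def by (rule compact_sums[OF C(1) compact_cball])
  have C1I: "w \<in> C1" if "z \<in> C" "cmod (z - w) \<le> d / 2" for z w
    unfolding C1_def mem_Collect_eq
    by (intro exI[of _ z] exI[of _ "w - z"]) (use that in \<open>simp add: norm_minus_commute\<close>)
  have C1\<Omega>: "C1 \<subseteq> \<Omega>"
  proof
    fix w assume "w \<in> C1"
    then obtain x y where "x \<in> C" "cmod y \<le> d / 2" "w = x + y" by (auto simp: C1_def)
    then have "dist x w < d" using d(1) by (simp add: dist_norm)
    then show "w \<in> \<Omega>" using d(2)[OF \<open>x \<in> C\<close>, of w] by fastforce
  qed
  have hC1: "continuous_on C1 h" using h C1\<Omega> continuous_on_subset by blast
  obtain H where H: "continuous_on UNIV H" "\<And>w. w \<in> C1 \<Longrightarrow> H w = h w"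
    using Tietze_unbounded[OF hC1, of UNIV] C1c compact_imp_closed by (metis closed_closedin subtopology_UNIV)
  have "bounded (h ` C1)" using hC1 C1c compact_continuous_image compact_imp_bounded by blast
  then obtain b where b: "\<And>w. w \<in> C1 \<Longrightarrow> cmod (h w) \<le> b" by (auto simp: bounded_iff)
  have "uniformly_continuous_on (cball 0 (b + 1)) V"
    by (rule compact_uniformly_continuous[OF continuous_on_subset[OF V(1)]]) auto
  then obtain \<eta> where \<eta>: "\<eta> > 0" "\<And>u v. u \<in> cball 0 (b + 1) \<Longrightarrow> v \<in> cball 0 (b + 1) \<Longrightarrow> dist u v < \<eta> \<Longrightarrow> dist (V u) (V v) < e"
    using e unfolding uniformly_continuous_on_def by (metis dist_commute)
  define \<eta>' where "\<eta>' = min (\<eta> / 3) (min (e / 2) 1)"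
  have \<eta>': "\<eta>' > 0" "\<eta>' < e" "\<eta>' \<le> 1" "2 * \<eta>' < \<eta>" using \<eta>(1) e by (auto simp: \<eta>'_def)
  have "uniformly_continuous_on C1 h" by (rule compact_uniformly_continuous[OF hC1 C1c])
  then obtain \<delta> where \<delta>: "\<delta> > 0" "\<And>w z. w \<in> C1 \<Longrightarrow> z \<in> C1 \<Longrightarrow> dist w z < \<delta> \<Longrightarrow> dist (h w) (h z) < \<eta>'"
    using \<eta>'(1) unfolding uniformly_continuous_on_def by (metis dist_commute)
  define \<epsilon> where "\<epsilon> = min (d / 2) \<delta>"
  have \<epsilon>: "\<epsilon> > 0" "\<epsilon> \<le> d / 2" "\<epsilon> \<le> \<delta>" using d(1) \<delta>(1) by (auto simp: \<epsilon>_def)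
  have near: "w \<in> C1" "cmod (h w - h z) < \<eta>'" if "z \<in> C" "cmod (z - w) < \<epsilon>" for z w
  proof -
    show "w \<in> C1" using C1I[of z w] that \<epsilon> by simp
    moreover have "z \<in> C1" using C1I[of z z] that d(1) by simp
    ultimately show "cmod (h w - h z) < \<eta>'"
      using \<delta>(2)[of w z] that(2) \<epsilon>(3) by (simp add: dist_norm norm_minus_commute)
  qed
  obtain \<phi> :: "complex \<Rightarrow> real" where \<phi>: "\<And>k. Ck_on k UNIV \<phi>" "\<And>w. \<phi> w \<ge> 0" "\<And>w. cmod w \<ge> \<epsilon> / 2 \<Longrightarrow> \<phi> w = 0"
    "integrable lborel \<phi>" "(LINT w|lborel. \<phi> w) = 1"
    using mollifier_exists[of "\<epsilon> / 2"] \<epsilon>(1) by (metis half_gt_zero)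
  have c\<phi>: "continuous_on UNIV \<phi>" using \<phi>(1)[of 0] by simp
  have [measurable]: "\<phi> \<in> borel_measurable borel" using c\<phi> by (rule borel_measurable_continuous_onI)
  have \<phi>nn: "(\<integral>\<^sup>+w. ennreal (\<phi> w) \<partial>lborel) = 1"
    using nn_integral_eq_integral[OF \<phi>(4)] \<phi>(2,5) by simp
  have \<phi>'0: "dx \<phi> w = 0" "dy \<phi> w = 0" if "cmod w \<ge> \<epsilon>" for w
  proof -
    have "(\<phi> has_derivative (\<lambda>_. 0)) (at w)"
      by (rule has_derivative_zero_outside[of "cball 0 (\<epsilon> / 2)"]) (use \<phi>(3) that \<epsilon>(1) in auto)
    from dx_dy_eqI[OF this] show "dx \<phi> w = 0" "dy \<phi> w = 0" by auto
  qed
  have "bounded C1" using C1c compact_imp_bounded by blast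
  then obtain q where q: "C1 \<subseteq> cbox (- q) q" using bounded_subset_cbox_symmetric by blast
  define k where "k = conv (- q) q \<phi> H"
  have kC: "Ck_on n UNIV k" for n unfolding k_def by (rule Ck_on_conv[OF \<phi>(1) H(1)])
  have dk: "dx k z = conv (- q) q (dx \<phi>) H z" "dy k z = conv (- q) q (dy \<phi>) H z" for z
    using has_derivative_dx_dy_I[OF conv_has_derivative[OF \<phi>(1) H(1)]] by (simp_all add: k_def)
  have conv_eq: "conv (- q) q \<psi> H z = (LINT w|lborel. \<psi> (z - w) *\<^sub>R H w)"
    "conv (- q) q \<psi> H z = (LINT w:\<Omega>|lebesgue. \<psi> (z - w) *\<^sub>R h w)"
    if z: "z \<in> C" and \<psi>: "continuous_on UNIV \<psi>" "\<And>w. cmod w \<ge> \<epsilon> \<Longrightarrow> \<psi> w = 0" for z \<psi>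
  proof -
    have c: "continuous_on UNIV (\<lambda>w. \<psi> (z - w) *\<^sub>R H w)"
      by (intro continuous_intros continuous_on_compose2[OF \<psi>(1)] H(1)) auto
    have out: "\<psi> (z - w) *\<^sub>R H w = 0" if "w \<notin> C1" for w
      using near(1)[OF z, of w] \<psi>(2)[of "z - w"] that by force
    show 1: "conv (- q) q \<psi> H z = (LINT w|lborel. \<psi> (z - w) *\<^sub>R H w)"
      unfolding conv_def by (rule integral_over_box_eq_lborel[OF c]) (use out q in blast)
    have eq: "(if w \<in> \<Omega> then \<psi> (z - w) *\<^sub>R h w else 0) = \<psi> (z - w) *\<^sub>R H w" for w
      using out[of w] H(2)[of w] C1\<Omega> \<psi>(2)[of "z - w"] near(1)[OF z, of w] by (cases "w \<in> C1") force+
    show "conv (- q) q \<psi> H z = (LINT w:\<Omega>|lebesgue. \<psi> (z - w) *\<^sub>R h w)"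
      unfolding 1 by (subst set_lebesgue_integral_lborel) (simp_all add: eq c)
  qed
  have knear: "cmod (k z - h z) \<le> \<eta>'" if z: "z \<in> C" for z
  proof -
    have i1: "integrable lborel (\<lambda>w. \<phi> (z - w))" and I1: "(LINT w|lborel. \<phi> (z - w)) = 1"
      using \<phi>(4,5) integrable_distr_eq[of "\<lambda>w. z - w" lborel borel \<phi>] integral_distr[of "\<lambda>w. z - w" lborel borel \<phi>]
      by (simp_all add: lborel_distr_reflect)
    have i2: "integrable lborel (\<lambda>w. \<phi> (z - w) *\<^sub>R H w)"
    proof (rule integrable_compact_support[OF _ C1c])
      show "continuous_on UNIV (\<lambda>w. \<phi> (z - w) *\<^sub>R H w)"
        by (intro continuous_intros continuous_on_compose2[OF c\<phi>] H(1)) auto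
      show "\<phi> (z - w) *\<^sub>R H w = 0" if "w \<notin> C1" for w
        using near(1)[OF z, of w] \<phi>(3)[of "z - w"] that \<epsilon>(1) by force
    qed
    have i3: "integrable lborel (\<lambda>w. \<phi> (z - w) *\<^sub>R h z)" using i1 by (rule integrable_scaleR_left)
    have "k z - h z = (LINT w|lborel. \<phi> (z - w) *\<^sub>R H w) - (LINT w|lborel. \<phi> (z - w) *\<^sub>R h z)"
      using conv_eq(1)[OF z c\<phi>] \<phi>(3) \<epsilon>(1) i1 I1 by (simp add: k_def)
    also have "\<dots> = (LINT w|lborel. \<phi> (z - w) *\<^sub>R (H w - h z))"
      using i2 i3 by (simp add: scaleR_diff_right)
    finally have "cmod (k z - h z) \<le> (LINT w|lborel. norm (\<phi> (z - w) *\<^sub>R (H w - h z)))"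
      using integral_norm_bound by metis
    also have "\<dots> \<le> (LINT w|lborel. \<phi> (z - w) * \<eta>')"
    proof (rule integral_mono)
      show "integrable lborel (\<lambda>w. norm (\<phi> (z - w) *\<^sub>R (H w - h z)))"
        using Bochner_Integration.integrable_diff[OF i2 i3] by (intro integrable_norm) (simp add: scaleR_diff_right)
      show "integrable lborel (\<lambda>w. \<phi> (z - w) * \<eta>')" using i1 by simp
      fix w
      show "norm (\<phi> (z - w) *\<^sub>R (H w - h z)) \<le> \<phi> (z - w) * \<eta>'"
      proof (cases "cmod (z - w) < \<epsilon>")
        case True
        then show ?thesis using near[OF z True] H(2)[of w] \<phi>(2)[of "z - w"]
          by (simp add: mult_left_mono less_imp_le)
      next
        case False
        then show ?thesis using \<phi>(3)[of "z - w"] \<epsilon>(1) by simp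
      qed
    qed
    also have "\<dots> = \<eta>'" using I1 by simp
    finally show ?thesis .
  qed
  have Vk: "V (k z) \<le> V (h w) + e" if z: "z \<in> C" and w: "cmod (z - w) < \<epsilon>" for z w
  proof -
    have "cmod (k z - h w) \<le> cmod (k z - h z) + cmod (h w - h z)"
      using norm_triangle_ineq[of "k z - h z" "h z - h w"] by (simp add: norm_minus_commute)
    then have 1: "dist (k z) (h w) < \<eta>" using knear[OF z] near(2)[OF z w] \<eta>' by (simp add: dist_norm)
    have 2: "cmod (h w) \<le> b" "cmod (h z) \<le> b" using b near(1)[OF z w] C1I[OF z, of z] d(1) by auto
    have "cmod (k z) \<le> cmod (h z) + cmod (k z - h z)" using norm_triangle_ineq[of "h z" "k z - h z"] by simp
    then have "k z \<in> cball 0 (b + 1)" "h w \<in> cball 0 (b + 1)" using 2 knear[OF z] \<eta>' by auto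
    then show ?thesis using \<eta>(2)[OF _ _ 1] by (auto simp: dist_real_def)
  qed
  define g1 g2 where "g1 = fst g" and "g2 = snd g"
  have lg: "locally_integrable \<Omega> g1" "locally_integrable \<Omega> g2"
    using g by (auto simp: weak_gradient_def g1_def g2_def)
  define v1 v2 where "v1 w = indicator \<Omega> w *\<^sub>R g1 w" and "v2 w = indicator \<Omega> w *\<^sub>R g2 w" for w
  have mv [measurable]: "v1 \<in> borel_measurable lebesgue" "v2 \<in> borel_measurable lebesgue"
    unfolding v1_def v2_def by (intro locally_integrable_measurable[OF \<Omega>] lg)+
  define D where "D w = ennreal ((cmod (v1 w))\<^sup>2 + (cmod (v2 w))\<^sup>2)" for w
  have "D \<in> borel_measurable lebesgue" unfolding D_def by measurable
  \<comment> \<open>a Borel representative, to which the theorem of Tonelli applies\<close>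
  then obtain D' where [measurable]: "D' \<in> borel_measurable lborel" and D': "AE w in lborel. D w = D' w"
    using completion_ex_borel_measurable[of D lborel] by auto
  have grad: "ennreal ((cmod (dx k z))\<^sup>2 + (cmod (dy k z))\<^sup>2) \<le> (\<integral>\<^sup>+w. ennreal (\<phi> (z - w)) * D' w \<partial>lborel)"
    if z: "z \<in> C" for z
  proof -
    let ?\<phi> = "\<lambda>w. \<phi> (z - w)"
    have t: "test_function \<Omega> ?\<phi>"
      unfolding test_function_def
    proof (intro conjI exI[of _ "cball z (\<epsilon> / 2)"] allI impI)
      show "smooth_on UNIV ?\<phi>" unfolding smooth_on_def using Ck_on_translate[OF \<phi>(1)] by blast
      show "cball z (\<epsilon> / 2) \<subseteq> \<Omega>"
        using near(1)[OF z] C1\<Omega> \<epsilon>(1) by (fastforce simp: dist_norm)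
      show "?\<phi> w = 0" if "w \<notin> cball z (\<epsilon> / 2)" for w
        using that by (intro \<phi>(3)) (simp add: dist_norm)
    qed simp
    have refl: "dx ?\<phi> w = - dx \<phi> (z - w)" "dy ?\<phi> w = - dy \<phi> (z - w)" for w
      using dx_dy_reflect[OF \<phi>(1)] by auto
    have cd: "continuous_on UNIV (dx \<phi>)" "continuous_on UNIV (dy \<phi>)" using \<phi>(1)[of "Suc 0"] by auto
    have wk: "(LINT w:\<Omega>|lebesgue. dx ?\<phi> w *\<^sub>R h w) = - (LINT w:\<Omega>|lebesgue. ?\<phi> w *\<^sub>R g1 w)"
      "(LINT w:\<Omega>|lebesgue. dy ?\<phi> w *\<^sub>R h w) = - (LINT w:\<Omega>|lebesgue. ?\<phi> w *\<^sub>R g2 w)"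
      using g t unfolding weak_gradient_def g1_def g2_def by blast+
    have toL: "(LINT w:\<Omega>|lebesgue. ?\<phi> w *\<^sub>R u w) = (LINT w|lebesgue. ?\<phi> w *\<^sub>R (indicator \<Omega> w *\<^sub>R u w))" for u :: "complex \<Rightarrow> complex"
      by (simp add: set_lebesgue_integral_def mult.commute)
    have dxk: "dx k z = (LINT w|lebesgue. ?\<phi> w *\<^sub>R v1 w)" "dy k z = (LINT w|lebesgue. ?\<phi> w *\<^sub>R v2 w)"
      using conv_eq(2)[OF z cd(1) \<phi>'0(1)] conv_eq(2)[OF z cd(2) \<phi>'0(2)] wk toL[of g1] toL[of g2]
      by (simp_all add: dk refl v1_def v2_def set_lebesgue_integral_def)
    have m\<phi>: "?\<phi> \<in> borel_measurable lborel" by measurable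
    have i1: "integrable lebesgue ?\<phi>" and I1: "(LINT w|lebesgue. ?\<phi> w) = 1"
      using \<phi>(4,5) integrable_distr_eq[of "\<lambda>w. z - w" lborel borel \<phi>] integral_distr[of "\<lambda>w. z - w" lborel borel \<phi>] m\<phi>
      by (simp_all add: lborel_distr_reflect integrable_completion integral_completion)
    have iv: "integrable lebesgue (\<lambda>w. ?\<phi> w *\<^sub>R v1 w)" "integrable lebesgue (\<lambda>w. ?\<phi> w *\<^sub>R v2 w)"
      using integrable_test_function_times[OF t lg(1)] integrable_test_function_times[OF t lg(2)]
      by (simp_all add: v1_def v2_def set_integrable_def mult.commute)
    have m\<phi>' [measurable]: "?\<phi> \<in> borel_measurable lebesgue" by (rule measurable_completion[OF m\<phi>])
    have "ennreal ((cmod (dx k z))\<^sup>2 + (cmod (dy k z))\<^sup>2) = ennreal ((cmod (dx k z))\<^sup>2) + ennreal ((cmod (dy k z))\<^sup>2)"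
      by simp
    also have "\<dots> \<le> (\<integral>\<^sup>+w. ennreal (?\<phi> w * (cmod (v1 w))\<^sup>2) \<partial>lebesgue) + (\<integral>\<^sup>+w. ennreal (?\<phi> w * (cmod (v2 w))\<^sup>2) \<partial>lebesgue)"
      unfolding dxk by (intro add_mono jensen_sq \<phi>(2) i1 I1 iv) measurable
    also have "\<dots> = (\<integral>\<^sup>+w. ennreal (?\<phi> w * (cmod (v1 w))\<^sup>2) + ennreal (?\<phi> w * (cmod (v2 w))\<^sup>2) \<partial>lebesgue)"
      by (rule nn_integral_add[symmetric]) measurable
    also have "\<dots> = (\<integral>\<^sup>+w. ennreal (\<phi> (z - w)) * D' w \<partial>lebesgue)"
    proof (rule nn_integral_cong_AE)
      show "AE w in lebesgue. ennreal (?\<phi> w * (cmod (v1 w))\<^sup>2) + ennreal (?\<phi> w * (cmod (v2 w))\<^sup>2) = ennreal (\<phi> (z - w)) * D' w"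
        using AE_completion[OF D']
      proof eventually_elim
        case (elim w)
        have "ennreal (?\<phi> w * (cmod (v1 w))\<^sup>2) + ennreal (?\<phi> w * (cmod (v2 w))\<^sup>2) =
            ennreal (?\<phi> w * ((cmod (v1 w))\<^sup>2 + (cmod (v2 w))\<^sup>2))"
          by (simp add: \<phi>(2) distrib_left)
        also have "\<dots> = ennreal (\<phi> (z - w)) * D w"
          unfolding D_def by (rule ennreal_mult) (simp_all add: \<phi>(2))
        finally show ?case using elim by simp
      qed
    qed
    also have "\<dots> = (\<integral>\<^sup>+w. ennreal (\<phi> (z - w)) * D' w \<partial>lborel)"
      by (rule nn_integral_completion) measurable
    finally show ?thesis .
  qed
  define Vh where "Vh w = indicator \<Omega> w *\<^sub>R V (h w)" for w
  have [measurable]: "Vh \<in> borel_measurable borel"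
    unfolding Vh_def using \<Omega> by (intro borel_measurable_continuous_on_indicator continuous_on_compose2[OF V(1) h]) auto
  have Vh0: "Vh w \<ge> 0" for w using V(2) by (simp add: Vh_def)
  have ck: "continuous_on UNIV k" using kC[of 0] by simp
  have [measurable]: "(\<lambda>z. V (k z)) \<in> borel_measurable borel"
    by (intro borel_measurable_continuous_onI continuous_on_compose2[OF V(1) ck]) auto
  have [measurable]: "C \<in> sets borel" using C(1) by (simp add: compact_imp_closed borel_closed)
  have "(\<integral>\<^sup>+z\<in>C. ennreal (V (k z) * ((cmod (dx k z))\<^sup>2 + (cmod (dy k z))\<^sup>2)) \<partial>lborel) \<le>
     (\<integral>\<^sup>+z. (\<integral>\<^sup>+w. (indicator C z * ennreal (V (k z))) * (ennreal (\<phi> (z - w)) * D' w) \<partial>lborel) \<partial>lborel)"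
  proof (rule nn_integral_mono)
    fix z :: complex
    have "(\<integral>\<^sup>+w. (indicator C z * ennreal (V (k z))) * (ennreal (\<phi> (z - w)) * D' w) \<partial>lborel) =
      (indicator C z * ennreal (V (k z))) * (\<integral>\<^sup>+w. ennreal (\<phi> (z - w)) * D' w \<partial>lborel)"
      by (rule nn_integral_cmult) measurable
    then show "ennreal (V (k z) * ((cmod (dx k z))\<^sup>2 + (cmod (dy k z))\<^sup>2)) * indicator C z \<le>
      (\<integral>\<^sup>+w. (indicator C z * ennreal (V (k z))) * (ennreal (\<phi> (z - w)) * D' w) \<partial>lborel)"
      using grad[of z] V(2)[of "k z"] by (cases "z \<in> C") (auto simp: ennreal_mult intro!: mult_left_mono simp del: ennreal_plus)
  qed
  also have "\<dots> = (\<integral>\<^sup>+w. (\<integral>\<^sup>+z. (indicator C z * ennreal (V (k z))) * (ennreal (\<phi> (z - w)) * D' w) \<partial>lborel) \<partial>lborel)"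
    by (rule lborel_pair.Fubini'[symmetric]) measurable
  also have "\<dots> \<le> (\<integral>\<^sup>+w. ennreal (Vh w + e) * D' w \<partial>lborel)"
  proof (rule nn_integral_mono)
    fix w :: complex
    have "(\<integral>\<^sup>+z. (indicator C z * ennreal (V (k z))) * (ennreal (\<phi> (z - w)) * D' w) \<partial>lborel) \<le>
       (\<integral>\<^sup>+z. (ennreal (Vh w + e) * D' w) * ennreal (\<phi> (z - w)) \<partial>lborel)"
    proof (rule nn_integral_mono)
      fix z :: complex
      show "(indicator C z * ennreal (V (k z))) * (ennreal (\<phi> (z - w)) * D' w) \<le> (ennreal (Vh w + e) * D' w) * ennreal (\<phi> (z - w))"
      proof (cases "z \<in> C \<and> cmod (z - w) < \<epsilon>")
        case True
        then have "w \<in> \<Omega>" using near(1) C1\<Omega> by blast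
        then have "ennreal (V (k z)) \<le> ennreal (Vh w + e)" using Vk True by (intro ennreal_leI) (simp add: Vh_def)
        then have "ennreal (V (k z)) * (ennreal (\<phi> (z - w)) * D' w) \<le> ennreal (Vh w + e) * (ennreal (\<phi> (z - w)) * D' w)"
          by (rule mult_right_mono) simp
        then show ?thesis using True by (simp add: ac_simps)
      next
        case False
        then show ?thesis using \<phi>(3)[of "z - w"] \<epsilon>(1) by (cases "z \<in> C") auto
      qed
    qed
    also have "\<dots> = (ennreal (Vh w + e) * D' w) * (\<integral>\<^sup>+z. ennreal (\<phi> (z - w)) \<partial>lborel)"
      by (rule nn_integral_cmult) measurable
    also have "(\<integral>\<^sup>+z. ennreal (\<phi> (z - w)) \<partial>lborel) = 1"
      using nn_integral_distr[of "(+) (- w)" lborel borel "\<lambda>z. ennreal (\<phi> z)"] \<phi>nn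
      by (simp add: lborel_distr_plus)
    finally show "(\<integral>\<^sup>+z. (indicator C z * ennreal (V (k z))) * (ennreal (\<phi> (z - w)) * D' w) \<partial>lborel) \<le> ennreal (Vh w + e) * D' w"
      by simp
  qed
  also have "\<dots> = (\<integral>\<^sup>+w. ennreal (Vh w + e) * D' w \<partial>lebesgue)"
    by (rule nn_integral_completion[symmetric]) measurable
  also have "\<dots> = (\<integral>\<^sup>+w\<in>\<Omega>. ennreal ((V (h w) + e) * ((cmod (fst g w))\<^sup>2 + (cmod (snd g w))\<^sup>2)) \<partial>lebesgue)"
  proof (rule nn_integral_cong_AE)
    show "AE w in lebesgue. ennreal (Vh w + e) * D' w =
        ennreal ((V (h w) + e) * ((cmod (fst g w))\<^sup>2 + (cmod (snd g w))\<^sup>2)) * indicator \<Omega> w"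
      using AE_completion[OF D']
    proof eventually_elim
      case (elim w)
      have "V (h w) + e \<ge> 0" using V(2)[of "h w"] e by simp
      then show ?case
        using elim[symmetric] by (cases "w \<in> \<Omega>") (auto simp: Vh_def D_def v1_def v2_def g1_def g2_def ennreal_mult simp del: ennreal_plus)
    qed
  qed
  finally show thesis using that[of k] kC knear \<eta>'(2) by force
qed

section \<open>Null Lagrangians and the calibration on a cylinder\<close>

text \<open>Stokes' theorem for the form \<open>G(\<lambda>) d\<theta>\<close> with
  \<open>d\<theta> = A dx + B dt\<close>. Only \<open>d\<theta>\<close> enters and not
  \<open>\<theta>\<close>, which is multivalued; \<open>C\<close> is the common value of the
  mixed derivatives and expresses that \<open>d\<theta>\<close> is closed. The sides \<open>t =
  0\<close> and \<open>t = 2 \<pi>\<close> cancel by periodicity.\<close>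

lemma stokes_rectangle:
  fixes x0 x1 :: real and lam lx lt A B C :: "real \<Rightarrow> real \<Rightarrow> real" and G G' :: "real \<Rightarrow> real"
  defines "Q \<equiv> {x0..x1} \<times> {0..2*pi}"
  assumes "x0 \<le> x1"
    and G: "\<And>p. p \<in> Q \<Longrightarrow> (G has_real_derivative G' (lam (fst p) (snd p))) (at (lam (fst p) (snd p)))"
    and cG': "continuous_on UNIV G'"
    and lx: "\<And>x t. x \<in> {x0..x1} \<Longrightarrow> t \<in> {0..2*pi} \<Longrightarrow>
        ((\<lambda>x. lam x t) has_real_derivative lx x t) (at x within {x0..x1})"
    and lt: "\<And>x t. x \<in> {x0..x1} \<Longrightarrow> t \<in> {0..2*pi} \<Longrightarrow>
        ((\<lambda>t. lam x t) has_real_derivative lt x t) (at t within {0..2*pi})"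
    and Bx: "\<And>x t. x \<in> {x0..x1} \<Longrightarrow> t \<in> {0..2*pi} \<Longrightarrow>
        ((\<lambda>x. B x t) has_real_derivative C x t) (at x within {x0..x1})"
    and At: "\<And>x t. x \<in> {x0..x1} \<Longrightarrow> t \<in> {0..2*pi} \<Longrightarrow>
        ((\<lambda>t. A x t) has_real_derivative C x t) (at t within {0..2*pi})"
    and cont: "continuous_on Q (\<lambda>(x, t). lam x t)" "continuous_on Q (\<lambda>(x, t). lx x t)"
      "continuous_on Q (\<lambda>(x, t). lt x t)" "continuous_on Q (\<lambda>(x, t). A x t)"
      "continuous_on Q (\<lambda>(x, t). B x t)" "continuous_on Q (\<lambda>(x, t). C x t)"
    and per: "\<And>x. x \<in> {x0..x1} \<Longrightarrow> lam x (2*pi) = lam x 0" "\<And>x. x \<in> {x0..x1} \<Longrightarrow> A x (2*pi) = A x 0"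
  shows "integral Q (\<lambda>(x, t). G' (lam x t) * (lx x t * B x t - lt x t * A x t)) =
     integral {0..2*pi} (\<lambda>t. G (lam x1 t) * B x1 t) - integral {0..2*pi} (\<lambda>t. G (lam x0 t) * B x0 t)"
proof -
  have Qc: "Q = cbox (x0, 0) (x1, 2*pi)" by (simp add: Q_def cbox_Pair_eq)
  define P where "P x t = (G' (lam x t) * lx x t) * B x t + C x t * G (lam x t)" for x t
  define R where "R x t = (G' (lam x t) * lt x t) * A x t + C x t * G (lam x t)" for x t
  have cG: "continuous_on ((\<lambda>p. lam (fst p) (snd p)) ` Q) G"
    using G by (auto intro!: continuous_at_imp_continuous_on DERIV_isCont)
  note c = cont[unfolded case_prod_unfold]
  have cGl: "continuous_on Q (\<lambda>p. G (lam (fst p) (snd p)))"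
    by (rule continuous_on_compose2[OF cG c(1)]) auto
  have cGl': "continuous_on Q (\<lambda>p. G' (lam (fst p) (snd p)))"
    by (rule continuous_on_compose2[OF cG' c(1)]) auto
  have cP: "continuous_on Q (\<lambda>(x, t). P x t)" and cR: "continuous_on Q (\<lambda>(x, t). R x t)"
    unfolding P_def R_def case_prod_unfold by (intro continuous_intros c cGl cGl')+
  have P: "integral Q (\<lambda>(x, t). P x t) = integral {0..2*pi} (\<lambda>t. G (lam x1 t) * B x1 t - G (lam x0 t) * B x0 t)"
  proof -
    have "integral Q (\<lambda>(x, t). P x t) = integral {x0..x1} (\<lambda>x. integral {0..2*pi} (P x))"
      using integral_prod_continuous[of x0 0 x1 "2*pi" "\<lambda>(x, t). P x t"] cP by (simp add: Qc)
    also have "\<dots> = integral {0..2*pi} (\<lambda>t. integral {x0..x1} (\<lambda>x. P x t))"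
      using integral_swap_continuous[of x0 0 x1 "2*pi" P] cP by (simp add: Qc)
    also have "\<dots> = integral {0..2*pi} (\<lambda>t. G (lam x1 t) * B x1 t - G (lam x0 t) * B x0 t)"
    proof (rule integral_cong)
      fix t :: real assume t: "t \<in> {0..2*pi}"
      have "((\<lambda>x. P x t) has_integral G (lam x1 t) * B x1 t - G (lam x0 t) * B x0 t) {x0..x1}"
      proof (rule fundamental_theorem_of_calculus[OF \<open>x0 \<le> x1\<close>])
        fix x assume x: "x \<in> {x0..x1}"
        have "((\<lambda>x. G (lam x t)) has_real_derivative G' (lam x t) * lx x t) (at x within {x0..x1})"
          using DERIV_chain2[OF _ lx[OF x t]] G[of "(x, t)"] x t by (simp add: Q_def)
        then show "((\<lambda>x. G (lam x t) * B x t) has_vector_derivative P x t) (at x within {x0..x1})"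
          using DERIV_mult[OF _ Bx[OF x t]] unfolding P_def
          by (simp flip: has_real_derivative_iff_has_vector_derivative)
      qed
      then show "integral {x0..x1} (\<lambda>x. P x t) = G (lam x1 t) * B x1 t - G (lam x0 t) * B x0 t"
        by (rule integral_unique)
    qed
    finally show ?thesis .
  qed
  have R: "integral Q (\<lambda>(x, t). R x t) = 0"
  proof -
    have "integral Q (\<lambda>(x, t). R x t) = integral {x0..x1} (\<lambda>x. integral {0..2*pi} (R x))"
      using integral_prod_continuous[of x0 0 x1 "2*pi" "\<lambda>(x, t). R x t"] cR by (simp add: Qc)
    also have "\<dots> = integral {x0..x1} (\<lambda>x. 0)"
    proof (rule integral_cong)
      fix x assume x: "x \<in> {x0..x1}"
      have "((\<lambda>t. R x t) has_integral G (lam x (2*pi)) * A x (2*pi) - G (lam x 0) * A x 0) {0..2*pi}"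
      proof (rule fundamental_theorem_of_calculus)
        fix t :: real assume t: "t \<in> {0..2*pi}"
        have "((\<lambda>t. G (lam x t)) has_real_derivative G' (lam x t) * lt x t) (at t within {0..2*pi})"
          using DERIV_chain2[OF _ lt[OF x t]] G[of "(x, t)"] x t by (simp add: Q_def)
        then show "((\<lambda>t. G (lam x t) * A x t) has_vector_derivative R x t) (at t within {0..2*pi})"
          using DERIV_mult[OF _ At[OF x t]] unfolding R_def
          by (simp flip: has_real_derivative_iff_has_vector_derivative)
      qed simp
      then show "integral {0..2*pi} (R x) = 0"
        using per[OF x] by (simp add: integral_unique)
    qed
    finally show ?thesis by simp
  qed
  have "integral Q (\<lambda>(x, t). G' (lam x t) * (lx x t * B x t - lt x t * A x t)) =
      integral Q (\<lambda>p. (\<lambda>(x, t). P x t) p - (\<lambda>(x, t). R x t) p)"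
    by (intro integral_cong) (simp add: P_def R_def case_prod_unfold algebra_simps)
  also have "\<dots> = integral Q (\<lambda>(x, t). P x t) - integral Q (\<lambda>(x, t). R x t)"
    using cP cR by (intro integral_diff) (simp_all add: Qc integrable_continuous)
  also have "\<dots> = integral {0..2*pi} (\<lambda>t. G (lam x1 t) * B x1 t - G (lam x0 t) * B x0 t)"
    by (simp add: P R)
  also have "\<dots> = integral {0..2*pi} (\<lambda>t. G (lam x1 t) * B x1 t) - integral {0..2*pi} (\<lambda>t. G (lam x0 t) * B x0 t)"
  proof (rule integral_diff)
    have cGB: "continuous_on Q (\<lambda>p. G (lam (fst p) (snd p)) * B (fst p) (snd p))"
      by (intro continuous_intros c cGl)
    have "continuous_on {0..2*pi} (\<lambda>t. G (lam x t) * B x t)" if "x \<in> {x0..x1}" for x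
    proof -
      have "continuous_on {0..2*pi} (\<lambda>t. G (lam (fst (x, t)) (snd (x, t))) * B (fst (x, t)) (snd (x, t)))"
        by (rule continuous_on_compose2[OF cGB]) (use that in \<open>auto intro!: continuous_intros simp: Q_def\<close>)
      then show ?thesis by simp
    qed
    then show "(\<lambda>t. G (lam x1 t) * B x1 t) integrable_on {0..2*pi}"
      "(\<lambda>t. G (lam x0 t) * B x0 t) integrable_on {0..2*pi}"
      using \<open>x0 \<le> x1\<close> by (auto intro!: integrable_continuous_interval)
  qed
  finally show ?thesis .
qed

text \<open>With \<open>M = m\<^sup>2\<close>, \<open>cal_slope\<close> is the slope
  \<open>a\<close> of the radial extremal, and the other three are the coefficients
  \<open>\<alpha>\<close>, \<open>\<kappa>\<close> and \<open>\<beta>\<close> of the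
  calibration.\<close>

definition cal_slope :: "real \<Rightarrow> real \<Rightarrow> real" where
  "cal_slope \<gamma> M = sqrt (1 + \<gamma> / M)"

definition cal_radial :: "real \<Rightarrow> real \<Rightarrow> real" where
  "cal_radial \<gamma> M = (if \<gamma> \<ge> 0 then 2 * \<gamma> / cal_slope \<gamma> M else 0)"

definition cal_jacobian :: "real \<Rightarrow> real \<Rightarrow> real" where
  "cal_jacobian \<gamma> M = (if \<gamma> \<ge> 0 then 2 * M / cal_slope \<gamma> M else 2 * M * cal_slope \<gamma> M)"

definition cal_angular :: "real \<Rightarrow> real" where
  "cal_angular \<gamma> = (if \<gamma> \<ge> 0 then 0 else - 2 * \<gamma>)"

lemma cal_slope_pos:
  assumes "M > 0" "\<gamma> \<ge> 0" shows "cal_slope \<gamma> M > 0"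
  unfolding cal_slope_def using assms by (simp add: add_pos_nonneg)

lemma cal_nonneg:
  assumes "M > 0" "M + \<gamma> \<ge> 0"
  shows "cal_slope \<gamma> M \<ge> 0" "cal_radial \<gamma> M \<ge> 0" "cal_jacobian \<gamma> M \<ge> 0" "cal_angular \<gamma> \<ge> 0"
    and cal_slope_sq: "M * (cal_slope \<gamma> M)\<^sup>2 = M + \<gamma>"
proof -
  have "1 + \<gamma> / M \<ge> 0" using assms by (simp add: field_simps)
  then show "cal_slope \<gamma> M \<ge> 0" "M * (cal_slope \<gamma> M)\<^sup>2 = M + \<gamma>"
    using assms by (simp_all add: cal_slope_def field_simps)
  then show "cal_radial \<gamma> M \<ge> 0" "cal_jacobian \<gamma> M \<ge> 0" "cal_angular \<gamma> \<ge> 0"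
    using assms by (simp_all add: cal_radial_def cal_jacobian_def cal_angular_def)
qed

text \<open>Equality in the calibration for the radial extremal, for which
  \<open>\<lambda>\<^sub>x = a\<close> and \<open>\<theta>\<^sub>t = 1\<close>.\<close>

lemma calibration_identity:
  assumes "M > 0" "M + \<gamma> \<ge> 0"
  shows "(cal_radial \<gamma> M + cal_jacobian \<gamma> M) * cal_slope \<gamma> M + (cal_angular \<gamma> - \<bar>\<gamma>\<bar>)
     = M * ((cal_slope \<gamma> M)\<^sup>2 + 1)"
proof -
  note sq = cal_slope_sq[OF assms]
  show ?thesis
  proof (cases "\<gamma> \<ge> 0")
    case True
    then show ?thesis using cal_slope_pos[OF assms(1) True] sq
      by (simp add: cal_radial_def cal_jacobian_def cal_angular_def field_simps)
  next
    case False
    then show ?thesis using sq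
      by (simp add: cal_radial_def cal_jacobian_def cal_angular_def power2_eq_square algebra_simps)
  qed
qed

text \<open>The Jacobian is estimated by \<open>(X - a W)\<^sup>2 + (Z + a Y)\<^sup>2 \<ge>
  0\<close> and its counterpart with the opposite signs, the linear term by \<open>(X - sg
  a)\<^sup>2 \<ge> 0\<close> if \<open>\<gamma> \<ge> 0\<close> and by \<open>(W - sg)\<^sup>2
  \<ge> 0\<close> if \<open>\<gamma> < 0\<close>. The coefficient of the Jacobian may be any
  \<open>k\<close> between \<open>0\<close> and \<open>\<kappa>\<close>, which leaves room for a
  cutoff. The sign \<open>sg\<close> covers maps that interchange the boundary
  components.\<close>

lemma calibration_inequality:
  assumes M: "M > 0" "M + \<gamma> \<ge> 0" and sg: "sg = 1 \<or> sg = -1"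
    and k: "0 \<le> k" "k \<le> cal_jacobian \<gamma> M"
  shows "M * (X\<^sup>2 + Y\<^sup>2 + Z\<^sup>2 + W\<^sup>2) \<ge>
    cal_radial \<gamma> M * (sg * X) + cal_angular \<gamma> * (sg * W) + k * (X * W - Y * Z) - \<bar>\<gamma>\<bar>"
proof -
  define a where "a = cal_slope \<gamma> M"
  have a0: "a \<ge> 0" using cal_nonneg[OF M] by (simp add: a_def)
  have a2: "M * a\<^sup>2 = M + \<gamma>" using cal_slope_sq[OF M] by (simp add: a_def)
  have s2: "sg * sg = 1" using sg by auto
  define D where "D = X * W - Y * Z"
  have kD: "k * D \<le> cal_jacobian \<gamma> M * \<bar>D\<bar>"
    by (meson abs_ge_self abs_ge_zero k mult_left_mono mult_right_mono order_trans)
  have sq4: "c * \<bar>2 * D\<bar> \<le> X\<^sup>2 + Z\<^sup>2 + c\<^sup>2 * (Y\<^sup>2 + W\<^sup>2)" if "c \<ge> 0" for c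
  proof -
    have "0 \<le> (X - c * W)\<^sup>2 + (Z + c * Y)\<^sup>2" "0 \<le> (X + c * W)\<^sup>2 + (Z - c * Y)\<^sup>2" by simp_all
    then have "c * (2 * D) \<le> X\<^sup>2 + Z\<^sup>2 + c\<^sup>2 * (Y\<^sup>2 + W\<^sup>2)" "- (c * (2 * D)) \<le> X\<^sup>2 + Z\<^sup>2 + c\<^sup>2 * (Y\<^sup>2 + W\<^sup>2)"
      unfolding D_def by (simp_all add: power2_eq_square algebra_simps)
    moreover have "c * \<bar>2 * D\<bar> = \<bar>c * (2 * D)\<bar>" using that by (simp add: abs_mult)
    ultimately show ?thesis by linarith
  qed
  show ?thesis
  proof (cases "\<gamma> \<ge> 0")
    case True
    have ap: "a > 0" using cal_slope_pos[OF M(1) True] by (simp add: a_def)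
    have "M * (a * \<bar>2 * D\<bar>) \<le> M * (X\<^sup>2 + Z\<^sup>2 + a\<^sup>2 * (Y\<^sup>2 + W\<^sup>2))"
      using sq4[OF a0] M(1) by (intro mult_left_mono) auto
    also have "\<dots> = M * (X\<^sup>2 + Z\<^sup>2) + (M * a\<^sup>2) * (Y\<^sup>2 + W\<^sup>2)"
      by (simp add: algebra_simps)
    also note a2
    finally have 1: "M * (a * \<bar>2 * D\<bar>) \<le> M * (X\<^sup>2 + Z\<^sup>2) + (M + \<gamma>) * (Y\<^sup>2 + W\<^sup>2)" .
    have 2: "\<gamma> * (2 * a * (sg * X) - a\<^sup>2) \<le> \<gamma> * X\<^sup>2"
    proof (rule mult_left_mono[OF _ True])
      have "0 \<le> (X - sg * a)\<^sup>2" by simp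
      also have "\<dots> = X\<^sup>2 - 2 * a * (sg * X) + (sg * sg) * a\<^sup>2"
        by (simp add: power2_eq_square algebra_simps)
      finally show "2 * a * (sg * X) - a\<^sup>2 \<le> X\<^sup>2" using s2 by simp
    qed
    have "a\<^sup>2 * (2 * M / a * \<bar>D\<bar> + 2 * \<gamma> / a * (sg * X) - \<gamma>) =
        M * (a * \<bar>2 * D\<bar>) + \<gamma> * (2 * a * (sg * X) - a\<^sup>2)"
      using ap by (simp add: power2_eq_square field_simps abs_mult)
    also have "\<dots> \<le> M * (X\<^sup>2 + Z\<^sup>2) + (M + \<gamma>) * (Y\<^sup>2 + W\<^sup>2) + \<gamma> * X\<^sup>2 + \<gamma> * Z\<^sup>2"
      using 1 2 mult_nonneg_nonneg[OF True zero_le_power2[of Z]] by linarith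
    also have "\<dots> = a\<^sup>2 * (M * (X\<^sup>2 + Y\<^sup>2 + Z\<^sup>2 + W\<^sup>2))"
    proof -
      have "a\<^sup>2 * (M * (X\<^sup>2 + Y\<^sup>2 + Z\<^sup>2 + W\<^sup>2)) = (M * a\<^sup>2) * (X\<^sup>2 + Y\<^sup>2 + Z\<^sup>2 + W\<^sup>2)"
        by (simp add: ac_simps)
      then show ?thesis unfolding a2 by (simp add: algebra_simps)
    qed
    finally have "2 * M / a * \<bar>D\<bar> + 2 * \<gamma> / a * (sg * X) - \<gamma> \<le> M * (X\<^sup>2 + Y\<^sup>2 + Z\<^sup>2 + W\<^sup>2)"
      using ap by (simp add: mult_le_cancel_left)
    then show ?thesis
      using True kD by (simp add: cal_radial_def cal_jacobian_def cal_angular_def flip: a_def D_def)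
  next
    case False
    have "M * (a * \<bar>2 * D\<bar>) \<le> M * (X\<^sup>2 + Z\<^sup>2 + a\<^sup>2 * (Y\<^sup>2 + W\<^sup>2))"
      using sq4[OF a0] M(1) by (intro mult_left_mono) auto
    also have "\<dots> = M * (X\<^sup>2 + Z\<^sup>2) + (M * a\<^sup>2) * (Y\<^sup>2 + W\<^sup>2)"
      by (simp add: algebra_simps)
    also note a2
    finally have 1: "M * (a * \<bar>2 * D\<bar>) \<le> M * (X\<^sup>2 + Z\<^sup>2) + (M + \<gamma>) * (Y\<^sup>2 + W\<^sup>2)" .
    have "0 \<le> (W - sg)\<^sup>2" by simp
    also have "\<dots> = W\<^sup>2 - 2 * (sg * W) + sg * sg" by (simp add: power2_eq_square algebra_simps)
    finally have "2 * (sg * W) - 1 \<le> W\<^sup>2" using s2 by simp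
    then have 2: "(-\<gamma>) * (2 * (sg * W) - 1) \<le> (-\<gamma>) * W\<^sup>2"
      using False by (intro mult_left_mono) auto
    have 3: "(-\<gamma>) * Y\<^sup>2 \<ge> 0" using False by (simp add: mult_nonpos_nonneg)
    have "2 * M * a * \<bar>D\<bar> + (-2*\<gamma>) * (sg * W) + \<gamma> \<le> M * (X\<^sup>2 + Y\<^sup>2 + Z\<^sup>2 + W\<^sup>2)"
      using 1 2 3 by (simp add: algebra_simps abs_mult)
    then show ?thesis
      using False kD by (simp add: cal_radial_def cal_jacobian_def cal_angular_def flip: a_def D_def)
  qed
qed

lemma continuous_on_cal:
  assumes "\<And>u. M u > 0" "\<And>u. M u + \<gamma> \<ge> 0" "continuous_on UNIV M"
  shows "continuous_on UNIV (\<lambda>u. cal_radial \<gamma> (M u))" "continuous_on UNIV (\<lambda>u. cal_jacobian \<gamma> (M u))"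
    "continuous_on UNIV (\<lambda>u. cal_slope \<gamma> (M u))"
proof -
  have nz: "M u \<noteq> 0" for u using assms(1)[of u] by simp
  show c: "continuous_on UNIV (\<lambda>u. cal_slope \<gamma> (M u))"
    unfolding cal_slope_def by (intro continuous_intros assms(3)) (use nz in auto)
  have nz': "\<gamma> \<ge> 0 \<Longrightarrow> cal_slope \<gamma> (M u) \<noteq> 0" for u using cal_slope_pos[OF assms(1)[of u]] by force
  show "continuous_on UNIV (\<lambda>u. cal_radial \<gamma> (M u))" "continuous_on UNIV (\<lambda>u. cal_jacobian \<gamma> (M u))"
    unfolding cal_radial_def cal_jacobian_def
    by (cases "\<gamma> \<ge> 0"; use nz' in \<open>auto intro!: continuous_intros c assms(3)\<close>)+
qed

lemma has_real_derivative_integral_upto: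
  fixes g :: "real \<Rightarrow> real"
  assumes "continuous_on UNIV g" "a < u"
  shows "((\<lambda>u. integral {a..u} g) has_real_derivative g u) (at u)"
proof -
  have "((\<lambda>u. integral {a..u} g) has_real_derivative g u) (at u within {a..u+1})"
    by (rule integral_has_real_derivative) (use assms continuous_on_subset in auto)
  moreover have "at u within {a..u+1} = at u" using assms(2) by (intro at_within_interior) auto
  ultimately show ?thesis by simp
qed

text \<open>The calibration integrated. The map is only known to bring the two boundary circles
  into the zones \<open>\<lambda> \<le> l + e\<close> and \<open>\<lambda> \<ge> - e\<close>, so
  the coefficient of the Jacobian is cut off there: its primitive is then constant in both zones
  and the boundary terms in Stokes' theorem reduce to the winding number. For the radial term it
  is enough that its primitive is monotone.\<close>

lemma cylinder_energy_bound:
  fixes x0 x1 l e \<gamma> sg :: real and lam lx lt A B C :: "real \<Rightarrow> real \<Rightarrow> real" and M :: "real \<Rightarrow> real"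
  defines "Q \<equiv> {x0..x1} \<times> {0..2*pi}"
  assumes x01: "x0 \<le> x1"
    and M: "\<And>u. M u > 0" "\<And>u. M u + \<gamma> \<ge> 0" "continuous_on UNIV M"
    and sg: "sg = 1 \<or> sg = -1" and e: "e > 0" "l + 2 * e \<le> - 2 * e"
    and lx: "\<And>x t. x \<in> {x0..x1} \<Longrightarrow> t \<in> {0..2*pi} \<Longrightarrow>
        ((\<lambda>x. lam x t) has_real_derivative lx x t) (at x within {x0..x1})"
    and lt: "\<And>x t. x \<in> {x0..x1} \<Longrightarrow> t \<in> {0..2*pi} \<Longrightarrow>
        ((\<lambda>t. lam x t) has_real_derivative lt x t) (at t within {0..2*pi})"
    and Bx: "\<And>x t. x \<in> {x0..x1} \<Longrightarrow> t \<in> {0..2*pi} \<Longrightarrow>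
        ((\<lambda>x. B x t) has_real_derivative C x t) (at x within {x0..x1})"
    and At: "\<And>x t. x \<in> {x0..x1} \<Longrightarrow> t \<in> {0..2*pi} \<Longrightarrow>
        ((\<lambda>t. A x t) has_real_derivative C x t) (at t within {0..2*pi})"
    and cont: "continuous_on Q (\<lambda>(x, t). lam x t)" "continuous_on Q (\<lambda>(x, t). lx x t)"
      "continuous_on Q (\<lambda>(x, t). lt x t)" "continuous_on Q (\<lambda>(x, t). A x t)"
      "continuous_on Q (\<lambda>(x, t). B x t)" "continuous_on Q (\<lambda>(x, t). C x t)"
    and per: "\<And>x. x \<in> {x0..x1} \<Longrightarrow> lam x (2*pi) = lam x 0" "\<And>x. x \<in> {x0..x1} \<Longrightarrow> A x (2*pi) = A x 0"
    and circ: "\<And>x. x \<in> {x0..x1} \<Longrightarrow> sg * integral {0..2*pi} (B x) \<ge> 2 * pi"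
    and ends: "\<And>t. t \<in> {0..2*pi} \<Longrightarrow>
       (if sg = 1 then lam x0 t \<le> l + e \<and> lam x1 t \<ge> - e else lam x0 t \<ge> - e \<and> lam x1 t \<le> l + e)"
  shows "2 * pi * (integral {l+e..-e} (\<lambda>u. cal_radial \<gamma> (M u)) +
      integral {l+2*e..-2*e} (\<lambda>u. cal_jacobian \<gamma> (M u)) + (cal_angular \<gamma> - \<bar>\<gamma>\<bar>) * (x1 - x0))
    \<le> integral Q (\<lambda>(x, t). M (lam x t) * ((lx x t)\<^sup>2 + (lt x t)\<^sup>2 + (A x t)\<^sup>2 + (B x t)\<^sup>2))"
proof -
  have Qc: "Q = cbox (x0, 0) (x1, 2*pi)" by (simp add: Q_def cbox_Pair_eq)
  have intQ: "F integrable_on Q" if "continuous_on Q F" for F :: "real \<times> real \<Rightarrow> real"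
    using that by (simp add: Qc integrable_continuous)
  note c = cont[unfolded case_prod_unfold]
  define \<alpha> where "\<alpha> u = cal_radial \<gamma> (M u)" for u
  define \<kappa> where "\<kappa> u = cal_jacobian \<gamma> (M u)" for u
  define \<beta> where "\<beta> = cal_angular \<gamma>"
  have c\<alpha>: "continuous_on UNIV \<alpha>" and c\<kappa>: "continuous_on UNIV \<kappa>"
    using continuous_on_cal[OF M] by (simp_all add: \<alpha>_def[abs_def] \<kappa>_def[abs_def])
  have \<alpha>0: "\<alpha> u \<ge> 0" and \<kappa>0: "\<kappa> u \<ge> 0" and \<beta>0: "\<beta> \<ge> 0" for u
    using cal_nonneg[OF M(1,2)] by (auto simp: \<alpha>_def \<kappa>_def \<beta>_def)
  \<comment> \<open>zero in both boundary zones and one between \<open>l + 2 e\<close> and \<open>- 2 e\<close>\<close>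
  define cut where "cut u = max 0 (min 1 (min ((u - (l + e)) / e) ((- e - u) / e)))" for u
  have cut01: "0 \<le> cut u" "cut u \<le> 1" for u by (auto simp: cut_def)
  have cut_out: "cut u = 0" if "u \<le> l + e \<or> u \<ge> - e" for u
  proof -
    have "(u - (l + e)) / e \<le> 0 \<or> (- e - u) / e \<le> 0" using that e by (auto simp: divide_le_0_iff)
    then show ?thesis by (auto simp: cut_def)
  qed
  have cut_in: "cut u = 1" if "l + 2 * e \<le> u" "u \<le> - 2 * e" for u
  proof -
    have "(u - (l + e)) / e \<ge> 1" "(- e - u) / e \<ge> 1" using that e by (auto simp: field_simps)
    then show ?thesis by (auto simp: cut_def)
  qed
  define k where "k u = \<kappa> u * cut u" for u
  have ck: "continuous_on UNIV k"
    unfolding k_def cut_def by (intro continuous_intros c\<kappa>) (use e in auto)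
  have k0: "0 \<le> k u" "k u \<le> \<kappa> u" for u
    using \<kappa>0[of u] cut01[of u] by (auto simp: k_def mult_left_le)
  have "bounded ((\<lambda>p. lam (fst p) (snd p)) ` Q)"
    by (intro compact_imp_bounded compact_continuous_image c(1)) (simp add: Qc compact_cbox)
  then obtain b where b: "\<And>p. p \<in> Q \<Longrightarrow> \<bar>lam (fst p) (snd p)\<bar> \<le> b"
    by (auto simp: bounded_iff)
  define L where "L = \<bar>b\<bar> + \<bar>l\<bar> + 1"
  have L1: "- L < lam x t" if "x \<in> {x0..x1}" "t \<in> {0..2*pi}" for x t
    using b[of "(x, t)"] that by (auto simp: L_def Q_def)
  have L2: "- L < l + e" "- L < - e" "- L < l + 2 * e" using e by (auto simp: L_def)
  define H where "H u = integral {-L..u} \<alpha>" for u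
  define G where "G u = integral {-L..u} k" for u
  have ig: "g integrable_on {a..b}" if "continuous_on UNIV g" for g :: "real \<Rightarrow> real" and a b
    using that by (meson continuous_on_subset integrable_continuous_interval top_greatest)
  have comb: "integral {-L..v} g = integral {-L..u} g + integral {u..v} g"
    if "continuous_on UNIV g" "- L \<le> u" "u \<le> v" for g :: "real \<Rightarrow> real" and u v
    using Henstock_Kurzweil_Integration.integral_combine[OF that(2,3) ig[OF that(1)]] by simp
  have Hmono: "H u \<le> H v" if "- L \<le> u" "u \<le> v" for u v
    unfolding H_def using comb[OF c\<alpha> that] integral_nonneg[OF ig[OF c\<alpha>], of u v] \<alpha>0 by simp
  have G0: "G u = 0" if "u \<le> l + e" for u
    unfolding G_def using that integral_cong[of "{-L..u}" k "\<lambda>_. 0"] by (simp add: k_def cut_out)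
  have G1: "G u = G (- e)" if "u \<ge> - e" for u
    unfolding G_def using comb[OF ck _ that] L2 integral_cong[of "{-e..u}" k "\<lambda>_. 0"]
    by (simp add: k_def cut_out)
  have Gc: "integral {l+2*e..-2*e} \<kappa> \<le> G (- e)"
  proof -
    have "integral {l+2*e..-2*e} \<kappa> = integral {l+2*e..-2*e} k"
      by (rule integral_cong) (simp add: k_def cut_in)
    also have "\<dots> \<le> integral {-L..-e} k"
      by (rule integral_subset_le) (use ig[OF ck] L2 e k0 in auto)
    finally show ?thesis by (simp add: G_def)
  qed
  have cl: "continuous_on Q (\<lambda>p. g (lam (fst p) (snd p)))" if "continuous_on UNIV g" for g :: "real \<Rightarrow> real"
    by (rule continuous_on_compose2[OF that c(1)]) auto
  have line: "continuous_on {0..2*pi} (\<lambda>t. F (x, t))" if "continuous_on Q F" "x \<in> {x0..x1}"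
    for F :: "real \<times> real \<Rightarrow> real" and x
    by (rule continuous_on_compose2[OF that(1)]) (use that(2) in \<open>auto intro!: continuous_intros simp: Q_def\<close>)
  have cH: "continuous_on {- L<..} H"
    unfolding H_def using has_real_derivative_integral_upto[OF c\<alpha>]
    by (intro continuous_at_imp_continuous_on ballI DERIV_isCont) auto
  have cHl: "(\<lambda>t. H (lam x t)) integrable_on {0..2*pi}" if "x \<in> {x0..x1}" for x
    by (rule integrable_continuous_interval, rule continuous_on_compose2[OF cH line[OF c(1) that, simplified]])
      (use L1 that in auto)
  have x0in: "x0 \<in> {x0..x1}" "x1 \<in> {x0..x1}" using x01 by auto
  have T1: "2 * pi * integral {l+e..-e} \<alpha> \<le> integral Q (\<lambda>(x, t). \<alpha> (lam x t) * (sg * lx x t))"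
  proof -
    have S: "integral Q (\<lambda>(x, t). \<alpha> (lam x t) * (lx x t * 1 - lt x t * 0)) =
      integral {0..2*pi} (\<lambda>t. H (lam x1 t) * 1) - integral {0..2*pi} (\<lambda>t. H (lam x0 t) * 1)"
      unfolding Q_def
      by (rule stokes_rectangle[where C = "\<lambda>_ _. 0"])
        (use x01 lx lt c\<alpha> cont per has_real_derivative_integral_upto[OF c\<alpha> L1] in
          \<open>auto simp: Q_def H_def[abs_def] case_prod_unfold\<close>)
    have E: "integral Q (\<lambda>(x, t). \<alpha> (lam x t) * (sg * lx x t)) =
        sg * integral Q (\<lambda>(x, t). \<alpha> (lam x t) * (lx x t * 1 - lt x t * 0))"
      by (subst integral_mult_right[symmetric]) (simp add: case_prod_unfold ac_simps)
    have D: "H (- e) = H (l + e) + integral {l+e..-e} \<alpha>"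
      unfolding H_def using comb[OF c\<alpha>, of "l + e" "- e"] L2 e by simp
    have int_ge: "2 * pi * v \<le> integral {0..2*pi} (\<lambda>t. H (lam x t))"
      if "x \<in> {x0..x1}" "\<And>t. t \<in> {0..2*pi} \<Longrightarrow> v \<le> H (lam x t)" for x v
      using integral_le[OF integrable_const_ivl cHl[OF that(1)], of v] that(2) by simp
    have int_le: "integral {0..2*pi} (\<lambda>t. H (lam x t)) \<le> 2 * pi * v"
      if "x \<in> {x0..x1}" "\<And>t. t \<in> {0..2*pi} \<Longrightarrow> H (lam x t) \<le> v" for x v
      using integral_le[OF cHl[OF that(1)] integrable_const_ivl, of v] that(2) by simp
    show ?thesis
    proof (cases "sg = 1")
      case True
      have "H (- e) \<le> H (lam x1 t)" "H (lam x0 t) \<le> H (l + e)" if "t \<in> {0..2*pi}" for t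
        using ends[OF that] True L1[OF x0in(1) that] L2 by (auto intro!: Hmono)
      then show ?thesis using int_ge[OF x0in(2), of "H (-e)"] int_le[OF x0in(1), of "H (l+e)"] E S D True
        by (simp add: algebra_simps)
    next
      case False
      then have sg': "sg = -1" using sg by simp
      have "H (- e) \<le> H (lam x0 t)" "H (lam x1 t) \<le> H (l + e)" if "t \<in> {0..2*pi}" for t
        using ends[OF that] False L1[OF x0in(2) that] L2 by (auto intro!: Hmono)
      then show ?thesis using int_ge[OF x0in(1), of "H (-e)"] int_le[OF x0in(2), of "H (l+e)"] E S D sg'
        by (simp add: algebra_simps)
    qed
  qed
  have T2: "2 * pi * (\<beta> * (x1 - x0)) \<le> integral Q (\<lambda>(x, t). \<beta> * (sg * B x t))"
  proof -
    have "integral Q (\<lambda>(x, t). \<beta> * (sg * B x t)) = \<beta> * integral Q (\<lambda>(x, t). sg * B x t)"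
      by (subst integral_mult_right[symmetric]) (simp add: case_prod_unfold)
    moreover have "integral Q (\<lambda>(x, t). sg * B x t) = integral {x0..x1} (\<lambda>x. sg * integral {0..2*pi} (B x))"
      using integral_prod_continuous[of x0 0 x1 "2*pi" "\<lambda>(x, t). sg * B x t"] cont(5)
      by (simp add: Qc case_prod_unfold continuous_intros)
    moreover have "2 * pi * (x1 - x0) \<le> integral {x0..x1} (\<lambda>x. sg * integral {0..2*pi} (B x))"
    proof -
      have "continuous_on {x0..x1} (\<lambda>x. integral (cbox 0 (2*pi)) (B x))"
        using integral_continuous_on_param[of "{x0..x1}" 0 "2*pi" B] cont(5) by (simp add: Q_def)
      then have "(\<lambda>x. sg * integral {0..2*pi} (B x)) integrable_on {x0..x1}"
        by (intro integrable_continuous_interval continuous_intros) simp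
      from integral_le[OF integrable_const_ivl this, of "2 * pi"] circ x01
      show ?thesis by (simp add: ac_simps)
    qed
    ultimately have "2 * pi * (x1 - x0) \<le> integral Q (\<lambda>(x, t). sg * B x t)" by linarith
    from mult_left_mono[OF this \<beta>0]
    show ?thesis
      using \<open>integral Q (\<lambda>(x, t). \<beta> * (sg * B x t)) = \<beta> * integral Q (\<lambda>(x, t). sg * B x t)\<close>
      by (simp only: ac_simps)
  qed
  have T3: "2 * pi * integral {l+2*e..-2*e} \<kappa> \<le>
      integral Q (\<lambda>(x, t). k (lam x t) * (lx x t * B x t - lt x t * A x t))"
  proof -
    have S: "integral Q (\<lambda>(x, t). k (lam x t) * (lx x t * B x t - lt x t * A x t)) =
      integral {0..2*pi} (\<lambda>t. G (lam x1 t) * B x1 t) - integral {0..2*pi} (\<lambda>t. G (lam x0 t) * B x0 t)"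
      unfolding Q_def
      by (rule stokes_rectangle[where C = C])
        (use x01 lx lt Bx At ck cont per has_real_derivative_integral_upto[OF ck L1] in
          \<open>auto simp: Q_def G_def[abs_def]\<close>)
    have nn: "0 \<le> G (- e)"
      unfolding G_def using integral_nonneg[OF ig[OF ck]] k0 by simp
    have val: "integral {0..2*pi} (\<lambda>t. G (lam x t) * B x t) = v * integral {0..2*pi} (B x)"
      if "\<And>t. t \<in> {0..2*pi} \<Longrightarrow> G (lam x t) = v" for x v
      by (subst integral_mult_right[symmetric], rule integral_cong) (simp add: that)
    have "2 * pi * G (- e) \<le> integral Q (\<lambda>(x, t). k (lam x t) * (lx x t * B x t - lt x t * A x t))"
    proof (cases "sg = 1")
      case True
      have "G (lam x1 t) = G (- e)" "G (lam x0 t) = 0" if "t \<in> {0..2*pi}" for t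
        using ends[OF that] True G0[of "lam x0 t"] G1[of "lam x1 t"] by auto
      then have "integral {0..2*pi} (\<lambda>t. G (lam x1 t) * B x1 t) = G (- e) * integral {0..2*pi} (B x1)"
        "integral {0..2*pi} (\<lambda>t. G (lam x0 t) * B x0 t) = 0"
        using val[of x1 "G (- e)"] val[of x0 0] by auto
      moreover have "G (- e) * (2 * pi) \<le> G (- e) * integral {0..2*pi} (B x1)"
        using circ[OF x0in(2)] True nn by (intro mult_left_mono) auto
      ultimately show ?thesis using S by (simp add: ac_simps)
    next
      case False
      then have sg': "sg = -1" using sg by simp
      have "G (lam x0 t) = G (- e)" "G (lam x1 t) = 0" if "t \<in> {0..2*pi}" for t
        using ends[OF that] False G0[of "lam x1 t"] G1[of "lam x0 t"] by auto
      then have "integral {0..2*pi} (\<lambda>t. G (lam x0 t) * B x0 t) = G (- e) * integral {0..2*pi} (B x0)"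
        "integral {0..2*pi} (\<lambda>t. G (lam x1 t) * B x1 t) = 0"
        using val[of x0 "G (- e)"] val[of x1 0] by auto
      moreover have "G (- e) * (2 * pi) \<le> G (- e) * (- integral {0..2*pi} (B x0))"
        using circ[OF x0in(1)] sg' nn by (intro mult_left_mono) auto
      ultimately show ?thesis using S by (simp add: ac_simps)
    qed
    then show ?thesis using Gc by (smt (verit) mult_left_mono pi_gt_zero)
  qed
  let ?F1 = "\<lambda>(x, t). \<alpha> (lam x t) * (sg * lx x t)" and ?F2 = "\<lambda>(x, t). \<beta> * (sg * B x t)"
    and ?F3 = "\<lambda>(x, t). k (lam x t) * (lx x t * B x t - lt x t * A x t)"
  have cF: "continuous_on Q ?F1" "continuous_on Q ?F2" "continuous_on Q ?F3"
    unfolding case_prod_unfold by (intro continuous_intros c cl c\<alpha> ck)+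
  have T4: "integral Q (\<lambda>_. \<bar>\<gamma>\<bar>) = 2 * pi * (\<bar>\<gamma>\<bar> * (x1 - x0))"
    using x01 by (simp add: Qc content_Pair)
  have "integral Q (\<lambda>p. ?F1 p + ?F2 p + ?F3 p - \<bar>\<gamma>\<bar>) =
     integral Q ?F1 + integral Q ?F2 + integral Q ?F3 - integral Q (\<lambda>_. \<bar>\<gamma>\<bar>)"
    by (subst integral_diff integral_add; (intro intQ continuous_intros cF)?)+ simp
  moreover have "integral Q (\<lambda>p. ?F1 p + ?F2 p + ?F3 p - \<bar>\<gamma>\<bar>) \<le>
      integral Q (\<lambda>(x, t). M (lam x t) * ((lx x t)\<^sup>2 + (lt x t)\<^sup>2 + (A x t)\<^sup>2 + (B x t)\<^sup>2))"
  proof (rule integral_le)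
    show "(\<lambda>p. ?F1 p + ?F2 p + ?F3 p - \<bar>\<gamma>\<bar>) integrable_on Q" by (intro intQ continuous_intros cF)
    show "(\<lambda>(x, t). M (lam x t) * ((lx x t)\<^sup>2 + (lt x t)\<^sup>2 + (A x t)\<^sup>2 + (B x t)\<^sup>2)) integrable_on Q"
      unfolding case_prod_unfold by (intro intQ continuous_intros c cl M(3))
    fix p assume "p \<in> Q"
    show "?F1 p + ?F2 p + ?F3 p - \<bar>\<gamma>\<bar> \<le>
       (case p of (x, t) \<Rightarrow> M (lam x t) * ((lx x t)\<^sup>2 + (lt x t)\<^sup>2 + (A x t)\<^sup>2 + (B x t)\<^sup>2))"
      using calibration_inequality[OF M(1,2) sg, of "k (lam (fst p) (snd p))"] k0
      by (simp add: case_prod_unfold \<alpha>_def \<beta>_def \<kappa>_def)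
  qed
  ultimately show ?thesis
    using T1 T2 T3 T4 by (simp add: \<alpha>_def[abs_def] \<beta>_def \<kappa>_def[abs_def] algebra_simps)
qed

section \<open>Regular radial metrics up to the boundary\<close>

lemma has_derivative_radial:
  fixes B :: "real \<Rightarrow> real"
  assumes "(B has_real_derivative b) (at (cmod z))" "z \<noteq> 0"
  shows "((\<lambda>z. B (cmod z)) has_derivative
     (\<lambda>h. Re h *\<^sub>R (b * (Re z / cmod z)) + Im h *\<^sub>R (b * (Im z / cmod z)))) (at z)"
proof (rule has_derivative_real_chain[of cmod "Re z / cmod z" "Im z / cmod z" z B b, OF _ assms(1)])
  show "(cmod has_derivative (\<lambda>h. Re h *\<^sub>R (Re z / cmod z) + Im h *\<^sub>R (Im z / cmod z))) (at z)"
    by (rule has_derivative_eq_rhs[OF has_derivative_norm[OF assms(2)]])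
      (simp add: fun_eq_iff inner_complex_def sgn_div_norm divide_inverse mult.commute)
qed

lemma open_annulus: "open (annulus a b)"
  unfolding annulus_def by (intro open_Collect_conj open_Collect_less continuous_intros)

lemma measurable_annulus [measurable]: "annulus a b \<in> sets borel"
  using open_annulus[of a b] by simp

lemma closed_ring_compact: "compact {z::complex. a \<le> cmod z \<and> cmod z \<le> b}"
proof -
  have "closed {z::complex. a \<le> cmod z \<and> cmod z \<le> b}"
    by (intro closed_Collect_conj closed_Collect_le continuous_intros)
  moreover have "bounded {z::complex. a \<le> cmod z \<and> cmod z \<le> b}"
    by (rule bounded_subset[of "cball 0 b"]) auto
  ultimately show ?thesis by (simp add: compact_eq_bounded_closed)
qed

lemma cmod_exp_Complex: "cmod (exp (Complex x t)) = exp x"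
  by (simp add: norm_exp_eq_Re)

text \<open>Integrals of radial densities, written with the factor \<open>1 / |z|\<^sup>2\<close>
  that cancels the Jacobian of \<open>exp\<close>.\<close>

lemma annulus_nn_integral:
  assumes r: "0 < r" and w: "continuous_on {ln r<..<0} w" "\<And>x. x \<in> {ln r<..<0} \<Longrightarrow> 0 \<le> w x"
    and F: "\<And>z. z \<in> annulus r 1 \<Longrightarrow> F z = w (ln (cmod z)) / (cmod z)\<^sup>2"
  shows "(\<integral>\<^sup>+z\<in>annulus r 1. ennreal (F z) \<partial>lebesgue) =
    ennreal (2 * pi) * (\<integral>\<^sup>+x. ennreal (indicator {ln r<..<0} x * w x) \<partial>lborel)"
proof -
  let ?\<Omega> = "annulus r 1"
  have lnin: "ln (cmod z) \<in> {ln r<..<0}" "cmod z > 0" if "z \<in> ?\<Omega>" for z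
  proof -
    have z: "r < cmod z" "cmod z < 1" using that by (auto simp: annulus_def)
    then show "cmod z > 0" using r by linarith
    then show "ln (cmod z) \<in> {ln r<..<0}" using z r by simp
  qed
  have c: "continuous_on ?\<Omega> (\<lambda>z. w (ln (cmod z)) / (cmod z)\<^sup>2)"
    by (intro continuous_intros continuous_on_compose2[OF w(1)]) (use lnin in force)+
  have m: "(\<lambda>z. indicator ?\<Omega> z *\<^sub>R (w (ln (cmod z)) / (cmod z)\<^sup>2)) \<in> borel_measurable borel"
    by (intro borel_measurable_continuous_on_indicator c) simp
  have mm: "(\<lambda>x. indicator {ln r<..<0} x *\<^sub>R w x) \<in> borel_measurable borel"
    by (intro borel_measurable_continuous_on_indicator w(1)) simp
  have "(\<integral>\<^sup>+z\<in>?\<Omega>. ennreal (F z) \<partial>lebesgue) =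
      (\<integral>\<^sup>+z. ennreal (indicator ?\<Omega> z *\<^sub>R (w (ln (cmod z)) / (cmod z)\<^sup>2)) \<partial>lebesgue)"
    by (intro nn_integral_cong) (use F in \<open>simp split: split_indicator\<close>)
  also have "\<dots> = (\<integral>\<^sup>+z. ennreal (indicator ?\<Omega> z *\<^sub>R (w (ln (cmod z)) / (cmod z)\<^sup>2)) \<partial>lborel)"
    using m by (simp add: nn_integral_completion)
  also have "\<dots> = (\<integral>\<^sup>+x. (\<integral>\<^sup>+t. ennreal (indicator ?\<Omega> (exp (Complex x t)) *\<^sub>R (w (ln (cmod (exp (Complex x t)))) / (cmod (exp (Complex x t)))\<^sup>2))
      * ennreal (indicator {0<..<2*pi} t * exp (2 * x)) \<partial>lborel) \<partial>lborel)"
    using m by (intro nn_integral_exp_coordinates) simp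
  also have "\<dots> = (\<integral>\<^sup>+x. (\<integral>\<^sup>+t. ennreal (indicator {ln r<..<0} x * w x) * indicator {0<..<2*pi} t \<partial>lborel) \<partial>lborel)"
  proof (intro nn_integral_cong)
    fix x t :: real
    have "r < exp x \<longleftrightarrow> ln r < x" using exp_less_cancel_iff[of "ln r" x] r by simp
    then have ann: "exp (Complex x t) \<in> ?\<Omega> \<longleftrightarrow> x \<in> {ln r<..<0}" by (simp add: annulus_def cmod_exp_Complex)
    have e: "w x / (exp x)\<^sup>2 * exp (2 * x) = w x" by (simp add: exp_double)
    show "ennreal (indicator ?\<Omega> (exp (Complex x t)) *\<^sub>R (w (ln (cmod (exp (Complex x t)))) / (cmod (exp (Complex x t)))\<^sup>2))
      * ennreal (indicator {0<..<2*pi} t * exp (2 * x)) =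
      ennreal (indicator {ln r<..<0} x * w x) * indicator {0<..<2*pi} t"
    proof (cases "x \<in> {ln r<..<0} \<and> t \<in> {0<..<2*pi}")
      case True
      then have "0 \<le> w x / (exp x)\<^sup>2" "0 \<le> exp (2 * x)" using w(2)[of x] by simp_all
      from ennreal_mult[OF this] have "ennreal (w x / (exp x)\<^sup>2) * ennreal (exp (2 * x)) = ennreal (w x)"
        unfolding e ..
      then show ?thesis using True ann by (simp add: cmod_exp_Complex)
    qed (use ann in \<open>auto split: split_indicator\<close>)
  qed
  also have "\<dots> = (\<integral>\<^sup>+x. ennreal (indicator {ln r<..<0} x * w x) * ennreal (2 * pi) \<partial>lborel)"
    by (subst nn_integral_cmult_indicator) simp_all
  also have "\<dots> = ennreal (2 * pi) * (\<integral>\<^sup>+x. ennreal (indicator {ln r<..<0} x * w x) \<partial>lborel)"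
    using mm by (subst nn_integral_multc) (auto simp: mult.commute)
  finally show ?thesis .
qed

locale regular_annulus_metric =
  fixes R :: real and \<rho> :: "complex \<Rightarrow> real"
  assumes R: "0 < R" "R < 1"
    and allow: "allowable (annulus R 1) \<rho>"
    and radial: "radial_metric R \<rho>"
    and regular: "regular_metric R \<rho>"
begin

lemma Ck_rho: "Ck_on k (annulus R 1) \<rho>"
  and rho_pos: "w \<in> annulus R 1 \<Longrightarrow> \<rho> w > 0"
  and rho_radial: "w \<in> annulus R 1 \<Longrightarrow> \<rho> w = \<rho> (of_real (cmod w))"
  using radial by (auto simp: radial_metric_def is_metric_def smooth_on_def)

definition \<sigma> :: "real \<Rightarrow> real" where "\<sigma> s = \<rho> (of_real s)"
definition \<sigma>' :: "real \<Rightarrow> real" where "\<sigma>' s = dx \<rho> (of_real s)"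
definition \<sigma>'' :: "real \<Rightarrow> real" where "\<sigma>'' s = dx (dx \<rho>) (of_real s)"

lemma of_real_in_annulus: "R < s \<Longrightarrow> s < 1 \<Longrightarrow> of_real s \<in> annulus R 1"
  using R by (simp add: annulus_def)

lemma \<sigma>_pos: "R < s \<Longrightarrow> s < 1 \<Longrightarrow> \<sigma> s > 0"
  using rho_pos of_real_in_annulus by (simp add: \<sigma>_def)

lemma \<sigma>_deriv: "R < s \<Longrightarrow> s < 1 \<Longrightarrow> (\<sigma> has_real_derivative \<sigma>' s) (at s)"
  and \<sigma>'_deriv: "R < s \<Longrightarrow> s < 1 \<Longrightarrow> (\<sigma>' has_real_derivative \<sigma>'' s) (at s)"
proof -
  assume s: "R < s" "s < 1"
  have C: "Ck_on (Suc (Suc 0)) (annulus R 1) \<rho>" by (rule Ck_rho)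
  have C': "Ck_on (Suc 0) (annulus R 1) (dx \<rho>)" using C by simp
  have c: "complex_of_real s = Complex s 0" for s by (simp add: complex_eq_iff)
  show "(\<sigma> has_real_derivative \<sigma>' s) (at s)"
    using vector_derivative_horizontal(1)[of \<rho> "dx \<rho> (of_real s)" "dy \<rho> (of_real s)" s 0]
      Ck_on_SucD[OF C of_real_in_annulus[OF s]]
    by (simp add: \<sigma>_def[abs_def] \<sigma>'_def c has_real_derivative_iff_has_vector_derivative)
  show "(\<sigma>' has_real_derivative \<sigma>'' s) (at s)"
    using vector_derivative_horizontal(1)[of "dx \<rho>" "dx (dx \<rho>) (of_real s)" "dy (dx \<rho>) (of_real s)" s 0]
      Ck_on_SucD[OF C' of_real_in_annulus[OF s]]
    by (simp add: \<sigma>''_def \<sigma>'_def[abs_def] c has_real_derivative_iff_has_vector_derivative)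
qed

definition lslope :: "real \<Rightarrow> real" where "lslope s = \<sigma>' s / \<sigma> s"
definition lslope' :: "real \<Rightarrow> real" where "lslope' s = \<sigma>'' s / \<sigma> s - (\<sigma>' s / \<sigma> s)\<^sup>2"

lemma ln_\<sigma>_deriv: "R < s \<Longrightarrow> s < 1 \<Longrightarrow> ((\<lambda>s. ln (\<sigma> s)) has_real_derivative lslope s) (at s)"
  using \<sigma>_deriv[of s] \<sigma>_pos[of s]
  by (auto intro!: derivative_eq_intros simp: lslope_def)

lemma lslope_deriv: "R < s \<Longrightarrow> s < 1 \<Longrightarrow> (lslope has_real_derivative lslope' s) (at s)"
proof -
  assume s: "R < s" "s < 1"
  have "((\<lambda>s. \<sigma>' s / \<sigma> s) has_real_derivative (\<sigma>'' s * \<sigma> s - \<sigma>' s * \<sigma>' s) / (\<sigma> s * \<sigma> s)) (at s)"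
    using \<sigma>_pos[OF s] by (intro DERIV_divide \<sigma>_deriv \<sigma>'_deriv s) simp
  then show ?thesis
    using \<sigma>_pos[OF s] unfolding lslope_def[abs_def] lslope'_def
    by (simp add: power2_eq_square diff_divide_distrib)
qed

lemma laplacian_ln_rho:
  assumes s: "R < s" "s < 1"
  shows "laplacian (\<lambda>w. ln (\<rho> w)) (of_real s) = lslope' s + lslope s / s"
proof -
  have nz: "z \<noteq> 0" "R < cmod z" "cmod z < 1" if "z \<in> annulus R 1" for z
    using that R by (auto simp: annulus_def)
  have s0: "s > 0" using s R by simp
  define B where "B t = lslope t / t" for t
  have dB: "(B has_real_derivative (lslope' s / s - lslope s / s\<^sup>2)) (at s)"
  proof -
    have "((\<lambda>t. lslope t / t) has_real_derivative (lslope' s * s - lslope s * 1) / (s * s)) (at s)"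
      using s0 by (intro DERIV_divide lslope_deriv s DERIV_ident) simp
    then show ?thesis using s0 unfolding B_def[abs_def]
      by (simp add: power2_eq_square diff_divide_distrib)
  qed
  have d: "((\<lambda>w. ln (\<rho> w)) has_derivative
      (\<lambda>h. Re h *\<^sub>R (lslope (cmod z) * (Re z / cmod z)) + Im h *\<^sub>R (lslope (cmod z) * (Im z / cmod z)))) (at z)"
    if z: "z \<in> annulus R 1" for z
  proof -
    have "((\<lambda>w. ln (\<sigma> (cmod w))) has_derivative
      (\<lambda>h. Re h *\<^sub>R (lslope (cmod z) * (Re z / cmod z)) + Im h *\<^sub>R (lslope (cmod z) * (Im z / cmod z)))) (at z)"
      by (rule has_derivative_radial[OF ln_\<sigma>_deriv]) (use nz[OF z] in auto)
    then show ?thesis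
      by (rule has_derivative_transform_within_open[OF _ open_annulus z])
        (simp add: \<sigma>_def rho_radial[symmetric])
  qed
  have dxy: "dx (\<lambda>w. ln (\<rho> w)) z = B (cmod z) * Re z" "dy (\<lambda>w. ln (\<rho> w)) z = B (cmod z) * Im z"
    if z: "z \<in> annulus R 1" for z
    using has_derivative_dx_dy_I(2,3)[OF d[OF z]] by (simp_all add: B_def)
  have in': "of_real s \<in> annulus R 1" using of_real_in_annulus s by simp
  have dBs: "((\<lambda>z. B (cmod z)) has_derivative
     (\<lambda>h. Re h *\<^sub>R (lslope' s / s - lslope s / s\<^sup>2))) (at (of_real s))"
    using has_derivative_radial[of B _ "of_real s"] dB s0 by simp
  have Rd: "(Re has_derivative Re) F" "(Im has_derivative Im) F" for F
    by (auto intro!: bounded_linear_imp_has_derivative bounded_linear_Re bounded_linear_Im)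
  have "((\<lambda>z. B (cmod z) * Re z) has_derivative
      (\<lambda>h. B (cmod (of_real s)) * Re h + Re h *\<^sub>R (lslope' s / s - lslope s / s\<^sup>2) * Re (of_real s))) (at (of_real s))"
    by (rule has_derivative_mult[OF dBs Rd(1)])
  then have "(dx (\<lambda>w. ln (\<rho> w)) has_derivative
      (\<lambda>h. B s * Re h + Re h * (lslope' s / s - lslope s / s\<^sup>2) * s)) (at (of_real s))"
    using has_derivative_transform_within_open[OF _ open_annulus in', of "\<lambda>z. B (cmod z) * Re z"] dxy s0
    by fastforce
  then have 1: "dx (dx (\<lambda>w. ln (\<rho> w))) (of_real s) = B s + (lslope' s / s - lslope s / s\<^sup>2) * s"
    using dx_dy_eqI(1) by fastforce
  have "((\<lambda>z. B (cmod z) * Im z) has_derivative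
      (\<lambda>h. B (cmod (of_real s)) * Im h + Re h *\<^sub>R (lslope' s / s - lslope s / s\<^sup>2) * Im (of_real s))) (at (of_real s))"
    by (rule has_derivative_mult[OF dBs Rd(2)])
  then have "(dy (\<lambda>w. ln (\<rho> w)) has_derivative (\<lambda>h. B s * Im h)) (at (of_real s))"
    using has_derivative_transform_within_open[OF _ open_annulus in', of "\<lambda>z. B (cmod z) * Im z"] dxy s0
    by fastforce
  then have 2: "dy (dy (\<lambda>w. ln (\<rho> w))) (of_real s) = B s"
    using dx_dy_eqI(2) by fastforce
  show ?thesis
    using s0 unfolding laplacian_def 1 2 by (simp add: B_def field_simps power2_eq_square)
qed

text \<open>\<open>logm\<close> is \<open>ln (s \<rho>(s))\<close> in the coordinate \<open>x = ln s\<close>.\<close>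

definition logm :: "real \<Rightarrow> real" where "logm x = x + ln (\<sigma> (exp x))"
definition logm' :: "real \<Rightarrow> real" where "logm' x = 1 + exp x * lslope (exp x)"
definition logm'' :: "real \<Rightarrow> real" where
  "logm'' x = exp x * lslope (exp x) + (exp x)\<^sup>2 * lslope' (exp x)"

lemma ln_interval: "x \<in> {ln R<..<0} \<Longrightarrow> R < exp x \<and> exp x < 1"
  using R by (metis exp_less_cancel_iff exp_ln exp_zero greaterThanLessThan_iff)

lemma logm_deriv: "x \<in> {ln R<..<0} \<Longrightarrow> (logm has_real_derivative logm' x) (at x)"
  and logm'_deriv: "x \<in> {ln R<..<0} \<Longrightarrow> (logm' has_real_derivative logm'' x) (at x)"
proof -
  assume x: "x \<in> {ln R<..<0}"
  note s = ln_interval[OF x]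
  show "(logm has_real_derivative logm' x) (at x)"
    unfolding logm_def[abs_def] logm'_def
    using DERIV_add[OF DERIV_ident DERIV_chain2[OF ln_\<sigma>_deriv[of "exp x"] DERIV_exp[of x]]] s
    by (simp add: mult.commute)
  have "((\<lambda>x. 1 + exp x * lslope (exp x)) has_real_derivative
      (0 + (exp x * lslope (exp x) + (lslope' (exp x) * exp x) * exp x))) (at x)"
    using DERIV_chain2[OF lslope_deriv[of "exp x"] DERIV_exp[of x]] s
    by (intro DERIV_add DERIV_const DERIV_mult DERIV_exp) auto
  then show "(logm' has_real_derivative logm'' x) (at x)"
    unfolding logm'_def[abs_def] logm''_def by (simp add: power2_eq_square algebra_simps)
qed

lemma exp_logm: "x \<in> {ln R<..<0} \<Longrightarrow> exp (logm x) = exp x * \<sigma> (exp x)"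
  using ln_interval \<sigma>_pos by (simp add: logm_def exp_add)

text \<open>The curvature equation in the coordinate \<open>x = ln s\<close>.\<close>

lemma logm''_eq: "x \<in> {ln R<..<0} \<Longrightarrow>
    logm'' x = - gauss_curvature \<rho> (of_real (exp x)) * (exp (logm x))\<^sup>2"
proof -
  assume x: "x \<in> {ln R<..<0}"
  note s = ln_interval[OF x]
  have "\<sigma> (exp x) > 0" using s \<sigma>_pos by simp
  then have "- gauss_curvature \<rho> (of_real (exp x)) * (exp x * \<sigma> (exp x))\<^sup>2
     = (exp x)\<^sup>2 * laplacian (\<lambda>w. ln (\<rho> w)) (of_real (exp x))"
    by (simp add: gauss_curvature_def \<sigma>_def power_mult_distrib)
  also have "\<dots> = logm'' x"
    using s by (subst laplacian_ln_rho) (auto simp: logm''_def power2_eq_square algebra_simps)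
  finally show ?thesis using exp_logm[OF x] by simp
qed

lemma area_eq: "metric_area (annulus R 1) \<rho> =
    ennreal (2 * pi) * (\<integral>\<^sup>+x. ennreal (indicator {ln R<..<0} x * (exp (logm x))\<^sup>2) \<partial>lborel)"
  unfolding metric_area_def
proof (rule annulus_nn_integral[OF R(1)])
  show "continuous_on {ln R<..<0} (\<lambda>x. (exp (logm x))\<^sup>2)"
    by (intro continuous_intros continuous_at_imp_continuous_on ballI DERIV_isCont[OF logm_deriv])
  fix z assume z: "z \<in> annulus R 1"
  then have "R < cmod z" "cmod z < 1" "0 < cmod z" using R by (auto simp: annulus_def)
  then show "(\<rho> z)\<^sup>2 = (exp (logm (ln (cmod z))))\<^sup>2 / (cmod z)\<^sup>2"
    using R exp_logm[of "ln (cmod z)"] rho_radial[OF z] by (simp add: \<sigma>_def power_mult_distrib)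
qed simp

text \<open>By the curvature equation \<open>|logm''| \<le> C exp (2 logm)\<close>, and the right
  hand side is integrable since the area is finite. So \<open>logm'\<close> has bounded variation
  and is bounded.\<close>

lemma logm_lipschitz:
  obtains B where "B-lipschitz_on {ln R<..<0} logm"
proof -
  let ?I = "{ln R<..<0}"
  obtain C where C: "\<And>w. w \<in> annulus R 1 \<Longrightarrow> \<bar>gauss_curvature \<rho> w\<bar> \<le> C"
    using allow by (auto simp: allowable_def bounded_iff)
  have C0: "C \<ge> 0" using C[of "of_real ((R+1)/2)"] of_real_in_annulus[of "(R+1)/2"] R by force
  let ?N = "\<integral>\<^sup>+x. ennreal (indicator ?I x * (exp (logm x))\<^sup>2) \<partial>lborel"
  have "ennreal (2 * pi) * ?N < \<infinity>" using allow area_eq by (simp add: allowable_def)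
  then have "?N < \<infinity>" by (auto simp: ennreal_mult_less_top)
  then obtain A where A: "A \<ge> 0" "?N = ennreal A" by (cases ?N) auto
  have cexp: "continuous_on {x..y} (\<lambda>x. (exp (logm x))\<^sup>2)" if "{x..y} \<subseteq> ?I" for x y
    using that by (intro continuous_intros continuous_at_imp_continuous_on ballI DERIV_isCont[OF logm_deriv]) auto
  have intA: "integral {x..y} (\<lambda>x. (exp (logm x))\<^sup>2) \<le> A" if "{x..y} \<subseteq> ?I" for x y
  proof -
    have "ennreal (integral {x..y} (\<lambda>x. (exp (logm x))\<^sup>2)) =
        (\<integral>\<^sup>+t. ennreal (indicator {x..y} t * (exp (logm t))\<^sup>2) \<partial>lborel)"
      by (rule nn_integral_has_integral_lebesgue[symmetric])
        (auto intro!: integrable_integral integrable_continuous_interval cexp that)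
    also have "\<dots> \<le> ?N" using that by (intro nn_integral_mono ennreal_leI) (auto simp: indicator_def)
    finally show ?thesis using A by simp
  qed
  have d': "\<bar>logm' y - logm' x\<bar> \<le> C * A" if "x \<le> y" "{x..y} \<subseteq> ?I" for x y
  proof -
    have h: "(logm'' has_integral logm' y - logm' x) {x..y}"
      by (rule fundamental_theorem_of_calculus)
        (use that in \<open>auto intro!: DERIV_subset[OF logm'_deriv] simp flip: has_real_derivative_iff_has_vector_derivative\<close>)
    have "norm (integral {x..y} logm'') \<le> integral {x..y} (\<lambda>x. C * (exp (logm x))\<^sup>2)"
    proof (rule integral_norm_bound_integral)
      show "logm'' integrable_on {x..y}" using h by blast
      show "(\<lambda>x. C * (exp (logm x))\<^sup>2) integrable_on {x..y}"
        by (intro integrable_continuous_interval continuous_intros cexp that)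
      fix t assume "t \<in> {x..y}"
      then have t: "t \<in> ?I" using that by blast
      then show "norm (logm'' t) \<le> C * (exp (logm t))\<^sup>2"
        using C[OF of_real_in_annulus[of "exp t"]] ln_interval[OF t]
        by (simp add: logm''_eq abs_mult mult_right_mono)
    qed
    also have "\<dots> \<le> C * A" using intA[OF that(2)] C0 by (simp add: mult_left_mono)
    finally show ?thesis using integral_unique[OF h] by simp
  qed
  define c where "c = ln R / 2"
  have c: "c \<in> ?I" using R by (simp add: c_def)
  define B where "B = \<bar>logm' c\<bar> + C * A"
  have bnd: "\<bar>logm' x\<bar> \<le> B" if "x \<in> ?I" for x
  proof (cases "x \<le> c")
    case True
    have "{x..c} \<subseteq> ?I" using that c by auto
    then show ?thesis using d'[OF True] by (simp add: B_def)
  next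
    case False
    have "{c..x} \<subseteq> ?I" using that c by auto
    then show ?thesis using d'[of c x] False by (simp add: B_def)
  qed
  have "B-lipschitz_on ?I logm"
  proof (rule lipschitz_onI)
    show "B \<ge> 0" using C0 A by (simp add: B_def)
    show "dist (logm x) (logm y) \<le> B * dist x y" if "x \<in> ?I" "y \<in> ?I" for x y
      unfolding dist_norm
      by (rule field_differentiable_bound[of ?I logm logm'])
        (use that bnd in \<open>auto intro: DERIV_subset[OF logm_deriv]\<close>)
  qed
  then show thesis by (rule that)
qed

lemma radial_value_interior: "R < s \<Longrightarrow> s < 1 \<Longrightarrow> radial_value R \<rho> s = \<sigma> s"
  using R by (simp add: radial_value_def bdry_ext_def \<sigma>_def)

text \<open>A Lipschitz function extends continuously to the end points, where its limits are the
  boundary values of the metric.\<close>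

lemma radial_value_cont_pos:
  "continuous_on {R..1} (radial_value R \<rho>)" "\<And>s. s \<in> {R..1} \<Longrightarrow> radial_value R \<rho> s > 0"
proof -
  obtain B where "B-lipschitz_on {ln R<..<0} logm" by (rule logm_lipschitz)
  then have "uniformly_continuous_on {ln R<..<0} logm" by (rule lipschitz_on_uniformly_continuous)
  then obtain v where v: "uniformly_continuous_on (closure {ln R<..<0}) v"
    "\<And>x. x \<in> {ln R<..<0} \<Longrightarrow> logm x = v x"
    using uniformly_continuous_on_extension_on_closure by metis
  have cl: "closure {ln R<..<0} = {ln R..0}" using R by (intro closure_greaterThanLessThan) simp
  have cv: "continuous_on {ln R..0} v" using v(1) uniformly_continuous_imp_continuous cl by metis
  define w where "w s = exp (v (ln s)) / s" for s
  have ln_in: "ln s \<in> {ln R..0}" if "s \<in> {R..1}" for s using that R by simp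
  have cw: "continuous_on {R..1} w"
    unfolding w_def using R ln_in
    by (intro continuous_intros continuous_on_compose2[OF cv]) auto
  have wpos: "w s > 0" if "s \<in> {R..1}" for s using that R by (simp add: w_def)
  have \<sigma>w: "\<sigma> s = w s" if "R < s" "s < 1" for s
  proof -
    have "ln s \<in> {ln R<..<0}" using that R by simp
    then show ?thesis using v(2)[of "ln s"] exp_logm[of "ln s"] that R by (simp add: w_def field_simps)
  qed
  have "(w \<longlongrightarrow> w R) (at_right R)"
    using cw R unfolding at_within_Icc_at_right[OF R(2), symmetric] continuous_on_def by auto
  then have "(\<sigma> \<longlongrightarrow> w R) (at_right R)"
    by (rule Lim_transform_eventually)
      (use eventually_at_right_less[of R] eventually_at_right_real[OF R(2)] in \<open>eventually_elim; simp add: \<sigma>w\<close>)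
  then have LR: "Lim (at_right R) (\<lambda>s. \<rho> (of_real s)) = w R"
    by (intro tendsto_Lim) (simp_all add: \<sigma>_def[abs_def])
  have "(w \<longlongrightarrow> w 1) (at_left 1)"
    using cw R unfolding at_within_Icc_at_left[OF R(2), symmetric] continuous_on_def by auto
  then have "(\<sigma> \<longlongrightarrow> w 1) (at_left 1)"
    by (rule Lim_transform_eventually)
      (use eventually_at_left_real[OF R(2)] in \<open>eventually_elim; simp add: \<sigma>w\<close>)
  then have L1: "Lim (at_left 1) (\<lambda>s. \<rho> (of_real s)) = w 1"
    by (intro tendsto_Lim) (simp_all add: \<sigma>_def[abs_def])
  have eq: "radial_value R \<rho> s = w s" if "s \<in> {R..1}" for s
  proof (cases "s = R \<or> s = 1")
    case True
    then show ?thesis using R LR L1 by (auto simp: radial_value_def bdry_ext_def)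
  next
    case False
    then show ?thesis using that \<sigma>w radial_value_interior by auto
  qed
  show "continuous_on {R..1} (radial_value R \<rho>)" using cw by (rule continuous_on_eq) (simp add: eq)
  show "\<And>s. s \<in> {R..1} \<Longrightarrow> radial_value R \<rho> s > 0" using eq wpos by simp
qed

text \<open>The infimum in the definition of regularity is the limit at \<open>R\<close>, which
  is the boundary value there.\<close>

lemma radial_value_minimum:
  assumes s: "s \<in> {R..1}"
  shows "R * radial_value R \<rho> R \<le> s * radial_value R \<rho> s"
proof -
  let ?g = "\<lambda>s. s * radial_value R \<rho> s"
  have cg: "continuous_on {R..1} ?g" by (intro continuous_intros radial_value_cont_pos)
  let ?m = "INF s\<in>{R<..<1}. s * \<rho> (of_real s)"
  have 1: "((\<lambda>s. s * \<rho> (of_real s)) \<longlongrightarrow> ?m) (at_right R)"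
    using regular by (simp add: regular_metric_def)
  have "(?g \<longlongrightarrow> ?g R) (at_right R)"
    using cg R unfolding at_within_Icc_at_right[OF R(2), symmetric] continuous_on_def by auto
  then have "((\<lambda>s. s * \<rho> (of_real s)) \<longlongrightarrow> ?g R) (at_right R)"
    by (rule Lim_transform_eventually)
      (use eventually_at_right_real[OF R(2)] in \<open>eventually_elim; simp add: radial_value_interior \<sigma>_def\<close>)
  then have m: "?m = ?g R" using 1 tendsto_unique trivial_limit_at_right_real by blast
  have int: "?g R \<le> ?g s" if "s \<in> {R<..<1}" for s
  proof -
    have "bdd_below ((\<lambda>s. s * \<rho> (of_real s)) ` {R<..<1})"
      using R \<sigma>_pos by (intro bdd_belowI[of _ 0]) (auto simp: \<sigma>_def intro!: mult_nonneg_nonneg less_imp_le)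
    then have "?m \<le> s * \<rho> (of_real s)" using that by (rule cINF_lower)
    then show ?thesis using m that by (simp add: radial_value_interior \<sigma>_def)
  qed
  have cl: "closure {R<..<1} = {R..1}" using R by (intro closure_greaterThanLessThan) simp
  show ?thesis
    using continuous_ge_on_closure[of "{R<..<1}" ?g s "?g R"] cg s int unfolding cl by blast
qed

lemma bdry_ext_eq_radial_value:
  assumes "R \<le> cmod w" "cmod w \<le> 1"
  shows "bdry_ext R \<rho> w = radial_value R \<rho> (cmod w)"
  using assms rho_radial[of w] R by (auto simp: radial_value_def bdry_ext_def annulus_def)

end

section \<open>Maps of annuli in logarithmic coordinates\<close>

lemma Ck_on_exp: "Ck_on k UNIV (\<lambda>w::complex. c * exp w)"
proof (induction k arbitrary: c)
  case 0
  show ?case by (auto intro!: continuous_intros)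
next
  case (Suc k)
  show ?case
  proof (rule Ck_on_SucI[OF open_UNIV _ Suc.IH[of c] Suc.IH[of "\<i> * c"]])
    fix z :: complex
    have "((\<lambda>w. c * exp w) has_derivative (\<lambda>h. c * exp z * h)) (at z)"
      by (auto intro!: derivative_eq_intros simp: has_field_derivative_def[symmetric])
    then show "((\<lambda>w. c * exp w) has_derivative (\<lambda>h. Re h *\<^sub>R (c * exp z) + Im h *\<^sub>R (\<i> * c * exp z))) (at z)"
      by (rule has_derivative_eq_rhs) (auto simp: fun_eq_iff scaleR_conv_of_real algebra_simps complex_eq_iff)
  qed
qed

lemma Ck_on_exp': "Ck_on k S (exp :: complex \<Rightarrow> complex)"
  using Ck_on_subset[OF Ck_on_exp[of k 1], of S] by simp

lemma dx_dy_exp_compose: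
  assumes "Ck_on (Suc 0) S k" "exp w \<in> S"
  shows "dx (\<lambda>w. k (exp w)) w = Re (exp w) *\<^sub>R dx k (exp w) + Im (exp w) *\<^sub>R dy k (exp w)"
    "dy (\<lambda>w. k (exp w)) w = - Im (exp w) *\<^sub>R dx k (exp w) + Re (exp w) *\<^sub>R dy k (exp w)"
proof -
  have "(exp has_derivative (\<lambda>h. exp w * h)) (at w)"
    by (auto intro!: derivative_eq_intros simp: has_field_derivative_def[symmetric])
  from has_derivative_compose[OF this Ck_on_SucD[OF assms]]
  have "((\<lambda>w. k (exp w)) has_derivative (\<lambda>h. Re (exp w * h) *\<^sub>R dx k (exp w) + Im (exp w * h) *\<^sub>R dy k (exp w))) (at w)" .
  from dx_dy_eqI[OF this]
  show "dx (\<lambda>w. k (exp w)) w = Re (exp w) *\<^sub>R dx k (exp w) + Im (exp w) *\<^sub>R dy k (exp w)"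
    "dy (\<lambda>w. k (exp w)) w = - Im (exp w) *\<^sub>R dx k (exp w) + Re (exp w) *\<^sub>R dy k (exp w)" by simp_all
qed

lemma dirichlet_exp_compose:
  assumes "Ck_on (Suc 0) S k" "exp w \<in> S"
  shows "(cmod (dx (\<lambda>w. k (exp w)) w))\<^sup>2 + (cmod (dy (\<lambda>w. k (exp w)) w))\<^sup>2 =
     (cmod (exp w))\<^sup>2 * ((cmod (dx k (exp w)))\<^sup>2 + (cmod (dy k (exp w)))\<^sup>2)"
  unfolding dx_dy_exp_compose[OF assms] cmod_power2 by (simp add: power2_eq_square algebra_simps)

lemma det2_exp_compose:
  assumes "Ck_on (Suc 0) S k" "exp w \<in> S"
  shows "det2 (dx (\<lambda>w. k (exp w)) w) (dy (\<lambda>w. k (exp w)) w) = (cmod (exp w))\<^sup>2 * det2 (dx k (exp w)) (dy k (exp w))"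
  unfolding dx_dy_exp_compose[OF assms] cmod_power2 det2_def by (simp add: power2_eq_square algebra_simps)

lemma jacobian_log:
  assumes "g \<noteq> 0"
  shows "Re (p / g) * Im (q / g) - Re (q / g) * Im (p / g) = det2 p q / (cmod g)\<^sup>2"
proof -
  define N where "N = (cmod g)\<^sup>2"
  have N1: "N \<noteq> 0" using assms by (simp add: N_def)
  have N2: "N = Re g * Re g + Im g * Im g"
    unfolding N_def cmod_power2 by (simp only: power2_eq_square)
  have "u / g = u * cnj g / complex_of_real N" for u
    unfolding N_def by (rule complex_div_cnj)
  then have d: "Re (u / g) = Re (u * cnj g) / N" "Im (u / g) = Im (u * cnj g) / N" for u
    by (simp_all only: Re_divide_of_real Im_divide_of_real)
  have "Re (p / g) * Im (q / g) - Re (q / g) * Im (p / g) =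
     (Re (p * cnj g) * Im (q * cnj g) - Re (q * cnj g) * Im (p * cnj g)) / (N * N)"
    unfolding d by (simp only: times_divide_times_eq diff_divide_distrib)
  also have "Re (p * cnj g) * Im (q * cnj g) - Re (q * cnj g) * Im (p * cnj g) = det2 p q * N"
    unfolding N2 by (simp add: det2_def algebra_simps)
  also have "det2 p q * N / (N * N) = det2 p q / N" using N1 by simp
  finally show ?thesis by (simp add: N_def)
qed

text \<open>A map \<open>k\<close> of an annulus read in the coordinate \<open>w = ln z\<close>; \<open>log_dx\<close> and \<open>log_dy\<close> are the
  partial derivatives of \<open>ln (k (exp w))\<close>.\<close>

definition log_abs :: "(complex \<Rightarrow> complex) \<Rightarrow> real \<Rightarrow> real \<Rightarrow> real" where
  "log_abs k x t = ln (cmod (k (exp (Complex x t))))"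
definition log_dx :: "(complex \<Rightarrow> complex) \<Rightarrow> real \<Rightarrow> real \<Rightarrow> complex" where
  "log_dx k x t = dx (\<lambda>w. k (exp w)) (Complex x t) / k (exp (Complex x t))"
definition log_dy :: "(complex \<Rightarrow> complex) \<Rightarrow> real \<Rightarrow> real \<Rightarrow> complex" where
  "log_dy k x t = dy (\<lambda>w. k (exp w)) (Complex x t) / k (exp (Complex x t))"
definition log_dxy :: "(complex \<Rightarrow> complex) \<Rightarrow> real \<Rightarrow> real \<Rightarrow> complex" where
  "log_dxy k x t = (dx (dy (\<lambda>w. k (exp w))) (Complex x t) * k (exp (Complex x t)) -
     dy (\<lambda>w. k (exp w)) (Complex x t) * dx (\<lambda>w. k (exp w)) (Complex x t)) / (k (exp (Complex x t)))\<^sup>2"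

locale log_map =
  fixes k :: "complex \<Rightarrow> complex" and S :: "complex set" and x0 x1 :: real
  assumes S: "open S" and kC: "Ck_on 2 S k" and k0: "\<And>z. z \<in> S \<Longrightarrow> k z \<noteq> 0"
    and sub: "\<And>x t. x \<in> {x0..x1} \<Longrightarrow> exp (Complex x t) \<in> S" and x01: "x0 \<le> x1"
begin

definition "T = exp -` S"
definition "G w = k (exp w)"

lemma T: "open T" "\<And>x t. x \<in> {x0..x1} \<Longrightarrow> Complex x t \<in> T" "\<And>w. w \<in> T \<Longrightarrow> G w \<noteq> 0"
  unfolding T_def G_def using S sub k0 by (auto intro!: open_vimage continuous_intros)

lemma GC: "Ck_on 2 T G"
  unfolding G_def[abs_def] by (rule Ck_on_compose[OF T(1) kC Ck_on_exp']) (auto simp: T_def)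

lemma GC2: "Ck_on (Suc (Suc 0)) T G" and GC1: "Ck_on (Suc 0) T (dx G)" "Ck_on (Suc 0) T (dy G)"
  and GC0: "Ck_on (Suc 0) T G"
proof -
  show 2: "Ck_on (Suc (Suc 0)) T G" using GC by (simp add: numeral_2_eq_2)
  then show "Ck_on (Suc 0) T (dx G)" "Ck_on (Suc 0) T (dy G)" by auto
  show "Ck_on (Suc 0) T G" using Ck_on_lower[OF 2] .
qed

lemma log_eqs: "log_abs k x t = ln (cmod (G (Complex x t)))" "log_dx k x t = dx G (Complex x t) / G (Complex x t)"
  "log_dy k x t = dy G (Complex x t) / G (Complex x t)"
  "log_dxy k x t = (dx (dy G) (Complex x t) * G (Complex x t) - dy G (Complex x t) * dx G (Complex x t)) / (G (Complex x t))\<^sup>2"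
  unfolding log_abs_def log_dx_def log_dy_def log_dxy_def G_def[abs_def] by auto

lemma log_abs_deriv:
  assumes "x \<in> {x0..x1}"
  shows "((\<lambda>x. log_abs k x t) has_real_derivative Re (log_dx k x t)) (at x within A)"
    "((\<lambda>t. log_abs k x t) has_real_derivative Re (log_dy k x t)) (at t within A)"
proof -
  let ?w = "Complex x t"
  have w: "?w \<in> T" using T(2) assms by blast
  have g0: "G ?w \<noteq> 0" using T(3) w by blast
  have "((\<lambda>w. cmod (G w)) has_derivative (\<lambda>h. (Re h *\<^sub>R dx G ?w + Im h *\<^sub>R dy G ?w) \<bullet> sgn (G ?w))) (at ?w)"
    using has_derivative_compose[OF Ck_on_SucD[OF GC0 w] has_derivative_norm[OF g0]] .
  moreover have "(ln has_derivative (\<lambda>h. (1 / cmod (G ?w)) * h)) (at (cmod (G ?w)))"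
    using DERIV_ln_divide[of "cmod (G ?w)"] g0 by (simp only: has_field_derivative_def zero_less_norm_iff simp_thms)
  ultimately have "((\<lambda>w. ln (cmod (G w))) has_derivative
      (\<lambda>h. (1 / cmod (G ?w)) * ((Re h *\<^sub>R dx G ?w + Im h *\<^sub>R dy G ?w) \<bullet> sgn (G ?w)))) (at ?w)"
    by (rule has_derivative_compose)
  then have d: "((\<lambda>w. ln (cmod (G w))) has_derivative
      (\<lambda>h. Re h *\<^sub>R Re (dx G ?w / G ?w) + Im h *\<^sub>R Re (dy G ?w / G ?w))) (at ?w)"
  proof (rule has_derivative_eq_rhs)
    have n: "cmod g * cmod g = Re g * Re g + Im g * Im g" for g
      using cmod_power2[of g] by (simp only: power2_eq_square)
    have e: "(1 / cmod g) * (u \<bullet> sgn g) = Re (u / g)" for u g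
    proof -
      have "(1 / cmod g) * (u \<bullet> sgn g) = (u \<bullet> g) / (cmod g * cmod g)"
        by (simp add: sgn_div_norm divide_inverse)
      then show ?thesis unfolding n by (simp add: inner_complex_def Re_divide power2_eq_square)
    qed
    have l: "Re ((r *\<^sub>R X + s *\<^sub>R Y) / g) = r *\<^sub>R Re (X / g) + s *\<^sub>R Re (Y / g)" for r s X Y g
    proof -
      have "(r *\<^sub>R X + s *\<^sub>R Y) / g = r *\<^sub>R (X / g) + s *\<^sub>R (Y / g)"
        by (simp add: add_divide_distrib scaleR_conv_of_real)
      then show ?thesis by simp
    qed
    show "(\<lambda>h. (1 / cmod (G ?w)) * ((Re h *\<^sub>R dx G ?w + Im h *\<^sub>R dy G ?w) \<bullet> sgn (G ?w))) =
        (\<lambda>h. Re h *\<^sub>R Re (dx G ?w / G ?w) + Im h *\<^sub>R Re (dy G ?w / G ?w))"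
      unfolding e l ..
  qed
  show "((\<lambda>x. log_abs k x t) has_real_derivative Re (log_dx k x t)) (at x within A)"
    "((\<lambda>t. log_abs k x t) has_real_derivative Re (log_dy k x t)) (at t within A)"
    using vector_derivative_horizontal[OF d] unfolding log_eqs
    by (auto simp: has_real_derivative_iff_has_vector_derivative intro: has_vector_derivative_at_within)
qed

lemma log_dx_dy_deriv:
  assumes "x \<in> {x0..x1}"
  shows "((\<lambda>x. Im (log_dy k x t)) has_real_derivative Im (log_dxy k x t)) (at x within A)"
    "((\<lambda>t. Im (log_dx k x t)) has_real_derivative Im (log_dxy k x t)) (at t within A)"
proof -
  let ?w = "Complex x t"
  have w: "?w \<in> T" using T(2) assms by blast
  have g0: "G ?w \<noteq> 0" using T(3) w by blast
  have sym: "dy (dx G) ?w = dx (dy G) ?w" by (rule mixed_partials_symmetric[OF T(1) GC w])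
  have q: "((\<lambda>t. u t / v t) has_vector_derivative (u' * v s - u s * v') / (v s)\<^sup>2) (at s)"
    if "(u has_vector_derivative u') (at s)" "(v has_vector_derivative v') (at s)" "v s \<noteq> 0"
    for u v :: "real \<Rightarrow> complex" and u' v' s
  proof -
    have "((\<lambda>t. u t / v t) has_derivative (\<lambda>h. (h *\<^sub>R u' * v s - u s * h *\<^sub>R v') / (v s * v s))) (at s)"
      using has_derivative_divide'[OF that(1,2)[unfolded has_vector_derivative_def] that(3)] by simp
    then show ?thesis
      unfolding has_vector_derivative_def
      by (rule has_derivative_eq_rhs) (simp add: fun_eq_iff power2_eq_square scaleR_conv_of_real diff_divide_distrib algebra_simps)
  qed
  have im: "((\<lambda>t. Im (u t)) has_real_derivative Im u') (at s within A)"
    if "(u has_vector_derivative u') (at s)" for u u' s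
    using bounded_linear.has_vector_derivative[OF bounded_linear_Im that]
    by (auto simp: has_real_derivative_iff_has_vector_derivative intro: has_vector_derivative_at_within)
  show "((\<lambda>x. Im (log_dy k x t)) has_real_derivative Im (log_dxy k x t)) (at x within A)"
    unfolding log_eqs
    by (rule im, rule q[OF vector_derivative_horizontal(1)[OF Ck_on_SucD[OF GC1(2) w]]
        vector_derivative_horizontal(1)[OF Ck_on_SucD[OF GC0 w]] g0])
  have eq: "log_dxy k x t = (dy (dx G) ?w * G ?w - dx G ?w * dy G ?w) / (G ?w)\<^sup>2"
    unfolding log_eqs sym by (simp only: mult.commute)
  show "((\<lambda>t. Im (log_dx k x t)) has_real_derivative Im (log_dxy k x t)) (at t within A)"
    unfolding eq unfolding log_eqs(2)
    by (rule im, rule q[OF vector_derivative_horizontal(2)[OF Ck_on_SucD[OF GC1(1) w]]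
        vector_derivative_horizontal(2)[OF Ck_on_SucD[OF GC0 w]] g0])
qed

lemma cont_strip:
  fixes F :: "complex \<Rightarrow> 'b::topological_space"
  assumes "continuous_on T F"
  shows "continuous_on ({x0..x1} \<times> U) (\<lambda>(x, t). F (Complex x t))"
proof -
  have "continuous_on ({x0..x1} \<times> U) (\<lambda>p. F (Complex (fst p) (snd p)))"
    by (rule continuous_on_compose2[OF assms]) (use T(2) in \<open>auto intro!: continuous_intros\<close>)
  then show ?thesis by (simp add: case_prod_unfold)
qed

lemma log_cont:
  "continuous_on ({x0..x1} \<times> U) (\<lambda>(x, t). log_abs k x t)"
  "continuous_on ({x0..x1} \<times> U) (\<lambda>(x, t). Re (log_dx k x t))"
  "continuous_on ({x0..x1} \<times> U) (\<lambda>(x, t). Re (log_dy k x t))"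
  "continuous_on ({x0..x1} \<times> U) (\<lambda>(x, t). Im (log_dx k x t))"
  "continuous_on ({x0..x1} \<times> U) (\<lambda>(x, t). Im (log_dy k x t))"
  "continuous_on ({x0..x1} \<times> U) (\<lambda>(x, t). Im (log_dxy k x t))"
proof -
  have c: "continuous_on T G" "continuous_on T (dx G)" "continuous_on T (dy G)" "continuous_on T (dx (dy G))"
    using Ck_on_imp_continuous_on[OF GC0] Ck_on_imp_continuous_on[OF GC1(1)]
      Ck_on_imp_continuous_on[OF GC1(2)] GC1(2) by simp_all
  show "continuous_on ({x0..x1} \<times> U) (\<lambda>(x, t). log_abs k x t)"
  "continuous_on ({x0..x1} \<times> U) (\<lambda>(x, t). Re (log_dx k x t))"
  "continuous_on ({x0..x1} \<times> U) (\<lambda>(x, t). Re (log_dy k x t))"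
  "continuous_on ({x0..x1} \<times> U) (\<lambda>(x, t). Im (log_dx k x t))"
  "continuous_on ({x0..x1} \<times> U) (\<lambda>(x, t). Im (log_dy k x t))"
  "continuous_on ({x0..x1} \<times> U) (\<lambda>(x, t). Im (log_dxy k x t))"
    unfolding log_eqs by (rule cont_strip; (intro continuous_intros c)?; use T(3) in force)+
qed

lemma log_periodic:
  "log_abs k x (2*pi) = log_abs k x 0"
  "x \<in> {x0..x1} \<Longrightarrow> log_dx k x (2*pi) = log_dx k x 0" "x \<in> {x0..x1} \<Longrightarrow> log_dy k x (2*pi) = log_dy k x 0"
proof -
  have e: "exp (Complex x (2*pi)) = exp (Complex x 0)" for x by (simp add: exp_eq_polar cis.code complex_eq_iff)
  show "log_abs k x (2*pi) = log_abs k x 0" by (simp add: log_abs_def e)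
  assume x: "x \<in> {x0..x1}"
  have k1: "Ck_on (Suc 0) S k" using Ck_on_lower[of "Suc 0" S k] kC by (simp add: numeral_2_eq_2)
  note d = dx_dy_exp_compose[OF k1 sub[OF x]]
  show "log_dx k x (2*pi) = log_dx k x 0" "log_dy k x (2*pi) = log_dy k x 0"
    unfolding log_dx_def log_dy_def d e by simp_all
qed

text \<open>The total change of the argument along the circle \<open>ln |z| = x\<close>.\<close>

definition circulation :: "real \<Rightarrow> real" where
  "circulation x = integral {0..2*pi} (\<lambda>t. Im (log_dy k x t))"

lemma stokes_log:
  assumes "x0 \<le> a" "a \<le> b" "b \<le> x1" and cH: "continuous_on UNIV H'"
    and H: "\<And>x t. x \<in> {a..b} \<Longrightarrow> t \<in> {0..2*pi} \<Longrightarrow> (H has_real_derivative H' (log_abs k x t)) (at (log_abs k x t))"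
  shows "integral ({a..b} \<times> {0..2*pi}) (\<lambda>(x, t). H' (log_abs k x t) *
       (Re (log_dx k x t) * Im (log_dy k x t) - Re (log_dy k x t) * Im (log_dx k x t))) =
     integral {0..2*pi} (\<lambda>t. H (log_abs k b t) * Im (log_dy k b t)) - integral {0..2*pi} (\<lambda>t. H (log_abs k a t) * Im (log_dy k a t))"
proof (rule stokes_rectangle[OF assms(2) _ cH, where C = "\<lambda>x t. Im (log_dxy k x t)"])
  have sub': "{a..b} \<times> {0..2*pi} \<subseteq> {x0..x1} \<times> {0..2*pi}" using assms by auto
  note c = log_cont[THEN continuous_on_subset, OF sub']
  show "continuous_on ({a..b} \<times> {0..2*pi}) (\<lambda>(x, t). log_abs k x t)"
    "continuous_on ({a..b} \<times> {0..2*pi}) (\<lambda>(x, t). Re (log_dx k x t))"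
    "continuous_on ({a..b} \<times> {0..2*pi}) (\<lambda>(x, t). Re (log_dy k x t))"
    "continuous_on ({a..b} \<times> {0..2*pi}) (\<lambda>(x, t). Im (log_dx k x t))"
    "continuous_on ({a..b} \<times> {0..2*pi}) (\<lambda>(x, t). Im (log_dy k x t))"
    "continuous_on ({a..b} \<times> {0..2*pi}) (\<lambda>(x, t). Im (log_dxy k x t))"
    by (fact c)+
  have mem: "x \<in> {x0..x1}" if "x \<in> {a..b}" for x using that assms by auto
  fix x t :: real
  assume x: "x \<in> {a..b}"
  show "((\<lambda>x. log_abs k x t) has_real_derivative Re (log_dx k x t)) (at x within {a..b})"
    "((\<lambda>t. log_abs k x t) has_real_derivative Re (log_dy k x t)) (at t within {0..2*pi})"
    "((\<lambda>x. Im (log_dy k x t)) has_real_derivative Im (log_dxy k x t)) (at x within {a..b})"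
    "((\<lambda>t. Im (log_dx k x t)) has_real_derivative Im (log_dxy k x t)) (at t within {0..2*pi})"
    by (rule log_abs_deriv[OF mem[OF x]] log_dx_dy_deriv[OF mem[OF x]])+
  show "log_abs k x (2*pi) = log_abs k x 0" "Im (log_dx k x (2*pi)) = Im (log_dx k x 0)"
    using log_periodic mem[OF x] by simp_all
next
  fix p assume "p \<in> {a..b} \<times> {0..2*pi}"
  then show "(H has_real_derivative H' (log_abs k (fst p) (snd p))) (at (log_abs k (fst p) (snd p)))"
    by (intro H) auto
qed

text \<open>Stokes' theorem with a constant weight.\<close>

lemma circulation_const:
  assumes "a \<in> {x0..x1}" "b \<in> {x0..x1}" shows "circulation a = circulation b"
proof -
  have *: "circulation a = circulation b" if "a \<in> {x0..x1}" "b \<in> {x0..x1}" "a \<le> b" for a b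
  proof -
    have ab: "x0 \<le> a" "b \<le> x1" using that by auto
    have "integral ({a..b} \<times> {0..2*pi}) (\<lambda>(x, t). 0 *
       (Re (log_dx k x t) * Im (log_dy k x t) - Re (log_dy k x t) * Im (log_dx k x t))) =
       integral {0..2*pi} (\<lambda>t. 1 * Im (log_dy k b t)) - integral {0..2*pi} (\<lambda>t. 1 * Im (log_dy k a t))"
      by (rule stokes_log[where H = "\<lambda>_. 1" and H' = "\<lambda>_. 0", OF ab(1) that(3) ab(2) continuous_on_const DERIV_const])
    moreover have "integral ({a..b} \<times> {0..2*pi}) (\<lambda>(x, t). 0 *
       (Re (log_dx k x t) * Im (log_dy k x t) - Re (log_dy k x t) * Im (log_dx k x t))) = 0"
      by (simp only: mult_zero_left case_prod_unfold integral_0)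
    ultimately show ?thesis by (simp only: circulation_def mult_1)
  qed
  show ?thesis
  proof (cases "a \<le> b")
    case False
    then have "b \<le> a" by simp
    from *[OF assms(2,1) this] show ?thesis by (rule sym)
  qed (rule *[OF assms])
qed

lemma has_integral_rescale_2pi:
  fixes F :: "real \<Rightarrow> complex"
  assumes "(F has_integral I) {0..2*pi}"
  shows "((\<lambda>s. F (2 * pi * s)) has_integral (I / (2*pi))) {0..1}"
proof -
  have 1: "((\<lambda>s. F ((2*pi) *\<^sub>R s + 0)) has_integral (I /\<^sub>R (2*pi) ^ DIM(real)))
      (cbox ((0 - 0) /\<^sub>R (2*pi)) ((2*pi - 0) /\<^sub>R (2*pi)))"
    by (rule has_integral_affinity') (use assms in auto)
  have 2: "cbox ((0 - 0) /\<^sub>R (2*pi)) ((2*pi - 0) /\<^sub>R (2*pi)) = {0..1::real}" by simp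
  have 3: "I /\<^sub>R (2*pi) ^ DIM(real) = I / (2*pi)"
    by (simp add: scaleR_conv_of_real field_simps)
  show ?thesis using 1[unfolded 2, unfolded 3] unfolding real_scaleR_def add_0_right .
qed

text \<open>This makes the circulation accessible to homotopy arguments.\<close>

lemma circulation_winding:
  assumes x: "x \<in> {x0..x1}"
  shows "path (\<lambda>s. k (exp (Complex x (2 * pi * s))))"
    "circulation x = 2 * pi * Re (winding_number (\<lambda>s. k (exp (Complex x (2 * pi * s)))) 0)"
proof -
  let ?g = "\<lambda>s. G (Complex x (2 * pi * s))"
  have d: "(?g has_vector_derivative (2*pi) *\<^sub>R dy G (Complex x (2 * pi * s))) (at s)" for s
  proof -
    have "((\<lambda>s. 2 * pi * s) has_real_derivative 2*pi) (at s)" by (auto intro!: derivative_eq_intros)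
    then have "((\<lambda>s. 2 * pi * s) has_vector_derivative 2*pi) (at s)"
      by (simp add: has_real_derivative_iff_has_vector_derivative)
    from vector_diff_chain_at[OF this vector_derivative_horizontal(2)[OF Ck_on_SucD[OF GC0 T(2)[OF x]]]]
    show ?thesis by (simp add: o_def)
  qed
  have cC: "continuous_on A (\<lambda>s. F (Complex x (2 * pi * s)))" if "continuous_on T F" for F :: "complex \<Rightarrow> complex" and A
    by (rule continuous_on_compose2[OF that]) (use T(2)[OF x] in \<open>auto intro!: continuous_intros\<close>)
  have cd: "continuous_on T (dy G)" "continuous_on T (dx G)" "continuous_on T G"
    using Ck_on_imp_continuous_on[OF GC0] Ck_on_imp_continuous_on[OF GC1(1)]
      Ck_on_imp_continuous_on[OF GC1(2)] by simp_all
  have vp: "valid_path ?g"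
    unfolding valid_path_def
    by (rule C1_differentiable_imp_piecewise, unfold C1_differentiable_on_def)
      (use d in \<open>auto intro!: exI[of _ "\<lambda>s. (2*pi) *\<^sub>R dy G (Complex x (2 * pi * s))"] continuous_intros cC cd\<close>)
  show "path (\<lambda>s. k (exp (Complex x (2 * pi * s))))"
    using valid_path_imp_path[OF vp] by (simp add: G_def)
  have nz: "0 \<notin> path_image ?g" using T(2)[OF x] T(3) by (force simp: path_image_def)
  let ?F = "\<lambda>t. dy G (Complex x t) / G (Complex x t)"
  have cF: "continuous_on {0..2*pi} ?F"
    by (intro continuous_intros continuous_on_compose2[OF cd(1)] continuous_on_compose2[OF cd(3)])
      (use T(2)[OF x] T(3) in \<open>auto intro!: continuous_intros\<close>)
  have h: "((\<lambda>s. ?F (2 * pi * s)) has_integral (integral {0..2*pi} ?F / (2*pi))) {0..1}"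
    by (rule has_integral_rescale_2pi[OF integrable_integral[OF integrable_continuous_interval[OF cF]]])
  have "contour_integral ?g (\<lambda>w. 1 / (w - 0)) = integral {0..1} (\<lambda>s. (2*pi) * ?F (2 * pi * s))"
    unfolding contour_integral_integral
    by (intro integral_cong) (simp add: vector_derivative_at[OF d] scaleR_conv_of_real)
  also have "\<dots> = (2*pi) * (integral {0..2*pi} ?F / (2*pi))"
    using has_integral_mult_right[OF h, of "2*pi"] by (simp add: integral_unique)
  finally have "winding_number ?g 0 = 1 / (2*pi*\<i>) * integral {0..2*pi} ?F"
    using winding_number_valid_path[OF vp nz] by simp
  moreover have "Re w = Im J / (2*pi)" if "w = 1 / (2*pi*\<i>) * J" for w J
  proof -
    have "J = 2*pi*\<i> * w" using that by simp
    then show ?thesis by simp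
  qed
  ultimately have "Re (winding_number ?g 0) = Im (integral {0..2*pi} ?F) / (2*pi)" by blast
  also have "Im (integral {0..2*pi} ?F) = integral {0..2*pi} (\<lambda>t. Im (?F t))"
    using integral_linear[OF integrable_continuous_interval[OF cF] bounded_linear_Im] by (simp add: o_def)
  finally show "circulation x = 2 * pi * Re (winding_number (\<lambda>s. k (exp (Complex x (2 * pi * s)))) 0)"
    by (simp add: circulation_def log_eqs G_def)
qed

lemma circulation_integer:
  assumes x: "x \<in> {x0..x1}"
  obtains n :: int where "circulation x = 2 * pi * n"
proof -
  let ?g = "\<lambda>s. k (exp (Complex x (2 * pi * s)))"
  have "exp (Complex x (2*pi)) = exp (Complex x 0)" by (simp add: exp_eq_polar cis.code complex_eq_iff)
  then have "pathfinish ?g = pathstart ?g" by (simp add: pathfinish_def pathstart_def)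
  moreover have "0 \<notin> path_image ?g" using sub[OF x] k0 by (force simp: path_image_def)
  ultimately have "winding_number ?g 0 \<in> \<int>"
    using integer_winding_number circulation_winding(1)[OF x] by blast
  then show thesis using circulation_winding(2)[OF x] that by (auto elim!: Ints_cases)
qed

text \<open>By Stokes' theorem the integral of the Jacobian against a positive weight that lives between
  the two zones is a nonnegative multiple of \<open>sg\<close> times the circulation. It is positive, so the
  circulation has the sign \<open>sg\<close>, and it is an integer multiple of \<open>2 \<pi>\<close>.\<close>

lemma circulation_sign:
  assumes J: "\<And>z. z \<in> S \<Longrightarrow> det2 (dx k z) (dy k z) > 0" and "x0 < x1" and sg: "sg = 1 \<or> sg = -1" and "c < d"
    and ends: "\<And>t. t \<in> {0..2*pi} \<Longrightarrow>
       (if sg = 1 then log_abs k x0 t \<le> c \<and> log_abs k x1 t \<ge> d else log_abs k x0 t \<ge> d \<and> log_abs k x1 t \<le> c)"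
    and x: "x \<in> {x0..x1}"
  shows "sg * circulation x \<ge> 2 * pi"
proof -
  \<comment> \<open>a weight that lives between the two zones: its primitive is constant in each of them, while the Jacobian integral is positive\<close>
  define H' where "H' u = max 0 (min (u - c) (d - u))" for u
  have cH': "continuous_on UNIV H'" unfolding H'_def by (intro continuous_intros)
  have H'0: "H' u \<ge> 0" for u by (simp add: H'_def)
  let ?Q = "{x0..x1} \<times> {0..2*pi}"
  have Qc: "?Q = cbox (x0, 0) (x1, 2*pi)" by (simp add: cbox_Pair_eq)
  have "bounded ((\<lambda>(x, t). log_abs k x t) ` ?Q)"
    by (intro compact_imp_bounded compact_continuous_image log_cont) (simp add: Qc)
  then obtain b where b: "\<And>p. p \<in> ?Q \<Longrightarrow> \<bar>(\<lambda>(x, t). log_abs k x t) p\<bar> \<le> b"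
    unfolding bounded_iff by auto
  define L where "L = \<bar>b\<bar> + \<bar>c\<bar> + \<bar>d\<bar> + 1"
  have L1: "- L < log_abs k x t" if "x \<in> {x0..x1}" "t \<in> {0..2*pi}" for x t
    using b[of "(x, t)"] that by (auto simp: L_def)
  define H where "H u = integral {-L..u} H'" for u
  have ig: "H' integrable_on {p..q}" for p q
    using cH' by (meson continuous_on_subset integrable_continuous_interval top_greatest)
  have Hc: "H u = 0" if "u \<le> c" for u
  proof -
    have "integral {-L..u} H' = integral {-L..u} (\<lambda>_. 0)"
      by (rule integral_cong) (use that in \<open>auto simp: H'_def\<close>)
    then show ?thesis by (simp add: H_def)
  qed
  have Hd: "H u = H d" if "u \<ge> d" for u
  proof -
    have "- L \<le> d" by (auto simp: L_def)
    from Henstock_Kurzweil_Integration.integral_combine[OF this that ig]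
    have "H u = H d + integral {d..u} H'" by (simp add: H_def)
    moreover have "integral {d..u} H' = integral {d..u} (\<lambda>_. 0)"
      by (rule integral_cong) (use \<open>c < d\<close> in \<open>auto simp: H'_def\<close>)
    ultimately show ?thesis by simp
  qed
  have Hd0: "H d \<ge> 0" unfolding H_def by (rule integral_nonneg[OF ig]) (simp add: H'0)
  let ?I = "\<lambda>(x, t). H' (log_abs k x t) *
       (Re (log_dx k x t) * Im (log_dy k x t) - Re (log_dy k x t) * Im (log_dx k x t))"
  have k1: "Ck_on (Suc 0) S k" using Ck_on_lower[of "Suc 0" S k] kC by (simp add: numeral_2_eq_2)
  have Jpos: "Re (log_dx k x t) * Im (log_dy k x t) - Re (log_dy k x t) * Im (log_dx k x t) > 0"
    if "x \<in> {x0..x1}" for x t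
  proof -
    have "k (exp (Complex x t)) \<noteq> 0" using sub[OF that] k0 by blast
    then show ?thesis
      unfolding log_dx_def log_dy_def
      using J[OF sub[OF that]] by (subst jacobian_log) (auto simp: det2_exp_compose[OF k1 sub[OF that]])
  qed
  have S: "integral ?Q ?I = integral {0..2*pi} (\<lambda>t. H (log_abs k x1 t) * Im (log_dy k x1 t)) -
       integral {0..2*pi} (\<lambda>t. H (log_abs k x0 t) * Im (log_dy k x0 t))"
    by (rule stokes_log) (use x01 cH' has_real_derivative_integral_upto[OF cH' L1] in \<open>auto simp: H_def[abs_def]\<close>)
  have cI: "continuous_on ?Q ?I"
    unfolding case_prod_unfold
    by (intro continuous_intros continuous_on_compose2[OF cH'] log_cont[unfolded case_prod_unfold]) auto
  have pos: "integral ?Q ?I > 0"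
  proof -
    have nn: "?I p \<ge> 0" if "p \<in> ?Q" for p
    proof -
      obtain x t where p: "p = (x, t)" by (cases p)
      then have "x \<in> {x0..x1}" using that by simp
      then show ?thesis unfolding p prod.case by (rule mult_nonneg_nonneg[OF H'0 less_imp_le[OF Jpos]])
    qed
    have "continuous_on {x0..x1} (\<lambda>x. (\<lambda>(x, t). log_abs k x t) (x, 0))"
      by (rule continuous_on_compose2[OF log_cont(1)[of "{0..2*pi}"]]) (auto intro!: continuous_intros)
    then have cl: "continuous_on {x0..x1} (\<lambda>x. log_abs k x 0)" by simp
    have "\<exists>x\<ge>x0. x \<le> x1 \<and> log_abs k x 0 = (c + d) / 2"
      using ends[of 0] \<open>c < d\<close> x01 IVT'[of "\<lambda>x. log_abs k x 0" x0 "(c+d)/2" x1, OF _ _ _ cl]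
        IVT2'[of "\<lambda>x. log_abs k x 0" x1 "(c+d)/2" x0, OF _ _ _ cl]
      by (auto split: if_splits)
    then obtain y where y: "y \<in> {x0..x1}" "log_abs k y 0 = (c + d) / 2" by auto
    have "H' ((c + d) / 2) > 0" using \<open>c < d\<close> by (simp add: H'_def)
    then have "?I (y, 0) > 0" unfolding prod.case y(2) by (rule mult_pos_pos[OF _ Jpos[OF y(1)]])
    moreover have "(y, 0) \<in> ?Q" using y by simp
    ultimately have "integral ?Q ?I \<noteq> 0"
      using integral_cbox_eq_0_iff[of "(x0, 0)" "(x1, 2*pi)" ?I] cI nn \<open>x0 < x1\<close>
      by (force simp: Qc box_ne_empty inner_Pair Basis_prod_def)
    moreover have "integral ?Q ?I \<ge> 0"
      by (rule integral_nonneg) (use cI nn in \<open>auto simp: Qc intro: integrable_continuous\<close>)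
    ultimately show ?thesis by simp
  qed
  have val: "integral {0..2*pi} (\<lambda>t. H (log_abs k y t) * Im (log_dy k y t)) = v * circulation y"
    if "\<And>t. t \<in> {0..2*pi} \<Longrightarrow> H (log_abs k y t) = v" for y v
    unfolding circulation_def by (subst integral_mult_right[symmetric], rule integral_cong) (simp add: that)
  have x0in: "x0 \<in> {x0..x1}" "x1 \<in> {x0..x1}" using x01 by auto
  have "0 < H d * (sg * circulation x)"
  proof (cases "sg = 1")
    case True
    have "H (log_abs k x1 t) = H d" "H (log_abs k x0 t) = 0" if "t \<in> {0..2*pi}" for t
      using ends[OF that] True Hc[of "log_abs k x0 t"] Hd[of "log_abs k x1 t"] by auto
    then show ?thesis using val[of x1 "H d"] val[of x0 0] S pos circulation_const[OF x x0in(2)] True by simp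
  next
    case False
    then have sg': "sg = -1" using sg by simp
    have "H (log_abs k x0 t) = H d" "H (log_abs k x1 t) = 0" if "t \<in> {0..2*pi}" for t
      using ends[OF that] False Hc[of "log_abs k x1 t"] Hd[of "log_abs k x0 t"] by auto
    then show ?thesis using val[of x0 "H d"] val[of x1 0] S pos circulation_const[OF x x0in(1)] sg' by simp
  qed
  then have p: "sg * circulation x > 0" using Hd0 by (simp add: zero_less_mult_iff)
  obtain n :: int where n: "circulation x = 2 * pi * n" by (rule circulation_integer[OF x])
  show ?thesis
  proof (cases "sg = 1")
    case True
    then have "n \<ge> 1" using p n by (simp add: zero_less_mult_iff)
    then show ?thesis using True n by simp
  next
    case False
    then have sg': "sg = -1" using sg by simp
    then have "- n \<ge> 1" using p n by (simp add: mult_less_0_iff)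
    then have "real_of_int (- n) \<ge> 1" by linarith
    then show ?thesis using sg' n mult_left_mono[of 1 "real_of_int (- n)" "2 * pi"] by simp
  qed
qed

end

section \<open>Deformations near the boundary circles\<close>

lemma closure_annulus_subset: "closure (annulus a b) \<subseteq> {z. a \<le> cmod z \<and> cmod z \<le> b}"
proof (rule closure_minimal)
  show "annulus a b \<subseteq> {z. a \<le> cmod z \<and> cmod z \<le> b}" by (auto simp: annulus_def)
  show "closed {z. a \<le> cmod z \<and> cmod z \<le> b}"
    by (intro closed_Collect_conj closed_Collect_le continuous_intros)
qed

lemma frontier_annulus_subset: "frontier (annulus a b) \<subseteq> {z. cmod z = a \<or> cmod z = b}"
  using closure_annulus_subset[of a b] open_annulus[of a b]
  by (auto simp: frontier_def interior_open annulus_def subset_iff)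

lemma circle_in_frontier_annulus:
  assumes "0 < a" "a < b" "cmod z = a \<or> cmod z = b"
  shows "z \<in> frontier (annulus a b)"
proof -
  have "z \<in> closure (annulus a b)"
    unfolding closure_approachable
  proof (intro allI impI)
    fix e :: real assume "e > 0"
    define d where "d = min (e / 2) ((b - a) / 2)"
    have "d \<le> e / 2" "d \<le> (b - a) / 2" unfolding d_def by (rule min.cobounded1, rule min.cobounded2)
    moreover have "0 < d" using \<open>e > 0\<close> assms(2) unfolding d_def by simp
    ultimately have d: "0 < d \<and> d < e \<and> d < b - a" using \<open>e > 0\<close> assms(2) by (simp add: field_simps)
    define s where "s = (if cmod z = a then a + d else b - d)"
    have s: "a < s" "s < b" "\<bar>s - cmod z\<bar> < e" using d assms by (auto simp: s_def)
    have z0: "cmod z > 0" using assms by auto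
    let ?y = "of_real (s / cmod z) * z"
    have "cmod ?y = \<bar>s / cmod z\<bar> * cmod z" by (simp only: norm_mult norm_of_real)
    also have "\<dots> = s" using z0 s(1) assms(1) by (simp add: abs_of_pos)
    finally have "cmod ?y = s" .
    then have "?y \<in> annulus a b" using s by (simp add: annulus_def)
    moreover have "?y - z = of_real ((s - cmod z) / cmod z) * z"
      using z0 by (simp add: field_simps)
    then have "dist ?y z = \<bar>s - cmod z\<bar>"
      using z0 by (simp add: dist_norm norm_mult norm_divide flip: of_real_diff)
    ultimately show "\<exists>y\<in>annulus a b. dist y z < e" using s(3) by metis
  qed
  moreover have "z \<notin> annulus a b" using assms by (auto simp: annulus_def)
  ultimately show ?thesis using open_annulus by (simp add: frontier_def interior_open)
qed

lemma compact_in_annulus: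
  assumes "compact K" "K \<subseteq> annulus r 1" "0 < r" "r < 1"
  obtains a b where "r < a" "a < b" "b < 1" "\<And>z. z \<in> K \<Longrightarrow> a < cmod z \<and> cmod z < b"
proof (cases "K = {}")
  case True
  then show ?thesis using that[of "(2 * r + 1) / 3" "(r + 2) / 3"] assms by auto
next
  case False
  have c: "continuous_on K cmod" by (intro continuous_intros)
  obtain z1 where z1: "z1 \<in> K" "\<And>z. z \<in> K \<Longrightarrow> cmod z1 \<le> cmod z"
    using continuous_attains_inf[OF assms(1) False c] by blast
  obtain z2 where z2: "z2 \<in> K" "\<And>z. z \<in> K \<Longrightarrow> cmod z \<le> cmod z2"
    using continuous_attains_sup[OF assms(1) False c] by blast
  have "r < cmod z1" "cmod z2 < 1" "cmod z1 \<le> cmod z2" using z1 z2 assms(2) by (auto simp: annulus_def)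
  then show ?thesis
    using that[of "(r + cmod z1) / 2" "(cmod z2 + 1) / 2"] z1(2) z2(2) by fastforce
qed

text \<open>An upper bound for the distance from one admissible arc, a segment.\<close>

lemma rho_dist_segment_le:
  assumes "w \<noteq> b" "\<And>t. t \<in> {0<..<1} \<Longrightarrow> linepath w b t \<in> \<Omega>" "\<And>v. v \<in> \<Omega> \<Longrightarrow> 0 \<le> \<rho> v \<and> \<rho> v \<le> c"
  shows "rho_dist \<Omega> \<rho> w b \<le> ennreal (c * cmod (b - w))"
proof -
  have "rho_dist \<Omega> \<rho> w b \<le> (\<integral>\<^sup>+ t \<in> {0<..<1}. ennreal (\<rho> (linepath w b t) * norm (vector_derivative (linepath w b) (at t))) \<partial>lebesgue)"
    unfolding rho_dist_def
  proof (rule INF_lower)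
    have "(cmod (b - w))-lipschitz_on {0..1} (linepath w b)"
    proof (rule lipschitz_onI)
      fix x y :: real
      have "linepath w b x - linepath w b y = (x - y) *\<^sub>R (b - w)"
        by (simp add: linepath_def algebra_simps)
      then show "dist (linepath w b x) (linepath w b y) \<le> cmod (b - w) * dist x y"
        by (simp add: dist_norm)
    qed simp
    then show "linepath w b \<in> {g. arc g \<and> (\<exists>L. L-lipschitz_on {0..1} g) \<and> pathstart g = w \<and> pathfinish g = b \<and> g ` {0<..<1} \<subseteq> \<Omega>}"
      using assms(1,2) by (auto simp: arc_linepath)
  qed
  also have "\<dots> \<le> (\<integral>\<^sup>+ t \<in> {0<..<1::real}. ennreal (c * cmod (b - w)) \<partial>lebesgue)"
  proof (intro nn_integral_mono)
    fix t :: real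
    show "ennreal (\<rho> (linepath w b t) * norm (vector_derivative (linepath w b) (at t))) * indicator {0<..<1} t \<le> ennreal (c * cmod (b - w)) * indicator {0<..<1} t"
      using assms(2,3) by (auto simp: indicator_def intro!: ennreal_leI mult_right_mono)
  qed
  also have "\<dots> = ennreal (c * cmod (b - w))"
    by (subst nn_integral_cmult_indicator) auto
  finally show ?thesis .
qed

context regular_annulus_metric
begin

abbreviation "rv \<equiv> radial_value R \<rho>"
abbreviation "\<Omega>' \<equiv> annulus R 1"
abbreviation "\<rho>b \<equiv> bdry_ext R \<rho>"

text \<open>Serves to extend the density \<open>m\<^sup>2\<close> to a continuous function on the
  whole line, constant outside \<open>[ln R, 0]\<close>. Mollified maps may leave the closed
  target annulus slightly.\<close>

definition clampl :: "real \<Rightarrow> real" where "clampl u = max (ln R) (min 0 u)"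
definition msq :: "real \<Rightarrow> real" where "msq u = (exp (clampl u) * rv (exp (clampl u)))\<^sup>2"

lemma exp_clampl: "exp (clampl u) \<in> {R..1}"
proof -
  have "ln R \<le> clampl u" "clampl u \<le> 0" using R by (auto simp: clampl_def)
  then show ?thesis using R exp_le_cancel_iff[of "ln R" "clampl u"] by (simp del: exp_le_cancel_iff)
qed

lemma msq_pos: "msq u > 0"
  unfolding msq_def using radial_value_cont_pos(2)[OF exp_clampl[of u]] by simp

lemma msq_cont: "continuous_on UNIV msq"
  unfolding msq_def clampl_def
  by (intro continuous_intros continuous_on_compose2[OF radial_value_cont_pos(1)])
    (use exp_clampl[unfolded clampl_def] in auto)

lemma msq_ge: "msq u \<ge> - gamma_crit R \<rho>"
proof -
  have "(R * rv R)\<^sup>2 \<le> msq u" unfolding msq_def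
    using radial_value_minimum[OF exp_clampl[of u]] radial_value_cont_pos(2)[of R] R
    by (intro power_mono) auto
  then show ?thesis by (simp add: gamma_crit_def power_mult_distrib)
qed

lemma msq_ln: "R \<le> s \<Longrightarrow> s \<le> 1 \<Longrightarrow> msq (ln s) = (s * rv s)\<^sup>2"
  using R by (simp add: msq_def clampl_def)

lemma rho_bounds:
  obtains c1 c2 where "0 < c1" "\<And>s. s \<in> {R..1} \<Longrightarrow> c1 \<le> rv s \<and> rv s \<le> c2"
proof -
  have ne: "{R..1} \<noteq> {}" using R by simp
  obtain s1 where s1: "s1 \<in> {R..1}" "\<And>s. s \<in> {R..1} \<Longrightarrow> rv s1 \<le> rv s"
    using continuous_attains_inf[OF compact_Icc ne radial_value_cont_pos(1)] by blast
  obtain s2 where s2: "s2 \<in> {R..1}" "\<And>s. s \<in> {R..1} \<Longrightarrow> rv s \<le> rv s2"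
    using continuous_attains_sup[OF compact_Icc ne radial_value_cont_pos(1)] by blast
  show thesis using that[of "rv s1" "rv s2"] s1 s2 radial_value_cont_pos(2) by blast
qed

lemma bdry_ext_on_annulus: "w \<in> \<Omega>' \<Longrightarrow> \<rho>b w = rv (cmod w)"
  by (rule bdry_ext_eq_radial_value) (auto simp: annulus_def)

text \<open>The metric is bounded from above and below, so the defect of a point in the target is
  comparable with its Euclidean distance to the boundary.\<close>

lemma bdry_defect_bounds:
  obtains c1 c2 where "0 < c1" "0 < c2"
    "\<And>f \<Omega> z. z \<in> \<Omega> \<Longrightarrow> f z \<in> \<Omega>' \<Longrightarrow>
       ennreal (c1 * min (cmod (f z) - R) (1 - cmod (f z))) \<le> bdry_defect \<Omega> \<Omega>' \<rho>b f z"
    "\<And>f \<Omega> z. z \<in> \<Omega> \<Longrightarrow> f z \<in> \<Omega>' \<Longrightarrow>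
       bdry_defect \<Omega> \<Omega>' \<rho>b f z \<le> ennreal (c2 * min (cmod (f z) - R) (1 - cmod (f z)))"
proof -
  obtain c1 c2 where c: "0 < c1" "\<And>s. s \<in> {R..1} \<Longrightarrow> c1 \<le> rv s \<and> rv s \<le> c2" by (rule rho_bounds) blast
  have c2: "0 < c2" using c(1) c(2)[of 1] R by auto
  have \<rho>b: "c1 \<le> \<rho>b w" "0 \<le> \<rho>b w" "\<rho>b w \<le> c2" if "w \<in> \<Omega>'" for w
    using bdry_ext_on_annulus[OF that] c(1) c(2)[of "cmod w"] that by (auto simp: annulus_def)
  have nf: "f z \<notin> frontier \<Omega>'" if "f z \<in> \<Omega>'" for f z
    using that open_annulus by (auto simp: frontier_def interior_open)
  show thesis
  proof (rule that[OF c(1) c2])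
    fix f \<Omega> and z :: complex assume z: "z \<in> \<Omega>" "f z \<in> \<Omega>'"
    have d: "bdry_defect \<Omega> \<Omega>' \<rho>b f z = (INF b\<in>frontier \<Omega>'. rho_dist \<Omega>' \<rho>b (f z) b)"
      using z nf[of f z, OF z(2)] by (simp add: bdry_defect_def)
    show "ennreal (c1 * min (cmod (f z) - R) (1 - cmod (f z))) \<le> bdry_defect \<Omega> \<Omega>' \<rho>b f z"
      unfolding d
    proof (rule INF_greatest)
      fix b assume "b \<in> frontier \<Omega>'"
      then have "cmod b = R \<or> cmod b = 1" using frontier_annulus_subset by blast
      moreover have "cmod (f z) - cmod b \<le> cmod (f z - b)" "cmod b - cmod (f z) \<le> cmod (f z - b)"
        using norm_triangle_ineq2[of "f z" b] norm_triangle_ineq2[of b "f z"] by (simp_all only: norm_minus_commute)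
      ultimately have "min (cmod (f z) - R) (1 - cmod (f z)) \<le> cmod (f z - b)" by auto
      then have "ennreal (c1 * min (cmod (f z) - R) (1 - cmod (f z))) \<le> ennreal (c1 * cmod (f z - b))"
        using c(1) by (intro ennreal_leI mult_left_mono) auto
      also have "\<dots> \<le> rho_dist \<Omega>' \<rho>b (f z) b"
        by (rule rho_dist_ge) (use c(1) \<rho>b in auto)
      finally show "ennreal (c1 * min (cmod (f z) - R) (1 - cmod (f z))) \<le> rho_dist \<Omega>' \<rho>b (f z) b" .
    qed
    have up: "bdry_defect \<Omega> \<Omega>' \<rho>b f z \<le> ennreal (c2 * \<bar>\<beta> - cmod (f z)\<bar>)" if \<beta>: "\<beta> = R \<or> \<beta> = 1" for \<beta>
    proof -
      define w where "w = f z"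
      have w: "R < cmod w" "cmod w < 1" "w \<noteq> 0" using z(2) R by (auto simp: w_def annulus_def)
      define b where "b = of_real (\<beta> / cmod w) * w"
      have \<beta>0: "\<beta> > 0" using \<beta> R by auto
      have nb: "cmod b = \<beta>" using w \<beta>0 unfolding b_def norm_mult norm_of_real by simp
      have "b - w = of_real ((\<beta> - cmod w) / cmod w) * w" using w by (simp add: b_def field_simps)
      then have db: "cmod (b - w) = \<bar>\<beta> - cmod w\<bar>"
        using w by (simp add: norm_mult norm_divide flip: of_real_diff)
      have "b \<in> frontier \<Omega>'" using circle_in_frontier_annulus[of R 1 b] R nb \<beta> by auto
      then have "bdry_defect \<Omega> \<Omega>' \<rho>b f z \<le> rho_dist \<Omega>' \<rho>b w b"
        unfolding d w_def by (rule INF_lower)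
      also have "\<dots> \<le> ennreal (c2 * cmod (b - w))"
      proof (rule rho_dist_segment_le)
        show "w \<noteq> b" using nb w \<beta> by auto
        show "0 \<le> \<rho>b v \<and> \<rho>b v \<le> c2" if "v \<in> \<Omega>'" for v using \<rho>b[OF that] by simp
        fix t :: real assume t: "t \<in> {0<..<1}"
        have "linepath w b t = of_real ((1 - t) + t * \<beta> / cmod w) * w"
          by (simp add: linepath_def b_def scaleR_conv_of_real algebra_simps)
        then have "cmod (linepath w b t) = \<bar>(1 - t) + t * \<beta> / cmod w\<bar> * cmod w"
          by (simp only: norm_mult norm_of_real)
        also have "\<dots> = (1 - t) * cmod w + t * \<beta>"
        proof -
          have "(1 - t) + t * \<beta> / cmod w \<ge> 0" using t \<beta>0 by (simp add: add_nonneg_nonneg)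
          then show ?thesis using w by (simp add: field_simps)
        qed
        finally have n: "cmod (linepath w b t) = (1 - t) * cmod w + t * \<beta>" .
        have "R < (1 - t) * cmod w + t * \<beta>"
        proof -
          have "(1 - t) * R < (1 - t) * cmod w" "t * R \<le> t * \<beta>" using t w \<beta> R by auto
          then show ?thesis by (simp add: algebra_simps)
        qed
        moreover have "(1 - t) * cmod w + t * \<beta> < 1"
        proof -
          have "(1 - t) * cmod w < (1 - t) * 1" "t * \<beta> \<le> t * 1" using t w \<beta> R by auto
          then show ?thesis by (simp add: algebra_simps)
        qed
        ultimately show "linepath w b t \<in> \<Omega>'" by (simp add: annulus_def n)
      qed
      finally show ?thesis using db by (simp add: w_def)
    qed
    show "bdry_defect \<Omega> \<Omega>' \<rho>b f z \<le> ennreal (c2 * min (cmod (f z) - R) (1 - cmod (f z)))"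
      using up[of R] up[of 1] z(2) by (auto simp: annulus_def min_def)
  qed
qed

text \<open>A diffeomorphism is proper: the preimage of the compact set of points at distance at
  least \<open>e\<close> from the boundary circles is compact.\<close>

lemma diffeo_collar:
  assumes r: "0 < r" "r < 1" and f: "sense_preserving_diffeo (annulus r 1) \<Omega>' f" and "e > 0"
  obtains a b where "r < a" "a < b" "b < 1"
    "\<And>z. z \<in> annulus r 1 \<Longrightarrow> cmod z \<le> a \<or> b \<le> cmod z \<Longrightarrow> cmod (f z) < R + e \<or> 1 - e < cmod (f z)"
proof -
  let ?g = "the_inv_into (annulus r 1) f"
  have bij: "bij_betw f (annulus r 1) \<Omega>'" and sm: "smooth_on \<Omega>' ?g"
    using f by (auto simp: sense_preserving_diffeo_def)
  have cg: "continuous_on \<Omega>' ?g" using sm Ck_on_imp_continuous_on unfolding smooth_on_def by blast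
  define K' where "K' = {w. R + e \<le> cmod w \<and> cmod w \<le> 1 - e}"
  have K'\<Omega>: "K' \<subseteq> \<Omega>'" using \<open>e > 0\<close> by (auto simp: K'_def annulus_def)
  have "compact K'" unfolding K'_def by (rule closed_ring_compact)
  then have cK: "compact (?g ` K')" using cg K'\<Omega> compact_continuous_image continuous_on_subset by blast
  have gin: "?g w \<in> annulus r 1" if "w \<in> \<Omega>'" for w
    using bij that by (metis bij_betw_def bij_betw_the_inv_into imageI)
  have sub: "?g ` K' \<subseteq> annulus r 1" using gin K'\<Omega> by blast
  obtain a b where ab: "r < a" "a < b" "b < 1" "\<And>z. z \<in> ?g ` K' \<Longrightarrow> a < cmod z \<and> cmod z < b"
    by (rule compact_in_annulus[OF cK sub r]) blast
  show thesis
  proof (rule that[OF ab(1-3)])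
    fix z assume z: "z \<in> annulus r 1" "cmod z \<le> a \<or> b \<le> cmod z"
    have "z = ?g (f z)" using bij z(1) by (simp add: bij_betw_def the_inv_into_f_f)
    then have "f z \<notin> K'" using ab(4)[of z] z(2) by (metis imageI linorder_not_less)
    then show "cmod (f z) < R + e \<or> 1 - e < cmod (f z)" by (auto simp: K'_def)
  qed
qed

text \<open>On a connected set the modulus cannot jump across the gap between the two
  zones.\<close>

lemma connected_one_side:
  assumes "connected A" "continuous_on A f" "e < (1 - R) / 2"
    and "\<And>z. z \<in> A \<Longrightarrow> cmod (f z) < R + e \<or> 1 - e < cmod (f z)"
  shows "(\<forall>z\<in>A. cmod (f z) < R + e) \<or> (\<forall>z\<in>A. 1 - e < cmod (f z))"
proof (rule ccontr)
  assume "\<not> ?thesis"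
  then obtain u v where uv: "u \<in> A" "v \<in> A" "\<not> cmod (f u) < R + e" "\<not> 1 - e < cmod (f v)" by blast
  then have "cmod (f u) > 1 - e" "cmod (f v) < R + e" using assms(4) by blast+
  moreover have "connected ((\<lambda>z. cmod (f z)) ` A)"
    by (intro connected_continuous_image continuous_intros assms)
  ultimately have "(R + 1) / 2 \<in> (\<lambda>z. cmod (f z)) ` A"
    using connectedD_interval[of "(\<lambda>z. cmod (f z)) ` A" "cmod (f v)" "cmod (f u)" "(R+1)/2"] uv(1,2) assms(3)
    by (auto simp: field_simps)
  then show False using assms(3,4) by (fastforce simp: field_simps)
qed

text \<open>Each collar is connected and hence lies over one of the two zones. Both cannot lie
  over the same one, for then the moduli of all values would avoid an interval, against
  surjectivity.\<close>

lemma diffeo_two_sides: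
  assumes r: "0 < r" "r < 1" and f: "sense_preserving_diffeo (annulus r 1) \<Omega>' f" and e: "0 < e" "e < (1 - R) / 2"
    and ab: "r < a" "a < b" "b < 1"
    and col: "\<And>z. z \<in> annulus r 1 \<Longrightarrow> cmod z \<le> a \<or> b \<le> cmod z \<Longrightarrow> cmod (f z) < R + e \<or> 1 - e < cmod (f z)"
  obtains sg :: real where "sg = 1 \<or> sg = -1"
    "\<And>z. z \<in> annulus r 1 \<Longrightarrow> cmod z \<le> a \<Longrightarrow> (if sg = 1 then cmod (f z) < R + e else 1 - e < cmod (f z))"
    "\<And>z. z \<in> annulus r 1 \<Longrightarrow> b \<le> cmod z \<Longrightarrow> (if sg = 1 then 1 - e < cmod (f z) else cmod (f z) < R + e)"
proof -
  have bij: "bij_betw f (annulus r 1) \<Omega>'" and sm: "smooth_on (annulus r 1) f"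
    using f by (auto simp: sense_preserving_diffeo_def)
  have cf: "continuous_on (annulus r 1) f" using sm Ck_on_imp_continuous_on unfolding smooth_on_def by blast
  define A where "A = {z::complex. r < norm (z - 0) \<and> norm (z - 0) \<le> a}"
  define B where "B = {z::complex. b \<le> norm (z - 0) \<and> norm (z - 0) < 1}"
  have AB: "connected A" "connected B"
    unfolding A_def B_def by (rule connected_annulus; simp)+
  have sub: "A \<subseteq> annulus r 1" "B \<subseteq> annulus r 1" using ab by (auto simp: A_def B_def annulus_def)
  have sA: "(\<forall>z\<in>A. cmod (f z) < R + e) \<or> (\<forall>z\<in>A. 1 - e < cmod (f z))"
    by (rule connected_one_side[OF AB(1) continuous_on_subset[OF cf sub(1)] e(2)])
      (use col sub(1) in \<open>auto simp: A_def\<close>)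
  have sB: "(\<forall>z\<in>B. cmod (f z) < R + e) \<or> (\<forall>z\<in>B. 1 - e < cmod (f z))"
    by (rule connected_one_side[OF AB(2) continuous_on_subset[OF cf sub(2)] e(2)])
      (use col sub(2) in \<open>auto simp: B_def\<close>)
  define C where "C = {z::complex. a \<le> cmod z \<and> cmod z \<le> b}"
  have Csub: "C \<subseteq> annulus r 1" using ab by (auto simp: C_def annulus_def)
  have cC: "compact C" unfolding C_def by (rule closed_ring_compact)
  have neC: "C \<noteq> {}"
  proof -
    have "of_real a \<in> C" using ab r by (simp add: C_def)
    then show ?thesis by blast
  qed
  have ccf: "continuous_on C (\<lambda>z. cmod (f z))" by (intro continuous_intros continuous_on_subset[OF cf Csub])
  have cover: "z \<in> A \<or> z \<in> B \<or> z \<in> C" if "z \<in> annulus r 1" for z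
    using that by (auto simp: A_def B_def C_def annulus_def)
  have fin: "f z \<in> \<Omega>'" if "z \<in> annulus r 1" for z using bij that by (auto simp: bij_betw_def)
  have surj: "\<exists>z\<in>annulus r 1. cmod (f z) = s" if "R < s" "s < 1" for s
  proof -
    have "of_real s \<in> \<Omega>'" by (rule of_real_in_annulus[OF that])
    then obtain z where "z \<in> annulus r 1" "f z = of_real s" using bij by (metis bij_betw_def imageE)
    then show ?thesis using that R by (intro bexI[of _ z]) auto
  qed
  have not_both_small: "\<not> ((\<forall>z\<in>A. cmod (f z) < R + e) \<and> (\<forall>z\<in>B. cmod (f z) < R + e))"
  proof
    assume sm: "(\<forall>z\<in>A. cmod (f z) < R + e) \<and> (\<forall>z\<in>B. cmod (f z) < R + e)"
    obtain z0 where z0: "z0 \<in> C" "\<And>z. z \<in> C \<Longrightarrow> cmod (f z) \<le> cmod (f z0)"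
      using continuous_attains_sup[OF cC neC ccf] by blast
    have z01: "cmod (f z0) < 1" "R < cmod (f z0)" using fin Csub z0(1) by (auto simp: annulus_def)
    define s where "s = (max (R + e) (cmod (f z0)) + 1) / 2"
    have s: "R < s" "s < 1" "R + e < s" "cmod (f z0) < s" using z01 e by (auto simp: s_def max_def field_simps)
    obtain z where "z \<in> annulus r 1" "cmod (f z) = s" using surj[OF s(1,2)] by blast
    then show False using cover[of z] sm z0(2)[of z] s by force
  qed
  have not_both_large: "\<not> ((\<forall>z\<in>A. 1 - e < cmod (f z)) \<and> (\<forall>z\<in>B. 1 - e < cmod (f z)))"
  proof
    assume lg: "(\<forall>z\<in>A. 1 - e < cmod (f z)) \<and> (\<forall>z\<in>B. 1 - e < cmod (f z))"
    obtain z0 where z0: "z0 \<in> C" "\<And>z. z \<in> C \<Longrightarrow> cmod (f z0) \<le> cmod (f z)"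
      using continuous_attains_inf[OF cC neC ccf] by blast
    have z01: "cmod (f z0) < 1" "R < cmod (f z0)" using fin Csub z0(1) by (auto simp: annulus_def)
    define s where "s = (min (1 - e) (cmod (f z0)) + R) / 2"
    have s: "R < s" "s < 1" "s < 1 - e" "s < cmod (f z0)" using z01 e R by (auto simp: s_def min_def field_simps)
    obtain z where "z \<in> annulus r 1" "cmod (f z) = s" using surj[OF s(1,2)] by blast
    then show False using cover[of z] lg z0(2)[of z] s by force
  qed
  have inA: "z \<in> A" if "z \<in> annulus r 1" "cmod z \<le> a" for z using that by (auto simp: A_def annulus_def)
  have inB: "z \<in> B" if "z \<in> annulus r 1" "b \<le> cmod z" for z using that by (auto simp: B_def annulus_def)
  show thesis
  proof (cases "\<forall>z\<in>A. cmod (f z) < R + e")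
    case True
    then have "\<forall>z\<in>B. 1 - e < cmod (f z)" using sB not_both_small by blast
    then show ?thesis using that[of 1] True inA inB by simp
  next
    case False
    then have A': "\<forall>z\<in>A. 1 - e < cmod (f z)" using sA by blast
    then have "\<forall>z\<in>B. cmod (f z) < R + e" using sB not_both_large by blast
    then show ?thesis using that[of "-1"] A' inA inB by simp
  qed
qed

text \<open>A single diffeomorphism \<open>hs N\<close> provides the collars; the boundary defect
  of all later \<open>hs n\<close> is close to that of \<open>hs N\<close> there, by comparison
  with the defect of \<open>h\<close>. A late \<open>n\<close> then serves also for the uniform
  approximation on the compact annulus between the collars.\<close>

lemma deformation_approx:
  assumes r: "0 < r" "r < 1" and h: "h \<in> deformations (annulus r 1) \<Omega>' \<rho>b"
    and e: "0 < e" "e < (1 - R) / 2" and e2: "0 < e2" and lim: "r < a'" "b' < 1"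
  obtains a b f and sg :: real where "r < a" "a < b" "b < 1" "a \<le> a'" "b' \<le> b" "sense_preserving_diffeo (annulus r 1) \<Omega>' f"
    "\<And>z. a \<le> cmod z \<Longrightarrow> cmod z \<le> b \<Longrightarrow> cmod (f z - h z) < e2" "sg = 1 \<or> sg = -1"
    "\<And>z. z \<in> annulus r 1 \<Longrightarrow> cmod z \<le> a \<Longrightarrow> (if sg = 1 then cmod (f z) < R + e else 1 - e < cmod (f z))"
    "\<And>z. z \<in> annulus r 1 \<Longrightarrow> b \<le> cmod z \<Longrightarrow> (if sg = 1 then 1 - e < cmod (f z) else cmod (f z) < R + e)"
proof -
  let ?\<Omega> = "annulus r 1"
  let ?\<delta> = "bdry_defect ?\<Omega> \<Omega>' \<rho>b"
  have "\<exists>hs. (\<forall>j. sense_preserving_diffeo ?\<Omega> \<Omega>' (hs j)) \<and>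
        (\<forall>K. compact K \<and> K \<subseteq> ?\<Omega> \<longrightarrow> uniform_limit K hs h sequentially) \<and>
        ennreal_uniform_limit (closure ?\<Omega>) (\<lambda>j. ?\<delta> (hs j)) (?\<delta> h)"
    using h unfolding deformations_def mem_Collect_eq by (elim conjE)
  then obtain hs where hs: "\<And>j. sense_preserving_diffeo ?\<Omega> \<Omega>' (hs j)"
    "\<And>K. compact K \<Longrightarrow> K \<subseteq> ?\<Omega> \<Longrightarrow> uniform_limit K hs h sequentially"
    "ennreal_uniform_limit (closure ?\<Omega>) (\<lambda>j. ?\<delta> (hs j)) (?\<delta> h)"
    by blast
  obtain c1 c2 where c: "0 < c1" "0 < c2"
    and lo: "\<And>f \<Omega> z. z \<in> \<Omega> \<Longrightarrow> f z \<in> \<Omega>' \<Longrightarrow>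
       ennreal (c1 * min (cmod (f z) - R) (1 - cmod (f z))) \<le> bdry_defect \<Omega> \<Omega>' \<rho>b f z"
    and up: "\<And>f \<Omega> z. z \<in> \<Omega> \<Longrightarrow> f z \<in> \<Omega>' \<Longrightarrow>
       bdry_defect \<Omega> \<Omega>' \<rho>b f z \<le> ennreal (c2 * min (cmod (f z) - R) (1 - cmod (f z)))"
    by (rule bdry_defect_bounds) blast
  have fin: "hs j z \<in> \<Omega>'" if "z \<in> ?\<Omega>" for j z
    using hs(1)[of j] that by (auto simp: sense_preserving_diffeo_def bij_betw_def)
  \<comment> \<open>three errors of size \<open>t\<close> add up to less than \<open>c1 * e\<close>\<close>
  define t where "t = c1 * e / 4"
  have t: "t > 0" using c e by (simp add: t_def)
  obtain N where N: "\<And>n x. n \<ge> N \<Longrightarrow> x \<in> closure ?\<Omega> \<Longrightarrow> ?\<delta> (hs n) x \<le> ?\<delta> h x + ennreal t \<and> ?\<delta> h x \<le> ?\<delta> (hs n) x + ennreal t"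
    using hs(3) t unfolding ennreal_uniform_limit_def by meson
  have "t / c2 > 0" using t c by simp
  obtain a0 b0 where ab0: "r < a0" "a0 < b0" "b0 < 1"
    "\<And>z. z \<in> ?\<Omega> \<Longrightarrow> cmod z \<le> a0 \<or> b0 \<le> cmod z \<Longrightarrow> cmod (hs N z) < R + t / c2 \<or> 1 - t / c2 < cmod (hs N z)"
    by (rule diffeo_collar[OF r hs(1) \<open>t / c2 > 0\<close>]) blast
  define a b where "a = min a0 a'" and "b = max b0 b'"
  have ab: "r < a" "a < b" "b < 1" "a \<le> a'" "b' \<le> b" using ab0 lim by (auto simp: a_def b_def)
  have col: "cmod (hs n z) < R + e \<or> 1 - e < cmod (hs n z)"
    if "n \<ge> N" "z \<in> ?\<Omega>" "cmod z \<le> a \<or> b \<le> cmod z" for n z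
  proof -
    have zc: "z \<in> closure ?\<Omega>" using that(2) closure_subset by blast
    have "cmod z \<le> a0 \<or> b0 \<le> cmod z" using that(3) by (auto simp: a_def b_def)
    then have "min (cmod (hs N z) - R) (1 - cmod (hs N z)) \<le> t / c2" using ab0(4)[OF that(2)] by auto
    then have "c2 * min (cmod (hs N z) - R) (1 - cmod (hs N z)) \<le> t" using c by (simp add: field_simps)
    then have "?\<delta> (hs N) z \<le> ennreal t" using up[of z ?\<Omega> "hs N", OF that(2) fin[OF that(2)]] by (meson ennreal_leI order_trans)
    moreover have "?\<delta> h z \<le> ?\<delta> (hs N) z + ennreal t" "?\<delta> (hs n) z \<le> ?\<delta> h z + ennreal t"
      using N[OF order_refl zc] N[OF that(1) zc] by auto
    ultimately have "?\<delta> (hs n) z \<le> ennreal t + ennreal t + ennreal t"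
      by (meson add_right_mono order_trans)
    also have "\<dots> = ennreal (3 * t)" using t by (simp flip: ennreal_plus)
    finally have "ennreal (c1 * min (cmod (hs n z) - R) (1 - cmod (hs n z))) \<le> ennreal (3 * t)"
      using lo[of z ?\<Omega> "hs n", OF that(2) fin[OF that(2)]] by (meson order_trans)
    then have "c1 * min (cmod (hs n z) - R) (1 - cmod (hs n z)) \<le> 3 * t" using t by (simp add: ennreal_le_iff)
    also have "\<dots> < c1 * e" using c e by (simp add: t_def)
    finally have "min (cmod (hs n z) - R) (1 - cmod (hs n z)) < e" using c by simp
    then show ?thesis by (auto simp: min_def split: if_splits)
  qed
  define C where "C = {z::complex. a \<le> cmod z \<and> cmod z \<le> b}"
  have Csub: "C \<subseteq> ?\<Omega>" using ab by (auto simp: C_def annulus_def)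
  have cC: "compact C" unfolding C_def by (rule closed_ring_compact)
  have "\<forall>\<^sub>F n in sequentially. \<forall>z\<in>C. dist (hs n z) (h z) < e2"
    using hs(2)[OF cC Csub] e2 by (simp add: uniform_limit_iff)
  then obtain n where n: "n \<ge> N" "\<And>z. z \<in> C \<Longrightarrow> dist (hs n z) (h z) < e2"
    unfolding eventually_sequentially by (metis nle_le)
  obtain sg :: real where sg: "sg = 1 \<or> sg = -1"
    "\<And>z. z \<in> annulus r 1 \<Longrightarrow> cmod z \<le> a \<Longrightarrow> (if sg = 1 then cmod (hs n z) < R + e else 1 - e < cmod (hs n z))"
    "\<And>z. z \<in> annulus r 1 \<Longrightarrow> b \<le> cmod z \<Longrightarrow> (if sg = 1 then 1 - e < cmod (hs n z) else cmod (hs n z) < R + e)"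
    by (rule diffeo_two_sides[OF r hs(1) e ab(1-3) col[OF n(1)]]) blast+
  show thesis
    by (rule that[OF ab hs(1) _ sg]) (use n(2) in \<open>auto simp: C_def dist_norm\<close>)
qed

end

section \<open>The lower bound for the energy of deformations\<close>

lemma ring_integral_ge:
  assumes ab: "0 < a" "a < b" and c: "continuous_on {z. a \<le> cmod z \<and> cmod z \<le> b} F"
    and F: "\<And>z. a \<le> cmod z \<Longrightarrow> cmod z \<le> b \<Longrightarrow> F z \<ge> 0"
  shows "ennreal (integral ({ln a..ln b} \<times> {0..2*pi}) (\<lambda>(x, t). F (exp (Complex x t)) * exp (2 * x)))
     \<le> (\<integral>\<^sup>+ z \<in> {z. a \<le> cmod z \<and> cmod z \<le> b}. ennreal (F z) \<partial>lborel)"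
proof -
  let ?C = "{z::complex. a \<le> cmod z \<and> cmod z \<le> b}"
  let ?Q = "cbox (ln a, 0) (ln b, 2*pi)" and ?B = "box (ln a, 0) (ln b, 2*pi)"
  let ?G = "\<lambda>p. F (exp (Complex (fst p) (snd p))) * exp (2 * fst p)"
  have Q: "{ln a..ln b} \<times> {0..2*pi} = ?Q" by (simp add: cbox_Pair_eq)
  have mem: "a \<le> cmod (exp (Complex (fst p) (snd p)))" "cmod (exp (Complex (fst p) (snd p))) \<le> b" if "p \<in> ?Q" for p
  proof -
    have "fst p \<in> {ln a..ln b}" using that unfolding Q[symmetric] by auto
    then have "exp (ln a) \<le> exp (fst p)" "exp (fst p) \<le> exp (ln b)" by (simp_all only: exp_le_cancel_iff) auto
    then show "a \<le> cmod (exp (Complex (fst p) (snd p)))" "cmod (exp (Complex (fst p) (snd p))) \<le> b"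
      using ab by (simp_all add: cmod_exp_Complex)
  qed
  have "continuous_on ?Q (\<lambda>p. F (exp (Complex (fst p) (snd p))))"
    by (rule continuous_on_compose2[OF c]) (use mem in \<open>auto intro!: continuous_intros simp: Complex_eq\<close>)
  then have "continuous_on ?Q ?G" by (intro continuous_intros)
  then have "?G integrable_on ?Q" by (rule integrable_continuous)
  then have "(?G has_integral integral ?Q ?G) ?Q" by (rule integrable_integral)
  then have I: "(?G has_integral integral ?Q ?G) ?B" by (simp add: has_integral_open_interval)
  have nn: "0 \<le> ?G p" if "p \<in> ?B" for p
  proof -
    have "p \<in> ?Q" using that box_subset_cbox by blast
    then show ?thesis using F[OF mem[of p]] by simp
  qed
  let ?F' = "\<lambda>z. ennreal (F z) * indicator ?C z"
  have "(\<lambda>z. indicator ?C z *\<^sub>R F z) \<in> borel_measurable borel"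
    by (rule borel_measurable_continuous_on_indicator[OF _ c])
      (use compact_imp_closed[OF closed_ring_compact[of a b]] in simp)
  then have "(\<lambda>z. ennreal (indicator ?C z *\<^sub>R F z)) \<in> borel_measurable borel" by measurable
  also have "(\<lambda>z. ennreal (indicator ?C z *\<^sub>R F z)) = ?F'" by (auto simp: indicator_def)
  finally have m: "?F' \<in> borel_measurable borel" .
  have mF: "(\<lambda>p. ?F' (exp (Complex (fst p) (snd p))) * ennreal (indicator {0<..<2*pi} (snd p) * exp (2 * fst p)))
      \<in> borel_measurable (lborel \<Otimes>\<^sub>M lborel)"
    unfolding Complex_eq by (intro borel_measurable_times_ennreal measurable_compose[OF _ m]) measurable
  have "ennreal (integral ?Q ?G) = (\<integral>\<^sup>+p. ennreal (indicator ?B p * ?G p) \<partial>lborel)"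
    using nn_integral_has_integral_lebesgue[OF nn I] by simp
  also have "\<dots> \<le> (\<integral>\<^sup>+p. ?F' (exp (Complex (fst p) (snd p))) * ennreal (indicator {0<..<2*pi} (snd p) * exp (2 * fst p)) \<partial>lborel)"
  proof (intro nn_integral_mono)
    fix p :: "real \<times> real"
    show "ennreal (indicator ?B p * ?G p) \<le> ?F' (exp (Complex (fst p) (snd p))) * ennreal (indicator {0<..<2*pi} (snd p) * exp (2 * fst p))"
    proof (cases "p \<in> ?B")
      case True
      then have pQ: "p \<in> ?Q" using box_subset_cbox by blast
      have s: "snd p \<in> {0<..<2*pi}" using True by (cases p) (auto simp: mem_box Basis_prod_def)
      have "ennreal (indicator ?B p * ?G p) = ennreal (F (exp (Complex (fst p) (snd p)))) * ennreal (exp (2 * fst p))"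
        using True F[OF mem[OF pQ]] by (simp add: ennreal_mult)
      also have "\<dots> = ?F' (exp (Complex (fst p) (snd p))) * ennreal (indicator {0<..<2*pi} (snd p) * exp (2 * fst p))"
        using s mem[OF pQ] by simp
      finally show ?thesis by simp
    qed simp
  qed
  also have "\<dots> = (\<integral>\<^sup>+x. (\<integral>\<^sup>+t. ?F' (exp (Complex x t)) * ennreal (indicator {0<..<2*pi} t * exp (2 * x)) \<partial>lborel) \<partial>lborel)"
    unfolding lborel_prod[symmetric] by (subst lborel.nn_integral_fst[OF mF, symmetric]) simp
  also have "\<dots> = (\<integral>\<^sup>+ z. ?F' z \<partial>lborel)" by (rule nn_integral_exp_coordinates[OF m, symmetric])
  finally show ?thesis unfolding Q by (simp add: case_prod_unfold)
qed

lemma energy_eq: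
  "energy \<Omega> \<rho> h = (\<integral>\<^sup>+ z \<in> \<Omega>. ennreal ((\<rho> (h z))\<^sup>2 * ((cmod (wdx \<Omega> h z))\<^sup>2 + (cmod (wdy \<Omega> h z))\<^sup>2)) \<partial>lebesgue)"
proof -
  have "2 * c * ((cmod (wdz \<Omega> h z))\<^sup>2 + (cmod (wdzbar \<Omega> h z))\<^sup>2) = c * ((cmod (wdx \<Omega> h z))\<^sup>2 + (cmod (wdy \<Omega> h z))\<^sup>2)" for c z
    unfolding wdz_def wdzbar_def cmod_power2 by (simp add: power2_eq_square field_simps)
  then show ?thesis unfolding energy_def by presburger
qed

lemma integral_shrink:
  fixes F :: "real \<Rightarrow> real"
  assumes "continuous_on UNIV F" "\<And>u. u \<in> {a..b} \<Longrightarrow> F u \<le> B" "0 \<le> s" "a + s \<le> b - s"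
  shows "integral {a..b} F \<le> integral {a+s..b-s} F + 2 * s * B"
proof -
  have i: "F integrable_on {c..d}" for c d by (rule integrable_continuous_interval) (rule continuous_on_subset[OF assms(1)], simp)
  have "integral {a..a+s} F + integral {a+s..b} F = integral {a..b} F"
    by (rule Henstock_Kurzweil_Integration.integral_combine) (use assms i in auto)
  moreover have "integral {a+s..b-s} F + integral {b-s..b} F = integral {a+s..b} F"
    by (rule Henstock_Kurzweil_Integration.integral_combine) (use assms i in auto)
  moreover have "integral {c..d} F \<le> (d - c) * B" if "c \<le> d" "{c..d} \<subseteq> {a..b}" for c d
  proof -
    have "integral {c..d} F \<le> integral {c..d} (\<lambda>_. B)"
      by (rule integral_le) (use assms(2) that i in auto)
    then show ?thesis using that by simp
  qed
  from this[of a "a+s"] this[of "b-s" b] have "integral {a..a+s} F \<le> s * B" "integral {b-s..b} F \<le> s * B"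
    using assms by auto
  ultimately show ?thesis by simp
qed

context regular_annulus_metric
begin

text \<open>Deformations are locally uniform limits of diffeomorphisms.\<close>

lemma deformation_continuous:
  assumes "h \<in> deformations (annulus r 1) \<Omega>' \<rho>b"
  shows "continuous_on (annulus r 1) h"
proof -
  obtain hs where hs: "\<And>j. sense_preserving_diffeo (annulus r 1) \<Omega>' (hs j)"
    "\<And>K. compact K \<Longrightarrow> K \<subseteq> annulus r 1 \<Longrightarrow> uniform_limit K hs h sequentially"
    using assms unfolding deformations_def mem_Collect_eq by metis
  have c: "continuous_on (annulus r 1) (hs j)" for j
    using hs(1)[of j] Ck_on_imp_continuous_on unfolding sense_preserving_diffeo_def smooth_on_def by blast
  show ?thesis
  proof (rule continuous_at_imp_continuous_on, rule ballI)
    fix z assume "z \<in> annulus r 1"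
    then obtain d where d: "d > 0" "cball z d \<subseteq> annulus r 1" using open_annulus open_contains_cball by metis
    have "continuous_on (cball z d) h"
      by (rule uniform_limit_theorem[OF always_eventually hs(2)])
        (use d continuous_on_subset[OF c d(2)] in auto)
    then show "isCont h z" using d(1) by (intro continuous_on_interior[of "cball z d"]) auto
  qed
qed

lemma deformation_range:
  assumes "h \<in> deformations (annulus r 1) \<Omega>' \<rho>b" "z \<in> annulus r 1"
  shows "R \<le> cmod (h z)" "cmod (h z) \<le> 1"
proof -
  have "h z \<in> closure \<Omega>'" using assms by (auto simp: deformations_def)
  then show "R \<le> cmod (h z)" "cmod (h z) \<le> 1" using closure_annulus_subset by blast+
qed

lemma deformation_weak_gradient:
  assumes "h \<in> deformations (annulus r 1) \<Omega>' \<rho>b"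
  shows "weak_gradient (annulus r 1) h (wgrad (annulus r 1) h)"
  using assms unfolding deformations_def W12loc_def wgrad_def by (auto intro: someI)

text \<open>The density \<open>\<rho>\<^sup>2\<close> extended to a continuous function on the
  whole plane. The lower bound \<open>R / 2\<close> keeps the argument of the logarithm away from
  zero and is at most the modulus of the maps that occur.\<close>

definition Vext :: "complex \<Rightarrow> real" where
  "Vext w = msq (ln (max (cmod w) (R / 2))) / (max (cmod w) (R / 2))\<^sup>2"

lemma Vext_cont: "continuous_on UNIV Vext"
  unfolding Vext_def using R by (intro continuous_intros continuous_on_compose2[OF msq_cont]) auto

lemma Vext_nonneg: "Vext w \<ge> 0"
  unfolding Vext_def using msq_pos[of "ln (max (cmod w) (R / 2))"] by simp

lemma Vext_eq: "R \<le> cmod w \<Longrightarrow> cmod w \<le> 1 \<Longrightarrow> Vext w = (\<rho>b w)\<^sup>2"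
  using R by (auto simp: Vext_def msq_ln bdry_ext_eq_radial_value power_mult_distrib)

lemma Vext_eq': "R / 2 \<le> cmod w \<Longrightarrow> Vext w = msq (ln (cmod w)) / (cmod w)\<^sup>2"
  by (simp add: Vext_def)

lemma energy_integrand_measurable:
  assumes h: "h \<in> deformations (annulus r 1) \<Omega>' \<rho>b"
  shows "(\<lambda>w. ennreal ((\<rho>b (h w))\<^sup>2 * ((cmod (wdx (annulus r 1) h w))\<^sup>2 + (cmod (wdy (annulus r 1) h w))\<^sup>2)) *
      indicator (annulus r 1) w) \<in> borel_measurable lebesgue" (is "?F \<in> _")
proof -
  let ?\<Omega> = "annulus r 1"
  define u v1 v2 where "u w = indicator ?\<Omega> w *\<^sub>R h w" and "v1 w = indicator ?\<Omega> w *\<^sub>R wdx ?\<Omega> h w"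
    and "v2 w = indicator ?\<Omega> w *\<^sub>R wdy ?\<Omega> h w" for w
  have lg: "locally_integrable ?\<Omega> h" "locally_integrable ?\<Omega> (wdx ?\<Omega> h)" "locally_integrable ?\<Omega> (wdy ?\<Omega> h)"
    using deformation_weak_gradient[OF h] unfolding weak_gradient_def wdx_def wdy_def by blast+
  have [measurable]: "u \<in> borel_measurable lebesgue" "v1 \<in> borel_measurable lebesgue" "v2 \<in> borel_measurable lebesgue"
    unfolding u_def v1_def v2_def by (intro locally_integrable_measurable[OF open_annulus] lg)+
  have [measurable]: "Vext \<in> borel_measurable borel" by (rule borel_measurable_continuous_onI[OF Vext_cont])
  have "(\<lambda>w. ennreal (Vext (u w) * ((cmod (v1 w))\<^sup>2 + (cmod (v2 w))\<^sup>2))) \<in> borel_measurable lebesgue"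
    by measurable
  also have "(\<lambda>w. ennreal (Vext (u w) * ((cmod (v1 w))\<^sup>2 + (cmod (v2 w))\<^sup>2))) = ?F"
  proof
    fix w
    show "ennreal (Vext (u w) * ((cmod (v1 w))\<^sup>2 + (cmod (v2 w))\<^sup>2)) = ?F w"
      using Vext_eq[OF deformation_range[OF h, of w]] by (cases "w \<in> ?\<Omega>") (simp_all add: u_def v1_def v2_def)
  qed
  finally show ?thesis .
qed

text \<open>The diffeomorphism \<open>f\<close> supplies the winding number, the mollified map
  \<open>k\<close> the energy. Both are uniformly close to \<open>h\<close> on a compact annulus
  that contains \<open>{z. r exp e \<le> |z| \<le> exp (- e)}\<close>.\<close>

lemma energy_bound_approx:
  assumes r: "0 < r" "r < 1" and \<gamma>: "\<gamma> \<ge> gamma_crit R \<rho>" and h: "h \<in> deformations (annulus r 1) \<Omega>' \<rho>b"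
    and c1: "0 < c1" "\<And>s. s \<in> {R..1} \<Longrightarrow> c1 \<le> rv s"
    and e: "0 < e" "ln R + 2 * e \<le> - 2 * e"
  obtains l where "ln (1 / r) - 2 * e \<le> l" "l \<le> ln (1 / r)"
    "ennreal (2 * pi * (integral {ln R+e..-e} (\<lambda>u. cal_radial \<gamma> (msq u)) +
      integral {ln R+2*e..-2*e} (\<lambda>u. cal_jacobian \<gamma> (msq u)) + (cal_angular \<gamma> - \<bar>\<gamma>\<bar>) * l))
     \<le> ennreal (1 + e / c1\<^sup>2) * energy (annulus r 1) \<rho>b h"
proof -
  let ?\<Omega> = "annulus r 1"
  \<comment> \<open>the closeness \<open>e'\<close> in the target that amounts to at most \<open>e\<close> in logarithmic scale, with room for the mollification\<close>
  define e' where "e' = Min {R * (exp e - 1) / 2, (1 - exp (-e)) / 2, (1 - R) / 4, R / 4}"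
  have e1: "1 - exp (-e) \<le> e" using exp_ge_add_one_self[of "-e"] by linarith
  have "0 < R * (exp e - 1) / 2" "0 < (1 - exp (-e)) / 2" "0 < (1 - R) / 4" "0 < R / 4" using R e(1) by simp_all
  then have "0 < e'" unfolding e'_def by (subst Min_gr_iff) auto
  moreover have "e' \<le> x" if "x \<in> {R * (exp e - 1) / 2, (1 - exp (-e)) / 2, (1 - R) / 4, R / 4}" for x
    unfolding e'_def by (rule Min_le[OF _ that]) simp
  ultimately have e': "0 < e'" "e' \<le> R * (exp e - 1) / 2" "e' \<le> (1 - exp (-e)) / 2" "e' \<le> (1 - R) / 4" "e' \<le> R / 4"
    by blast+
  have e'': "R + 2 * e' \<le> R * exp e" "exp (-e) \<le> 1 - 2 * e'" "e' < (1 - R) / 2" "e' \<le> e"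
    using e' R e1 by (simp_all add: algebra_simps)
  have lim: "r < r * exp e" "exp (-e) < 1" using r e by simp_all
  have e2: "0 < e' / 2" using e' by simp
  obtain a b f and sg :: real where ab: "r < a" "a < b" "b < 1" "a \<le> r * exp e" "exp (-e) \<le> b"
    and f: "sense_preserving_diffeo ?\<Omega> \<Omega>' f"
    and fh: "\<And>z. a \<le> cmod z \<Longrightarrow> cmod z \<le> b \<Longrightarrow> cmod (f z - h z) < e' / 2" and sg: "sg = 1 \<or> sg = -1"
    and fa: "\<And>z. z \<in> annulus r 1 \<Longrightarrow> cmod z \<le> a \<Longrightarrow> (if sg = 1 then cmod (f z) < R + e' else 1 - e' < cmod (f z))"
    and fb: "\<And>z. z \<in> annulus r 1 \<Longrightarrow> b \<le> cmod z \<Longrightarrow> (if sg = 1 then 1 - e' < cmod (f z) else cmod (f z) < R + e')"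
    by (rule deformation_approx[OF r h e'(1) e''(3) e2 lim]) blast
  let ?C = "{z::complex. a \<le> cmod z \<and> cmod z \<le> b}"
  have C\<Omega>: "?C \<subseteq> ?\<Omega>" using ab by (auto simp: annulus_def)
  obtain k where k: "\<And>n. Ck_on n UNIV k" and kh: "\<And>z. z \<in> ?C \<Longrightarrow> cmod (k z - h z) < e' / 2"
    and kE: "(\<integral>\<^sup>+z\<in>?C. ennreal (Vext (k z) * ((cmod (dx k z))\<^sup>2 + (cmod (dy k z))\<^sup>2)) \<partial>lborel) \<le>
     (\<integral>\<^sup>+w\<in>?\<Omega>. ennreal ((Vext (h w) + e' / 2) * ((cmod (wdx ?\<Omega> h w))\<^sup>2 + (cmod (wdy ?\<Omega> h w))\<^sup>2)) \<partial>lebesgue)"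
    unfolding wdx_def wdy_def
    by (rule smooth_approximation[OF open_annulus closed_ring_compact C\<Omega> deformation_continuous[OF h]
      deformation_weak_gradient[OF h] Vext_cont Vext_nonneg e2]) blast
  have kf: "cmod (k z - f z) < e'" if "z \<in> ?C" for z
  proof -
    have "cmod (k z - f z) \<le> cmod (k z - h z) + cmod (f z - h z)"
      using norm_triangle_ineq4[of "k z - h z" "f z - h z"] by simp
    then show ?thesis using kh[OF that] fh[of z] that by simp
  qed
  have fin: "R < cmod (f z)" "cmod (f z) < 1" if "z \<in> ?\<Omega>" for z
    using f that by (auto simp: sense_preserving_diffeo_def bij_betw_def annulus_def)
  have kR: "R / 2 \<le> cmod (k z)" if "z \<in> ?C" for z
  proof -
    have "cmod (f z) - cmod (k z) \<le> cmod (k z - f z)" by (metis norm_minus_commute norm_triangle_ineq2)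
    then show ?thesis using kf[OF that] fin(1)[of z] C\<Omega> that e'(5) R by auto
  qed
  define x0 x1 where "x0 = ln a" and "x1 = ln b"
  have x01: "x0 < x1" "x0 \<le> x1" using ab r by (simp_all add: x0_def x1_def)
  have ex: "exp x0 = a" "exp x1 = b" using ab r by (simp_all add: x0_def x1_def)
  have inC: "exp (Complex x t) \<in> ?C" if "x \<in> {x0..x1}" for x t
    using that ex exp_le_cancel_iff[of x0 x] exp_le_cancel_iff[of x x1] by (simp add: cmod_exp_Complex)
  define S where "S = {z. k z \<noteq> 0}"
  have ck: "continuous_on UNIV k" using k[of 0] by simp
  have oS: "open S" unfolding S_def by (intro open_Collect_neq ck continuous_on_const)
  interpret K: log_map k S x0 x1
  proof
    show "open S" by (rule oS)
    show "Ck_on 2 S k" using Ck_on_subset[OF k] by blast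
    show "\<And>z. z \<in> S \<Longrightarrow> k z \<noteq> 0" by (simp add: S_def)
    show "exp (Complex x t) \<in> S" if "x \<in> {x0..x1}" for x t
    proof -
      have "k (exp (Complex x t)) \<noteq> 0" using kR[OF inC[OF that, of t]] R by auto
      then show ?thesis by (simp add: S_def)
    qed
  qed (rule x01)
  interpret F: log_map f ?\<Omega> x0 x1
  proof
    show "open ?\<Omega>" by (rule open_annulus)
    show "Ck_on 2 ?\<Omega> f" using f unfolding sense_preserving_diffeo_def smooth_on_def by blast
    show "f z \<noteq> 0" if "z \<in> ?\<Omega>" for z using fin(1)[OF that] R by auto
    show "exp (Complex x t) \<in> ?\<Omega>" if "x \<in> {x0..x1}" for x t using inC[OF that] C\<Omega> by blast
  qed (rule x01)
  have x0x1: "x0 \<in> {x0..x1}" "x1 \<in> {x0..x1}" using x01 by auto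
  have cRe: "ln R + e < - e" using e by linarith
  have lnle: "ln s \<le> ln R + e" if "s \<le> R * exp e" "0 < s" for s
  proof -
    have "ln s \<le> ln (R * exp e)" using that by (subst ln_le_cancel_iff) (use R in auto)
    then show ?thesis using R by (simp add: ln_mult)
  qed
  have lnge: "- e \<le> ln s" if "exp (-e) \<le> s" for s
  proof -
    have "ln (exp (-e)) \<le> ln s" using that less_le_trans[OF exp_gt_zero that] by (subst ln_le_cancel_iff) auto
    then show ?thesis by simp
  qed
  have at0: "exp (Complex x0 t) \<in> ?\<Omega>" "cmod (exp (Complex x0 t)) \<le> a" "exp (Complex x1 t) \<in> ?\<Omega>" "b \<le> cmod (exp (Complex x1 t))" for t
    using inC[OF x0x1(1)] inC[OF x0x1(2)] C\<Omega> by (auto simp: cmod_exp_Complex ex)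
  have circF: "sg * F.circulation x \<ge> 2 * pi" if "x \<in> {x0..x1}" for x
  proof (rule F.circulation_sign[OF _ x01(1) sg cRe _ that])
    show "det2 (dx f z) (dy f z) > 0" if "z \<in> ?\<Omega>" for z using f that by (simp add: sense_preserving_diffeo_def)
    fix t :: real
    show "if sg = 1 then log_abs f x0 t \<le> ln R + e \<and> - e \<le> log_abs f x1 t
       else - e \<le> log_abs f x0 t \<and> log_abs f x1 t \<le> ln R + e"
      using fa[OF at0(1,2), of t] fb[OF at0(3,4), of t] fin(1)[OF at0(1)[of t]] fin(1)[OF at0(3)[of t]] R e'(1) e''(1,2)
      unfolding log_abs_def by (auto intro!: lnle lnge)
  qed
  have circK: "K.circulation x = F.circulation x" if x: "x \<in> {x0..x1}" for x
  proof -
    have eq: "exp (Complex x (2*pi)) = exp (Complex x 0)" by (simp add: exp_eq_polar cis.code complex_eq_iff)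
    have "winding_number (\<lambda>s. k (exp (Complex x (2 * pi * s)))) 0 = winding_number (\<lambda>s. f (exp (Complex x (2 * pi * s)))) 0"
    proof (rule winding_number_nearby_loops_eq[OF F.circulation_winding(1)[OF x] K.circulation_winding(1)[OF x]])
      fix s :: real
      have "cmod (k z - f z) < cmod (f z - 0)" if "z \<in> ?C" for z
        using kf[OF that] fin(1)[of z] C\<Omega> that e'(5) R by force
      from this[OF inC[OF x]]
      show "cmod (k (exp (Complex x (2 * pi * s))) - f (exp (Complex x (2 * pi * s)))) < cmod (f (exp (Complex x (2 * pi * s))) - 0)" .
    qed (simp_all add: pathfinish_def pathstart_def eq)
    then show ?thesis using F.circulation_winding(2)[OF x] K.circulation_winding(2)[OF x] by simp
  qed
  have kends: "if sg = 1 then log_abs k x0 t \<le> ln R + e \<and> - e \<le> log_abs k x1 t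
       else - e \<le> log_abs k x0 t \<and> log_abs k x1 t \<le> ln R + e" for t
  proof -
    have kclose: "cmod (k z) < cmod (f z) + e'" "cmod (f z) - e' < cmod (k z)" "0 < cmod (k z)" if "z \<in> ?C" for z
      using kf[OF that] norm_triangle_ineq2[of "k z" "f z"] norm_triangle_ineq2[of "f z" "k z"] kR[OF that] R
      by (auto simp: norm_minus_commute)
    note k0 = kclose[OF inC[OF x0x1(1), of t]] and k1 = kclose[OF inC[OF x0x1(2), of t]]
    show ?thesis
      using fa[OF at0(1,2), of t] fb[OF at0(3,4), of t] k0 k1 R e'(1) e''(1,2)
      unfolding log_abs_def by (auto intro!: lnle lnge split: if_splits)
  qed
  let ?Q = "{x0..x1} \<times> {0..2*pi}"
  let ?LB = "2 * pi * (integral {ln R+e..-e} (\<lambda>u. cal_radial \<gamma> (msq u)) +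
      integral {ln R+2*e..-2*e} (\<lambda>u. cal_jacobian \<gamma> (msq u)) + (cal_angular \<gamma> - \<bar>\<gamma>\<bar>) * (x1 - x0))"
  have "?LB \<le> integral ?Q (\<lambda>(x, t). msq (log_abs k x t) * ((Re (log_dx k x t))\<^sup>2 + (Re (log_dy k x t))\<^sup>2
         + (Im (log_dx k x t))\<^sup>2 + (Im (log_dy k x t))\<^sup>2))"
  proof (rule cylinder_energy_bound[OF x01(2) msq_pos _ msq_cont sg e, where C = "\<lambda>x t. Im (log_dxy k x t)"])
    show "0 \<le> msq u + \<gamma>" for u using msq_ge[of u] \<gamma> by linarith
    fix x t :: real assume x: "x \<in> {x0..x1}"
    show "((\<lambda>x. log_abs k x t) has_real_derivative Re (log_dx k x t)) (at x within {x0..x1})"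
      "((\<lambda>t. log_abs k x t) has_real_derivative Re (log_dy k x t)) (at t within {0..2*pi})"
      by (rule K.log_abs_deriv[OF x])+
    show "((\<lambda>x. Im (log_dy k x t)) has_real_derivative Im (log_dxy k x t)) (at x within {x0..x1})"
      "((\<lambda>t. Im (log_dx k x t)) has_real_derivative Im (log_dxy k x t)) (at t within {0..2*pi})"
      by (rule K.log_dx_dy_deriv[OF x])+
    show "log_abs k x (2*pi) = log_abs k x 0" "Im (log_dx k x (2*pi)) = Im (log_dx k x 0)"
      using K.log_periodic x by simp_all
    show "sg * integral {0..2*pi} (\<lambda>t. Im (log_dy k x t)) \<ge> 2 * pi"
      using circF[OF x] circK[OF x] unfolding K.circulation_def by simp
  next
    fix t :: real
    show "if sg = 1 then log_abs k x0 t \<le> ln R + e \<and> - e \<le> log_abs k x1 t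
       else - e \<le> log_abs k x0 t \<and> log_abs k x1 t \<le> ln R + e" by (rule kends)
  qed (fact K.log_cont)+
  also have "\<dots> = integral ?Q (\<lambda>(x, t). (\<lambda>z. Vext (k z) * ((cmod (dx k z))\<^sup>2 + (cmod (dy k z))\<^sup>2)) (exp (Complex x t)) * exp (2 * x))"
  proof (rule integral_cong)
    fix p assume "p \<in> ?Q"
    then obtain x t where p: "p = (x, t)" and x: "x \<in> {x0..x1}" by auto
    let ?z = "exp (Complex x t)"
    have k1: "Ck_on (Suc 0) UNIV k" by (rule k)
    have nz: "cmod (k ?z) \<noteq> 0" using kR[OF inC[OF x]] R by (metis half_gt_zero not_less)
    have sq: "(Re (u / g))\<^sup>2 + (Re (v / g))\<^sup>2 + (Im (u / g))\<^sup>2 + (Im (v / g))\<^sup>2 = ((cmod u)\<^sup>2 + (cmod v)\<^sup>2) / (cmod g)\<^sup>2" for u v g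
    proof -
      have "(Re (u / g))\<^sup>2 + (Re (v / g))\<^sup>2 + (Im (u / g))\<^sup>2 + (Im (v / g))\<^sup>2 = (cmod (u / g))\<^sup>2 + (cmod (v / g))\<^sup>2"
        unfolding cmod_power2 by simp
      then show ?thesis by (simp add: norm_divide power_divide add_divide_distrib)
    qed
    have ee: "(exp x)\<^sup>2 = exp (2 * x)" by (simp add: exp_double)
    have "(Re (log_dx k x t))\<^sup>2 + (Re (log_dy k x t))\<^sup>2 + (Im (log_dx k x t))\<^sup>2 + (Im (log_dy k x t))\<^sup>2
       = exp (2 * x) * ((cmod (dx k ?z))\<^sup>2 + (cmod (dy k ?z))\<^sup>2) / (cmod (k ?z))\<^sup>2"
      unfolding log_dx_def log_dy_def sq dirichlet_exp_compose[OF k1 UNIV_I] cmod_exp_Complex ee ..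
    then show "(case p of (x, t) \<Rightarrow> msq (log_abs k x t) * ((Re (log_dx k x t))\<^sup>2 + (Re (log_dy k x t))\<^sup>2
         + (Im (log_dx k x t))\<^sup>2 + (Im (log_dy k x t))\<^sup>2)) =
       (case p of (x, t) \<Rightarrow> (\<lambda>z. Vext (k z) * ((cmod (dx k z))\<^sup>2 + (cmod (dy k z))\<^sup>2)) (exp (Complex x t)) * exp (2 * x))"
      unfolding p prod.case log_abs_def using Vext_eq'[OF kR[OF inC[OF x]], of t] by simp
  qed
  finally have 1: "?LB \<le> \<dots>" .
  have ca: "0 < a" using r ab by simp
  have "ennreal ?LB \<le> ennreal (integral ({ln a..ln b} \<times> {0..2*pi}) (\<lambda>(x, t). (\<lambda>z. Vext (k z) * ((cmod (dx k z))\<^sup>2 + (cmod (dy k z))\<^sup>2)) (exp (Complex x t)) * exp (2 * x)))"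
    using 1 unfolding x0_def x1_def by (rule ennreal_leI)
  also have "\<dots> \<le> (\<integral>\<^sup>+ z \<in> ?C. ennreal (Vext (k z) * ((cmod (dx k z))\<^sup>2 + (cmod (dy k z))\<^sup>2)) \<partial>lborel)"
  proof (rule ring_integral_ge[OF ca ab(2)])
    have "continuous_on UNIV (dx k)" "continuous_on UNIV (dy k)" using k[of "Suc 0"] by simp_all
    then have "continuous_on UNIV (\<lambda>z. Vext (k z) * ((cmod (dx k z))\<^sup>2 + (cmod (dy k z))\<^sup>2))"
      by (intro continuous_intros continuous_on_compose2[OF Vext_cont] ck) auto
    then show "continuous_on ?C (\<lambda>z. Vext (k z) * ((cmod (dx k z))\<^sup>2 + (cmod (dy k z))\<^sup>2))"
      by (rule continuous_on_subset) simp
  qed (simp add: Vext_nonneg)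
  also note kE
  also have "(\<integral>\<^sup>+w\<in>?\<Omega>. ennreal ((Vext (h w) + e' / 2) * ((cmod (wdx ?\<Omega> h w))\<^sup>2 + (cmod (wdy ?\<Omega> h w))\<^sup>2)) \<partial>lebesgue)
     \<le> (\<integral>\<^sup>+w\<in>?\<Omega>. ennreal (1 + e / c1\<^sup>2) * ennreal ((\<rho>b (h w))\<^sup>2 * ((cmod (wdx ?\<Omega> h w))\<^sup>2 + (cmod (wdy ?\<Omega> h w))\<^sup>2)) \<partial>lebesgue)"
  proof (intro nn_integral_mono)
    fix w
    show "ennreal ((Vext (h w) + e' / 2) * ((cmod (wdx ?\<Omega> h w))\<^sup>2 + (cmod (wdy ?\<Omega> h w))\<^sup>2)) * indicator ?\<Omega> w
      \<le> ennreal (1 + e / c1\<^sup>2) * ennreal ((\<rho>b (h w))\<^sup>2 * ((cmod (wdx ?\<Omega> h w))\<^sup>2 + (cmod (wdy ?\<Omega> h w))\<^sup>2)) * indicator ?\<Omega> w"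
    proof (cases "w \<in> ?\<Omega>")
      case True
      note rg = deformation_range[OF h True]
      define D where "D = (cmod (wdx ?\<Omega> h w))\<^sup>2 + (cmod (wdy ?\<Omega> h w))\<^sup>2"
      have D: "D \<ge> 0" by (simp add: D_def)
      have "c1 \<le> rv (cmod (h w))" using c1(2)[of "cmod (h w)"] rg by simp
      then have "c1\<^sup>2 \<le> (\<rho>b (h w))\<^sup>2" using c1(1) bdry_ext_eq_radial_value[OF rg] by (simp add: power_mono)
      then have "e \<le> e / c1\<^sup>2 * (\<rho>b (h w))\<^sup>2" using c1(1) e(1) by (simp add: field_simps)
      then have "Vext (h w) + e' / 2 \<le> (1 + e / c1\<^sup>2) * (\<rho>b (h w))\<^sup>2"
        unfolding Vext_eq[OF rg] distrib_right mult_1 using e''(4) e'(1) by linarith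
      then have "(Vext (h w) + e' / 2) * D \<le> (1 + e / c1\<^sup>2) * (\<rho>b (h w))\<^sup>2 * D"
        using D by (rule mult_right_mono)
      then have "ennreal ((Vext (h w) + e' / 2) * D) \<le> ennreal ((1 + e / c1\<^sup>2) * ((\<rho>b (h w))\<^sup>2 * D))"
        by (intro ennreal_leI) (simp add: mult.assoc)
      also have "\<dots> = ennreal (1 + e / c1\<^sup>2) * ennreal ((\<rho>b (h w))\<^sup>2 * D)"
        using D e(1) by (intro ennreal_mult) auto
      finally show ?thesis using True by (simp add: D_def)
    qed simp
  qed
  also have "\<dots> = ennreal (1 + e / c1\<^sup>2) * energy ?\<Omega> \<rho>b h"
    unfolding energy_eq mult.assoc by (rule nn_integral_cmult[OF energy_integrand_measurable[OF h]])
  finally have main: "ennreal ?LB \<le> ennreal (1 + e / c1\<^sup>2) * energy ?\<Omega> \<rho>b h" .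
  have "ln a \<le> ln (r * exp e)" using ab ca r by (subst ln_le_cancel_iff) auto
  then have "x0 \<le> ln r + e" using r by (simp add: x0_def ln_mult)
  moreover have "- e \<le> x1" unfolding x1_def by (rule lnge[OF ab(5)])
  moreover have "x1 \<le> 0" "ln r \<le> x0" using ab r by (simp_all add: x0_def x1_def)
  ultimately have "ln (1 / r) - 2 * e \<le> x1 - x0" "x1 - x0 \<le> ln (1 / r)" using r by (simp_all add: ln_div)
  then show thesis using that main by blast
qed

text \<open>The value of the calibration, the energy of the radial map.\<close>

definition energy_level :: "real \<Rightarrow> real \<Rightarrow> real" where
  "energy_level \<gamma> l = 2 * pi * (integral {ln R..0} (\<lambda>u. cal_radial \<gamma> (msq u) + cal_jacobian \<gamma> (msq u)) +
     (cal_angular \<gamma> - \<bar>\<gamma>\<bar>) * l)"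

text \<open>The limit \<open>e \<rightarrow> 0\<close> of the approximate bound: shortening the
  intervals of integration and the source changes the bound by at most a multiple of
  \<open>e\<close>.\<close>

theorem energy_lower_bound:
  assumes r: "0 < r" "r < 1" and \<gamma>: "\<gamma> \<ge> gamma_crit R \<rho>" and h: "h \<in> deformations (annulus r 1) \<Omega>' \<rho>b"
  shows "ennreal (energy_level \<gamma> (ln (1 / r))) \<le> energy (annulus r 1) \<rho>b h"
proof -
  let ?E = "energy (annulus r 1) \<rho>b h"
  have "?E < \<infinity>" using h by (simp add: deformations_def)
  then obtain E where E: "?E = ennreal E" "E \<ge> 0" by (cases ?E) auto
  obtain c1 c2 where c1: "0 < c1" "\<And>s. s \<in> {R..1} \<Longrightarrow> c1 \<le> rv s \<and> rv s \<le> c2" by (rule rho_bounds) blast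
  have M\<gamma>: "0 \<le> msq u + \<gamma>" for u using msq_ge[of u] \<gamma> by linarith
  let ?\<alpha> = "\<lambda>u. cal_radial \<gamma> (msq u)" and ?\<kappa> = "\<lambda>u. cal_jacobian \<gamma> (msq u)"
  have c: "continuous_on UNIV ?\<alpha>" "continuous_on UNIV ?\<kappa>"
    by (rule continuous_on_cal[OF msq_pos M\<gamma> msq_cont])+
  have i: "?\<alpha> integrable_on {ln R..0}" "?\<kappa> integrable_on {ln R..0}"
    using c continuous_on_subset by (auto intro!: integrable_continuous_interval)
  have ne: "{ln R..0} \<noteq> {}" using R by simp
  obtain u1 u2 where u: "\<And>u. u \<in> {ln R..0} \<Longrightarrow> ?\<alpha> u \<le> ?\<alpha> u1" "\<And>u. u \<in> {ln R..0} \<Longrightarrow> ?\<kappa> u \<le> ?\<kappa> u2"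
    using continuous_attains_sup[OF compact_Icc ne continuous_on_subset[OF c(1)]]
      continuous_attains_sup[OF compact_Icc ne continuous_on_subset[OF c(2)]] by blast
  define D where "D = 2 * pi * (2 * ?\<alpha> u1 + 4 * ?\<kappa> u2 + 2 * \<bar>\<gamma>\<bar>)"
  let ?L = "energy_level \<gamma> (ln (1 / r))"
  have ang: "\<bar>cal_angular \<gamma> - \<bar>\<gamma>\<bar>\<bar> = \<bar>\<gamma>\<bar>" by (simp add: cal_angular_def)
  have step: "?L \<le> (1 + e / c1\<^sup>2) * E + D * e" if e: "0 < e" "e \<le> - ln R / 4" for e
  proof -
    have e4: "ln R + 2 * e \<le> - 2 * e" using e by simp
    have c1': "c1 \<le> rv s" if "s \<in> {R..1}" for s using c1(2)[OF that] by blast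
    obtain l where l: "ln (1 / r) - 2 * e \<le> l" "l \<le> ln (1 / r)"
      "ennreal (2 * pi * (integral {ln R+e..-e} ?\<alpha> + integral {ln R+2*e..-2*e} ?\<kappa> + (cal_angular \<gamma> - \<bar>\<gamma>\<bar>) * l))
        \<le> ennreal (1 + e / c1\<^sup>2) * ?E"
      by (rule energy_bound_approx[OF r \<gamma> h c1(1) c1' e(1) e4]) blast
    have "1 + e / c1\<^sup>2 \<ge> 0" using e by simp
    then have "2 * pi * (integral {ln R+e..-e} ?\<alpha> + integral {ln R+2*e..-2*e} ?\<kappa> + (cal_angular \<gamma> - \<bar>\<gamma>\<bar>) * l)
        \<le> (1 + e / c1\<^sup>2) * E"
      using l(3) E by (simp add: ennreal_mult[symmetric] ennreal_le_iff)
    then have "integral {ln R+e..-e} ?\<alpha> + integral {ln R+2*e..-2*e} ?\<kappa> + (cal_angular \<gamma> - \<bar>\<gamma>\<bar>) * l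
        \<le> (1 + e / c1\<^sup>2) * E / (2 * pi)"
      by (subst pos_le_divide_eq) (simp_all add: mult.commute)
    moreover have "integral {ln R..0} ?\<alpha> \<le> integral {ln R+e..0-e} ?\<alpha> + 2 * e * ?\<alpha> u1"
      by (rule integral_shrink[OF c(1) u(1)]) (use e e4 in auto)
    moreover have "integral {ln R..0} ?\<kappa> \<le> integral {ln R+2*e..0-2*e} ?\<kappa> + 2 * (2*e) * ?\<kappa> u2"
      by (rule integral_shrink[OF c(2) u(2)]) (use e e4 in auto)
    moreover have "(cal_angular \<gamma> - \<bar>\<gamma>\<bar>) * ln (1 / r) \<le> (cal_angular \<gamma> - \<bar>\<gamma>\<bar>) * l + 2 * e * \<bar>\<gamma>\<bar>"
    proof -
      have "(cal_angular \<gamma> - \<bar>\<gamma>\<bar>) * (ln (1 / r) - l) \<le> \<bar>cal_angular \<gamma> - \<bar>\<gamma>\<bar>\<bar> * (2 * e)"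
        by (rule mult_mono) (use l in auto)
      then show ?thesis unfolding ang by (simp add: algebra_simps)
    qed
    ultimately have "integral {ln R..0} ?\<alpha> + integral {ln R..0} ?\<kappa> + (cal_angular \<gamma> - \<bar>\<gamma>\<bar>) * ln (1 / r)
       \<le> (1 + e / c1\<^sup>2) * E / (2 * pi) + (2 * ?\<alpha> u1 + 4 * ?\<kappa> u2 + 2 * \<bar>\<gamma>\<bar>) * e"
      by (simp add: distrib_right mult.assoc mult.left_commute mult.commute[of e])
    then have "2 * pi * (integral {ln R..0} ?\<alpha> + integral {ln R..0} ?\<kappa> + (cal_angular \<gamma> - \<bar>\<gamma>\<bar>) * ln (1 / r))
       \<le> 2 * pi * ((1 + e / c1\<^sup>2) * E / (2 * pi) + (2 * ?\<alpha> u1 + 4 * ?\<kappa> u2 + 2 * \<bar>\<gamma>\<bar>) * e)"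
      by (intro mult_left_mono) auto
    also have "\<dots> = (1 + e / c1\<^sup>2) * E + D * e" unfolding D_def by (simp add: field_simps)
    finally show ?thesis unfolding energy_level_def Henstock_Kurzweil_Integration.integral_add[OF i] .
  qed
  have "?L \<le> (1 + 0 / c1\<^sup>2) * E + D * 0"
  proof (rule tendsto_lowerbound)
    show "((\<lambda>e. (1 + e / c1\<^sup>2) * E + D * e) \<longlongrightarrow> (1 + 0 / c1\<^sup>2) * E + D * 0) (at_right 0)"
      using c1(1) by (intro tendsto_intros) auto
    show "\<forall>\<^sub>F e in at_right 0. ?L \<le> (1 + e / c1\<^sup>2) * E + D * e"
      unfolding eventually_at_right_field using step R by (intro exI[of _ "- ln R / 4"]) auto
  qed simp
  then show ?thesis using E by (simp add: ennreal_leI)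
qed

end

section \<open>The radial profile\<close>

lemma nn_integral_derivative:
  fixes f f' :: "real \<Rightarrow> real"
  assumes "a \<le> b" "continuous_on {a..b} f" and f': "\<And>x. x \<in> {a<..<b} \<Longrightarrow> (f has_real_derivative f' x) (at x)"
    and nn: "\<And>x. x \<in> {a<..<b} \<Longrightarrow> f' x \<ge> 0"
  shows "(\<integral>\<^sup>+x. ennreal (indicator {a<..<b} x * f' x) \<partial>lborel) = ennreal (f b - f a)"
proof -
  have "(f' has_integral (f b - f a)) {a..b}"
    by (rule fundamental_theorem_of_calculus_interior[OF assms(1,2)])
      (use f' in \<open>simp add: has_real_derivative_iff_has_vector_derivative\<close>)
  then have "(f' has_integral (f b - f a)) {a<..<b}" by (simp add: has_integral_Icc_iff_Ioo)
  from nn_integral_has_integral_lebesgue[OF nn this] show ?thesis by simp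
qed

lemma nn_integral_reciprocal:
  assumes "0 < d" "0 < c"
  shows "(\<integral>\<^sup>+y. ennreal (indicator {a<..<a+d} y * (c / (y - a))) \<partial>lborel) = \<infinity>" (is "?I = _")
proof (rule ccontr)
  assume "?I \<noteq> \<infinity>"
  then obtain X where X: "?I = ennreal X" "X \<ge> 0" by (cases ?I) auto
  \<comment> \<open>the integral over \<open>(a + e, a + d)\<close> is then \<open>X + 1\<close>\<close>
  define e where "e = d * exp (- ((X + 1) / c))"
  have "(X + 1) / c > 0" using X assms by simp
  then have "exp (- ((X + 1) / c)) < 1" by simp
  then have e: "0 < e" "e < d" using assms by (simp_all add: e_def)
  have "(\<integral>\<^sup>+y. ennreal (indicator {a+e<..<a+d} y * (c / (y - a))) \<partial>lborel) =
     ennreal (c * ln (a + d - a) - c * ln (a + e - a))"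
  proof (rule nn_integral_derivative[where f = "\<lambda>y. c * ln (y - a)"])
    show "continuous_on {a+e..a+d} (\<lambda>y. c * ln (y - a))" using e by (intro continuous_intros) auto
    show "((\<lambda>y. c * ln (y - a)) has_real_derivative c / (x - a)) (at x)" if "x \<in> {a+e<..<a+d}" for x
      using that e by (auto intro!: derivative_eq_intros)
  qed (use e assms in auto)
  also have "c * ln (a + d - a) - c * ln (a + e - a) = X + 1" using assms by (simp add: e_def ln_mult right_diff_distrib distrib_left add_divide_distrib)
  finally have "ennreal (X + 1) = (\<integral>\<^sup>+y. ennreal (indicator {a+e<..<a+d} y * (c / (y - a))) \<partial>lborel)" by simp
  also have "\<dots> \<le> ?I"
    using e assms by (intro nn_integral_mono ennreal_leI) (auto simp: indicator_def)
  finally show False using X by (simp add: ennreal_le_iff)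
qed

context regular_annulus_metric
begin

text \<open>In the notation of the introduction this is \<open>m\<^sup>2 -
  m(R)\<^sup>2\<close>.\<close>

definition crit_radicand :: "real \<Rightarrow> real" where
  "crit_radicand y = y\<^sup>2 * (rv y)\<^sup>2 - R\<^sup>2 * (rv R)\<^sup>2"

lemma crit_radicand_eq: "crit_radicand y = y\<^sup>2 * (rv y)\<^sup>2 + gamma_crit R \<rho>"
  by (simp add: crit_radicand_def gamma_crit_def)

lemma crit_radicand_nonneg: "y \<in> {R..1} \<Longrightarrow> crit_radicand y \<ge> 0"
proof -
  assume y: "y \<in> {R..1}"
  have "(R * rv R)\<^sup>2 \<le> (y * rv y)\<^sup>2"
    using radial_value_minimum[OF y] radial_value_cont_pos(2)[of R] R by (intro power_mono) auto
  then show ?thesis by (simp add: crit_radicand_def power_mult_distrib)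
qed

lemma tau_crit_eq: "tau_crit R \<rho> =
    (\<integral>\<^sup>+y. ennreal (rv y) / ennreal (sqrt (crit_radicand y)) * indicator {R<..<1} y \<partial>lborel)"
  by (simp add: tau_crit_def crit_radicand_def)

text \<open>An interior zero is a minimum, so the derivative vanishes there, and it grows at most
  linearly near the zero because it is differentiable.\<close>

lemma crit_radicand_quadratic:
  assumes y0: "y0 \<in> {R<..<1}" "crit_radicand y0 = 0"
  obtains d K where "0 < d" "0 < K" "y0 + d < 1" "\<And>y. y \<in> {y0<..<y0+d} \<Longrightarrow> crit_radicand y \<le> (K * (y - y0))\<^sup>2"
proof -
  define v where "v y = (y * \<sigma> y)\<^sup>2 + gamma_crit R \<rho>" for y
  define v' where "v' y = 2 * (y * \<sigma> y) * (\<sigma> y + y * \<sigma>' y)" for y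
  have ve: "crit_radicand y = v y" if "y \<in> {R<..<1}" for y
    using that by (simp add: crit_radicand_eq v_def radial_value_interior power_mult_distrib)
  have dv: "(v has_real_derivative v' y) (at y)" if "y \<in> {R<..<1}" for y
    unfolding v_def v'_def using that
    by (auto intro!: derivative_eq_intros \<sigma>_deriv)
  obtain L where dv': "(v' has_real_derivative L) (at y0)"
  proof -
    have "(\<lambda>y. 2 * (y * \<sigma> y) * (\<sigma> y + y * \<sigma>' y)) field_differentiable at y0"
      using \<sigma>_deriv[of y0] \<sigma>'_deriv[of y0] y0
      by (intro derivative_intros) (auto simp: field_differentiable_def)
    then show thesis using that unfolding field_differentiable_def v'_def[abs_def] by blast
  qed
  define d0 where "d0 = min (y0 - R) (1 - y0)"
  have d0: "d0 > 0" using y0 by (auto simp: d0_def)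
  have v'0: "v' y0 = 0"
  proof (rule DERIV_local_min[OF dv[OF y0(1)] d0], intro allI impI)
    fix y assume "\<bar>y0 - y\<bar> < d0"
    then have "y \<in> {R<..<1}" by (auto simp: d0_def abs_if split: if_splits)
    then show "v y0 \<le> v y" using ve[OF y0(1)] ve[of y] crit_radicand_nonneg[of y] y0(2) by auto
  qed
  have "((\<lambda>y. (v' y - v' y0) / (y - y0)) \<longlongrightarrow> L) (at y0)" using dv' by (simp add: has_field_derivative_iff)
  then have "\<forall>\<^sub>F y in at y0. dist ((v' y - v' y0) / (y - y0)) L < 1" by (rule tendstoD) simp
  then obtain d1 where d1: "d1 > 0" "\<And>y. y \<noteq> y0 \<Longrightarrow> dist y y0 < d1 \<Longrightarrow> dist ((v' y - v' y0) / (y - y0)) L < 1"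
    unfolding eventually_at by auto
  define K where "K = \<bar>L\<bar> + 1"
  define d where "d = min d1 d0 / 2"
  have d: "0 < d" "d < d1" "d < d0" using d0 d1 by (auto simp: d_def)
  have v'b: "v' y \<le> K * (y - y0)" if "y \<in> {y0<..<y0+d}" for y
  proof -
    have "\<bar>v' y / (y - y0) - L\<bar> < 1" using d1(2)[of y] that d v'0 by (auto simp: dist_real_def)
    then have "v' y / (y - y0) \<le> K" by (simp add: K_def)
    then show ?thesis using that by (simp add: pos_divide_le_eq)
  qed
  have y1: "y0 + d < 1" using d by (auto simp: d0_def)
  show thesis
  proof (rule that[OF d(1) _ y1])
    show "0 < K" by (simp add: K_def)
    fix y assume y: "y \<in> {y0<..<y0+d}"
    have "\<exists>z. y0 < z \<and> z < y \<and> v y - v y0 = (y - y0) * v' z"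
      by (rule MVT2) (use y y0 y1 dv in auto)
    then obtain z where z: "y0 < z" "z < y" "v y - v y0 = (y - y0) * v' z" by blast
    have K1: "K \<ge> 1" by (simp add: K_def)
    have "v' z \<le> K * (z - y0)" using v'b[of z] z y by auto
    also have "\<dots> \<le> K * (y - y0)" using z K1 by (intro mult_left_mono) auto
    also have "\<dots> \<le> K * (K * (y - y0))" using K1 y by (intro mult_left_mono) auto
    finally have "(y - y0) * v' z \<le> (y - y0) * (K * (K * (y - y0)))" using y by (intro mult_left_mono) auto
    then have "v y \<le> (K * (y - y0))\<^sup>2"
      using z(3) ve[OF y0(1)] y0(2) by (simp add: power2_eq_square algebra_simps)
    then show "crit_radicand y \<le> (K * (y - y0))\<^sup>2" using ve[of y] y y0 y1 by auto
  qed
qed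

lemma crit_radicand_pos:
  assumes fin: "tau_crit R \<rho> < \<infinity>" and y0: "y0 \<in> {R<..<1}"
  shows "crit_radicand y0 > 0"
proof (rule ccontr)
  assume "\<not> ?thesis"
  then have z: "crit_radicand y0 = 0" using crit_radicand_nonneg[of y0] y0 by auto
  obtain d K where dK: "0 < d" "0 < K" "y0 + d < 1" "\<And>y. y \<in> {y0<..<y0+d} \<Longrightarrow> crit_radicand y \<le> (K * (y - y0))\<^sup>2"
    by (rule crit_radicand_quadratic[OF y0 z]) blast
  obtain c1 c2 where c: "0 < c1" "\<And>s. s \<in> {R..1} \<Longrightarrow> c1 \<le> rv s \<and> rv s \<le> c2" by (rule rho_bounds) blast
  have "\<infinity> = (\<integral>\<^sup>+y. ennreal (indicator {y0<..<y0+d} y * (c1 / K / (y - y0))) \<partial>lborel)"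
    by (rule nn_integral_reciprocal[symmetric]) (use dK c in auto)
  also have "\<dots> \<le> tau_crit R \<rho>"
    unfolding tau_crit_eq
  proof (intro nn_integral_mono)
    fix y
    show "ennreal (indicator {y0<..<y0+d} y * (c1 / K / (y - y0))) \<le>
       ennreal (rv y) / ennreal (sqrt (crit_radicand y)) * indicator {R<..<1} y"
    proof (cases "y \<in> {y0<..<y0+d}")
      case True
      then have y: "y \<in> {R<..<1}" "y \<in> {R..1}" using y0 dK by auto
      have rv: "c1 \<le> rv y" using c(2)[OF y(2)] by blast
      have sq: "sqrt (crit_radicand y) \<le> K * (y - y0)"
        using dK(4)[OF True] True dK(2) by (intro real_le_lsqrt) auto
      have "ennreal (c1 / K / (y - y0)) \<le> ennreal (rv y) / ennreal (sqrt (crit_radicand y))"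
      proof (cases "crit_radicand y = 0")
        case True
        then show ?thesis using rv c(1) by (simp add: ennreal_divide_zero)
      next
        case False
        then have s: "sqrt (crit_radicand y) > 0" using crit_radicand_nonneg[OF y(2)] by simp
        have "c1 / K / (y - y0) = c1 / (K * (y - y0))" by simp
        also have "\<dots> \<le> rv y / sqrt (crit_radicand y)"
          by (rule frac_le) (use rv c sq s in auto)
        finally show ?thesis using s rv c(1) by (simp add: divide_ennreal ennreal_leI)
      qed
      then show ?thesis using True y by simp
    qed simp
  qed
  finally show False using fin by simp
qed

end

text \<open>The two assumptions are those on \<open>\<gamma>\<close> in the main theorem.\<close>

locale radial_profile = regular_annulus_metric +
  fixes \<gamma> :: real
  assumes radicand: "\<And>y. y \<in> {R..1} \<Longrightarrow> y\<^sup>2 * (rv y)\<^sup>2 + \<gamma> \<ge> 0"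
    and crit_finite: "\<gamma> = gamma_crit R \<rho> \<Longrightarrow> tau_crit R \<rho> < \<infinity>"
begin

abbreviation "\<gamma>c \<equiv> gamma_crit R \<rho>"

lemma gamma_ge: "\<gamma>c \<le> \<gamma>"
  using radicand[of R] R by (simp add: gamma_crit_def)

text \<open>The profile \<open>p\<close> satisfies \<open>s p'(s) = speed (p s)\<close>.\<close>

definition speed :: "real \<Rightarrow> real" where "speed y = sqrt (y\<^sup>2 + \<gamma> / (rv y)\<^sup>2)"

lemma speed_eq: "y \<in> {R..1} \<Longrightarrow> speed y = sqrt (y\<^sup>2 * (rv y)\<^sup>2 + \<gamma>) / rv y"
proof -
  assume y: "y \<in> {R..1}"
  have r: "rv y > 0" by (rule radial_value_cont_pos(2)[OF y])
  then have "y\<^sup>2 + \<gamma> / (rv y)\<^sup>2 = (y\<^sup>2 * (rv y)\<^sup>2 + \<gamma>) / (rv y)\<^sup>2" by (simp add: field_simps)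
  then show ?thesis using r by (simp add: speed_def real_sqrt_divide)
qed

lemma speed_nonneg: "y \<in> {R..1} \<Longrightarrow> speed y \<ge> 0"
  using radicand[of y] radial_value_cont_pos(2)[of y] by (simp add: speed_eq)

lemma speed_cont: "continuous_on {R..1} speed"
  unfolding speed_def using radial_value_cont_pos(2)
  by (intro continuous_intros radial_value_cont_pos(1)) force

lemma radicand_pos:
  assumes y: "y \<in> {R<..<1}" shows "y\<^sup>2 * (rv y)\<^sup>2 + \<gamma> > 0"
proof (cases "\<gamma> = \<gamma>c")
  case True
  then show ?thesis using crit_radicand_pos[OF crit_finite[OF True] y] by (simp add: crit_radicand_eq)
next
  case False
  then show ?thesis using gamma_ge crit_radicand_nonneg[of y] y by (simp add: crit_radicand_eq)
qed

lemma speed_pos: "y \<in> {R<..<1} \<Longrightarrow> speed y > 0"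
  using radicand_pos[of y] radial_value_cont_pos(2)[of y] by (simp add: speed_eq)

lemma speed_sq: "y \<in> {R..1} \<Longrightarrow> (speed y)\<^sup>2 = y\<^sup>2 + \<gamma> / (rv y)\<^sup>2"
proof -
  assume y: "y \<in> {R..1}"
  have r: "rv y > 0" by (rule radial_value_cont_pos(2)[OF y])
  then have "y\<^sup>2 + \<gamma> / (rv y)\<^sup>2 = (y\<^sup>2 * (rv y)\<^sup>2 + \<gamma>) / (rv y)\<^sup>2" by (simp add: field_simps)
  then have "y\<^sup>2 + \<gamma> / (rv y)\<^sup>2 \<ge> 0" using radicand[OF y] by simp
  then show ?thesis by (simp add: speed_def)
qed

definition total_time :: ennreal where
  "total_time = (\<integral>\<^sup>+y. ennreal (indicator {R<..<1} y * (1 / speed y)) \<partial>lborel)"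

lemma reciprocal_speed_eq: "y \<in> {R<..<1} \<Longrightarrow>
   ennreal (1 / speed y) = ennreal (rv y) / ennreal (sqrt (y\<^sup>2 * (rv y)\<^sup>2 + \<gamma>))"
  using radicand_pos[of y] radial_value_cont_pos(2)[of y]
  by (simp add: speed_eq divide_ennreal)

lemma total_time_crit: "\<gamma> = \<gamma>c \<Longrightarrow> total_time = tau_crit R \<rho>"
  unfolding total_time_def tau_crit_eq crit_radicand_eq
  by (intro nn_integral_cong) (use reciprocal_speed_eq in \<open>auto split: split_indicator\<close>)

lemma total_time_finite: "total_time < \<infinity>"
proof (cases "\<gamma> = \<gamma>c")
  case True
  then show ?thesis using total_time_crit crit_finite by simp
next
  case False
  then have gt: "\<gamma> > \<gamma>c" using gamma_ge by simp
  have pos: "speed y > 0" if "y \<in> {R..1}" for y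
    using crit_radicand_nonneg[OF that] radial_value_cont_pos(2)[OF that] gt
    by (simp add: speed_eq[OF that] crit_radicand_eq)
  have ne: "{R..1} \<noteq> {}" using R by simp
  obtain y0 where y0: "y0 \<in> {R..1}" "\<And>y. y \<in> {R..1} \<Longrightarrow> speed y0 \<le> speed y"
    using continuous_attains_inf[OF compact_Icc ne speed_cont] by blast
  have "total_time \<le> (\<integral>\<^sup>+y. ennreal (1 / speed y0) * indicator {R<..<1} y \<partial>lborel)"
    unfolding total_time_def
  proof (intro nn_integral_mono)
    fix y
    show "ennreal (indicator {R<..<1} y * (1 / speed y)) \<le> ennreal (1 / speed y0) * indicator {R<..<1} y"
      using y0(2)[of y] pos[OF y0(1)] by (auto simp: indicator_def intro!: ennreal_leI divide_left_mono mult_pos_pos)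
  qed
  also have "\<dots> = ennreal (1 / speed y0) * ennreal (1 - R)"
    using R by (subst nn_integral_cmult_indicator) auto
  also have "\<dots> < \<infinity>" by (simp add: ennreal_mult_less_top)
  finally show ?thesis .
qed

lemma reciprocal_measurable: "(\<lambda>y. indicator {R<..<1} y * (1 / speed y)) \<in> borel_measurable borel"
proof -
  have "continuous_on {R<..<1} (\<lambda>y. 1 / speed y)"
    by (intro continuous_intros continuous_on_subset[OF speed_cont]) (use speed_pos in force)+
  then have "(\<lambda>y. indicator {R<..<1} y *\<^sub>R (1 / speed y)) \<in> borel_measurable borel"
    by (intro borel_measurable_continuous_on_indicator) auto
  then show ?thesis by simp
qed

lemma reciprocal_set_integrable: "set_integrable lborel {R<..<1} (\<lambda>y. 1 / speed y)"
proof -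
  have "integrable lborel (\<lambda>y. indicator {R<..<1} y * (1 / speed y))"
  proof (rule integrableI_nonneg)
    show "AE y in lborel. 0 \<le> indicator {R<..<1} y * (1 / speed y)"
      using speed_pos by (intro AE_I2) (auto simp: indicator_def intro: less_imp_le)
  qed (use reciprocal_measurable total_time_finite in \<open>simp_all add: total_time_def\<close>)
  then show ?thesis by (simp add: set_integrable_def)
qed

lemma reciprocal_integrable: "(\<lambda>y. 1 / speed y) integrable_on {R..1}"
  using set_borel_integral_eq_integral(1)[OF reciprocal_set_integrable]
  by (simp add: integrable_on_def has_integral_Icc_iff_Ioo)

definition arrival :: "real \<Rightarrow> real" where "arrival s = integral {R..s} (\<lambda>y. 1 / speed y)"

abbreviation "q \<equiv> q_fun R \<rho> \<gamma>"
abbreviation "p \<equiv> p_fun R \<rho> \<gamma>"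

lemma q_eq:
  assumes s: "s \<in> {R..1}"
  shows "q s = exp (arrival s - arrival 1)"
proof -
  have "(LBINT y=1..s. 1 / speed y) = - (LINT y:{s<..<1}|lborel. 1 / speed y)"
  proof (cases "s = 1")
    case True
    then show ?thesis by (simp add: interval_lebesgue_integral_def one_ereal_def set_lebesgue_integral_def)
  next
    case False
    then have "s < 1" using s by simp
    then show ?thesis by (simp add: interval_lebesgue_integral_def one_ereal_def)
  qed
  also have "(LINT y:{s<..<1}|lborel. 1 / speed y) = integral {s<..<1} (\<lambda>y. 1 / speed y)"
    by (rule set_borel_integral_eq_integral(2), rule set_integrable_subset[OF reciprocal_set_integrable]) (use s in auto)
  also have "\<dots> = integral {s..1} (\<lambda>y. 1 / speed y)" by (rule integral_open_interval_real[symmetric])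
  also have "arrival s + \<dots> = arrival 1"
    unfolding arrival_def
    by (rule Henstock_Kurzweil_Integration.integral_combine[OF _ _ reciprocal_integrable]) (use s in auto)
  then have "integral {s..1} (\<lambda>y. 1 / speed y) = arrival 1 - arrival s" by simp
  finally show ?thesis by (simp add: q_fun_def speed_def)
qed

lemma arrival_cont: "continuous_on {R..1} arrival"
  unfolding arrival_def[abs_def] by (rule indefinite_integral_continuous_1[OF reciprocal_integrable])

lemma arrival_deriv:
  assumes s: "s \<in> {R<..<1}"
  shows "(arrival has_real_derivative 1 / speed s) (at s)"
proof -
  have "s \<in> interior {R..1}" using s by simp
  then have "isCont speed s" by (rule continuous_on_interior[OF speed_cont])
  then have c: "continuous (at s within ({R..1} - {})) (\<lambda>y. 1 / speed y)"
    using continuous_at_imp_continuous_at_within[OF isCont_divide[OF continuous_const]] speed_pos[OF s] by force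
  have "((\<lambda>u. integral {R..u} (\<lambda>y. 1 / speed y)) has_vector_derivative 1 / speed s) (at s within ({R..1} - {}))"
    by (rule integral_has_vector_derivative_continuous_at[OF reciprocal_integrable _ _ c]) (use s in auto)
  moreover have "at s within ({R..1} - {}) = at s" using s by (intro at_within_interior) auto
  ultimately show ?thesis unfolding arrival_def[abs_def] has_real_derivative_iff_has_vector_derivative by simp
qed

lemma q_cont: "continuous_on {R..1} q"
  using continuous_on_exp[OF continuous_on_diff[OF arrival_cont continuous_on_const]]
  by (rule continuous_on_eq) (simp add: q_eq)

lemma q_deriv:
  assumes s: "s \<in> {R<..<1}" shows "(q has_real_derivative q s / speed s) (at s)"
proof -
  have "((\<lambda>s. exp (arrival s - arrival 1)) has_real_derivative exp (arrival s - arrival 1) * (1 / speed s)) (at s)"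
    using arrival_deriv[OF s] by (auto intro!: derivative_eq_intros)
  then have "((\<lambda>s. exp (arrival s - arrival 1)) has_real_derivative q s / speed s) (at s)"
    using s by (simp add: q_eq)
  then show ?thesis
    by (rule has_field_derivative_transform_within_open[of _ _ _ "{R<..<1}"]) (use s q_eq in auto)
qed

lemma q_pos: "q s > 0" by (simp add: q_fun_def)

lemma q_strict_mono:
  assumes "s \<in> {R..1}" "t \<in> {R..1}" "s < t" shows "q s < q t"
proof (rule DERIV_pos_imp_increasing_open[OF assms(3)])
  show "continuous_on {s..t} q" by (rule continuous_on_subset[OF q_cont]) (use assms in auto)
  show "\<exists>y. (q has_real_derivative y) (at x) \<and> 0 < y" if "s < x" "x < t" for x
  proof -
    have x: "x \<in> {R<..<1}" using that assms by auto
    then have "q x / speed x > 0" using speed_pos q_pos by simp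
    then show ?thesis using q_deriv[OF x] by blast
  qed
qed

abbreviation "r \<equiv> q R"

lemma q_one: "q 1 = 1" using R by (simp add: q_eq)

lemma r_bounds: "0 < r" "r < 1"
  using q_strict_mono[of R 1] q_one q_pos R by auto

lemma modulus_eq: "ln (1 / r) = arrival 1" "ennreal (ln (1 / r)) = total_time"
proof -
  show 1: "ln (1 / r) = arrival 1" using R by (simp add: q_eq ln_div arrival_def)
  have "((\<lambda>y. 1 / speed y) has_integral arrival 1) {R<..<1}"
    using integrable_integral[OF reciprocal_integrable] unfolding arrival_def by (simp add: has_integral_Icc_iff_Ioo)
  from nn_integral_has_integral_lebesgue[OF _ this] speed_pos
  have "total_time = ennreal (arrival 1)" unfolding total_time_def by (simp add: less_imp_le)
  then show "ennreal (ln (1 / r)) = total_time" using 1 by simp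
qed

text \<open>The radicand, and with it the speed, increases strictly with \<open>\<gamma>\<close>.
  Strictness survives integration, since it holds on a set of positive measure and the smaller
  integral is finite.\<close>

lemma modulus_less_iff: "ennreal (ln (1 / r)) < tau_crit R \<rho> \<longleftrightarrow> \<gamma> > \<gamma>c"
proof (cases "\<gamma> = \<gamma>c")
  case True
  then show ?thesis using total_time_crit modulus_eq by simp
next
  case False
  then have gt: "\<gamma> > \<gamma>c" using gamma_ge by simp
  have "total_time < tau_crit R \<rho>"
    unfolding total_time_def tau_crit_eq
  proof (rule nn_integral_less)
    show "(\<lambda>y. ennreal (indicator {R<..<1} y * (1 / speed y))) \<in> borel_measurable lborel"
      using reciprocal_measurable by measurable
    have "continuous_on {R<..<1} crit_radicand" "continuous_on {R<..<1} rv"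
      unfolding crit_radicand_def[abs_def]
      by (intro continuous_intros continuous_on_subset[OF radial_value_cont_pos(1)]; force)+
    then have "(\<lambda>y. indicator {R<..<1} y *\<^sub>R crit_radicand y) \<in> borel_measurable borel"
      "(\<lambda>y. indicator {R<..<1} y *\<^sub>R rv y) \<in> borel_measurable borel"
      by (intro borel_measurable_continuous_on_indicator; simp)+
    then have "(\<lambda>y. ennreal (indicator {R<..<1} y *\<^sub>R rv y) / ennreal (sqrt (indicator {R<..<1} y *\<^sub>R crit_radicand y)) * indicator {R<..<1} y)
        \<in> borel_measurable lborel" by measurable
    also have "(\<lambda>y. ennreal (indicator {R<..<1} y *\<^sub>R rv y) / ennreal (sqrt (indicator {R<..<1} y *\<^sub>R crit_radicand y)) * indicator {R<..<1} y)
       = (\<lambda>y. ennreal (rv y) / ennreal (sqrt (crit_radicand y)) * indicator {R<..<1} y)"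
      by (auto simp: fun_eq_iff split: split_indicator)
    finally show "(\<lambda>y. ennreal (rv y) / ennreal (sqrt (crit_radicand y)) * indicator {R<..<1} y) \<in> borel_measurable lborel" .
    show "(\<integral>\<^sup>+ y. ennreal (indicator {R<..<1} y * (1 / speed y)) \<partial>lborel) \<noteq> \<infinity>"
      using total_time_finite by (simp add: total_time_def)
    have less: "ennreal (1 / speed y) < ennreal (rv y) / ennreal (sqrt (crit_radicand y))" if y: "y \<in> {R<..<1}" for y
    proof -
      have rv: "rv y > 0" using y radial_value_cont_pos(2)[of y] by auto
      have c0: "crit_radicand y \<ge> 0" using y crit_radicand_nonneg[of y] by auto
      show ?thesis
      proof (cases "crit_radicand y = 0")
        case True
        then show ?thesis using rv by (simp add: ennreal_divide_zero)
      next
        case False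
        then have cp: "sqrt (crit_radicand y) > 0" using c0 by simp
        have "sqrt (crit_radicand y) < sqrt (y\<^sup>2 * (rv y)\<^sup>2 + \<gamma>)" using gt by (simp add: crit_radicand_eq)
        then have "rv y / sqrt (y\<^sup>2 * (rv y)\<^sup>2 + \<gamma>) < rv y / sqrt (crit_radicand y)"
          using rv cp by (intro divide_strict_left_mono mult_pos_pos) auto
        moreover have "rv y / sqrt (y\<^sup>2 * (rv y)\<^sup>2 + \<gamma>) \<ge> 0" using rv radicand[of y] y by simp
        ultimately have "ennreal (rv y / sqrt (y\<^sup>2 * (rv y)\<^sup>2 + \<gamma>)) < ennreal (rv y / sqrt (crit_radicand y))"
          by (simp only: ennreal_less_iff)
        then show ?thesis using y rv cp by (simp add: speed_eq divide_ennreal)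
      qed
    qed
    show "AE y in lborel. ennreal (indicator {R<..<1} y * (1 / speed y)) \<le> ennreal (rv y) / ennreal (sqrt (crit_radicand y)) * indicator {R<..<1} y"
      using less by (intro AE_I2) (auto simp: indicator_def intro: less_imp_le)
    show "\<not> (AE y in lborel. ennreal (rv y) / ennreal (sqrt (crit_radicand y)) * indicator {R<..<1} y \<le> ennreal (indicator {R<..<1} y * (1 / speed y)))"
    proof
      assume "AE y in lborel. ennreal (rv y) / ennreal (sqrt (crit_radicand y)) * indicator {R<..<1} y \<le> ennreal (indicator {R<..<1} y * (1 / speed y))"
      then have "AE y in lborel. y \<notin> {R<..<1}"
        by eventually_elim (use less in \<open>force simp: indicator_def\<close>)
      then have "emeasure lborel {R<..<1} = 0" by (subst (asm) AE_iff_measurable[OF _ refl]) (auto simp: greaterThanLessThan_def greaterThan_def lessThan_def Collect_conj_eq)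
      then show False using R by simp
    qed
  qed
  then show ?thesis using gt modulus_eq by simp
qed

lemma p_q: "y \<in> {R..1} \<Longrightarrow> p (q y) = y"
proof -
  have "inj_on q {R..1}"
    by (intro linorder_inj_onI) (use q_strict_mono in fastforce)+
  then show "y \<in> {R..1} \<Longrightarrow> p (q y) = y" by (simp add: p_fun_def)
qed

lemma q_surj: "s \<in> {r..1} \<Longrightarrow> \<exists>y\<in>{R..1}. q y = s"
  using IVT'[of q R s 1] q_cont q_one R by auto

lemma p_bounds:
  assumes "s \<in> {r..1}" shows "p s \<in> {R..1}" "q (p s) = s"
  using q_surj[OF assms] p_q by auto

lemma p_interior: "s \<in> {r<..<1} \<Longrightarrow> p s \<in> {R<..<1}"
proof -
  assume s: "s \<in> {r<..<1}"
  then have "p s \<in> {R..1}" "q (p s) = s" using p_bounds[of s] by auto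
  moreover from this have "p s \<noteq> R" "p s \<noteq> 1" using s q_one by auto
  ultimately show ?thesis by auto
qed

lemma q_interior: "y \<in> {R<..<1} \<Longrightarrow> q y \<in> {r<..<1}"
  using q_strict_mono[of R y] q_strict_mono[of y 1] q_one R by auto

lemma p_cont: "continuous_on {r..1} p"
proof -
  have "continuous_on (q ` {R..1}) p"
    by (rule continuous_on_inv[OF q_cont compact_Icc]) (use p_q in auto)
  moreover have "q ` {R..1} = {r..1}"
  proof
    show "q ` {R..1} \<subseteq> {r..1}"
    proof
      fix s assume "s \<in> q ` {R..1}"
      then obtain y where y: "y \<in> {R..1}" "s = q y" by blast
      then have "q R \<le> q y" "q y \<le> q 1"
        using q_strict_mono[of R y] q_strict_mono[of y 1] R by (cases "y = R"; cases "y = 1"; force)+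
      then show "s \<in> {r..1}" using y q_one by simp
    qed
    show "{r..1} \<subseteq> q ` {R..1}" using q_surj by fastforce
  qed
  ultimately show ?thesis by simp
qed

lemma p_deriv:
  assumes s: "s \<in> {r<..<1}" shows "(p has_real_derivative speed (p s) / s) (at s)"
proof -
  have ps: "p s \<in> {R<..<1}" "q (p s) = s" using p_interior[OF s] p_bounds[of s] s by auto
  have s0: "s > 0" using s r_bounds by auto
  have "(p has_real_derivative inverse (q (p s) / speed (p s))) (at s)"
  proof (rule DERIV_inverse_function[where f = q and g = p and a = r and b = 1, OF q_deriv[OF ps(1)]])
    show "q (p s) / speed (p s) \<noteq> 0" using speed_pos[OF ps(1)] q_pos[of "p s"] by simp
    show "r < s" "s < 1" using s by auto
    show "q (p y) = y" if "r < y" "y < 1" for y using p_bounds[of y] that by auto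
    have "s \<in> interior {r..1}" using s by simp
    then show "isCont p s" by (rule continuous_on_interior[OF p_cont])
  qed
  then show ?thesis using ps s0 by simp
qed

end

section \<open>The radial map and its dilatation\<close>

text \<open>The partial derivatives of a map that preserves rays, where \<open>c\<close> is the
  unit vector in the direction of the ray, \<open>b\<close> the radial and \<open>\<beta>\<close>
  the angular stretch.\<close>

definition stretch_x :: "real \<Rightarrow> real \<Rightarrow> complex \<Rightarrow> complex" where
  "stretch_x b \<beta> c = c * Complex (b * Re c) (- (\<beta> * Im c))"
definition stretch_y :: "real \<Rightarrow> real \<Rightarrow> complex \<Rightarrow> complex" where
  "stretch_y b \<beta> c = c * Complex (b * Im c) (\<beta> * Re c)"

lemma has_derivative_radial_stretch:
  assumes B: "(B has_real_derivative b) (at (cmod z))" and z: "z \<noteq> 0"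
  shows "((\<lambda>z. of_real (B (cmod z)) * sgn z) has_derivative
    (\<lambda>h. Re h *\<^sub>R stretch_x b (B (cmod z) / cmod z) (sgn z) + Im h *\<^sub>R stretch_y b (B (cmod z) / cmod z) (sgn z))) (at z)"
proof -
  define s where "s = cmod z"
  have s: "s > 0" using z by (simp add: s_def)
  define \<beta> where "\<beta> = (b * s - B s) / (s * s)"
  have "((\<lambda>s. B s / s) has_real_derivative \<beta>) (at (cmod z))"
    using DERIV_divide[OF B DERIV_ident, of] z unfolding \<beta>_def s_def by simp
  from has_derivative_scaleR[OF has_derivative_radial[OF this z] has_derivative_ident]
  have d: "((\<lambda>z. (B (cmod z) / cmod z) *\<^sub>R z) has_derivative
     (\<lambda>h. (B s / s) *\<^sub>R h + (Re h *\<^sub>R (\<beta> * (Re z / s)) + Im h *\<^sub>R (\<beta> * (Im z / s))) *\<^sub>R z)) (at z)"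
    unfolding s_def .
  have ss: "s * s = Re z * Re z + Im z * Im z"
    unfolding s_def using cmod_power2[of z] by (simp add: power2_eq_square)
  have sg: "Re (sgn z) = Re z / s" "Im (sgn z) = Im z / s" by (simp_all add: s_def sgn_div_norm divide_inverse mult.commute)
  have Bs: "B s / s = B s / (s * s * s) * (Re z * Re z + Im z * Im z)"
    using s unfolding ss[symmetric] by (simp add: field_simps)
  have \<beta>': "\<beta> * (x / s) = b / (s * s) * x - B s / (s * s * s) * x" for x
    using s unfolding \<beta>_def by (simp add: field_simps)
  have eq: "(\<lambda>h. (B s / s) *\<^sub>R h + (Re h *\<^sub>R (\<beta> * (Re z / s)) + Im h *\<^sub>R (\<beta> * (Im z / s))) *\<^sub>R z) =
    (\<lambda>h. Re h *\<^sub>R stretch_x b (B s / s) (sgn z) + Im h *\<^sub>R stretch_y b (B s / s) (sgn z))"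
  proof
    fix h
    define P where "P = B s / (s * s * s)"
    define T where "T = b / (s * s)"
    have 1: "Re (stretch_x b (B s / s) (sgn z)) = T * Re z * Re z + P * Im z * Im z"
      "Im (stretch_x b (B s / s) (sgn z)) = T * Re z * Im z - P * Re z * Im z"
      "Re (stretch_y b (B s / s) (sgn z)) = T * Re z * Im z - P * Re z * Im z"
      "Im (stretch_y b (B s / s) (sgn z)) = T * Im z * Im z + P * Re z * Re z"
      unfolding stretch_x_def stretch_y_def P_def T_def times_complex.sel complex.sel sg by (simp_all add: mult_ac)
    show "(B s / s) *\<^sub>R h + (Re h *\<^sub>R (\<beta> * (Re z / s)) + Im h *\<^sub>R (\<beta> * (Im z / s))) *\<^sub>R z =
      Re h *\<^sub>R stretch_x b (B s / s) (sgn z) + Im h *\<^sub>R stretch_y b (B s / s) (sgn z)"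
      unfolding complex_eq_iff plus_complex.sel scaleR_complex.sel 1
      unfolding Bs \<beta>' P_def[symmetric] T_def[symmetric] real_scaleR_def
      by (simp add: algebra_simps)
  qed
  have "(\<lambda>z. (B (cmod z) / cmod z) *\<^sub>R z) = (\<lambda>z. of_real (B (cmod z)) * sgn z)"
    by (simp add: fun_eq_iff sgn_div_norm scaleR_conv_of_real divide_inverse)
  then show ?thesis using d unfolding eq unfolding s_def by simp
qed

lemma stretch_facts:
  assumes "cmod c = 1"
  shows "(cmod (stretch_x b \<beta> c))\<^sup>2 + (cmod (stretch_y b \<beta> c))\<^sup>2 = b\<^sup>2 + \<beta>\<^sup>2"
    "det2 (stretch_x b \<beta> c) (stretch_y b \<beta> c) = b * \<beta>"
    "(stretch_x b \<beta> c - \<i> * stretch_y b \<beta> c) / 2 = of_real ((b + \<beta>) / 2)"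
    "(stretch_x b \<beta> c + \<i> * stretch_y b \<beta> c) / 2 = of_real ((b - \<beta>) / 2) * c\<^sup>2"
proof -
  have c: "Re c * Re c + Im c * Im c = 1" using assms cmod_power2[of c] by (simp add: power2_eq_square)
  have "(cmod (stretch_x b \<beta> c))\<^sup>2 + (cmod (stretch_y b \<beta> c))\<^sup>2 = (b\<^sup>2 + \<beta>\<^sup>2) * (Re c * Re c + Im c * Im c)"
    unfolding stretch_x_def stretch_y_def norm_mult assms mult_1 cmod_power2 by (simp add: power2_eq_square algebra_simps)
  then show "(cmod (stretch_x b \<beta> c))\<^sup>2 + (cmod (stretch_y b \<beta> c))\<^sup>2 = b\<^sup>2 + \<beta>\<^sup>2" by (simp add: c)
  have "det2 (stretch_x b \<beta> c) (stretch_y b \<beta> c) = b * \<beta> * (Re c * Re c + Im c * Im c) * (Re c * Re c + Im c * Im c)"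
    unfolding stretch_x_def stretch_y_def det2_def by (simp add: algebra_simps)
  then show "det2 (stretch_x b \<beta> c) (stretch_y b \<beta> c) = b * \<beta>" by (simp add: c)
  have cc: "c * cnj c = 1" using assms by (simp add: complex_norm_square[symmetric])
  have "(stretch_x b \<beta> c - \<i> * stretch_y b \<beta> c) / 2 = of_real ((b + \<beta>) / 2) * (c * cnj c)"
    unfolding stretch_x_def stretch_y_def by (simp add: complex_eq_iff algebra_simps add_divide_distrib diff_divide_distrib)
  then show "(stretch_x b \<beta> c - \<i> * stretch_y b \<beta> c) / 2 = of_real ((b + \<beta>) / 2)" by (simp add: cc)
  show "(stretch_x b \<beta> c + \<i> * stretch_y b \<beta> c) / 2 = of_real ((b - \<beta>) / 2) * c\<^sup>2"
    unfolding stretch_x_def stretch_y_def by (simp add: complex_eq_iff power2_eq_square field_simps)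
qed

lemma sgn_coords: "sgn z = of_real (Re z / cmod z) + \<i> * of_real (Im z / cmod z)"
  and cnj_sgn_coords: "cnj (sgn z) = of_real (Re z / cmod z) - \<i> * of_real (Im z / cmod z)"
  by (simp_all add: complex_eq_iff Re_sgn Im_sgn del: of_real_divide)

lemma stretch_sgn:
  "stretch_x b \<beta> (sgn z) = (Re z / cmod z * b) *\<^sub>R sgn z - (Im z / cmod z * \<beta>) *\<^sub>R (\<i> * sgn z)"
  "stretch_y b \<beta> (sgn z) = (Im z / cmod z * b) *\<^sub>R sgn z + (Re z / cmod z * \<beta>) *\<^sub>R (\<i> * sgn z)"
proof -
  have sg: "Re (sgn z) = Re z / cmod z" "Im (sgn z) = Im z / cmod z" by (simp_all add: sgn_div_norm divide_inverse mult.commute)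
  have "stretch_x b \<beta> c = (Re c * b) *\<^sub>R c - (Im c * \<beta>) *\<^sub>R (\<i> * c)"
    "stretch_y b \<beta> c = (Im c * b) *\<^sub>R c + (Re c * \<beta>) *\<^sub>R (\<i> * c)" for c
    unfolding stretch_x_def stretch_y_def by (simp_all add: complex_eq_iff algebra_simps)
  from this[of "sgn z"] show "stretch_x b \<beta> (sgn z) = (Re z / cmod z * b) *\<^sub>R sgn z - (Im z / cmod z * \<beta>) *\<^sub>R (\<i> * sgn z)"
    "stretch_y b \<beta> (sgn z) = (Im z / cmod z * b) *\<^sub>R sgn z + (Re z / cmod z * \<beta>) *\<^sub>R (\<i> * sgn z)"
    unfolding sg .
qed

lemma scale_pair: "a *\<^sub>R (u *\<^sub>R c) = (a * u) *\<^sub>R c" "\<i> * (u *\<^sub>R c) = u *\<^sub>R (\<i> * c)" for c :: complex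
  by simp_all

lemma ereal_quotient: "y \<noteq> 0 \<Longrightarrow> ereal x / ereal y = ereal (x / y)" by simp

context radial_profile
begin

abbreviation "\<Omega> \<equiv> annulus r 1"
abbreviation "f \<equiv> f_map R \<rho> \<gamma>"

text \<open>The inverse of \<open>f\<close>.\<close>

definition g :: "complex \<Rightarrow> complex" where "g w = of_real (q (cmod w)) * sgn w"

lemma annulus_polar: "z \<in> \<Omega> \<Longrightarrow> cmod z \<in> {r<..<1} \<and> z \<noteq> 0" "w \<in> \<Omega>' \<Longrightarrow> cmod w \<in> {R<..<1} \<and> w \<noteq> 0"
  using R r_bounds by (auto simp: annulus_def)

lemma zero_not_in: "0 \<notin> \<Omega>" "0 \<notin> \<Omega>'" using annulus_polar by blast+

lemma f_eq: "z \<noteq> 0 \<Longrightarrow> f z = of_real (p (cmod z)) * sgn z"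
  by (simp add: f_map_def rcis_def cis_Arg)

lemma cmod_f: "z \<in> \<Omega> \<Longrightarrow> cmod (f z) = p (cmod z)"
proof -
  assume z: "z \<in> \<Omega>"
  then have "p (cmod z) > 0" using annulus_polar(1)[OF z] p_interior[of "cmod z"] R by auto
  then show ?thesis using annulus_polar(1)[OF z] by (simp add: f_eq norm_mult norm_sgn)
qed

lemma sgn_f: "z \<in> \<Omega> \<Longrightarrow> sgn (f z) = sgn z"
proof -
  assume z: "z \<in> \<Omega>"
  then have "p (cmod z) > 0" using annulus_polar(1)[OF z] p_interior[of "cmod z"] R by auto
  then show ?thesis using annulus_polar(1)[OF z] by (simp add: f_eq sgn_mult sgn_of_real)
qed

lemma cmod_g: "w \<in> \<Omega>' \<Longrightarrow> cmod (g w) = q (cmod w)"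
  using annulus_polar(2)[of w] q_pos[of "cmod w"] by (simp add: g_def norm_mult norm_sgn)

lemma sgn_g: "w \<in> \<Omega>' \<Longrightarrow> sgn (g w) = sgn w"
  using annulus_polar(2)[of w] q_pos[of "cmod w"] by (simp add: g_def sgn_mult sgn_of_real)

lemma f_in: "z \<in> \<Omega> \<Longrightarrow> f z \<in> \<Omega>'"
  using cmod_f[of z] annulus_polar(1)[of z] p_interior[of "cmod z"] by (simp add: annulus_def)

lemma g_in: "w \<in> \<Omega>' \<Longrightarrow> g w \<in> \<Omega>"
  using cmod_g[of w] annulus_polar(2)[of w] q_interior[of "cmod w"] by (simp add: annulus_def)

lemma polar: "of_real (cmod z) * sgn z = z"
  by (cases "z = 0") (simp_all add: sgn_div_norm scaleR_conv_of_real)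

lemma g_f: "z \<in> \<Omega> \<Longrightarrow> g (f z) = z"
proof -
  assume z: "z \<in> \<Omega>"
  have "g (f z) = of_real (q (p (cmod z))) * sgn z" by (simp add: g_def cmod_f[OF z] sgn_f[OF z])
  also have "q (p (cmod z)) = cmod z" using p_bounds(2)[of "cmod z"] annulus_polar(1)[OF z] by auto
  finally show ?thesis by (simp add: polar)
qed

lemma f_g: "w \<in> \<Omega>' \<Longrightarrow> f (g w) = w"
proof -
  assume w: "w \<in> \<Omega>'"
  have "g w \<noteq> 0" using annulus_polar(1)[OF g_in[OF w]] by simp
  then have "f (g w) = of_real (p (q (cmod w))) * sgn w" using w by (simp add: f_eq cmod_g sgn_g)
  also have "p (q (cmod w)) = cmod w" using p_q[of "cmod w"] annulus_polar(2)[OF w] by auto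
  finally show ?thesis by (simp add: polar)
qed

lemma f_bij: "bij_betw f \<Omega> \<Omega>'"
  by (rule bij_betw_byWitness[where f' = g]) (use g_f f_g f_in g_in in auto)

definition radial_slope :: "complex \<Rightarrow> real" where "radial_slope z = speed (p (cmod z)) / cmod z"
definition angular_slope :: "complex \<Rightarrow> real" where "angular_slope z = p (cmod z) / cmod z"

lemma slopes_pos: "z \<in> \<Omega> \<Longrightarrow> radial_slope z > 0" "z \<in> \<Omega> \<Longrightarrow> angular_slope z > 0"
proof -
  assume z: "z \<in> \<Omega>"
  have p: "p (cmod z) \<in> {R<..<1}" using annulus_polar(1)[OF z] p_interior by blast
  show "radial_slope z > 0" "angular_slope z > 0"
    using p speed_pos[OF p] annulus_polar(1)[OF z] R by (auto simp: radial_slope_def angular_slope_def)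
qed

lemma f_deriv:
  assumes z: "z \<in> \<Omega>"
  shows "(f has_derivative (\<lambda>h. Re h *\<^sub>R stretch_x (radial_slope z) (angular_slope z) (sgn z) +
     Im h *\<^sub>R stretch_y (radial_slope z) (angular_slope z) (sgn z))) (at z)"
proof -
  have z0: "z \<noteq> 0" and s: "cmod z \<in> {r<..<1}" using annulus_polar(1)[OF z] by auto
  show ?thesis unfolding radial_slope_def angular_slope_def
    by (rule has_derivative_transform_within_open[OF has_derivative_radial_stretch[OF p_deriv[OF s] z0] open_annulus z])
      (use annulus_polar(1) f_eq in auto)
qed

lemma g_deriv:
  assumes w: "w \<in> \<Omega>'"
  shows "(g has_derivative (\<lambda>h. Re h *\<^sub>R stretch_x (q (cmod w) / speed (cmod w)) (q (cmod w) / cmod w) (sgn w) +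
     Im h *\<^sub>R stretch_y (q (cmod w) / speed (cmod w)) (q (cmod w) / cmod w) (sgn w))) (at w)"
proof -
  have w0: "w \<noteq> 0" and s: "cmod w \<in> {R<..<1}" using annulus_polar(2)[OF w] by auto
  show ?thesis unfolding g_def[abs_def] by (rule has_derivative_radial_stretch[OF q_deriv[OF s] w0])
qed

lemma f_dx_dy:
  assumes "z \<in> \<Omega>"
  shows "f differentiable (at z)" "dx f z = stretch_x (radial_slope z) (angular_slope z) (sgn z)"
    "dy f z = stretch_y (radial_slope z) (angular_slope z) (sgn z)"
  by (rule has_derivative_dx_dy_I[OF f_deriv[OF assms]])+

lemma cmod_sgn: "z \<in> \<Omega> \<Longrightarrow> cmod (sgn z) = 1"
  using annulus_polar(1) by (simp add: norm_sgn)

lemma f_dirichlet: "z \<in> \<Omega> \<Longrightarrow> (cmod (dx f z))\<^sup>2 + (cmod (dy f z))\<^sup>2 = (radial_slope z)\<^sup>2 + (angular_slope z)\<^sup>2"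
  by (simp add: f_dx_dy stretch_facts(1) cmod_sgn)

lemma f_jacobian: "z \<in> \<Omega> \<Longrightarrow> det2 (dx f z) (dy f z) = radial_slope z * angular_slope z"
  by (simp add: f_dx_dy stretch_facts(2) cmod_sgn)

lemma f_dz: "z \<in> \<Omega> \<Longrightarrow> dz f z = of_real ((radial_slope z + angular_slope z) / 2)"
  unfolding dz_def by (simp only: f_dx_dy stretch_facts(3) cmod_sgn)

lemma f_dzbar: "z \<in> \<Omega> \<Longrightarrow> dzbar f z = of_real ((radial_slope z - angular_slope z) / 2) * (sgn z)\<^sup>2"
  unfolding dzbar_def by (simp only: f_dx_dy stretch_facts(4) cmod_sgn)

lemma speed_radial_Ck: "Ck_on k \<Omega>' (\<lambda>w. speed (cmod w))"
proof (rule Ck_on_cong[OF open_annulus])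
  let ?u = "\<lambda>w. cmod w * cmod w + \<gamma> * (inverse (\<rho> w) * inverse (\<rho> w))"
  have eq: "?u w = (speed (cmod w))\<^sup>2" if "w \<in> \<Omega>'" for w
    using that speed_sq[of "cmod w"] rho_radial[OF that] annulus_polar(2)[OF that]
    by (auto simp: radial_value_interior \<sigma>_def power2_eq_square divide_inverse inverse_mult_distrib)
  have pos: "speed (cmod w) > 0" if "w \<in> \<Omega>'" for w using speed_pos annulus_polar(2)[OF that] by blast
  have "\<rho> w \<noteq> 0" if "w \<in> \<Omega>'" for w using rho_pos[OF that] by simp
  then show "Ck_on k \<Omega>' (\<lambda>w. sqrt (?u w))"
    by (intro Ck_on_sqrt Ck_on_add Ck_on_mult Ck_on_inverse Ck_on_const Ck_on_cmod Ck_rho open_annulus zero_not_in)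
      (use eq pos in fastforce)+
  show "sqrt (?u w) = speed (cmod w)" if "w \<in> \<Omega>'" for w
    unfolding eq[OF that] using pos[OF that] by simp
qed

text \<open>The partial derivatives of \<open>f\<close> are smooth expressions in
  \<open>z\<close> and \<open>f z\<close>, because the derivative of the profile is a function of
  the profile. Smoothness follows by induction without computing higher derivatives of
  \<open>p\<close>.\<close>

lemma f_Ck: "Ck_on k \<Omega> f"
proof (induction k)
  case 0
  have "continuous_on \<Omega> f"
    using f_dx_dy(1) by (intro differentiable_imp_continuous_on) (auto simp: differentiable_on_def intro: differentiable_at_withinI)
  then show ?case by simp
next
  case (Suc k)
  let ?\<Phi> = "\<lambda>w. (speed (cmod w) * inverse (cmod w)) *\<^sub>R w"
  let ?N = "\<lambda>z. inverse (cmod z * cmod z)"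
  let ?fx = "\<lambda>z. (Re z * ?N z) *\<^sub>R ?\<Phi> (f z) - (Im z * ?N z) *\<^sub>R (\<i> * f z)"
  let ?fy = "\<lambda>z. (Im z * ?N z) *\<^sub>R ?\<Phi> (f z) + (Re z * ?N z) *\<^sub>R (\<i> * f z)"
  have "cmod z \<noteq> 0" if "z \<in> \<Omega>'" for z using annulus_polar(2)[OF that] by simp
  then have \<Phi>: "Ck_on k \<Omega>' ?\<Phi>"
    by (intro Ck_on_scaleR Ck_on_mult Ck_on_inverse speed_radial_Ck Ck_on_cmod Ck_on_id open_annulus zero_not_in)
  have \<Phi>f: "Ck_on k \<Omega> (\<lambda>z. ?\<Phi> (f z))"
    by (rule Ck_on_compose[OF open_annulus \<Phi> Suc.IH]) (use f_in in auto)
  have "cmod z * cmod z \<noteq> 0" if "z \<in> \<Omega>" for z using annulus_polar(1)[OF that] by simp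
  then have N: "Ck_on k \<Omega> ?N"
    by (intro Ck_on_inverse Ck_on_mult Ck_on_cmod open_annulus zero_not_in)
  have If: "Ck_on k \<Omega> (\<lambda>z. \<i> * f z)" by (intro Ck_on_mult Ck_on_const Suc.IH open_annulus)
  have c: "Ck_on k \<Omega> ?fx" "Ck_on k \<Omega> ?fy"
    by (intro Ck_on_diff Ck_on_add Ck_on_scaleR Ck_on_mult[of _ _ Re] Ck_on_mult[of _ _ Im] Ck_on_Re Ck_on_Im N \<Phi>f If open_annulus)+
  show ?case
  proof (rule Ck_on_SucI[OF open_annulus _ c])
    fix z assume z: "z \<in> \<Omega>"
    define s where "s = cmod z"
    have s: "s > 0" using annulus_polar(1)[OF z] by (simp add: s_def)
    have p0: "p s > 0" using annulus_polar(1)[OF z] p_interior[of s] R by (auto simp: s_def)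
    have fz: "f z = p s *\<^sub>R sgn z" using annulus_polar(1)[OF z] by (simp add: f_eq s_def scaleR_conv_of_real)
    have "?\<Phi> (f z) = (speed (p s) * inverse (p s)) *\<^sub>R f z" unfolding cmod_f[OF z] s_def ..
    also have "\<dots> = speed (p s) *\<^sub>R sgn z" unfolding fz using p0 by simp
    finally have \<Phi>z: "?\<Phi> (f z) = speed (p s) *\<^sub>R sgn z" .
    have "?fx z = stretch_x (radial_slope z) (angular_slope z) (sgn z)"
      unfolding \<Phi>z unfolding fz stretch_sgn scale_pair radial_slope_def angular_slope_def s_def[symmetric]
      using s by (simp add: field_simps)
    moreover have "?fy z = stretch_y (radial_slope z) (angular_slope z) (sgn z)"
      unfolding \<Phi>z unfolding fz stretch_sgn scale_pair radial_slope_def angular_slope_def s_def[symmetric]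
      using s by (simp add: field_simps)
    ultimately show "(f has_derivative (\<lambda>h. Re h *\<^sub>R ?fx z + Im h *\<^sub>R ?fy z)) (at z)" using f_deriv[OF z] by simp
  qed
qed

lemma g_Ck: "Ck_on k \<Omega>' g"
proof (induction k)
  case 0
  have "continuous_on \<Omega>' g"
    using has_derivative_dx_dy_I(1)[OF g_deriv]
    by (intro differentiable_imp_continuous_on) (auto simp: differentiable_on_def intro: differentiable_at_withinI)
  then show ?case by simp
next
  case (Suc k)
  let ?N = "\<lambda>z. inverse (cmod z * cmod z)"
  let ?S = "\<lambda>w. inverse (cmod w * speed (cmod w))"
  let ?gx = "\<lambda>z. (Re z * ?S z) *\<^sub>R g z - (Im z * ?N z) *\<^sub>R (\<i> * g z)"
  let ?gy = "\<lambda>z. (Im z * ?S z) *\<^sub>R g z + (Re z * ?N z) *\<^sub>R (\<i> * g z)"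
  have nz: "cmod z * cmod z \<noteq> 0" "cmod z * speed (cmod z) \<noteq> 0" if "z \<in> \<Omega>'" for z
    using annulus_polar(2)[OF that] speed_pos[of "cmod z"] by auto
  then have N: "Ck_on k \<Omega>' ?N" "Ck_on k \<Omega>' ?S"
    by (intro Ck_on_inverse Ck_on_mult Ck_on_cmod open_annulus zero_not_in speed_radial_Ck; blast)+
  have ig: "Ck_on k \<Omega>' (\<lambda>z. \<i> * g z)" by (intro Ck_on_mult Ck_on_const Suc.IH open_annulus)
  have c: "Ck_on k \<Omega>' ?gx" "Ck_on k \<Omega>' ?gy"
    by (intro Ck_on_diff Ck_on_add Ck_on_scaleR Ck_on_mult[of _ _ Re] Ck_on_mult[of _ _ Im] Ck_on_Re Ck_on_Im N ig Suc.IH open_annulus)+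
  show ?case
  proof (rule Ck_on_SucI[OF open_annulus _ c])
    fix z assume z: "z \<in> \<Omega>'"
    define s where "s = cmod z"
    have s: "s > 0" "speed s > 0" using annulus_polar(2)[OF z] speed_pos[of s] by (auto simp: s_def)
    have gz: "g z = q s *\<^sub>R sgn z" by (simp add: g_def s_def scaleR_conv_of_real)
    have "?gx z = stretch_x (q s / speed s) (q s / s) (sgn z)"
      unfolding gz stretch_sgn scale_pair s_def[symmetric] using s by (simp add: field_simps)
    moreover have "?gy z = stretch_y (q s / speed s) (q s / s) (sgn z)"
      unfolding gz stretch_sgn scale_pair s_def[symmetric] using s by (simp add: field_simps)
    ultimately show "(g has_derivative (\<lambda>h. Re h *\<^sub>R ?gx z + Im h *\<^sub>R ?gy z)) (at z)"
      using g_deriv[OF z] by (simp add: s_def)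
  qed
qed

lemma f_diffeo: "sense_preserving_diffeo \<Omega> \<Omega>' f"
proof -
  have "the_inv_into \<Omega> f w = g w" if "w \<in> \<Omega>'" for w
    by (rule the_inv_into_f_eq) (use f_bij g_in f_g that in \<open>auto simp: bij_betw_def\<close>)
  then have "Ck_on k \<Omega>' (the_inv_into \<Omega> f)" for k
    by (intro Ck_on_cong[OF open_annulus _ g_Ck]) simp
  moreover have "det2 (dx f z) (dy f z) > 0" if "z \<in> \<Omega>" for z
    using slopes_pos[OF that] by (simp add: f_jacobian[OF that])
  ultimately show ?thesis using f_bij f_Ck by (simp add: sense_preserving_diffeo_def smooth_on_def)
qed

lemma speed_deriv:
  assumes y: "y \<in> {R<..<1}"
  shows "(speed has_real_derivative (y - \<gamma> * \<sigma>' y / \<sigma> y ^ 3) / speed y) (at y)"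
proof -
  have \<sigma>0: "\<sigma> y > 0" using \<sigma>_pos y by auto
  have ry: "y\<^sup>2 + \<gamma> / (\<sigma> y)\<^sup>2 = (speed y)\<^sup>2" using speed_sq[of y] y by (simp add: radial_value_interior)
  have pos: "speed y > 0" by (rule speed_pos[OF y])
  have d: "((\<lambda>y. y\<^sup>2 + \<gamma> / (\<sigma> y)\<^sup>2) has_real_derivative 2 * (y - \<gamma> * \<sigma>' y / \<sigma> y ^ 3)) (at y)"
  proof (rule DERIV_cong)
    have \<sigma>d: "(\<sigma> has_real_derivative \<sigma>' y) (at y)" using y by (intro \<sigma>_deriv) auto
    have "(\<sigma> y)\<^sup>2 \<noteq> 0" using \<sigma>0 by simp
    from DERIV_add[OF DERIV_pow[of 2 y] DERIV_divide[OF DERIV_const DERIV_power[OF \<sigma>d, of 2] this]]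
    show "((\<lambda>y. y\<^sup>2 + \<gamma> / (\<sigma> y)\<^sup>2) has_real_derivative real 2 * y ^ (2 - Suc 0) +
       (0 * (\<sigma> y)\<^sup>2 - \<gamma> * (real 2 * (\<sigma>' y * \<sigma> y ^ (2 - Suc 0)))) / ((\<sigma> y)\<^sup>2 * (\<sigma> y)\<^sup>2)) (at y)" .
    show "real 2 * y ^ (2 - Suc 0) + (0 * (\<sigma> y)\<^sup>2 - \<gamma> * (real 2 * (\<sigma>' y * \<sigma> y ^ (2 - Suc 0)))) / ((\<sigma> y)\<^sup>2 * (\<sigma> y)\<^sup>2)
      = 2 * (y - \<gamma> * \<sigma>' y / \<sigma> y ^ 3)"
      using \<sigma>0 by (simp add: power2_eq_square power3_eq_cube right_diff_distrib mult_ac)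
  qed
  define E where "E = y - \<gamma> * \<sigma>' y / \<sigma> y ^ 3"
  have "0 < y\<^sup>2 + \<gamma> / (\<sigma> y)\<^sup>2" unfolding ry using pos by simp
  from DERIV_chain2[OF DERIV_real_sqrt[OF this] d]
  have "((\<lambda>y. sqrt (y\<^sup>2 + \<gamma> / (\<sigma> y)\<^sup>2)) has_real_derivative inverse (sqrt ((speed y)\<^sup>2)) / 2 * (2 * E)) (at y)"
    unfolding ry E_def .
  also have "sqrt ((speed y)\<^sup>2) = speed y" using pos by simp
  also have "inverse (speed y) / 2 * (2 * E) = E / speed y" by (simp add: field_simps)
  finally have "((\<lambda>y. sqrt (y\<^sup>2 + \<gamma> / (\<sigma> y)\<^sup>2)) has_real_derivative (y - \<gamma> * \<sigma>' y / \<sigma> y ^ 3) / speed y) (at y)"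
    unfolding E_def .
  then show ?thesis
    by (rule has_field_derivative_transform_within_open[of _ _ _ "{R<..<1}"])
      (use y in \<open>auto simp: speed_def radial_value_interior\<close>)
qed

text \<open>For a ray preserving map the harmonic map equation reduces to the derivative of the
  equation \<open>(s p')\<^sup>2 - p\<^sup>2 = \<gamma> / \<rho>\<^sup>2\<close>.\<close>

lemma f_harmonic: "rho_harmonic \<Omega> \<Omega>' \<rho> f"
  unfolding rho_harmonic_def
proof (intro conjI ballI)
  show "Ck_on 2 \<Omega> f" by (rule f_Ck)
  show "f ` \<Omega> \<subseteq> \<Omega>'" using f_in by auto
  fix z assume z: "z \<in> \<Omega>"
  define s where "s = cmod z"
  define y where "y = p s"
  have s: "s \<in> {r<..<1}" "s > 0" "z \<noteq> 0" using annulus_polar(1)[OF z] by (auto simp: s_def)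
  have y: "y \<in> {R<..<1}" unfolding y_def by (rule p_interior[OF s(1)])
  have \<sigma>0: "\<sigma> y > 0" using \<sigma>_pos y by auto
  have sp: "speed y > 0" by (rule speed_pos[OF y])
  define A' where "A' = - \<gamma> * \<sigma>' y / (2 * \<sigma> y ^ 3 * s\<^sup>2)"
  have dA: "((\<lambda>s. (speed (p s) / s + p s / s) / 2) has_real_derivative A') (at (cmod z))"
  proof -
    have 1: "((\<lambda>s. speed (p s)) has_real_derivative (y - \<gamma> * \<sigma>' y / \<sigma> y ^ 3) / speed y * (speed y / s)) (at s)"
      using DERIV_chain2[OF speed_deriv p_deriv[OF s(1)]] y unfolding y_def by simp
    have "((\<lambda>s. (speed (p s) + p s) / (2 * s)) has_real_derivative
       (((y - \<gamma> * \<sigma>' y / \<sigma> y ^ 3) / speed y * (speed y / s) + speed y / s) * (2 * s) - (speed (p s) + p s) * 2) / ((2 * s) * (2 * s))) (at s)"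
      using DERIV_divide[OF DERIV_add[OF 1 p_deriv[OF s(1), folded y_def]] DERIV_cmult_Id[of 2 s]] s(2) by simp
    also have "(((y - \<gamma> * \<sigma>' y / \<sigma> y ^ 3) / speed y * (speed y / s) + speed y / s) * (2 * s) - (speed (p s) + p s) * 2) / ((2 * s) * (2 * s)) = A'"
      using s(2) sp \<sigma>0 unfolding y_def[symmetric] A'_def by (simp add: field_simps power2_eq_square)
    also have "(\<lambda>s. (speed (p s) + p s) / (2 * s)) = (\<lambda>s. (speed (p s) / s + p s / s) / 2)"
      by (simp add: fun_eq_iff add_divide_distrib)
    finally show ?thesis by (simp add: s_def)
  qed
  have ofR: "((\<lambda>z. complex_of_real (u z)) has_derivative (\<lambda>h. Re h *\<^sub>R of_real a + Im h *\<^sub>R of_real b)) (at z)"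
    if "(u has_derivative (\<lambda>h. Re h *\<^sub>R a + Im h *\<^sub>R b)) (at z)" for u a b z
    using bounded_linear.has_derivative[OF bounded_linear_of_real that] by (simp add: scaleR_conv_of_real)
  have "((\<lambda>z. complex_of_real ((radial_slope z + angular_slope z) / 2)) has_derivative
     (\<lambda>h. Re h *\<^sub>R of_real (A' * (Re z / cmod z)) + Im h *\<^sub>R of_real (A' * (Im z / cmod z)))) (at z)"
    unfolding radial_slope_def angular_slope_def by (rule ofR[OF has_derivative_radial[OF dA s(3)]])
  then have "(dz f has_derivative (\<lambda>h. Re h *\<^sub>R of_real (A' * (Re z / cmod z)) + Im h *\<^sub>R of_real (A' * (Im z / cmod z)))) (at z)"
    by (rule has_derivative_transform_within_open[OF _ open_annulus z]) (simp add: f_dz)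
  note h1 = has_derivative_dx_dy_I(2,3)[OF this]
  have e1: "dzbar (dz f) z = of_real (A' / 2) * sgn z"
    unfolding dzbar_def h1 sgn_coords[of z] of_real_mult by (simp add: algebra_simps)
  have fz: "f z \<in> \<Omega>'" "f z \<noteq> 0" "cmod (f z) = y" using f_in[OF z] annulus_polar(2)[OF f_in[OF z]] cmod_f[OF z] by (auto simp: y_def s_def)
  define L where "L = \<sigma>' y / \<sigma> y"
  have dL: "((\<lambda>u. ln ((\<sigma> u)\<^sup>2)) has_real_derivative 2 * L) (at (cmod (f z)))"
    unfolding fz(3) L_def using y \<sigma>0 by (auto intro!: derivative_eq_intros \<sigma>_deriv simp: power2_eq_square)
  have "((\<lambda>w. complex_of_real (ln ((\<sigma> (cmod w))\<^sup>2))) has_derivative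
     (\<lambda>h. Re h *\<^sub>R of_real (2 * L * (Re (f z) / cmod (f z))) + Im h *\<^sub>R of_real (2 * L * (Im (f z) / cmod (f z))))) (at (f z))"
    by (rule ofR[OF has_derivative_radial[OF dL fz(2)]])
  then have "((\<lambda>w. complex_of_real (ln ((\<rho> w)\<^sup>2))) has_derivative
     (\<lambda>h. Re h *\<^sub>R of_real (2 * L * (Re (f z) / cmod (f z))) + Im h *\<^sub>R of_real (2 * L * (Im (f z) / cmod (f z))))) (at (f z))"
    by (rule has_derivative_transform_within_open[OF _ open_annulus fz(1)]) (simp add: rho_radial \<sigma>_def)
  note h2 = has_derivative_dx_dy_I(2,3)[OF this]
  have e2: "dz (\<lambda>w. of_real (ln ((\<rho> w)\<^sup>2))) (f z) = of_real L * cnj (sgn (f z))"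
    unfolding dz_def h2 cnj_sgn_coords[of "f z"] of_real_mult
    by (simp add: algebra_simps add_divide_distrib diff_divide_distrib)
  have cc: "cnj (sgn z) * (sgn z)\<^sup>2 = sgn z"
  proof -
    have "sgn z * cnj (sgn z) = 1" using cmod_sgn[OF z] by (simp add: complex_norm_square[symmetric])
    then show ?thesis by (simp add: power2_eq_square mult.commute mult.left_commute)
  qed
  have "(speed y)\<^sup>2 = y\<^sup>2 + \<gamma> / (\<sigma> y)\<^sup>2" using speed_sq[of y] y by (simp add: radial_value_interior)
  then have sq: "(speed y)\<^sup>2 - y\<^sup>2 = \<gamma> / (\<sigma> y)\<^sup>2" by simp
  have "(radial_slope z + angular_slope z) / 2 * ((radial_slope z - angular_slope z) / 2) = ((speed y)\<^sup>2 - y\<^sup>2) / (4 * s\<^sup>2)"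
    using s(2) unfolding radial_slope_def angular_slope_def s_def[symmetric] y_def[symmetric]
    by (simp add: field_simps power2_eq_square)
  then have diff: "(radial_slope z + angular_slope z) / 2 * ((radial_slope z - angular_slope z) / 2) = \<gamma> / (4 * (\<sigma> y)\<^sup>2 * s\<^sup>2)"
    unfolding sq by (simp add: mult_ac)
  have "dz (\<lambda>w. of_real (ln ((\<rho> w)\<^sup>2))) (f z) * dz f z * dzbar f z =
      of_real (L * ((radial_slope z + angular_slope z) / 2 * ((radial_slope z - angular_slope z) / 2))) * (cnj (sgn z) * (sgn z)\<^sup>2)"
    unfolding e2 f_dz[OF z] f_dzbar[OF z] sgn_f[OF z] by (simp only: of_real_mult mult_ac)
  also have "\<dots> = of_real (L * (\<gamma> / (4 * (\<sigma> y)\<^sup>2 * s\<^sup>2))) * sgn z" unfolding diff cc ..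
  also have "L * (\<gamma> / (4 * (\<sigma> y)\<^sup>2 * s\<^sup>2)) = - (A' / 2)"
    unfolding A'_def L_def using s(2) \<sigma>0 by (simp add: field_simps power2_eq_square power3_eq_cube)
  finally show "dzbar (dz f) z + dz (\<lambda>w. of_real (ln ((\<rho> w)\<^sup>2))) (f z) * dz f z * dzbar f z = 0"
    unfolding e1 by simp
qed

text \<open>The two singular values of the differential are the radial and the angular
  stretch.\<close>

lemma qc_quotient:
  assumes z: "z \<in> \<Omega>"
  defines "a \<equiv> speed (p (cmod z)) / p (cmod z)"
  shows "(ereal (cmod (dz f z) + cmod (dzbar f z)) / ereal (cmod (dz f z) - cmod (dzbar f z))) = ereal (max a (1 / a))"
proof -
  define b \<beta> where "b = radial_slope z" and "\<beta> = angular_slope z"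
  have pos: "b > 0" "\<beta> > 0" using slopes_pos[OF z] by (simp_all add: b_def \<beta>_def)
  have a: "a = b / \<beta>" using annulus_polar(1)[OF z] by (simp add: a_def b_def \<beta>_def radial_slope_def angular_slope_def)
  have c: "cmod (dz f z) = (b + \<beta>) / 2" "cmod (dzbar f z) = \<bar>b - \<beta>\<bar> / 2"
    unfolding f_dz[OF z] f_dzbar[OF z] norm_mult norm_power cmod_sgn[OF z] norm_of_real b_def[symmetric] \<beta>_def[symmetric]
    using pos by simp_all
  have X: "cmod (dz f z) + cmod (dzbar f z) = max b \<beta>" and Y: "cmod (dz f z) - cmod (dzbar f z) = min b \<beta>"
    unfolding c by (simp_all add: max_def min_def abs_if field_simps)
  have Y0: "cmod (dz f z) - cmod (dzbar f z) \<noteq> 0" using pos unfolding Y by (simp add: min_def)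
  have "max b \<beta> / min b \<beta> = max a (1 / a)"
  proof (cases "b \<le> \<beta>")
    case True
    then have "b / \<beta> \<le> 1" "1 \<le> \<beta> / b" using pos by simp_all
    then have "max (b / \<beta>) (\<beta> / b) = \<beta> / b" by (intro max_absorb2) linarith
    then show ?thesis using True by (simp add: a max_absorb2 min_absorb1)
  next
    case False
    then have "1 \<le> b / \<beta>" "\<beta> / b \<le> 1" using pos by simp_all
    then have "max (b / \<beta>) (\<beta> / b) = b / \<beta>" by (intro max_absorb1) linarith
    then show ?thesis using False by (simp add: a max_absorb1 min_absorb2)
  qed
  moreover have "ereal (cmod (dz f z) + cmod (dzbar f z)) / ereal (cmod (dz f z) - cmod (dzbar f z)) =
     ereal ((cmod (dz f z) + cmod (dzbar f z)) / (cmod (dz f z) - cmod (dzbar f z)))"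
    using Y0 by (rule ereal_quotient)
  ultimately show ?thesis unfolding X Y by (simp only:)
qed

definition slope_ratio :: "real \<Rightarrow> real" where "slope_ratio y = speed y / y"

lemma slope_ratio_sq: "y \<in> {R..1} \<Longrightarrow> (slope_ratio y)\<^sup>2 = 1 + \<gamma> / (y * rv y)\<^sup>2"
  using R radial_value_cont_pos(2)[of y] by (simp add: slope_ratio_def power_divide speed_sq field_simps)

lemma slope_ratio_pos: "y \<in> {R<..<1} \<Longrightarrow> slope_ratio y > 0"
  using speed_pos[of y] R by (simp add: slope_ratio_def)

lemma qc_constant_eq_SUP: "qc_constant \<Omega> f = (SUP y\<in>{R<..<1}. ereal (max (slope_ratio y) (1 / slope_ratio y)))"
proof -
  have "(SUP z\<in>\<Omega>. ereal (cmod (dz f z) + cmod (dzbar f z)) / ereal (cmod (dz f z) - cmod (dzbar f z)))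
     = (SUP z\<in>\<Omega>. ereal (max (slope_ratio (p (cmod z))) (1 / slope_ratio (p (cmod z)))))"
    by (rule SUP_cong[OF refl]) (simp only: qc_quotient slope_ratio_def)
  also have "\<dots> = (SUP y\<in>((\<lambda>z. p (cmod z)) ` \<Omega>). ereal (max (slope_ratio y) (1 / slope_ratio y)))"
    by (simp add: image_image)
  also have "(\<lambda>z. p (cmod z)) ` \<Omega> = {R<..<1}"
  proof
    show "(\<lambda>z. p (cmod z)) ` \<Omega> \<subseteq> {R<..<1}" using annulus_polar(1) p_interior by blast
    show "{R<..<1} \<subseteq> (\<lambda>z. p (cmod z)) ` \<Omega>"
    proof
      fix y assume y: "y \<in> {R<..<1}"
      have "of_real (q y) \<in> \<Omega>" "p (cmod (of_real (q y))) = y"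
        using q_interior[OF y] q_pos[of y] p_q[of y] y by (auto simp: annulus_def)
      then show "y \<in> (\<lambda>z. p (cmod z)) ` \<Omega>" by force
    qed
  qed
  finally show ?thesis by (simp add: qc_constant_def)
qed

lemma slope_ratio_cont: "continuous_on {R..1} slope_ratio"
  unfolding slope_ratio_def[abs_def] using R by (intro continuous_intros speed_cont) auto

lemma gamma_crit_neg: "\<gamma>c < 0"
  using R radial_value_cont_pos(2)[of R] by (simp add: gamma_crit_def)

lemma slope_ratio_R: "slope_ratio R = sqrt ((\<gamma>c - \<gamma>) / \<gamma>c)"
proof -
  have "slope_ratio R \<ge> 0" using speed_nonneg[of R] R by (simp add: slope_ratio_def)
  then have "slope_ratio R = sqrt ((slope_ratio R)\<^sup>2)" by simp
  also have "(slope_ratio R)\<^sup>2 = 1 + \<gamma> / (- \<gamma>c)" using R by (simp add: slope_ratio_sq gamma_crit_def power_mult_distrib)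
  also have "\<dots> = (\<gamma>c - \<gamma>) / \<gamma>c" using gamma_crit_neg by (simp add: field_simps)
  finally show ?thesis .
qed

lemma slope_ratio_tendsto: "(slope_ratio \<longlongrightarrow> slope_ratio R) (at_right R)"
  using slope_ratio_cont R unfolding at_within_Icc_at_right[OF R(2), symmetric] continuous_on_def by auto

lemma qc_crit: "\<gamma> = \<gamma>c \<Longrightarrow> qc_constant \<Omega> f = \<infinity>"
proof -
  assume g: "\<gamma> = \<gamma>c"
  have z: "slope_ratio R = 0" unfolding slope_ratio_R using g by simp
  show ?thesis unfolding qc_constant_eq_SUP
  proof (rule SUP_PInfty)
    fix n :: nat
    have "\<forall>\<^sub>F y in at_right R. slope_ratio y < 1 / (real n + 1)"
      using order_tendstoD(2)[OF slope_ratio_tendsto] by (simp add: z)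
    then have "\<forall>\<^sub>F y in at_right R. slope_ratio y < 1 / (real n + 1) \<and> y \<in> {R<..<1}"
      using eventually_at_right_real[OF R(2)] by eventually_elim simp
    then obtain y where y: "slope_ratio y < 1 / (real n + 1)" "y \<in> {R<..<1}"
      using eventually_happens[of _ "at_right R"] trivial_limit_at_right_real by blast
    have "real n + 1 \<le> 1 / slope_ratio y"
      using y(1) slope_ratio_pos[OF y(2)] by (simp add: field_simps)
    then have "ereal (real n) \<le> ereal (max (slope_ratio y) (1 / slope_ratio y))" by (simp add: max_def)
    then show "\<exists>i\<in>{R<..<1}. ereal (real n) \<le> ereal (max (slope_ratio i) (1 / slope_ratio i))" using y(2) by blast
  qed
qed

text \<open>The ratio depends monotonically on \<open>s \<rho>(s)\<close>, which is smallest at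
  \<open>R\<close>. In both cases it lies between \<open>1\<close> and its value at
  \<open>R\<close>.\<close>

lemma slope_ratio_between:
  assumes y: "y \<in> {R<..<1}"
  shows "\<gamma> \<ge> 0 \<Longrightarrow> 1 \<le> slope_ratio y \<and> slope_ratio y \<le> slope_ratio R"
    "\<gamma> < 0 \<Longrightarrow> slope_ratio R \<le> slope_ratio y \<and> slope_ratio y \<le> 1"
proof -
  have y': "y \<in> {R..1}" "R \<in> {R..1}" using y R by auto
  have m: "(R * rv R)\<^sup>2 \<le> (y * rv y)\<^sup>2" "(R * rv R)\<^sup>2 > 0"
    using radial_value_minimum[OF y'(1)] radial_value_cont_pos(2)[of R] R by (auto intro!: power_mono)
  have s0: "slope_ratio y \<ge> 0" "slope_ratio R \<ge> 0" using speed_nonneg y' R by (auto simp: slope_ratio_def)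
  have n: "(y * rv y)\<^sup>2 > 0" using m by linarith
  note sq = slope_ratio_sq[OF y'(1)] slope_ratio_sq[OF y'(2)]
  show "1 \<le> slope_ratio y \<and> slope_ratio y \<le> slope_ratio R" if g: "\<gamma> \<ge> 0"
  proof -
    have "\<gamma> / (y * rv y)\<^sup>2 \<le> \<gamma> / (R * rv R)\<^sup>2" by (rule divide_left_mono[OF m(1) g mult_pos_pos[OF n m(2)]])
    moreover have "0 \<le> \<gamma> / (y * rv y)\<^sup>2" using g by simp
    ultimately have "1\<^sup>2 \<le> (slope_ratio y)\<^sup>2" "(slope_ratio y)\<^sup>2 \<le> (slope_ratio R)\<^sup>2" unfolding sq by auto
    then show ?thesis using s0 by (auto intro: power2_le_imp_le)
  qed
  show "slope_ratio R \<le> slope_ratio y \<and> slope_ratio y \<le> 1" if g: "\<gamma> < 0"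
  proof -
    have g': "0 \<le> - \<gamma>" using g by simp
    have "- (\<gamma> / (y * rv y)\<^sup>2) \<le> - (\<gamma> / (R * rv R)\<^sup>2)"
      using divide_left_mono[OF m(1) g' mult_pos_pos[OF n m(2)]] by simp
    moreover have "\<gamma> / (y * rv y)\<^sup>2 \<le> 0" using g by (intro divide_nonpos_nonneg) auto
    ultimately have "(slope_ratio R)\<^sup>2 \<le> (slope_ratio y)\<^sup>2" "(slope_ratio y)\<^sup>2 \<le> 1\<^sup>2" unfolding sq by auto
    then show ?thesis using s0 by (auto intro: power2_le_imp_le)
  qed
qed

text \<open>The supremum is the limit at the inner boundary circle.\<close>

lemma qc_noncrit:
  assumes g: "\<gamma> \<noteq> \<gamma>c"
  shows "qc_constant \<Omega> f = ereal (max (sqrt ((\<gamma>c - \<gamma>) / \<gamma>c)) (sqrt (\<gamma>c / (\<gamma>c - \<gamma>))))"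
proof -
  have gt: "\<gamma> > \<gamma>c" using g gamma_ge by simp
  define m where "m y = max (slope_ratio y) (1 / slope_ratio y)" for y
  have "(\<gamma>c - \<gamma>) / \<gamma>c > 0" using gt gamma_crit_neg by (simp add: divide_neg_neg)
  then have R0: "slope_ratio R > 0" by (simp add: slope_ratio_R)
  have inv: "sqrt (\<gamma>c / (\<gamma>c - \<gamma>)) = 1 / slope_ratio R"
    unfolding slope_ratio_R by (simp add: real_sqrt_divide)
  have le: "m y \<le> m R" if y: "y \<in> {R<..<1}" for y
  proof (cases "\<gamma> \<ge> 0")
    case True
    note b = slope_ratio_between(1)[OF y True]
    then have "1 / slope_ratio y \<le> 1" by simp
    then have "1 / slope_ratio y \<le> slope_ratio R" using b by linarith
    then have "m y \<le> slope_ratio R" using b by (simp add: m_def)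
    also have "slope_ratio R \<le> m R" unfolding m_def by (rule max.cobounded1)
    finally show ?thesis .
  next
    case False
    then have b: "slope_ratio R \<le> slope_ratio y" "slope_ratio y \<le> 1" using slope_ratio_between(2)[OF y] by auto
    have "1 / slope_ratio y \<le> 1 / slope_ratio R" using b R0 by (simp add: frac_le)
    moreover have "1 \<le> 1 / slope_ratio R" using b R0 by simp
    ultimately show ?thesis using b by (simp add: m_def)
  qed
  have lim: "(m \<longlongrightarrow> m R) (at_right R)"
    unfolding m_def[abs_def] using R0 by (intro tendsto_max tendsto_divide tendsto_const slope_ratio_tendsto) simp_all
  have "(SUP y\<in>{R<..<1}. ereal (m y)) = ereal (m R)"
  proof (rule antisym)
    show "(SUP y\<in>{R<..<1}. ereal (m y)) \<le> ereal (m R)" by (rule SUP_least) (use le in simp)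
    show "ereal (m R) \<le> (SUP y\<in>{R<..<1}. ereal (m y))"
    proof (rule tendsto_upperbound)
      show "((\<lambda>y. ereal (m y)) \<longlongrightarrow> ereal (m R)) (at_right R)" using lim by simp
      show "\<forall>\<^sub>F y in at_right R. ereal (m y) \<le> (SUP y\<in>{R<..<1}. ereal (m y))"
        using eventually_at_right_real[OF R(2)] by eventually_elim (rule SUP_upper, simp)
    qed simp
  qed
  then show ?thesis unfolding qc_constant_eq_SUP m_def inv slope_ratio_R .
qed

lemma f_quasiconformal_iff: "quasiconformal \<Omega> f \<longleftrightarrow> \<gamma> > \<gamma>c"
proof (cases "\<gamma> = \<gamma>c")
  case True
  then show ?thesis using qc_crit by (simp add: quasiconformal_def)
next
  case False
  have "\<And>x. ereal x < \<infinity>" by simp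
  then have "qc_constant \<Omega> f < \<infinity>" unfolding qc_noncrit[OF False] .
  then show ?thesis using False gamma_ge f_dx_dy(1) by (simp add: quasiconformal_def)
qed

end

section \<open>Minimality of the radial map\<close>

context radial_profile
begin

lemma msq_gamma: "0 \<le> msq u + \<gamma>" using msq_ge[of u] gamma_ge by linarith

lemma msq_area: "metric_area \<Omega>' \<rho>b = ennreal (2 * pi) * ennreal (integral {ln R..0} msq)"
proof -
  have "metric_area \<Omega>' \<rho>b = metric_area \<Omega>' \<rho>"
    unfolding metric_area_def
  proof (intro nn_integral_cong)
    fix w
    show "ennreal ((\<rho>b w)\<^sup>2) * indicator \<Omega>' w = ennreal ((\<rho> w)\<^sup>2) * indicator \<Omega>' w"
      by (cases "w \<in> \<Omega>'") (simp_all add: bdry_ext_def annulus_def)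
  qed
  also have "\<dots> = ennreal (2 * pi) * (\<integral>\<^sup>+x. ennreal (indicator {ln R<..<0} x * msq x) \<partial>lborel)"
  proof -
    have "(exp (logm x))\<^sup>2 = msq x" if "x \<in> {ln R<..<0}" for x
      using exp_logm[OF that] msq_ln[of "exp x"] ln_interval[OF that] by (simp add: radial_value_interior)
    then have "ennreal (indicator {ln R<..<0} x * (exp (logm x))\<^sup>2) = ennreal (indicator {ln R<..<0} x * msq x)" for x
      by (cases "x \<in> {ln R<..<0}") simp_all
    then show ?thesis unfolding area_eq by simp
  qed
  also have "(\<integral>\<^sup>+x. ennreal (indicator {ln R<..<0} x * msq x) \<partial>lborel) = ennreal (integral {ln R..0} msq)"
  proof -
    have "msq integrable_on {ln R..0}"
      by (rule integrable_continuous_interval) (rule continuous_on_subset[OF msq_cont], simp)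
    then have "(msq has_integral integral {ln R..0} msq) {ln R<..<0}"
      using integrable_integral by (simp add: has_integral_Icc_iff_Ioo[symmetric])
    from nn_integral_has_integral_lebesgue[OF _ this] msq_pos show ?thesis by (simp add: less_imp_le)
  qed
  finally show ?thesis .
qed

definition log_profile :: "real \<Rightarrow> real" where "log_profile x = ln (p (exp x))"
definition log_slope :: "real \<Rightarrow> real" where "log_slope x = slope_ratio (p (exp x))"

lemma exp_in: "x \<in> {ln r..0} \<Longrightarrow> exp x \<in> {r..1}" "x \<in> {ln r<..<0} \<Longrightarrow> exp x \<in> {r<..<1}"
  using exp_le_cancel_iff[of "ln r" x] exp_less_cancel_iff[of "ln r" x] r_bounds by auto

lemma log_profile_cont: "continuous_on {ln r..0} log_profile"
proof -
  have "p s \<noteq> 0" if "s \<in> {r..1}" for s using p_bounds(1)[OF that] R by auto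
  then show ?thesis unfolding log_profile_def[abs_def]
    by (intro continuous_on_ln continuous_on_compose2[OF p_cont] continuous_intros) (use exp_in(1) in auto)
qed

lemma log_profile_deriv:
  assumes x: "x \<in> {ln r<..<0}" shows "(log_profile has_real_derivative log_slope x) (at x)"
proof -
  note s = exp_in(2)[OF x]
  have p0: "p (exp x) > 0" using p_interior[OF s] R by auto
  have "((\<lambda>x. ln (p (exp x))) has_real_derivative 1 / p (exp x) * (speed (p (exp x)) / exp x * exp x)) (at x)"
    by (rule DERIV_chain2[OF DERIV_ln_divide[OF p0] DERIV_chain2[OF p_deriv[OF s] DERIV_exp]])
  then show ?thesis unfolding log_profile_def[abs_def] log_slope_def slope_ratio_def by simp
qed

lemma log_profile_range: "x \<in> {ln r..0} \<Longrightarrow> log_profile x \<in> {ln R..0}"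
proof -
  assume x: "x \<in> {ln r..0}"
  have "p (exp x) \<in> {R..1}" by (rule p_bounds(1)[OF exp_in(1)[OF x]])
  then have "R \<le> p (exp x)" "p (exp x) \<le> 1" "0 < p (exp x)" using R by auto
  then show ?thesis using R by (simp add: log_profile_def)
qed

lemma log_profile_ends: "log_profile (ln r) = ln R" "log_profile 0 = 0"
  using p_q[of R] p_q[of 1] R r_bounds q_one by (simp_all add: log_profile_def)

lemma log_slope_eq: "x \<in> {ln r<..<0} \<Longrightarrow> cal_slope \<gamma> (msq (log_profile x)) = log_slope x"
proof -
  assume x: "x \<in> {ln r<..<0}"
  have y: "p (exp x) \<in> {R<..<1}" by (rule p_interior[OF exp_in(2)[OF x]])
  then have "msq (log_profile x) = (p (exp x) * rv (p (exp x)))\<^sup>2" unfolding log_profile_def by (intro msq_ln) auto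
  then have "1 + \<gamma> / msq (log_profile x) = (log_slope x)\<^sup>2" using slope_ratio_sq[of "p (exp x)"] y by (simp add: log_slope_def)
  then show ?thesis using slope_ratio_pos[OF y] by (simp add: cal_slope_def log_slope_def)
qed

lemma log_slope_cont: "continuous_on {ln r<..<0} log_slope"
proof -
  have "continuous_on {ln r<..<0} (\<lambda>x. p (exp x))"
    by (rule continuous_on_compose2[OF p_cont]) (use exp_in(2) in \<open>force intro!: continuous_intros\<close>)+
  moreover have "p (exp x) \<in> {R..1}" if "x \<in> {ln r<..<0}" for x using p_interior[OF exp_in(2)[OF that]] by auto
  ultimately show ?thesis unfolding log_slope_def[abs_def]
    by (intro continuous_on_compose2[OF slope_ratio_cont]) auto
qed

text \<open>Substitution \<open>u = log_profile x\<close>, carried out by the fundamental theorem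
  of calculus, since \<open>log_slope\<close> is the derivative of
  \<open>log_profile\<close>.\<close>

lemma radial_nn_integral:
  assumes c: "continuous_on UNIV \<psi>"
    and nn: "\<And>x. x \<in> {ln r<..<0} \<Longrightarrow> \<psi> (log_profile x) * log_slope x + \<kappa> \<ge> 0"
    and F: "\<And>z. z \<in> \<Omega> \<Longrightarrow> F z = (\<psi> (log_profile (ln (cmod z))) * log_slope (ln (cmod z)) + \<kappa>) / (cmod z)\<^sup>2"
  shows "(\<integral>\<^sup>+z\<in>\<Omega>. ennreal (F z) \<partial>lebesgue) = ennreal (2 * pi) * ennreal (integral {ln R..0} \<psi> + \<kappa> * ln (1 / r))"
proof -
  let ?w = "\<lambda>x. \<psi> (log_profile x) * log_slope x + \<kappa>"
  let ?I = "\<lambda>u. integral {ln R - 1..u} \<psi>"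
  let ?\<Theta> = "\<lambda>x. ?I (log_profile x) + \<kappa> * x"
  have "continuous_on {ln r<..<0} log_profile" by (rule continuous_on_subset[OF log_profile_cont]) auto
  then have "continuous_on {ln r<..<0} ?w"
    by (intro continuous_intros continuous_on_compose2[OF c] log_slope_cont) auto
  from annulus_nn_integral[OF r_bounds(1) this nn F]
  have "(\<integral>\<^sup>+z\<in>\<Omega>. ennreal (F z) \<partial>lebesgue) = ennreal (2 * pi) * (\<integral>\<^sup>+x. ennreal (indicator {ln r<..<0} x * ?w x) \<partial>lborel)" .
  also have "(\<integral>\<^sup>+x. ennreal (indicator {ln r<..<0} x * ?w x) \<partial>lborel) = ennreal (?\<Theta> 0 - ?\<Theta> (ln r))"
  proof (rule nn_integral_derivative)
    show "ln r \<le> 0" using r_bounds by simp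
    have dI: "(?I has_real_derivative \<psi> u) (at u)" if "u \<in> {ln R..0}" for u
      by (rule has_real_derivative_integral_upto[OF c]) (use that in simp)
    have "isCont ?I u" if "u \<in> {ln R..0}" for u using dI[OF that] by (rule DERIV_isCont)
    then have "continuous_on {ln R..0} ?I" by (intro continuous_at_imp_continuous_on ballI)
    from continuous_on_compose2[OF this log_profile_cont] log_profile_range
    have "continuous_on {ln r..0} (\<lambda>x. ?I (log_profile x))" by blast
    then show "continuous_on {ln r..0} ?\<Theta>" by (intro continuous_intros)
    fix x assume x: "x \<in> {ln r<..<0}"
    then have "log_profile x \<in> {ln R..0}" by (intro log_profile_range) auto
    from DERIV_add[OF DERIV_chain2[OF dI[OF this] log_profile_deriv[OF x]] DERIV_cmult_Id]
    show "(?\<Theta> has_real_derivative ?w x) (at x)" .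
    show "0 \<le> ?w x" by (rule nn[OF x])
  qed
  also have "?\<Theta> 0 - ?\<Theta> (ln r) = integral {ln R..0} \<psi> + \<kappa> * ln (1 / r)"
  proof -
    have "\<psi> integrable_on {ln R - 1..0}"
      by (rule integrable_continuous_interval) (rule continuous_on_subset[OF c], simp)
    then have "?I (ln R) + integral {ln R..0} \<psi> = ?I 0"
      using R by (intro Henstock_Kurzweil_Integration.integral_combine) auto
    then show ?thesis using r_bounds by (simp add: log_profile_ends ln_div)
  qed
  finally show ?thesis .
qed

lemma f_weak_gradient:
  "weak_gradient \<Omega> f (dx f, dy f)"
  "AE z in lebesgue. z \<in> \<Omega> \<longrightarrow> wdx \<Omega> f z = dx f z \<and> wdy \<Omega> f z = dy f z"
proof -
  show 1: "weak_gradient \<Omega> f (dx f, dy f)" by (rule classical_imp_weak_gradient[OF open_annulus f_Ck])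
  then have "weak_gradient \<Omega> f (wgrad \<Omega> f)" unfolding wgrad_def by (rule someI)
  from weak_gradient_unique[OF open_annulus this 1]
  show "AE z in lebesgue. z \<in> \<Omega> \<longrightarrow> wdx \<Omega> f z = dx f z \<and> wdy \<Omega> f z = dy f z"
    by (simp add: wdx_def wdy_def)
qed

lemma f_metric_value:
  assumes z: "z \<in> \<Omega>"
  shows "\<rho>b (f z) = rv (p (cmod z))" "msq (log_profile (ln (cmod z))) = (p (cmod z) * rv (p (cmod z)))\<^sup>2"
    "log_slope (ln (cmod z)) = speed (p (cmod z)) / p (cmod z)" "p (cmod z) > 0" "cmod z > 0" "ln (cmod z) \<in> {ln r<..<0}"
proof -
  have s: "cmod z \<in> {r<..<1}" and z0: "z \<noteq> 0" using annulus_polar(1)[OF z] by auto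
  show c0: "cmod z > 0" using z0 by simp
  have y: "p (cmod z) \<in> {R<..<1}" by (rule p_interior[OF s])
  show "\<rho>b (f z) = rv (p (cmod z))" using bdry_ext_on_annulus[OF f_in[OF z]] by (simp add: cmod_f[OF z])
  show "p (cmod z) > 0" using y R by auto
  show "msq (log_profile (ln (cmod z))) = (p (cmod z) * rv (p (cmod z)))\<^sup>2"
    using msq_ln[of "p (cmod z)"] y c0 by (simp add: log_profile_def)
  show "log_slope (ln (cmod z)) = speed (p (cmod z)) / p (cmod z)" using c0 by (simp add: log_slope_def slope_ratio_def)
  show "ln (cmod z) \<in> {ln r<..<0}" using s c0 r_bounds by simp
qed

text \<open>The radial map realises equality in the calibration at every point.\<close>

lemma f_energy: "energy \<Omega> \<rho>b f = ennreal (energy_level \<gamma> (ln (1 / r)))"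
proof -
  let ?\<psi> = "\<lambda>u. cal_radial \<gamma> (msq u) + cal_jacobian \<gamma> (msq u)" and ?\<kappa> = "cal_angular \<gamma> - \<bar>\<gamma>\<bar>"
  have c: "continuous_on UNIV ?\<psi>"
    by (intro continuous_intros continuous_on_cal[OF msq_pos msq_gamma msq_cont])
  have id: "?\<psi> (log_profile x) * log_slope x + ?\<kappa> = msq (log_profile x) * ((log_slope x)\<^sup>2 + 1)"
    if "x \<in> {ln r<..<0}" for x
    using calibration_identity[OF msq_pos msq_gamma, of "log_profile x"] unfolding log_slope_eq[OF that] .
  have "energy \<Omega> \<rho>b f = (\<integral>\<^sup>+z\<in>\<Omega>. ennreal ((\<rho>b (f z))\<^sup>2 * ((cmod (dx f z))\<^sup>2 + (cmod (dy f z))\<^sup>2)) \<partial>lebesgue)"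
    unfolding energy_eq
    by (rule nn_integral_cong_AE) (use f_weak_gradient(2) in \<open>eventually_elim; simp split: split_indicator\<close>)
  also have "\<dots> = ennreal (2 * pi) * ennreal (integral {ln R..0} ?\<psi> + ?\<kappa> * ln (1 / r))"
  proof (rule radial_nn_integral[OF c])
    show "0 \<le> ?\<psi> (log_profile x) * log_slope x + ?\<kappa>" if "x \<in> {ln r<..<0}" for x
      unfolding id[OF that] using msq_pos[of "log_profile x"] by simp
    fix z assume z: "z \<in> \<Omega>"
    note v = f_metric_value[OF z]
    show "(\<rho>b (f z))\<^sup>2 * ((cmod (dx f z))\<^sup>2 + (cmod (dy f z))\<^sup>2) =
      (?\<psi> (log_profile (ln (cmod z))) * log_slope (ln (cmod z)) + ?\<kappa>) / (cmod z)\<^sup>2"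
      unfolding id[OF v(6)]
      unfolding f_dirichlet[OF z] v(1-3) radial_slope_def angular_slope_def
      using v(4,5) by (simp add: field_simps power_mult_distrib)
  qed
  also have "\<dots> = ennreal (energy_level \<gamma> (ln (1 / r)))"
    unfolding energy_level_def by (subst ennreal_mult'[symmetric]) simp_all
  finally show ?thesis .
qed

lemma f_area: "(\<integral>\<^sup>+ z \<in> \<Omega>. ennreal ((\<rho>b (f z))\<^sup>2 * det2 (wdx \<Omega> f z) (wdy \<Omega> f z)) \<partial>lebesgue) = metric_area \<Omega>' \<rho>b"
proof -
  have "(\<integral>\<^sup>+ z \<in> \<Omega>. ennreal ((\<rho>b (f z))\<^sup>2 * det2 (wdx \<Omega> f z) (wdy \<Omega> f z)) \<partial>lebesgue) =
    (\<integral>\<^sup>+ z \<in> \<Omega>. ennreal ((\<rho>b (f z))\<^sup>2 * det2 (dx f z) (dy f z)) \<partial>lebesgue)"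
    by (rule nn_integral_cong_AE) (use f_weak_gradient(2) in \<open>eventually_elim; simp split: split_indicator\<close>)
  also have "\<dots> = ennreal (2 * pi) * ennreal (integral {ln R..0} msq + 0 * ln (1 / r))"
  proof (rule radial_nn_integral[OF msq_cont])
    show "0 \<le> msq (log_profile x) * log_slope x + 0" if "x \<in> {ln r<..<0}" for x
      using msq_pos[of "log_profile x"] slope_ratio_pos[OF p_interior[OF exp_in(2)[OF that]]] by (simp add: log_slope_def)
    fix z assume z: "z \<in> \<Omega>"
    note v = f_metric_value[OF z]
    show "(\<rho>b (f z))\<^sup>2 * det2 (dx f z) (dy f z) =
      (msq (log_profile (ln (cmod z))) * log_slope (ln (cmod z)) + 0) / (cmod z)\<^sup>2"
      unfolding f_jacobian[OF z] v(1-3) radial_slope_def angular_slope_def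
      using v(4,5) by (simp add: field_simps power2_eq_square)
  qed
  finally show ?thesis by (simp add: msq_area)
qed

text \<open>The radial map is a diffeomorphism, so it serves itself as the approximating
  sequence.\<close>

lemma f_deformation: "f \<in> deformations \<Omega> \<Omega>' \<rho>b"
proof -
  have c: "continuous_on \<Omega> f" "continuous_on \<Omega> (dx f)" "continuous_on \<Omega> (dy f)"
    using f_Ck[of 0] f_Ck[of "Suc 0"] by simp_all
  have "f ` \<Omega> \<subseteq> closure \<Omega>'" using f_in closure_subset by blast
  moreover have "f \<in> W12loc \<Omega>"
    unfolding W12loc_def mem_Collect_eq
  proof (intro conjI exI)
    show "weak_gradient \<Omega> f (dx f, dy f)" by (rule f_weak_gradient(1))
    show "locally_integrable \<Omega> (\<lambda>z. (cmod (f z))\<^sup>2)" "locally_integrable \<Omega> (\<lambda>z. (cmod (fst (dx f, dy f) z))\<^sup>2)"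
      "locally_integrable \<Omega> (\<lambda>z. (cmod (snd (dx f, dy f) z))\<^sup>2)"
      unfolding fst_conv snd_conv by (intro continuous_on_imp_locally_integrable continuous_intros c)+
  qed
  moreover have "energy \<Omega> \<rho>b f < \<infinity>" by (simp add: f_energy)
  moreover have "AE z in lebesgue. z \<in> \<Omega> \<longrightarrow> det2 (wdx \<Omega> f z) (wdy \<Omega> f z) \<ge> 0"
    using f_weak_gradient(2) by eventually_elim (use slopes_pos f_jacobian in \<open>simp add: less_imp_le\<close>)
  moreover have "\<exists>hs. (\<forall>j. sense_preserving_diffeo \<Omega> \<Omega>' (hs j)) \<and>
        (\<forall>K. compact K \<and> K \<subseteq> \<Omega> \<longrightarrow> uniform_limit K hs f sequentially) \<and>
        ennreal_uniform_limit (closure \<Omega>) (\<lambda>j. bdry_defect \<Omega> \<Omega>' \<rho>b (hs j)) (bdry_defect \<Omega> \<Omega>' \<rho>b f)"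
  proof (intro exI conjI allI impI)
    show "sense_preserving_diffeo \<Omega> \<Omega>' f" by (rule f_diffeo)
    show "uniform_limit K (\<lambda>_. f) f sequentially" for K by (simp add: uniform_limit_iff)
    show "ennreal_uniform_limit (closure \<Omega>) (\<lambda>_. bdry_defect \<Omega> \<Omega>' \<rho>b f) (bdry_defect \<Omega> \<Omega>' \<rho>b f)"
      by (simp add: ennreal_uniform_limit_def)
  qed
  ultimately show ?thesis unfolding deformations_def mem_Collect_eq using f_area by (intro conjI) simp_all
qed

theorem f_minimizer: "energy_minimizer \<Omega> \<Omega>' \<rho>b f"
  unfolding energy_minimizer_def
proof (intro conjI antisym)
  show "f \<in> deformations \<Omega> \<Omega>' \<rho>b" by (rule f_deformation)
  then show "(INF h\<in>deformations \<Omega> \<Omega>' \<rho>b. energy \<Omega> \<rho>b h) \<le> energy \<Omega> \<rho>b f" by (rule INF_lower)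
  show "energy \<Omega> \<rho>b f \<le> (INF h\<in>deformations \<Omega> \<Omega>' \<rho>b. energy \<Omega> \<rho>b h)"
    unfolding f_energy by (rule INF_greatest) (rule energy_lower_bound[OF r_bounds gamma_ge])
qed

end

theorem lemma9p5:
  fixes R \<gamma> \<gamma>\<^sub>0 r :: real and \<tau>\<^sub>0 :: ennreal
    and \<rho> :: "complex \<Rightarrow> real" and f :: "complex \<Rightarrow> complex"
  assumes "0 < R" and "R < 1"
    and "allowable (annulus R 1) \<rho>"
    and "radial_metric R \<rho>"
    and "regular_metric R \<rho>"
    and gamma0: "\<gamma>\<^sub>0 = gamma_crit R \<rho>"
    and tau0: "\<tau>\<^sub>0 = tau_crit R \<rho>"
    and "\<forall>y\<in>{R..1}. y\<^sup>2 * (radial_value R \<rho> y)\<^sup>2 + \<gamma> \<ge> 0"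
    \<comment> \<open>The integral defining \<open>q\<close> converges for \<open>\<gamma> > \<gamma>\<^sub>0\<close>. For \<open>\<gamma> = \<gamma>\<^sub>0\<close> its value over
      \<open>[R,1]\<close> is \<open>\<tau>\<^sub>0\<close>, which has to be finite for \<open>q\<close> and \<open>r > 0\<close> to make sense.\<close>
    and "\<gamma> = \<gamma>\<^sub>0 \<Longrightarrow> \<tau>\<^sub>0 < \<infinity>"
    and r: "r = q_fun R \<rho> \<gamma> R"
    and f: "f = f_map R \<rho> \<gamma>"
  shows "rho_harmonic (annulus r 1) (annulus R 1) \<rho> f
    \<and> (energy_minimizer (annulus r 1) (annulus R 1) (bdry_ext R \<rho>) f \<and> quasiconformal (annulus r 1) f
         \<longleftrightarrow> \<gamma> > \<gamma>\<^sub>0)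
    \<and> (energy_minimizer (annulus r 1) (annulus R 1) (bdry_ext R \<rho>) f \<and> quasiconformal (annulus r 1) f
         \<longleftrightarrow> ennreal (annulus_modulus r) < \<tau>\<^sub>0)
    \<and> (\<gamma> = \<gamma>\<^sub>0 \<longrightarrow>
         energy_minimizer (annulus r 1) (annulus R 1) (bdry_ext R \<rho>) f \<and>
         rho_harmonic (annulus r 1) (annulus R 1) \<rho> f \<and>
         \<not> quasiconformal (annulus r 1) f)
    \<and> qc_constant (annulus r 1) f =
         (if \<gamma> = \<gamma>\<^sub>0 then \<infinity>
          else ereal (max (sqrt ((\<gamma>\<^sub>0 - \<gamma>) / \<gamma>\<^sub>0)) (sqrt (\<gamma>\<^sub>0 / (\<gamma>\<^sub>0 - \<gamma>)))))"
proof -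
  interpret regular_annulus_metric R \<rho> by unfold_locales fact+
  interpret radial_profile R \<rho> \<gamma>
    by unfold_locales (use assms in auto)
  show ?thesis
    unfolding r f gamma0 tau0 annulus_modulus_def modulus_less_iff f_quasiconformal_iff
  proof (intro conjI impI)
    show "rho_harmonic \<Omega> \<Omega>' \<rho> (f_map R \<rho> \<gamma>)" "rho_harmonic \<Omega> \<Omega>' \<rho> (f_map R \<rho> \<gamma>)" by (rule f_harmonic)+
    show "energy_minimizer \<Omega> \<Omega>' \<rho>b (f_map R \<rho> \<gamma>)" by (rule f_minimizer)
    then show "energy_minimizer \<Omega> \<Omega>' \<rho>b (f_map R \<rho> \<gamma>) \<and> \<gamma>c < \<gamma> \<longleftrightarrow> \<gamma>c < \<gamma>"
      "energy_minimizer \<Omega> \<Omega>' \<rho>b (f_map R \<rho> \<gamma>) \<and> \<gamma>c < \<gamma> \<longleftrightarrow> \<gamma>c < \<gamma>" by blast+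
    show "qc_constant \<Omega> (f_map R \<rho> \<gamma>) = (if \<gamma> = \<gamma>c then \<infinity>
      else ereal (max (sqrt ((\<gamma>c - \<gamma>) / \<gamma>c)) (sqrt (\<gamma>c / (\<gamma>c - \<gamma>)))))"
    proof (cases "\<gamma> = \<gamma>c")
      case True
      show ?thesis unfolding if_P[OF True] by (rule qc_crit[OF True])
    next
      case False
      show ?thesis unfolding if_not_P[OF False] by (rule qc_noncrit[OF False])
    qed
  qed simp
qed

end
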